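(* Let $M$ be a finite dimensional manifold and $q$ a signature. On $\mathrm{Met}^q_{mw}(M)=\mathrm{Met}^q(M)\times\Gamma_c(S^2T^*M)$ consider the 1-form $$\Theta_{(g,h)}(k,l)=\int_M\mathrm{Tr}(g^{-1}kg^{-1}h)\,\mu(g).$$ The 2-form $\Omega:=-d\Theta$ defined, for $\xi_j=(k_j,l_j)\in T_{(g,h)}\mathrm{Met}^q_{mw}(M)$ ($j=1,2$), by $$\Omega_{(g,h)}(\xi_1,\xi_2)=\int_M\Big[\mathrm{Tr}(g^{-1}k_1g^{-1}h)\,\mathrm{Tr}(g^{-1}k_2)-\mathrm{Tr}(g^{-1}k_2g^{-1}h)\,\mathrm{Tr}(g^{-1}k_1)+\mathrm{Tr}(g^{-1}k_1g^{-1}l_2)-\mathrm{Tr}(g^{-1}k_2g^{-1}l_1)\Big]\mu(g)$$ defines an exact (weak) symplectic structure on $\mathrm{Met}^q_{mw}(M)$.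
   Context: $M$ is a smooth, connected, paracompact finite dimensional manifold. $\mathrm{Met}^q(M)$ is the set of pseudo-Riemannian metrics on $M$ of signature $q$; it is a smooth manifold (in the convenient calculus of Frölicher–Kriegl–Michor) modeled on the convenient vector space $\Gamma_c(S^2T^*M)$ of compactly supported symmetric 2-tensor fields on $M$. Hence $T_{(g,h)}\mathrm{Met}^q_{mw}(M)=\Gamma_c(S^2T^*M)\times\Gamma_c(S^2T^*M)$. In local coordinates $\mathrm{Tr}(g^{-1}kg^{-1}h)=g^{jr}k_{rs}g^{sp}h_{pj}$ and $\mathrm{Tr}(g^{-1}k)=g^{jr}k_{rj}$, and $\mu(g)=\sqrt{|\det g|}\,|dx_1\wedge\cdots\wedge dx_n|$ is the density of $g$. In convenient calculus, a map is smooth if it maps smooth curves to smooth curves; differential forms are smooth sections of bundles of bounded alternating multilinear forms, with the usual exterior derivative ($d\Theta(\xi_1,\xi_2)=\xi_1\Theta(\xi_2)-\xi_2\Theta(\xi_1)-\Theta([\xi_1,\xi_2])$). A weak symplectic structure is a closed 2-form $\sigma$ such that $\sigma_x(v,\cdot)=0$ implies $v=0$.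
   Formalization: The two product-of-traces terms Tr(g⁻¹k₁g⁻¹h)Tr(g⁻¹k₂) − Tr(g⁻¹k₂g⁻¹h)Tr(g⁻¹k₁) in Ω carry a factor 1/2, without which Ω is neither −dΘ nor closed when dim M ≥ 2; dim M ≥ 1 is assumed. *)

theory Defs
  imports "HOL-Analysis.Analysis" "HOL-Library.Function_Algebras"
begin

section \<open>Convenient calculus\<close>

instantiation "fun" :: (type, real_vector) real_vector
begin

definition scaleR_fun :: "real \<Rightarrow> ('a \<Rightarrow> 'b) \<Rightarrow> 'a \<Rightarrow> 'b"
  where "scaleR_fun r f = (\<lambda>x. r *\<^sub>R f x)"

instance
  by standard (auto simp: scaleR_fun_def fun_eq_iff scaleR_add_right scaleR_add_left)

end

text \<open>
  A locally convex space is given by a linear subspace of an ambient real vector space together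
  with a directed family of seminorms generating its topology.
\<close>

type_synonym 'v lcs = "'v set \<times> ('v \<Rightarrow> real) set"

definition lcs_tendsto :: "'v::real_vector lcs \<Rightarrow> (real \<Rightarrow> 'v) \<Rightarrow> 'v \<Rightarrow> real filter \<Rightarrow> bool" where
  "lcs_tendsto E f l F \<longleftrightarrow> (\<forall>p \<in> snd E. ((\<lambda>s. p (f s - l)) \<longlongrightarrow> 0) F)"

definition lcs_bounded :: "'v lcs \<Rightarrow> 'v set \<Rightarrow> bool" where
  "lcs_bounded E B \<longleftrightarrow> B \<subseteq> fst E \<and> (\<forall>p \<in> snd E. bounded (p ` B))"

definition lcs_prod :: "'v lcs \<Rightarrow> 'w lcs \<Rightarrow> ('v \<times> 'w) lcs" where
  "lcs_prod E F = (fst E \<times> fst F, {\<lambda>(x, y). p x + q y | p q. p \<in> snd E \<and> q \<in> snd F})"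

text \<open>The sequence \<open>d\<close> lists the iterated derivatives of the curve.\<close>

definition smooth_curve :: "'v::real_vector lcs \<Rightarrow> (real \<Rightarrow> 'v) \<Rightarrow> bool" where
  "smooth_curve E c \<longleftrightarrow>
     (\<exists>d :: nat \<Rightarrow> real \<Rightarrow> 'v. d 0 = c \<and>
        (\<forall>j t. d j t \<in> fst E \<and>
           lcs_tendsto E (\<lambda>s. (d j (t + s) - d j t) /\<^sub>R s) (d (Suc j) t) (at 0)))"

text \<open>
  The manifolds considered here are subsets \<open>W\<close> of a vector space which may be larger than the
  modelling space \<open>E\<close>. The charts are the translations \<open>y \<mapsto> y - x\<close> from the points of \<open>W\<close> whose
  difference with \<open>x\<close> lies in \<open>E\<close> into \<open>E\<close>. Different charts differ by a translation, so the
  tangent bundle is \<open>W \<times> E\<close>, and a curve stays in one chart domain.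
\<close>

definition smooth_curve_in :: "'v::real_vector set \<Rightarrow> 'v lcs \<Rightarrow> (real \<Rightarrow> 'v) \<Rightarrow> bool" where
  "smooth_curve_in W E \<gamma> \<longleftrightarrow> (\<forall>t. \<gamma> t \<in> W) \<and> smooth_curve E (\<lambda>t. \<gamma> t - \<gamma> 0)"

definition smooth_map ::
    "'v::real_vector set \<Rightarrow> 'v lcs \<Rightarrow> 'w::real_vector lcs \<Rightarrow> ('v \<Rightarrow> 'w) \<Rightarrow> bool" where
  "smooth_map W E F s \<longleftrightarrow> (\<forall>\<gamma>. smooth_curve_in W E \<gamma> \<longrightarrow> smooth_curve F (\<lambda>t. s (\<gamma> t)))"

definition linear_form_on :: "'v::real_vector set \<Rightarrow> ('v \<Rightarrow> real) \<Rightarrow> bool" where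
  "linear_form_on S f \<longleftrightarrow>
     (\<forall>v \<in> S. \<forall>w \<in> S. f (v + w) = f v + f w) \<and> (\<forall>r. \<forall>v \<in> S. f (r *\<^sub>R v) = r * f v)"

text \<open>
  Bounded alternating \<open>k\<close>-linear forms, for \<open>k = 1, 2\<close>, with the topology of uniform
  convergence on bounded sets. Only the values of a form on the space itself matter.
\<close>

definition bounded_forms1 :: "'v::real_vector lcs \<Rightarrow> ('v \<Rightarrow> real) lcs" where
  "bounded_forms1 E =
     ({\<omega>. linear_form_on (fst E) \<omega> \<and> (\<forall>B. lcs_bounded E B \<longrightarrow> bounded (\<omega> ` B))},
      {\<lambda>\<omega>. SUP v \<in> B. \<bar>\<omega> v\<bar> | B. lcs_bounded E B \<and> B \<noteq> {}})"

definition bounded_forms2 :: "'v::real_vector lcs \<Rightarrow> ('v \<Rightarrow> 'v \<Rightarrow> real) lcs" where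
  "bounded_forms2 E =
     ({\<omega>. (\<forall>v \<in> fst E. linear_form_on (fst E) (\<lambda>w. \<omega> v w)) \<and>
          (\<forall>w \<in> fst E. linear_form_on (fst E) (\<lambda>v. \<omega> v w)) \<and>
          (\<forall>v \<in> fst E. \<omega> v v = 0) \<and>
          (\<forall>B. lcs_bounded E B \<longrightarrow> bounded ((\<lambda>(v, w). \<omega> v w) ` (B \<times> B)))},
      {\<lambda>\<omega>. SUP (v, w) \<in> B \<times> B. \<bar>\<omega> v w\<bar> | B. lcs_bounded E B \<and> B \<noteq> {}})"

definition vector_field :: "'v::real_vector set \<Rightarrow> 'v lcs \<Rightarrow> ('v \<Rightarrow> 'v) \<Rightarrow> bool" where
  "vector_field W E \<xi> \<longleftrightarrow> smooth_map W E E \<xi>"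

definition one_form :: "'v::real_vector set \<Rightarrow> 'v lcs \<Rightarrow> ('v \<Rightarrow> 'v \<Rightarrow> real) \<Rightarrow> bool" where
  "one_form W E \<Theta> \<longleftrightarrow> smooth_map W E (bounded_forms1 E) \<Theta>"

definition two_form :: "'v::real_vector set \<Rightarrow> 'v lcs \<Rightarrow> ('v \<Rightarrow> 'v \<Rightarrow> 'v \<Rightarrow> real) \<Rightarrow> bool" where
  "two_form W E \<omega> \<longleftrightarrow> smooth_map W E (bounded_forms2 E) \<omega>"

definition field_apply :: "('v::real_vector \<Rightarrow> 'v) \<Rightarrow> ('v \<Rightarrow> real) \<Rightarrow> 'v \<Rightarrow> real" where
  "field_apply \<xi> f x = deriv (\<lambda>s. f (x + s *\<^sub>R \<xi> x)) 0"

definition dir_deriv :: "'v::real_vector lcs \<Rightarrow> ('v \<Rightarrow> 'v) \<Rightarrow> 'v \<Rightarrow> 'v \<Rightarrow> 'v" where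
  "dir_deriv E F x v =
     (THE w. w \<in> fst E \<and> lcs_tendsto E (\<lambda>s. (F (x + s *\<^sub>R v) - F x) /\<^sub>R s) w (at 0))"

definition bracket :: "'v::real_vector lcs \<Rightarrow> ('v \<Rightarrow> 'v) \<Rightarrow> ('v \<Rightarrow> 'v) \<Rightarrow> 'v \<Rightarrow> 'v" where
  "bracket E \<xi> \<eta> x = dir_deriv E \<eta> x (\<xi> x) - dir_deriv E \<xi> x (\<eta> x)"

definition ext_d1 ::
    "'v::real_vector lcs \<Rightarrow> ('v \<Rightarrow> 'v \<Rightarrow> real) \<Rightarrow> ('v \<Rightarrow> 'v) \<Rightarrow> ('v \<Rightarrow> 'v) \<Rightarrow> 'v \<Rightarrow> real" where
  "ext_d1 E \<Theta> \<xi> \<eta> x =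
     field_apply \<xi> (\<lambda>y. \<Theta> y (\<eta> y)) x - field_apply \<eta> (\<lambda>y. \<Theta> y (\<xi> y)) x
     - \<Theta> x (bracket E \<xi> \<eta> x)"

definition ext_d2 ::
    "'v::real_vector lcs \<Rightarrow> ('v \<Rightarrow> 'v \<Rightarrow> 'v \<Rightarrow> real) \<Rightarrow>
      ('v \<Rightarrow> 'v) \<Rightarrow> ('v \<Rightarrow> 'v) \<Rightarrow> ('v \<Rightarrow> 'v) \<Rightarrow> 'v \<Rightarrow> real" where
  "ext_d2 E \<omega> \<xi> \<eta> \<zeta> x =
     field_apply \<xi> (\<lambda>y. \<omega> y (\<eta> y) (\<zeta> y)) x
     - field_apply \<eta> (\<lambda>y. \<omega> y (\<xi> y) (\<zeta> y)) x
     + field_apply \<zeta> (\<lambda>y. \<omega> y (\<xi> y) (\<eta> y)) x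
     - \<omega> x (bracket E \<xi> \<eta> x) (\<zeta> x)
     + \<omega> x (bracket E \<xi> \<zeta> x) (\<eta> x)
     - \<omega> x (bracket E \<eta> \<zeta> x) (\<xi> x)"

text \<open>
  Constant vector fields are smooth, so the following determines \<open>\<omega>\<close> uniquely on
  tangent vectors.
\<close>

definition is_ext_d ::
    "'v::real_vector set \<Rightarrow> 'v lcs \<Rightarrow> ('v \<Rightarrow> 'v \<Rightarrow> real) \<Rightarrow> ('v \<Rightarrow> 'v \<Rightarrow> 'v \<Rightarrow> real) \<Rightarrow> bool" where
  "is_ext_d W E \<Theta> \<omega> \<longleftrightarrow>
     (\<forall>\<xi> \<eta>. vector_field W E \<xi> \<and> vector_field W E \<eta> \<longrightarrow>
        (\<forall>x \<in> W. \<omega> x (\<xi> x) (\<eta> x) = ext_d1 E \<Theta> \<xi> \<eta> x))"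

definition closed_two_form ::
    "'v::real_vector set \<Rightarrow> 'v lcs \<Rightarrow> ('v \<Rightarrow> 'v \<Rightarrow> 'v \<Rightarrow> real) \<Rightarrow> bool" where
  "closed_two_form W E \<omega> \<longleftrightarrow> two_form W E \<omega> \<and>
     (\<forall>\<xi> \<eta> \<zeta>. vector_field W E \<xi> \<and> vector_field W E \<eta> \<and> vector_field W E \<zeta> \<longrightarrow>
        (\<forall>x \<in> W. ext_d2 E \<omega> \<xi> \<eta> \<zeta> x = 0))"

definition exact_two_form ::
    "'v::real_vector set \<Rightarrow> 'v lcs \<Rightarrow> ('v \<Rightarrow> 'v \<Rightarrow> 'v \<Rightarrow> real) \<Rightarrow> bool" where
  "exact_two_form W E \<omega> \<longleftrightarrow> two_form W E \<omega> \<and> (\<exists>\<alpha>. one_form W E \<alpha> \<and> is_ext_d W E \<alpha> \<omega>)"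

definition weak_symplectic ::
    "'v::real_vector set \<Rightarrow> 'v lcs \<Rightarrow> ('v \<Rightarrow> 'v \<Rightarrow> 'v \<Rightarrow> real) \<Rightarrow> bool" where
  "weak_symplectic W E \<sigma> \<longleftrightarrow> closed_two_form W E \<sigma> \<and>
     (\<forall>x \<in> W. \<forall>v \<in> fst E. (\<forall>w \<in> fst E. \<sigma> x v w = 0) \<longrightarrow> v = 0)"


section \<open>Finite dimensional manifolds\<close>

definition paracompact_space :: "'a topology \<Rightarrow> bool" where
  "paracompact_space X \<longleftrightarrow>
     (\<forall>\<U>. (\<forall>U \<in> \<U>. openin X U) \<and> \<Union>\<U> = topspace X \<longrightarrow>
        (\<exists>\<V>. (\<forall>V \<in> \<V>. openin X V) \<and> \<Union>\<V> = topspace X \<and>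
             (\<forall>V \<in> \<V>. \<exists>U \<in> \<U>. V \<subseteq> U) \<and> locally_finite_in X \<V>))"

primrec iter_deriv ::
    "'b::real_normed_vector list \<Rightarrow> ('b \<Rightarrow> 'c::real_normed_vector) \<Rightarrow> 'b \<Rightarrow> 'c" where
  "iter_deriv [] f = f"
| "iter_deriv (v # vs) f = iter_deriv vs (\<lambda>x. frechet_derivative f (at x) v)"

text \<open>To be used for open \<open>S\<close> only.\<close>

definition smooth_on ::
    "'b::real_normed_vector set \<Rightarrow> ('b \<Rightarrow> 'c::real_normed_vector) \<Rightarrow> bool" where
  "smooth_on S f \<longleftrightarrow> (\<forall>vs. \<forall>x \<in> S. iter_deriv vs f differentiable (at x))"

text \<open>A chart consists of its domain and its coordinate map.\<close>

type_synonym ('a, 'n) chart = "'a set \<times> ('a \<Rightarrow> real^'n)"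

definition chart_inv :: "('a, 'n) chart \<Rightarrow> real^'n \<Rightarrow> 'a" where
  "chart_inv c = inv_into (fst c) (snd c)"

definition smooth_manifold :: "'a topology \<Rightarrow> ('a, 'n::finite) chart set \<Rightarrow> bool" where
  "smooth_manifold X \<A> \<longleftrightarrow>
     Hausdorff_space X \<and> connected_space X \<and> paracompact_space X \<and>
     (\<Union>c \<in> \<A>. fst c) = topspace X \<and>
     (\<forall>c \<in> \<A>. openin X (fst c) \<and> open (snd c ` fst c) \<and>
        homeomorphic_map (subtopology X (fst c)) (top_of_set (snd c ` fst c)) (snd c)) \<and>
     (\<forall>c \<in> \<A>. \<forall>d \<in> \<A>. smooth_on (snd c ` (fst c \<inter> fst d)) (snd d \<circ> chart_inv c))"

text \<open>
  A covariant 2-tensor field is given by its coefficient matrix \<open>h c p\<close> in each chart \<open>c\<close> at each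
  point \<open>p\<close> of the chart, subject to the usual transformation rule; the coefficients are set
  to \<open>0\<close> where they have no meaning, so that tensor fields are equal iff they are equal
  as functions.
\<close>

type_synonym ('a, 'n) tensor2 = "('a, 'n) chart \<Rightarrow> 'a \<Rightarrow> real^'n^'n"

definition transition_jacobian ::
    "('a, 'n::finite) chart \<Rightarrow> ('a, 'n) chart \<Rightarrow> 'a \<Rightarrow> real^'n^'n" where
  "transition_jacobian c d p = matrix (frechet_derivative (snd d \<circ> chart_inv c) (at (snd c p)))"

definition sym2_fields :: "('a, 'n::finite) chart set \<Rightarrow> ('a, 'n) tensor2 set" where
  "sym2_fields \<A> = {h.
     (\<forall>c p. c \<notin> \<A> \<or> p \<notin> fst c \<longrightarrow> h c p = 0) \<and>
     (\<forall>c \<in> \<A>. smooth_on (snd c ` fst c) (h c \<circ> chart_inv c)) \<and>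
     (\<forall>c \<in> \<A>. \<forall>p \<in> fst c. transpose (h c p) = h c p) \<and>
     (\<forall>c \<in> \<A>. \<forall>d \<in> \<A>. \<forall>p \<in> fst c \<inter> fst d.
        h c p = transpose (transition_jacobian c d p) ** h d p ** transition_jacobian c d p)}"

definition sym2_fields_on ::
    "('a, 'n::finite) chart set \<Rightarrow> 'a set \<Rightarrow> ('a, 'n) tensor2 set" where
  "sym2_fields_on \<A> K = {h \<in> sym2_fields \<A>. \<forall>c p. p \<notin> K \<longrightarrow> h c p = 0}"

definition sym2_fields_c ::
    "'a topology \<Rightarrow> ('a, 'n::finite) chart set \<Rightarrow> ('a, 'n) tensor2 set" where
  "sym2_fields_c X \<A> = (\<Union>K \<in> Collect (compactin X). sym2_fields_on \<A> K)"

text \<open>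
  The seminorms \<open>cinf_seminorm (c, L, vs)\<close> define the topology of uniform convergence of all
  derivatives on compact subsets of charts.
\<close>

definition cinf_indices ::
    "('a, 'n::finite) chart set \<Rightarrow> (('a, 'n) chart \<times> (real^'n) set \<times> (real^'n) list) set" where
  "cinf_indices \<A> = {(c, L, vs). c \<in> \<A> \<and> compact L \<and> L \<noteq> {} \<and> L \<subseteq> snd c ` fst c}"

definition cinf_seminorm ::
    "('a, 'n::finite) chart \<times> (real^'n) set \<times> (real^'n) list \<Rightarrow> ('a, 'n) tensor2 \<Rightarrow> real" where
  "cinf_seminorm = (\<lambda>(c, L, vs) h. SUP y \<in> L. norm (iter_deriv vs (h c \<circ> chart_inv c) y))"

definition seminorm_on :: "'v::real_vector set \<Rightarrow> ('v \<Rightarrow> real) \<Rightarrow> bool" where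
  "seminorm_on S p \<longleftrightarrow>
     (\<forall>v \<in> S. p v \<ge> 0) \<and> (\<forall>v \<in> S. \<forall>w \<in> S. p (v + w) \<le> p v + p w) \<and>
     (\<forall>r. \<forall>v \<in> S. p (r *\<^sub>R v) = \<bar>r\<bar> * p v)"

text \<open>
  The locally convex inductive limit topology on \<open>\<Gamma>\<^sub>c(S\<^sup>2T\<^sup>*M)\<close>: a seminorm is continuous iff its
  restriction to the sections supported in \<open>K\<close> is continuous for each compact \<open>K\<close>.
\<close>

definition Gamma_c :: "'a topology \<Rightarrow> ('a, 'n::finite) chart set \<Rightarrow> ('a, 'n) tensor2 lcs" where
  "Gamma_c X \<A> =
     (sym2_fields_c X \<A>,
      {p. seminorm_on (sym2_fields_c X \<A>) p \<and>
          (\<forall>K. compactin X K \<longrightarrow>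
             (\<exists>C I. finite I \<and> I \<subseteq> cinf_indices \<A> \<and>
                (\<forall>h \<in> sym2_fields_on \<A> K. p h \<le> C * (\<Sum>i \<in> I. cinf_seminorm i h))))})"


section \<open>Pseudo-Riemannian metrics\<close>

text \<open>
  A matrix has signature \<open>q\<close> if it is congruent to a diagonal matrix with \<open>q\<close> entries \<open>-1\<close> and all
  other entries \<open>1\<close>; in particular it is symmetric and invertible.
\<close>

definition has_signature :: "nat \<Rightarrow> real^'n::finite^'n \<Rightarrow> bool" where
  "has_signature q G \<longleftrightarrow>
     (\<exists>(P :: real^'n^'n) (N :: 'n set). invertible P \<and> card N = q \<and>
        transpose P ** G ** P = (\<chi> i j. if i = j then (if i \<in> N then - 1 else 1) else 0))"

definition Met :: "('a, 'n::finite) chart set \<Rightarrow> nat \<Rightarrow> ('a, 'n) tensor2 set" where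
  "Met \<A> q = {g \<in> sym2_fields \<A>. \<forall>c \<in> \<A>. \<forall>p \<in> fst c. has_signature q (g c p)}"

definition Met_mw ::
    "'a topology \<Rightarrow> ('a, 'n::finite) chart set \<Rightarrow> nat \<Rightarrow> (('a, 'n) tensor2 \<times> ('a, 'n) tensor2) set"
  where
  "Met_mw X \<A> q = Met \<A> q \<times> fst (Gamma_c X \<A>)"

definition T_Met_mw ::
    "'a topology \<Rightarrow> ('a, 'n::finite) chart set \<Rightarrow> (('a, 'n) tensor2 \<times> ('a, 'n) tensor2) lcs" where
  "T_Met_mw X \<A> = lcs_prod (Gamma_c X \<A>) (Gamma_c X \<A>)"

text \<open>
  The density of \<open>g\<close> as a measure: the unique Borel measure on \<open>M\<close> which has the density
  \<open>sqrt \<bar>det g\<bar>\<close> with respect to Lebesgue measure in each chart.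
\<close>

definition metric_measure ::
    "'a topology \<Rightarrow> ('a, 'n::finite) chart set \<Rightarrow> ('a, 'n) tensor2 \<Rightarrow> 'a measure" where
  "metric_measure X \<A> g =
     (SOME \<nu>. sets \<nu> = sets (sigma (topspace X) {U. openin X U}) \<and>
        (\<forall>c \<in> \<A>. \<forall>B \<in> sets \<nu>. B \<subseteq> fst c \<longrightarrow>
           emeasure \<nu> B =
             (\<integral>\<^sup>+ y \<in> snd c ` B. ennreal (sqrt \<bar>det (g c (chart_inv c y))\<bar>) \<partial>lborel)))"

text \<open>The following traces do not depend on the chart used.\<close>

definition chart_at :: "('a, 'n) chart set \<Rightarrow> 'a \<Rightarrow> ('a, 'n) chart" where
  "chart_at \<A> p = (SOME c. c \<in> \<A> \<and> p \<in> fst c)"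

definition tr1 ::
    "('a, 'n::finite) chart set \<Rightarrow> ('a, 'n) tensor2 \<Rightarrow> ('a, 'n) tensor2 \<Rightarrow> 'a \<Rightarrow> real" where
  "tr1 \<A> g k p = (let c = chart_at \<A> p in trace (matrix_inv (g c p) ** k c p))"

definition tr2 ::
    "('a, 'n::finite) chart set \<Rightarrow>
      ('a, 'n) tensor2 \<Rightarrow> ('a, 'n) tensor2 \<Rightarrow> ('a, 'n) tensor2 \<Rightarrow> 'a \<Rightarrow> real" where
  "tr2 \<A> g k h p =
     (let c = chart_at \<A> p
      in trace (matrix_inv (g c p) ** k c p ** matrix_inv (g c p) ** h c p))"

definition Theta ::
    "'a topology \<Rightarrow> ('a, 'n::finite) chart set \<Rightarrow>
      ('a, 'n) tensor2 \<times> ('a, 'n) tensor2 \<Rightarrow> ('a, 'n) tensor2 \<times> ('a, 'n) tensor2 \<Rightarrow> real" where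
  "Theta X \<A> = (\<lambda>(g, h) (k, l). \<integral>p. tr2 \<A> g k h p \<partial>metric_measure X \<A> g)"

text \<open>
  The factor \<open>1/2\<close> comes from the derivative \<open>d\<mu>(g)(k) = 1/2 Tr(g\<^sup>-\<^sup>1 k) \<mu>(g)\<close> of the density. It is
  missing in the source; without it the 2-form is neither \<open>-d\<Theta>\<close> nor closed if \<open>dim M \<ge> 2\<close>.
\<close>

definition Omega ::
    "'a topology \<Rightarrow> ('a, 'n::finite) chart set \<Rightarrow>
      ('a, 'n) tensor2 \<times> ('a, 'n) tensor2 \<Rightarrow>
      ('a, 'n) tensor2 \<times> ('a, 'n) tensor2 \<Rightarrow> ('a, 'n) tensor2 \<times> ('a, 'n) tensor2 \<Rightarrow> real" where
  "Omega X \<A> = (\<lambda>(g, h) (k\<^sub>1, l\<^sub>1) (k\<^sub>2, l\<^sub>2).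
     \<integral>p. (1/2 * (tr2 \<A> g k\<^sub>1 h p * tr1 \<A> g k\<^sub>2 p - tr2 \<A> g k\<^sub>2 h p * tr1 \<A> g k\<^sub>1 p)
           + tr2 \<A> g k\<^sub>1 l\<^sub>2 p - tr2 \<A> g k\<^sub>2 l\<^sub>1 p) \<partial>metric_measure X \<A> g)"

end

theory Submission
  imports Defs
begin

text \<open>
  A bounded set of compactly supported tensor fields has a common compact support \<open>K\<close>, by
  paracompactness. Once \<open>K\<close> is cut into finitely many pieces lying in compact parts of charts, tensor
  fields become bounded matrix-valued functions on a finite measure space, a smooth curve of tensor
  fields becomes a uniformly differentiable curve of such functions, and \<open>\<Theta>\<close> and \<open>\<Omega>\<close> become
  integrals of smooth functions of matrices. So all derivatives may be taken under the integral sign.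

  For vector fields \<open>\<xi>\<close>, \<open>\<eta>\<close> the derivative of \<open>\<Theta>(\<eta>)\<close> along \<open>\<xi>\<close> is the derivative of \<open>\<Theta>\<close> in the base
  point plus \<open>\<Theta>\<close> of the derivative of \<open>\<eta>\<close>; the latter terms cancel against the bracket. What remains
  of \<open>d\<Theta> = - \<Omega>\<close> and \<open>d\<Omega> = 0\<close> are pointwise identities between traces of products of matrices. The
  kernel of \<open>\<Omega>\<close> vanishes because \<open>(k, l) \<mapsto> Tr(g\<^sup>-\<^sup>1 k g\<^sup>-\<^sup>1 l)\<close> is a nondegenerate form at each point
  and \<open>l\<close> may be concentrated near a given point by a bump function.
\<close>

subsection \<open>Uniform differentiability of curves of functions\<close>

text \<open>The topology on bounded forms is uniform convergence on bounded sets of tangent vectors,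
  so a difference quotient has to converge uniformly in the point of \<open>K\<close> and in the
  tangent vectors at once. Hence uniform differentiability is stated over an arbitrary index set,
  later a product such as \<open>K \<times> B\<close> with \<open>B\<close> bounded, and inverse,
  determinant, square root and integral are differentiated along curves at this generality. Since
  \<mu>(g) is given only by its values in charts, its existence has to be shown; over a fixed
  compact set all these measures then get densities with respect to one finite measure that does not
  move with g. A second obstacle is that \<open>smooth_map\<close> tests only curves defined for all
  times inside the space of metrics, whereas \<open>field_apply\<close> and \<open>dir_deriv\<close>
  differentiate along straight lines, which may leave that space. A straight line is therefore
  traversed as x + \<epsilon> sin(t/\<epsilon>) u, and an arcsine substitution near 0 recovers the
  derivative along the line itself.\<close>

definition has_unif_deriv ::
    "'x set \<Rightarrow> (real \<Rightarrow> 'x \<Rightarrow> 'b::real_normed_vector) \<Rightarrow> ('x \<Rightarrow> 'b) \<Rightarrow> real \<Rightarrow> bool" where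
  "has_unif_deriv S f f' t \<longleftrightarrow>
     uniform_limit S (\<lambda>s x. (f (t + s) x - f t x) /\<^sub>R s) f' (at 0)"

lemma has_unif_deriv_cong:
  assumes "\<And>s x. x \<in> S \<Longrightarrow> f s x = g s x" "\<And>x. x \<in> S \<Longrightarrow> f' x = g' x"
  shows "has_unif_deriv S f f' t \<longleftrightarrow> has_unif_deriv S g g' t"
  unfolding has_unif_deriv_def by (intro uniform_limit_cong') (use assms in auto)

text \<open>Only values near \<open>t\<close> enter the limit. This lets a curve be redefined at
  larger parameters, where a line of metrics may have left the space of metrics.\<close>

lemma has_unif_deriv_transform:
  assumes "has_unif_deriv S f f' t" "0 < e"
    and "\<And>s x. \<bar>s - t\<bar> < e \<Longrightarrow> x \<in> S \<Longrightarrow> f s x = g s x"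
    and "\<And>x. x \<in> S \<Longrightarrow> f' x = g' x"
  shows "has_unif_deriv S g g' t"
proof -
  have "\<forall>\<^sub>F s in at 0. \<bar>s\<bar> < e"
    using assms(2) unfolding eventually_at by (intro exI[of _ e]) auto
  then have "uniform_limit S (\<lambda>s x. (f (t + s) x - f t x) /\<^sub>R s) f' (at 0) \<longleftrightarrow>
    uniform_limit S (\<lambda>s x. (g (t + s) x - g t x) /\<^sub>R s) g' (at 0)"
    using assms(2-4) by (intro uniform_limit_cong) (auto elim!: eventually_mono)
  then show ?thesis
    using assms(1) unfolding has_unif_deriv_def by simp
qed

lemma has_unif_deriv_reindex:
  "has_unif_deriv S f f' t \<Longrightarrow> \<pi> ` T \<subseteq> S
     \<Longrightarrow> has_unif_deriv T (\<lambda>s x. f s (\<pi> x)) (\<lambda>x. f' (\<pi> x)) t"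
  unfolding has_unif_deriv_def by (rule uniform_limit_compose') auto

lemma has_unif_deriv_const: "has_unif_deriv S (\<lambda>s. c) (\<lambda>x. 0) t"
  unfolding has_unif_deriv_def by (simp add: uniform_limit_const)

lemma tendsto_imp_has_vector_derivative:
  assumes "((\<lambda>s. (f (t + s) - f t) /\<^sub>R s) \<longlongrightarrow> D) (at (0::real))"
  shows "(f has_vector_derivative D) (at t)"
proof -
  have "((\<lambda>s. norm ((f (t + s) - f t) /\<^sub>R s - D)) \<longlongrightarrow> 0) (at 0)"
    using assms by (simp add: tendsto_norm_zero LIM_zero)
  then have "((\<lambda>s. norm (f (t + s) - f t - s *\<^sub>R D) / norm s) \<longlongrightarrow> 0) (at 0)"
  proof (rule Lim_transform_eventually)
    show "\<forall>\<^sub>F s in at 0. norm ((f (t + s) - f t) /\<^sub>R s - D)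
            = norm (f (t + s) - f t - s *\<^sub>R D) / norm s"
      unfolding eventually_at
    proof (intro exI[of _ 1] conjI ballI impI)
      fix s :: real assume s: "s \<noteq> 0 \<and> dist s 0 < 1"
      have "(f (t + s) - f t) /\<^sub>R s - D = (f (t + s) - f t - s *\<^sub>R D) /\<^sub>R s"
        using s by (simp add: algebra_simps)
      then show "norm ((f (t + s) - f t) /\<^sub>R s - D) = norm (f (t + s) - f t - s *\<^sub>R D) / norm s"
        by (simp add: divide_inverse mult.commute)
    qed simp
  qed
  then show ?thesis
    unfolding has_vector_derivative_def has_derivative_at
    by (simp add: bounded_linear_scaleR_left)
qed

lemma has_unif_deriv_pointwise:
  assumes "has_unif_deriv S f f' t" "x \<in> S"
  shows "((\<lambda>s. f s x) has_vector_derivative f' x) (at t)"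
  using tendsto_uniform_limitI[OF assms[unfolded has_unif_deriv_def]]
  by (intro tendsto_imp_has_vector_derivative)

lemma has_unif_deriv_add:
  "has_unif_deriv S f f' t \<Longrightarrow> has_unif_deriv S g g' t
     \<Longrightarrow> has_unif_deriv S (\<lambda>s x. f s x + g s x) (\<lambda>x. f' x + g' x) t"
  unfolding has_unif_deriv_def
  by (drule (1) uniform_limit_add, erule iffD1[OF uniform_limit_cong', rotated -1])
     (auto simp: algebra_simps)

lemma (in bounded_linear) has_unif_deriv:
  "has_unif_deriv S g g' t \<Longrightarrow> has_unif_deriv S (\<lambda>s x. f (g s x)) (\<lambda>x. f (g' x)) t"
  unfolding has_unif_deriv_def
  by (drule uniform_limit, erule iffD1[OF uniform_limit_cong', rotated -1])
     (auto simp: scaleR diff)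

lemma has_unif_deriv_sum:
  assumes "\<And>i. i \<in> I \<Longrightarrow> has_unif_deriv S (f i) (f' i) t"
  shows "has_unif_deriv S (\<lambda>s x. \<Sum>i\<in>I. f i s x) (\<lambda>x. \<Sum>i\<in>I. f' i x) t"
proof (cases "finite I")
  case True
  then show ?thesis
    using assms by (induction I) (auto intro: has_unif_deriv_add has_unif_deriv_const)
qed (simp add: has_unif_deriv_const)

text \<open>Boundedness of the limit \<open>l\<close> makes the factor \<open>s\<close> win
  uniformly in \<open>x\<close>. With the difference quotient as \<open>q\<close> this gives
  continuity in the parameter, uniformly over \<open>S\<close>.\<close>

lemma tendsto_scaled_uniform:
  fixes q :: "real \<Rightarrow> 'x \<Rightarrow> 'b::real_normed_vector"
  assumes "uniform_limit S q l (at (0::real))" "bounded (l ` S)"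
  shows "uniform_limit S (\<lambda>s x. s *\<^sub>R q s x) (\<lambda>x. 0) (at 0)"
proof -
  have "uniform_limit S (\<lambda>s x. s *\<^sub>R q s x) (\<lambda>x. 0 *\<^sub>R l x) (at 0)"
  proof (rule bounded_bilinear.bounded_uniform_limit[OF bounded_bilinear_scaleR])
    show "uniform_limit S (\<lambda>s x. s) (\<lambda>x. 0) (at (0::real))"
      by (rule uniform_limitI) (auto simp: eventually_at)
  qed (use assms in \<open>auto intro: finite_imp_bounded simp: image_constant_conv\<close>)
  then show ?thesis by simp
qed

lemma has_unif_deriv_imp_continuous:
  assumes "has_unif_deriv S f f' t" "bounded (f' ` S)"
  shows "uniform_limit S (\<lambda>s. f (t + s)) (f t) (at 0)"
proof -
  have "uniform_limit S (\<lambda>s x. s *\<^sub>R ((f (t + s) x - f t x) /\<^sub>R s)) (\<lambda>x. 0) (at 0)"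
    using assms unfolding has_unif_deriv_def by (rule tendsto_scaled_uniform)
  then have "uniform_limit S (\<lambda>s x. f t x + s *\<^sub>R ((f (t + s) x - f t x) /\<^sub>R s)) (\<lambda>x. f t x + 0) (at 0)"
    by (intro uniform_limit_add) (simp add: uniform_limit_iff)
  then show ?thesis
    by (rule iffD1[OF uniform_limit_cong, rotated -1]) (auto simp: eventually_at intro!: exI[of _ 1])
qed

text \<open>The difference quotient splits into \<open>prod (f t x)\<close> of that of
  \<open>g\<close>, plus \<open>prod\<close> of that of \<open>f\<close> with
  \<open>g (t + s) x\<close>. The bounds enter because products of uniformly convergent families
  converge uniformly when the limits are bounded.\<close>

lemma (in bounded_bilinear) has_unif_deriv:
  assumes f: "has_unif_deriv S f f' t" "bounded (f t ` S)" "bounded (f' ` S)"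
    and g: "has_unif_deriv S g g' t" "bounded (g t ` S)" "bounded (g' ` S)"
  shows "has_unif_deriv S (\<lambda>s x. prod (f s x) (g s x)) (\<lambda>x. prod (f t x) (g' x) + prod (f' x) (g t x)) t"
proof -
  have "uniform_limit S (\<lambda>s x. prod ((f (t + s) x - f t x) /\<^sub>R s) (g (t + s) x))
          (\<lambda>x. prod (f' x) (g t x)) (at 0)"
    using f g has_unif_deriv_imp_continuous[OF g(1,3)]
    by (intro bounded_uniform_limit) (auto simp: has_unif_deriv_def)
  moreover have "uniform_limit S (\<lambda>s x. prod (f t x) ((g (t + s) x - g t x) /\<^sub>R s))
          (\<lambda>x. prod (f t x) (g' x)) (at 0)"
    using f g by (intro bounded_uniform_limit) (auto simp: has_unif_deriv_def uniform_limit_iff)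
  ultimately have "uniform_limit S (\<lambda>s x. prod (f t x) ((g (t + s) x - g t x) /\<^sub>R s)
            + prod ((f (t + s) x - f t x) /\<^sub>R s) (g (t + s) x))
          (\<lambda>x. prod (f t x) (g' x) + prod (f' x) (g t x)) (at 0)"
    by (rule uniform_limit_add[rotated])
  then show ?thesis
    unfolding has_unif_deriv_def
    by (rule iffD1[OF uniform_limit_cong', rotated -1])
       (auto simp: diff_left diff_right scaleR_left scaleR_right scaleR_diff_right)
qed

lemma bounded_image_bilinear:
  assumes "bounded_bilinear bl" "bounded (f ` S)" "bounded (g ` S)"
  shows "bounded ((\<lambda>x. bl (f x) (g x)) ` S)"
proof -
  interpret bounded_bilinear bl by fact
  obtain K where K: "0 < K" "\<And>a b. norm (bl a b) \<le> norm a * norm b * K"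
    using pos_bounded by blast
  obtain F G where FG: "\<And>x. x \<in> S \<Longrightarrow> norm (f x) \<le> F" "\<And>x. x \<in> S \<Longrightarrow> norm (g x) \<le> G"
    using assms(2,3) by (auto simp: bounded_iff)
  have "norm (bl (f x) (g x)) \<le> F * G * K" if "x \<in> S" for x
    using K(2)[of "f x" "g x"] FG(1)[OF that] FG(2)[OF that] K(1)
    by (meson mult_mono norm_ge_zero order_trans less_imp_le mult_right_mono)
  then show ?thesis
    by (auto simp: bounded_iff)
qed

lemma bounded_image_add:
  fixes f g :: "'x \<Rightarrow> 'b::real_normed_vector"
  assumes "bounded (f ` S)" "bounded (g ` S)"
  shows "bounded ((\<lambda>x. f x + g x) ` S)"
  using bounded_plus_comp[OF assms] .

lemma bounded_image_linear:
  assumes "bounded_linear h" "bounded (f ` S)"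
  shows "bounded ((\<lambda>x. h (f x)) ` S)"
  using bounded_linear_image[OF assms(2,1)] by (simp add: image_image)

lemma bounded_image_sum:
  fixes f :: "'i \<Rightarrow> 'x \<Rightarrow> 'b::real_normed_vector"
  assumes "\<And>i. i \<in> I \<Longrightarrow> bounded (f i ` S)"
  shows "bounded ((\<lambda>x. \<Sum>i\<in>I. f i x) ` S)"
proof (cases "finite I")
  case True
  then show ?thesis
    using assms
  proof (induction I)
    case (insert i I)
    have "bounded ((\<lambda>x. f i x + (\<Sum>i\<in>I. f i x)) ` S)"
      using insert by (intro bounded_image_add) auto
    then show ?case using insert.hyps by simp
  qed (simp add: image_constant_conv)
qed (simp add: image_constant_conv)

text \<open>From 1/a - 1/b = -(a - b)/(ab). The lower bound \<open>\<delta>\<close> keeps the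
  denominators away from 0 uniformly in \<open>x\<close>, also at nearby parameters.\<close>

lemma has_unif_deriv_inverse:
  fixes f :: "real \<Rightarrow> 'x \<Rightarrow> real"
  assumes f: "has_unif_deriv S f f' t" "bounded (f' ` S)"
    and d: "0 < \<delta>" "\<And>x. x \<in> S \<Longrightarrow> \<delta> \<le> \<bar>f t x\<bar>"
  shows "has_unif_deriv S (\<lambda>s x. inverse (f s x)) (\<lambda>x. - (f' x * inverse (f t x) * inverse (f t x))) t"
proof -
  have cont: "uniform_limit S (\<lambda>s. f (t + s)) (f t) (at 0)"
    by (rule has_unif_deriv_imp_continuous[OF f])
  then have "\<forall>\<^sub>F s in at 0. \<forall>x\<in>S. dist (f (t + s) x) (f t x) < \<delta>"
    using d(1) by (auto simp: uniform_limit_iff)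
  then have nz: "\<forall>\<^sub>F s in at 0. \<forall>x\<in>S. f (t + s) x \<noteq> 0"
    by eventually_elim (use d(2) in \<open>fastforce simp: dist_real_def\<close>)
  have bi: "bounded ((\<lambda>x. inverse (f t x)) ` S)"
  proof -
    have "\<bar>inverse (f t x)\<bar> \<le> inverse \<delta>" if "x \<in> S" for x
      using d(1) d(2)[OF that] by (simp add: le_imp_inverse_le)
    then show ?thesis by (auto simp: bounded_iff)
  qed
  have inv: "uniform_limit S (\<lambda>s x. inverse (f (t + s) x)) (\<lambda>x. inverse (f t x)) (at 0)"
    using uniform_lim_inverse[OF cont, of \<delta>] d by (simp add: o_def)
  have "uniform_limit S (\<lambda>s x. - ((f (t + s) x - f t x) /\<^sub>R s * inverse (f (t + s) x) * inverse (f t x)))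
     (\<lambda>x. - (f' x * inverse (f t x) * inverse (f t x))) (at 0)"
    using f bi inv
    by (intro uniform_limit_uminus uniform_lim_mult bounded_image_bilinear[OF bounded_bilinear_mult])
       (auto simp: has_unif_deriv_def uniform_limit_iff)
  then show ?thesis
    unfolding has_unif_deriv_def
  proof (rule iffD1[OF uniform_limit_cong, rotated -1])
    show "\<forall>\<^sub>F s in at 0. \<forall>x\<in>S. - ((f (t + s) x - f t x) /\<^sub>R s * inverse (f (t + s) x) * inverse (f t x))
        = (inverse (f (t + s) x) - inverse (f t x)) /\<^sub>R s"
      using nz
    proof eventually_elim
      case (elim s)
      have "f t x \<noteq> 0" if "x \<in> S" for x using d(1) d(2)[OF that] by auto
      with elim show ?case
        by (auto simp: divide_simps) (auto simp: algebra_simps)?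
    qed
  qed auto
qed

text \<open>Once \<open>f (t + s) x\<close> is within \<open>\<delta>\<close> of
  \<open>f t x\<close>, both have the same sign, and sqrt|a| - sqrt|b| = sgn(b) (a - b) / (sqrt|a| +
  sqrt|b|). The derivative is written as a product of f', 1/f and the function itself, so that an
  induction on the order of differentiability can use it.\<close>

lemma has_unif_deriv_sqrt_abs:
  fixes f :: "real \<Rightarrow> 'x \<Rightarrow> real"
  assumes f: "has_unif_deriv S f f' t" "bounded (f' ` S)"
    and d: "0 < \<delta>" "\<And>x. x \<in> S \<Longrightarrow> \<delta> \<le> \<bar>f t x\<bar>"
  shows "has_unif_deriv S (\<lambda>s x. sqrt \<bar>f s x\<bar>) (\<lambda>x. f' x * inverse (f t x) * sqrt \<bar>f t x\<bar> * (1/2)) t"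
proof -
  let ?u = "\<lambda>s x. sqrt \<bar>f s x\<bar>"
  have cont: "uniform_limit S (\<lambda>s. f (t + s)) (f t) (at 0)"
    by (rule has_unif_deriv_imp_continuous[OF f])
  then have "\<forall>\<^sub>F s in at 0. \<forall>x\<in>S. dist (f (t + s) x) (f t x) < \<delta>"
    using d(1) by (auto simp: uniform_limit_iff)
  then have sg: "\<forall>\<^sub>F s in at 0. \<forall>x\<in>S. \<bar>f (t + s) x\<bar> - \<bar>f t x\<bar> = sgn (f t x) * (f (t + s) x - f t x)"
    by eventually_elim (use d(2) in \<open>fastforce simp: dist_real_def sgn_if abs_if split: if_splits\<close>)
  have ut: "sqrt \<delta> \<le> ?u t x" if "x \<in> S" for x
    using d(2)[OF that] by simp
  have sd: "0 < sqrt \<delta>" using d by simp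
  have ucont: "uniform_limit S (\<lambda>s. ?u (t + s)) (?u t) (at 0)"
  proof (rule uniform_limitI)
    fix e :: real assume "0 < e"
    then have "\<forall>\<^sub>F s in at 0. \<forall>x\<in>S. dist (f (t + s) x) (f t x) < e * sqrt \<delta>"
      using cont sd by (auto simp: uniform_limit_iff)
    then show "\<forall>\<^sub>F s in at 0. \<forall>x\<in>S. dist (?u (t + s) x) (?u t x) < e"
    proof eventually_elim
      case (elim s)
      show ?case
      proof
        fix x assume x: "x \<in> S"
        define a b where "a = ?u (t + s) x" and "b = ?u t x"
        have ab: "0 \<le> a" "sqrt \<delta> \<le> b" "a\<^sup>2 = \<bar>f (t + s) x\<bar>" "b\<^sup>2 = \<bar>f t x\<bar>"
          using ut[OF x] by (auto simp: a_def b_def)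
        \<comment> \<open>Since \<open>sqrt \<delta> \<le> b\<close>, the factor
          \<open>sqrt \<delta>\<close> is dominated by \<open>a + b\<close>, which turns the
          difference of roots into a difference of squares.\<close>
        have "\<bar>a - b\<bar> * sqrt \<delta> \<le> \<bar>a - b\<bar> * (a + b)"
          using ab sd by (intro mult_left_mono) auto
        also have "\<dots> = \<bar>a\<^sup>2 - b\<^sup>2\<bar>"
        proof -
          have "0 \<le> a + b" using ab sd by linarith
          then have "\<bar>a - b\<bar> * (a + b) = \<bar>(a - b) * (a + b)\<bar>" by (simp add: abs_mult)
          then show ?thesis by (simp add: algebra_simps power2_eq_square)
        qed
        also have "\<dots> \<le> \<bar>f (t + s) x - f t x\<bar>"
          using ab by linarith
        also have "\<dots> < e * sqrt \<delta>"
          using elim x by (auto simp: dist_real_def)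
        finally show "dist (?u (t + s) x) (?u t x) < e"
          using sd by (simp add: a_def b_def dist_real_def)
      qed
    qed
  qed
  have inv: "uniform_limit S (\<lambda>s x. inverse (?u (t + s) x + ?u t x)) (\<lambda>x. inverse (?u t x + ?u t x)) (at 0)"
  proof -
    have "uniform_limit S (\<lambda>s x. inverse (?u (t + s) x + ?u t x))
        (inverse \<circ> (\<lambda>x. ?u t x + ?u t x)) (at 0)"
    proof (rule uniform_lim_inverse)
      show "uniform_limit S (\<lambda>s x. ?u (t + s) x + ?u t x) (\<lambda>x. ?u t x + ?u t x) (at 0)"
        by (intro uniform_limit_add ucont uniform_limit_const)
      show "2 * sqrt \<delta> \<le> norm (?u t x + ?u t x)" if "x \<in> S" for x
        using ut[OF that] by simp
    qed (use sd in simp)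
    then show ?thesis by (simp add: o_def)
  qed
  have binv: "bounded ((\<lambda>x. inverse (?u t x + ?u t x)) ` S)"
  proof -
    have "\<bar>inverse (?u t x + ?u t x)\<bar> \<le> inverse (2 * sqrt \<delta>)" if "x \<in> S" for x
      using ut[OF that] sd by (simp add: le_imp_inverse_le)
    then show ?thesis unfolding bounded_iff real_norm_def by blast
  qed
  have bsgn: "bounded ((\<lambda>x. sgn (f t x)) ` S)"
    by (auto simp: bounded_iff sgn_if intro!: exI[of _ 1])
  have "uniform_limit S (\<lambda>s x. sgn (f t x) * ((f (t + s) x - f t x) /\<^sub>R s) * inverse (?u (t + s) x + ?u t x))
     (\<lambda>x. sgn (f t x) * f' x * inverse (?u t x + ?u t x)) (at 0)"
    using f bsgn binv inv
    by (intro uniform_lim_mult bounded_image_bilinear[OF bounded_bilinear_mult])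
       (auto simp: has_unif_deriv_def uniform_limit_const)
  then show ?thesis
    unfolding has_unif_deriv_def
  proof (rule iffD1[OF uniform_limit_cong, rotated -1])
    show "\<forall>\<^sub>F s in at 0. \<forall>x\<in>S. sgn (f t x) * ((f (t + s) x - f t x) /\<^sub>R s) * inverse (?u (t + s) x + ?u t x)
        = (?u (t + s) x - ?u t x) /\<^sub>R s"
      using sg
    proof eventually_elim
      case (elim s)
      show ?case
      proof
        fix x assume x: "x \<in> S"
        have p: "0 < ?u (t + s) x + ?u t x" using ut[OF x] sd by (smt (verit) real_sqrt_ge_0_iff abs_ge_zero)
        have "(?u (t + s) x - ?u t x) * (?u (t + s) x + ?u t x) = \<bar>f (t + s) x\<bar> - \<bar>f t x\<bar>"
          by (simp add: algebra_simps)
        then have "?u (t + s) x - ?u t x = sgn (f t x) * (f (t + s) x - f t x) * inverse (?u (t + s) x + ?u t x)"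
          using elim x p by (simp add: field_simps)
        then show "sgn (f t x) * ((f (t + s) x - f t x) /\<^sub>R s) * inverse (?u (t + s) x + ?u t x)
            = (?u (t + s) x - ?u t x) /\<^sub>R s" by simp
      qed
    qed
    show "sgn (f t x) * f' x * inverse (?u t x + ?u t x) = f' x * inverse (f t x) * ?u t x * (1/2)"
      if "x \<in> S" for x
    proof -
      have "f t x \<noteq> 0" using d(1) d(2)[OF that] by auto
      moreover have "?u t x * ?u t x = \<bar>f t x\<bar>" by simp
      ultimately show ?thesis
        using ut[OF that] sd by (auto simp: field_simps sgn_if abs_if split: if_splits)
    qed
  qed
qed

text \<open>Only the existence of a bounded derivative \<open>D\<close> is recorded; for the
  determinant it is identified pointwise afterwards. Boundedness of the product itself is carried
  along for the product rule in the induction step.\<close>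

lemma has_unif_deriv_prod:
  fixes f :: "'i \<Rightarrow> real \<Rightarrow> 'x \<Rightarrow> real"
  assumes "finite I" and "\<And>i. i \<in> I \<Longrightarrow> has_unif_deriv S (f i) (f' i) t"
    and "\<And>i. i \<in> I \<Longrightarrow> bounded (f i t ` S)" "\<And>i. i \<in> I \<Longrightarrow> bounded (f' i ` S)"
  shows "bounded ((\<lambda>x. \<Prod>i\<in>I. f i t x) ` S) \<and>
    (\<exists>D. has_unif_deriv S (\<lambda>s x. \<Prod>i\<in>I. f i s x) D t \<and> bounded (D ` S))"
  using assms
proof (induction I)
  case empty
  then show ?case
    using has_unif_deriv_const[of S "\<lambda>x. 1::real" t] by (auto simp: image_constant_conv intro!: exI)
next
  case (insert i I)
  then obtain D where D: "bounded ((\<lambda>x. \<Prod>i\<in>I. f i t x) ` S)"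
      "has_unif_deriv S (\<lambda>s x. \<Prod>i\<in>I. f i s x) D t" "bounded (D ` S)"
    by auto
  have "has_unif_deriv S (\<lambda>s x. f i s x * (\<Prod>i\<in>I. f i s x))
      (\<lambda>x. f i t x * D x + f' i x * (\<Prod>i\<in>I. f i t x)) t"
    using insert.prems D by (intro bounded_bilinear.has_unif_deriv[OF bounded_bilinear_mult]) auto
  moreover have "bounded ((\<lambda>x. f i t x * D x + f' i x * (\<Prod>i\<in>I. f i t x)) ` S)"
    using insert.prems D by (intro bounded_image_add bounded_image_bilinear[OF bounded_bilinear_mult]) auto
  moreover have "bounded ((\<lambda>x. f i t x * (\<Prod>i\<in>I. f i t x)) ` S)"
    using insert.prems D by (intro bounded_image_bilinear[OF bounded_bilinear_mult]) auto
  ultimately show ?case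
    using insert.hyps by auto
qed

text \<open>The set \<open>B\<close> is a set of parameters: integrating out the first factor of
  \<open>space \<sigma> \<times> B\<close> costs only the finite total mass, and uniformity over
  \<open>B\<close> remains. Measurability of \<open>F'\<close> in \<open>p\<close> holds because it
  is a pointwise limit of difference quotients along 1/(n + 1).\<close>

lemma has_unif_deriv_integral:
  fixes F :: "real \<Rightarrow> 'p \<times> 'v \<Rightarrow> real"
  assumes \<sigma>: "finite_measure \<sigma>"
    and F: "has_unif_deriv (space \<sigma> \<times> B) F F' t" "bounded (F' ` (space \<sigma> \<times> B))"
    and b: "\<And>s. bounded (F s ` (space \<sigma> \<times> B))"
    and meas: "\<And>s v. v \<in> B \<Longrightarrow> (\<lambda>p. F s (p, v)) \<in> borel_measurable \<sigma>"
  shows "has_unif_deriv B (\<lambda>s v. \<integral>p. F s (p, v) \<partial>\<sigma>) (\<lambda>v. \<integral>p. F' (p, v) \<partial>\<sigma>) t"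
    and "\<And>v. v \<in> B \<Longrightarrow> (\<lambda>p. F' (p, v)) \<in> borel_measurable \<sigma>"
proof -
  interpret finite_measure \<sigma> by fact
  show meas': "(\<lambda>p. F' (p, v)) \<in> borel_measurable \<sigma>" if v: "v \<in> B" for v
  proof (rule borel_measurable_LIMSEQ_real)
    fix p assume "p \<in> space \<sigma>"
    then have "((\<lambda>s. (F (t + s) (p, v) - F t (p, v)) /\<^sub>R s) \<longlongrightarrow> F' (p, v)) (at 0)"
      using tendsto_uniform_limitI[OF F(1)[unfolded has_unif_deriv_def], of "(p, v)"] v by auto
    moreover have "filterlim (\<lambda>n. 1 / real (Suc n)) (at 0) sequentially"
      using LIMSEQ_inverse_real_of_nat by (auto simp: filterlim_at inverse_eq_divide)
    ultimately show "(\<lambda>n. (F (t + 1 / real (Suc n)) (p, v) - F t (p, v)) /\<^sub>R (1 / real (Suc n)))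
         \<longlonglongrightarrow> F' (p, v)"
      by (rule filterlim_compose)
  next
    fix n
    show "(\<lambda>p. (F (t + 1 / real (Suc n)) (p, v) - F t (p, v)) /\<^sub>R (1 / real (Suc n))) \<in> borel_measurable \<sigma>"
      using meas[OF v] by (intro borel_measurable_scaleR borel_measurable_diff) auto
  qed
  have int: "integrable \<sigma> (\<lambda>p. F s (p, v))" if "v \<in> B" for s v
  proof -
    obtain C where "\<And>x. x \<in> space \<sigma> \<times> B \<Longrightarrow> norm (F s x) \<le> C" using b[of s] by (auto simp: bounded_iff)
    then show ?thesis using that meas by (intro integrable_const_bound[of _ C]) auto
  qed
  have int': "integrable \<sigma> (\<lambda>p. F' (p, v))" if "v \<in> B" for v
  proof -
    obtain C where "\<And>x. x \<in> space \<sigma> \<times> B \<Longrightarrow> norm (F' x) \<le> C" using F(2) by (auto simp: bounded_iff)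
    then show ?thesis using that meas' by (intro integrable_const_bound[of _ C]) auto
  qed
  show "has_unif_deriv B (\<lambda>s v. \<integral>p. F s (p, v) \<partial>\<sigma>) (\<lambda>v. \<integral>p. F' (p, v) \<partial>\<sigma>) t"
    unfolding has_unif_deriv_def
  proof (rule uniform_limitI)
    fix e :: real assume e: "0 < e"
    \<comment> \<open>One is added to the total mass to make \<open>m\<close> positive and the final
      inequality strict.\<close>
    define m where "m = measure \<sigma> (space \<sigma>) + 1"
    have m: "0 < m" by (simp add: m_def add_nonneg_pos)
    have "\<forall>\<^sub>F s in at 0. \<forall>x\<in>space \<sigma> \<times> B. dist ((F (t + s) x - F t x) /\<^sub>R s) (F' x) < e / m"
      using F(1) e m unfolding has_unif_deriv_def uniform_limit_iff by auto
    then show "\<forall>\<^sub>F s in at 0. \<forall>v\<in>B. dist (((\<integral>p. F (t + s) (p, v) \<partial>\<sigma>) - (\<integral>p. F t (p, v) \<partial>\<sigma>)) /\<^sub>R s)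
        (\<integral>p. F' (p, v) \<partial>\<sigma>) < e"
    proof eventually_elim
      case (elim s)
      show ?case
      proof
        fix v assume v: "v \<in> B"
        let ?D = "\<lambda>p. (F (t + s) (p, v) - F t (p, v)) /\<^sub>R s - F' (p, v)"
        have "((\<integral>p. F (t + s) (p, v) \<partial>\<sigma>) - (\<integral>p. F t (p, v) \<partial>\<sigma>)) /\<^sub>R s - (\<integral>p. F' (p, v) \<partial>\<sigma>)
            = (\<integral>p. ?D p \<partial>\<sigma>)"
          using int[OF v] int'[OF v] by simp
        also have "norm \<dots> \<le> (\<integral>p. norm (?D p) \<partial>\<sigma>)" by simp
        also have "\<dots> \<le> (\<integral>p. e / m \<partial>\<sigma>)"
          using int[OF v] int'[OF v] elim v by (intro integral_mono) (auto simp: dist_norm less_imp_le)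
        also have "\<dots> = e * (measure \<sigma> (space \<sigma>) / m)" by simp
        also have "\<dots> < e * 1"
          using m e by (intro mult_strict_left_mono) (auto simp: m_def)
        finally show "dist (((\<integral>p. F (t + s) (p, v) \<partial>\<sigma>) - (\<integral>p. F t (p, v) \<partial>\<sigma>)) /\<^sub>R s)
            (\<integral>p. F' (p, v) \<partial>\<sigma>) < e" by (simp add: dist_norm)
      qed
    qed
  qed
qed

section \<open>Curves of functions with \<open>n\<close> bounded uniform derivatives\<close>

primrec unif_C :: "nat \<Rightarrow> 'x set \<Rightarrow> (real \<Rightarrow> 'x \<Rightarrow> 'b::real_normed_vector) \<Rightarrow> bool" where
  "unif_C 0 S f \<longleftrightarrow> (\<forall>t. bounded (f t ` S))"
| "unif_C (Suc n) S f \<longleftrightarrow> (\<forall>t. bounded (f t ` S)) \<and>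
     (\<exists>f'. (\<forall>t. has_unif_deriv S f (f' t) t) \<and> unif_C n S f')"

lemma unif_C_bounded: "unif_C n S f \<Longrightarrow> bounded (f t ` S)"
  by (cases n) auto

lemma unif_C_SucI:
  "(\<And>t. bounded (f t ` S)) \<Longrightarrow> (\<And>t. has_unif_deriv S f (f' t) t) \<Longrightarrow> unif_C n S f'
     \<Longrightarrow> unif_C (Suc n) S f"
  by auto

lemma unif_C_SucD: "unif_C (Suc n) S f \<Longrightarrow> unif_C n S f"
proof (induction n arbitrary: f)
  case (Suc n)
  then obtain f' where f': "\<forall>t. has_unif_deriv S f (f' t) t" "unif_C (Suc n) S f'"
    unfolding unif_C.simps(2)[of "Suc n"] by auto
  show ?case
    using unif_C_bounded[OF Suc.prems] f'(1) Suc.IH[OF f'(2)] by (intro unif_C_SucI) auto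
qed auto

lemma unif_C_cong:
  assumes "\<And>t x. x \<in> S \<Longrightarrow> f t x = g t x"
  shows "unif_C n S f \<longleftrightarrow> unif_C n S g"
proof -
  have "has_unif_deriv S f d t \<longleftrightarrow> has_unif_deriv S g d t" for d t
    using assms by (intro has_unif_deriv_cong) auto
  moreover have "f t ` S = g t ` S" for t using assms by auto
  ultimately show ?thesis by (cases n) auto
qed

text \<open>It converts a derivative sequence such as the one supplied by
  \<open>smooth_curve\<close> into every finite order at once.\<close>

lemma unif_C_sequence:
  assumes "\<And>j t. bounded (d j t ` S)" "\<And>j t. has_unif_deriv S (d j) (d (Suc j) t) t"
  shows "unif_C n S (d j)"
proof (induction n arbitrary: j)
  case (Suc n)
  show ?case by (rule unif_C_SucI[OF assms(1,2) Suc])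
qed (use assms in auto)

lemma unif_C_const: "bounded (c ` S) \<Longrightarrow> unif_C n S (\<lambda>t. c)"
proof -
  assume b: "bounded (c ` S)"
  have *: "unif_C n S (\<lambda>t x. 0)" for n
    by (induction n) (auto simp: image_constant_conv intro!: exI[of _ "\<lambda>t x. 0"] has_unif_deriv_const)
  show ?thesis
    by (cases n) (use b * has_unif_deriv_const in \<open>auto intro!: exI[of _ "\<lambda>t x. 0"]\<close>)
qed

lemma unif_C_add: "unif_C n S f \<Longrightarrow> unif_C n S g \<Longrightarrow> unif_C n S (\<lambda>t x. f t x + g t x)"
proof (induction n arbitrary: f g)
  case (Suc n)
  then obtain f' g' where *: "\<forall>t. has_unif_deriv S f (f' t) t" "unif_C n S f'"
     "\<forall>t. has_unif_deriv S g (g' t) t" "unif_C n S g'" by auto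
  then show ?case
    using Suc by (auto intro!: exI[of _ "\<lambda>t x. f' t x + g' t x"] has_unif_deriv_add bounded_image_add)
qed (auto intro: bounded_image_add)

lemma unif_C_linear:
  "bounded_linear h \<Longrightarrow> unif_C n S f \<Longrightarrow> unif_C n S (\<lambda>t x. h (f t x))"
proof (induction n arbitrary: f)
  case (Suc n)
  then obtain f' where *: "\<forall>t. has_unif_deriv S f (f' t) t" "unif_C n S f'" by auto
  then show ?case
    by (intro unif_C_SucI[OF bounded_image_linear[OF Suc.prems(1) unif_C_bounded[OF Suc.prems(2)]]
          bounded_linear.has_unif_deriv[OF Suc.prems(1)] Suc.IH[OF Suc.prems(1)]]) auto
qed (auto intro: bounded_image_linear)

lemma unif_C_bilinear:
  assumes "bounded_bilinear bl"
  shows "unif_C n S f \<Longrightarrow> unif_C n S g \<Longrightarrow> unif_C n S (\<lambda>t x. bl (f t x) (g t x))"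
proof (induction n arbitrary: f g)
  case (Suc n)
  then obtain f' g' where *: "\<forall>t. has_unif_deriv S f (f' t) t" "unif_C n S f'"
     "\<forall>t. has_unif_deriv S g (g' t) t" "unif_C n S g'" by auto
  have "unif_C n S (\<lambda>t x. bl (f t x) (g' t x) + bl (f' t x) (g t x))"
    using * unif_C_SucD[OF Suc.prems(1)] unif_C_SucD[OF Suc.prems(2)] by (intro unif_C_add Suc.IH)
  moreover have "has_unif_deriv S (\<lambda>s x. bl (f s x) (g s x))
      (\<lambda>x. bl (f t x) (g' t x) + bl (f' t x) (g t x)) t" for t
    by (rule bounded_bilinear.has_unif_deriv[OF assms *(1)[rule_format] unif_C_bounded[OF Suc.prems(1)]
          unif_C_bounded[OF *(2)] *(3)[rule_format] unif_C_bounded[OF Suc.prems(2)] unif_C_bounded[OF *(4)]])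
  ultimately show ?case
    using unif_C_bounded[OF Suc.prems(1)] unif_C_bounded[OF Suc.prems(2)]
    by (intro unif_C_SucI bounded_image_bilinear[OF assms])
qed (auto intro: bounded_image_bilinear[OF assms])

lemmas unif_C_mult = unif_C_bilinear[OF bounded_bilinear_mult]

lemma unif_C_sum:
  assumes "\<And>i. i \<in> I \<Longrightarrow> unif_C n S (f i)"
  shows "unif_C n S (\<lambda>t x. \<Sum>i\<in>I. f i t x)"
proof (cases "finite I")
  case True
  then show ?thesis
    using assms by (induction I) (auto intro: unif_C_add unif_C_const simp: image_constant_conv)
qed (simp add: unif_C_const image_constant_conv)

lemma unif_C_prod:
  fixes f :: "'i \<Rightarrow> real \<Rightarrow> 'x \<Rightarrow> real"
  assumes "\<And>i. i \<in> I \<Longrightarrow> unif_C n S (f i)"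
  shows "unif_C n S (\<lambda>t x. \<Prod>i\<in>I. f i t x)"
proof (cases "finite I")
  case True
  then show ?thesis
    using assms by (induction I) (auto intro: unif_C_mult unif_C_const simp: image_constant_conv)
qed (simp add: unif_C_const image_constant_conv)

lemma unif_C_uminus: "unif_C n S f \<Longrightarrow> unif_C n S (\<lambda>t x. - f t x)"
  by (rule unif_C_linear[OF bounded_linear_minus[OF bounded_linear_ident]])

lemma bounded_image_reindex:
  "bounded (f ` S) \<Longrightarrow> \<pi> ` T \<subseteq> S \<Longrightarrow> bounded ((\<lambda>x. f (\<pi> x)) ` T)"
  by (erule bounded_subset) auto

text \<open>With a projection as \<open>\<pi>\<close>, a curve of functions of the point alone
  becomes one over \<open>K \<times> B\<close>.\<close>

lemma unif_C_reindex: "unif_C n S f \<Longrightarrow> \<pi> ` T \<subseteq> S \<Longrightarrow> unif_C n T (\<lambda>t x. f t (\<pi> x))"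
proof (induction n arbitrary: f)
  case 0
  then have "bounded ((\<lambda>x. f t (\<pi> x)) ` T)" for t
    using bounded_image_reindex[of "f t" S \<pi> T] by simp
  then show ?case by simp
next
  case (Suc n)
  then obtain f' where *: "\<forall>t. has_unif_deriv S f (f' t) t" "unif_C n S f'" by auto
  show ?case
    using * Suc.prems(2)
    by (intro unif_C_SucI[OF bounded_image_reindex[OF unif_C_bounded[OF Suc.prems(1)] Suc.prems(2)]
          has_unif_deriv_reindex[of S f "f' _"] Suc.IH]) auto
qed

text \<open>The derivative is a product of \<open>f'\<close> with two copies of the inverse, which
  has order \<open>n\<close> by induction. The bound \<open>\<delta>\<close> may vary with
  \<open>t\<close> because the differentiation rule uses a lower bound at the single time
  \<open>t\<close>.\<close>

lemma unif_C_inverse: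
  fixes f :: "real \<Rightarrow> 'x \<Rightarrow> real"
  assumes "unif_C n S f" and d: "\<And>t. 0 < \<delta> t" "\<And>t x. x \<in> S \<Longrightarrow> \<delta> t \<le> \<bar>f t x\<bar>"
  shows "unif_C n S (\<lambda>t x. inverse (f t x))"
proof -
  have b: "bounded ((\<lambda>x. inverse (f t x)) ` S)" for t
  proof -
    have "\<bar>inverse (f t x)\<bar> \<le> inverse (\<delta> t)" if "x \<in> S" for x
      using d(1)[of t] d(2)[OF that, of t] by (simp add: le_imp_inverse_le)
    then show ?thesis unfolding bounded_iff real_norm_def by blast
  qed
  show ?thesis
    using assms(1)
  proof (induction n)
    case (Suc n)
    then obtain f' where *: "\<forall>t. has_unif_deriv S f (f' t) t" "unif_C n S f'" by auto
    have "unif_C n S (\<lambda>t x. - (f' t x * inverse (f t x) * inverse (f t x)))"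
      using * Suc.IH[OF unif_C_SucD[OF Suc.prems]] by (intro unif_C_uminus unif_C_mult)
    moreover have "has_unif_deriv S (\<lambda>s x. inverse (f s x))
        (\<lambda>x. - (f' t x * inverse (f t x) * inverse (f t x))) t" for t
      by (rule has_unif_deriv_inverse[OF *(1)[rule_format] unif_C_bounded[OF *(2)] d])
    ultimately show ?case using b by (intro unif_C_SucI)
  qed (use b in auto)
qed

lemma unif_C_sqrt_abs:
  fixes f :: "real \<Rightarrow> 'x \<Rightarrow> real"
  assumes "unif_C n S f" and d: "\<And>t. 0 < \<delta> t" "\<And>t x. x \<in> S \<Longrightarrow> \<delta> t \<le> \<bar>f t x\<bar>"
  shows "unif_C n S (\<lambda>t x. sqrt \<bar>f t x\<bar>)"
proof -
  have b: "bounded ((\<lambda>x. sqrt \<bar>f t x\<bar>) ` S)" for t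
  proof -
    obtain C where "\<And>x. x \<in> S \<Longrightarrow> \<bar>f t x\<bar> \<le> C"
      using unif_C_bounded[OF assms(1), of t] by (auto simp: bounded_iff)
    then have "\<bar>sqrt \<bar>f t x\<bar>\<bar> \<le> sqrt C" if "x \<in> S" for x
      using that by simp
    then show ?thesis unfolding bounded_iff real_norm_def by blast
  qed
  show ?thesis
    using assms(1)
  proof (induction n)
    case (Suc n)
    then obtain f' where *: "\<forall>t. has_unif_deriv S f (f' t) t" "unif_C n S f'" by auto
    have "unif_C n S (\<lambda>t x. f' t x * inverse (f t x) * sqrt \<bar>f t x\<bar> * (1/2))"
      using * Suc.IH[OF unif_C_SucD[OF Suc.prems]] unif_C_inverse[OF unif_C_SucD[OF Suc.prems] d]
      by (intro unif_C_mult unif_C_const) (auto simp: image_constant_conv)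
    moreover have "has_unif_deriv S (\<lambda>s x. sqrt \<bar>f s x\<bar>)
        (\<lambda>x. f' t x * inverse (f t x) * sqrt \<bar>f t x\<bar> * (1/2)) t" for t
      by (rule has_unif_deriv_sqrt_abs[OF *(1)[rule_format] unif_C_bounded[OF *(2)] d])
    ultimately show ?case using b by (intro unif_C_SucI)
  qed (use b in auto)
qed

text \<open>Differentiation under the integral at every order: the derivative \<open>F'\<close>
  inherits measurability in \<open>p\<close>, so that the induction can continue with it.\<close>

lemma unif_C_integral:
  fixes F :: "real \<Rightarrow> 'p \<times> 'v \<Rightarrow> real"
  assumes \<sigma>: "finite_measure \<sigma>"
  shows "unif_C n (space \<sigma> \<times> B) F \<Longrightarrow> (\<And>t v. v \<in> B \<Longrightarrow> (\<lambda>p. F t (p, v)) \<in> borel_measurable \<sigma>)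
    \<Longrightarrow> unif_C n B (\<lambda>t v. \<integral>p. F t (p, v) \<partial>\<sigma>)"
proof (induction n arbitrary: F)
  have b: "bounded ((\<lambda>v. \<integral>p. F t (p, v) \<partial>\<sigma>) ` B)"
    if F: "unif_C n (space \<sigma> \<times> B) F" "\<And>t v. v \<in> B \<Longrightarrow> (\<lambda>p. F t (p, v)) \<in> borel_measurable \<sigma>"
    for F :: "real \<Rightarrow> 'p \<times> 'v \<Rightarrow> real" and t n
  proof -
    interpret finite_measure \<sigma> by fact
    obtain C where C: "\<And>x. x \<in> space \<sigma> \<times> B \<Longrightarrow> norm (F t x) \<le> C"
      using unif_C_bounded[OF F(1), of t] by (auto simp: bounded_iff)
    have "norm (\<integral>p. F t (p, v) \<partial>\<sigma>) \<le> C * measure \<sigma> (space \<sigma>)" if v: "v \<in> B" for v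
    proof -
      have "integrable \<sigma> (\<lambda>p. F t (p, v))"
        using v F C by (intro integrable_const_bound[of _ C]) auto
      then have "(\<integral>p. norm (F t (p, v)) \<partial>\<sigma>) \<le> (\<integral>p. C \<partial>\<sigma>)"
        using v C by (intro integral_mono) auto
      with integral_norm_bound[of \<sigma> "\<lambda>p. F t (p, v)"]
      have "norm (\<integral>p. F t (p, v) \<partial>\<sigma>) \<le> (\<integral>p. C \<partial>\<sigma>)"
        by linarith
      then show ?thesis by (simp add: mult.commute)
    qed
    then show ?thesis unfolding bounded_iff by blast
  qed
  {
    case 0
    then show ?case using b[of 0 F] by auto
  next
    case (Suc n)
    then obtain F' where F': "\<forall>t. has_unif_deriv (space \<sigma> \<times> B) F (F' t) t" "unif_C n (space \<sigma> \<times> B) F'"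
      by auto
    have 1: "has_unif_deriv B (\<lambda>s v. \<integral>p. F s (p, v) \<partial>\<sigma>) (\<lambda>v. \<integral>p. F' t (p, v) \<partial>\<sigma>) t"
      and 2: "\<And>v. v \<in> B \<Longrightarrow> (\<lambda>p. F' t (p, v)) \<in> borel_measurable \<sigma>" for t
      using has_unif_deriv_integral[OF \<sigma> F'(1)[rule_format] unif_C_bounded[OF F'(2)]
          unif_C_bounded[OF Suc.prems(1)] Suc.prems(2)] by blast+
    show ?case
      by (rule unif_C_SucI[OF b[OF Suc.prems] 1 Suc.IH[OF F'(2) 2]])
  }
qed

subsection \<open>Matrices\<close>

lemma bounded_bilinear_matrix_mult:
  "bounded_bilinear ((**) :: real^'n::finite^'m::finite \<Rightarrow> real^'k::finite^'n \<Rightarrow> real^'k^'m)"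
proof -
  have "bilinear ((**) :: real^'n^'m \<Rightarrow> real^'k^'n \<Rightarrow> real^'k^'m)"
    unfolding bilinear_def linear_iff
    by (auto simp: vec_eq_iff matrix_matrix_mult_def sum.distrib algebra_simps sum_distrib_left)
  then show ?thesis by (simp add: bilinear_conv_bounded_bilinear)
qed

interpretation matrix_mult: bounded_bilinear
  "(**) :: real^'n::finite^'m::finite \<Rightarrow> real^'k::finite^'n \<Rightarrow> real^'k^'m"
  by (rule bounded_bilinear_matrix_mult)

lemma bounded_linear_trace: "bounded_linear (trace :: real^'n::finite^'n \<Rightarrow> real)"
proof -
  have "linear (trace :: real^'n^'n \<Rightarrow> real)"
    unfolding linear_iff by (auto simp: trace_def sum.distrib algebra_simps sum_distrib_left)
  then show ?thesis by (simp add: linear_conv_bounded_linear)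
qed

lemma bounded_linear_entry: "bounded_linear (\<lambda>A :: real^'n::finite^'m::finite. A $ i $ j)"
  by (intro bounded_linear_compose[OF bounded_linear_vec_nth] bounded_linear_vec_nth)

lemma matrix_inv_mult:
  assumes "invertible (A :: real^'n::finite^'n)"
  shows "A ** matrix_inv A = mat 1" "matrix_inv A ** A = mat 1"
  using someI_ex[OF assms[unfolded invertible_def]] by (auto simp: matrix_inv_def)

lemma matrix_inv_unique':
  fixes A B :: "real^'n::finite^'n"
  assumes "A ** B = mat 1"
  shows "matrix_inv A = B"
proof -
  have "B ** A = mat 1" using assms by (simp add: matrix_left_right_inverse)
  then have "invertible A" using assms by (auto simp: invertible_def)
  then have "matrix_inv A = matrix_inv A ** (A ** B)" using assms by simp
  also have "\<dots> = B"
    by (simp only: matrix_mul_assoc matrix_inv_mult[OF \<open>invertible A\<close>] matrix_mul_lid)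
  finally show ?thesis .
qed

lemma continuous_on_det: "continuous_on UNIV (det :: real^'n::finite^'n \<Rightarrow> real)"
  unfolding det_def by (intro continuous_intros)

lemma det_matrix_inv:
  assumes "invertible (A :: real^'n::finite^'n)"
  shows "det A * det (matrix_inv A) = 1"
  using matrix_inv_mult(1)[OF assms] by (metis det_I det_mul)

text \<open>Cramer's rule, applied to the \<open>j\<close>-th column of the inverse. It exhibits
  inversion as a quotient of polynomials in the entries, whence its continuity.\<close>

lemma matrix_inv_entry:
  fixes A :: "real^'n::finite^'n"
  assumes "invertible A"
  shows "matrix_inv A $ k $ j =
     det (\<chi> i l. if l = k then (axis j 1 :: real^'n) $ i else A $ i $ l) / det A"
proof -
  have d: "det A \<noteq> 0" using assms by (simp add: invertible_det_nz)
  have "A *v (matrix_inv A *v axis j 1) = axis j 1"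
    by (simp add: matrix_vector_mul_assoc matrix_inv_mult(1)[OF assms])
  then have "matrix_inv A *v axis j 1 =
      (\<chi> k. det (\<chi> i l. if l = k then (axis j 1 :: real^'n) $ i else A $ i $ l) / det A)"
    using cramer[OF d] by blast
  moreover have "(matrix_inv A *v axis j 1) $ k = matrix_inv A $ k $ j"
    by (simp add: matrix_vector_mult_basis column_def)
  ultimately show ?thesis by simp
qed

lemma continuous_on_matrix_inv:
  "continuous_on {A :: real^'n::finite^'n. invertible A} matrix_inv"
proof -
  have *: "continuous_on {A :: real^'n^'n. invertible A}
     (\<lambda>A. det (\<chi> i l. if l = k then (axis j 1 :: real^'n) $ i else A $ i $ l) / det A)" for j k
  proof (rule continuous_on_divide)
    have "continuous_on UNIV (\<lambda>A :: real^'n^'n. \<chi> i l. if l = k then (axis j 1 :: real^'n) $ i else A $ i $ l)"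
    proof (intro continuous_on_vec_lambda)
      show "continuous_on UNIV (\<lambda>A :: real^'n^'n. if l = k then (axis j 1 :: real^'n) $ i else A $ i $ l)" for i l
        by (cases "l = k") (auto intro!: continuous_intros)
    qed
    then show "continuous_on {A. invertible A}
        (\<lambda>A :: real^'n^'n. det (\<chi> i l. if l = k then (axis j 1 :: real^'n) $ i else A $ i $ l))"
      by (rule continuous_on_subset[OF continuous_on_compose2[OF continuous_on_det]]) auto
    show "continuous_on {A :: real^'n^'n. invertible A} det"
      using continuous_on_det by (rule continuous_on_subset) simp
  qed (simp add: invertible_det_nz)
  have "continuous_on {A :: real^'n^'n. invertible A} (\<lambda>A. \<chi> k j.
     det (\<chi> i l. if l = k then (axis j 1 :: real^'n) $ i else A $ i $ l) / det A)"
    by (intro continuous_on_vec_lambda *)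
  then show ?thesis
    by (rule continuous_on_eq) (simp add: vec_eq_iff matrix_inv_entry)
qed

text \<open>The determinant is bounded on the compact closure of the set of inverses, and det G
  det(G^-1) = 1. So bounded inverses keep the determinant away from 0.\<close>

lemma det_lower_bound:
  fixes G :: "'x \<Rightarrow> real^'n::finite^'n"
  assumes "\<And>x. x \<in> S \<Longrightarrow> invertible (G x)" "bounded ((\<lambda>x. matrix_inv (G x)) ` S)"
  obtains \<delta> where "0 < \<delta>" "\<And>x. x \<in> S \<Longrightarrow> \<delta> \<le> \<bar>det (G x)\<bar>"
proof -
  have "bounded (det ` closure ((\<lambda>x. matrix_inv (G x)) ` S))"
    using assms(2) continuous_on_det
    by (intro compact_imp_bounded compact_continuous_image continuous_on_subset[OF continuous_on_det])
       (auto simp: compact_closure)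
  then obtain C where C: "0 < C" "\<And>A. A \<in> closure ((\<lambda>x. matrix_inv (G x)) ` S) \<Longrightarrow> \<bar>det A\<bar> \<le> C"
    unfolding bounded_pos by auto
  show thesis
  proof (rule that)
    show "0 < inverse C" using C by simp
    fix x assume x: "x \<in> S"
    then have "matrix_inv (G x) \<in> closure ((\<lambda>x. matrix_inv (G x)) ` S)"
      by (intro subsetD[OF closure_subset] imageI)
    then have "\<bar>det (matrix_inv (G x))\<bar> \<le> C" by (rule C(2))
    moreover have "\<bar>det (G x)\<bar> * \<bar>det (matrix_inv (G x))\<bar> = 1"
      using det_matrix_inv[OF assms(1)[OF x]] by (simp flip: abs_mult)
    ultimately have "1 \<le> \<bar>det (G x)\<bar> * C"
      by (metis abs_ge_zero mult_left_mono)
    then show "inverse C \<le> \<bar>det (G x)\<bar>" using C(1) by (simp add: field_simps)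
  qed
qed

text \<open>The identity A_s - A_t = - A_s (G_s - G_t) A_t for the inverses gives the derivative
  once A_s is known to converge. A bound on A_s for s near t comes from absorption: the identity
  bounds |A_s - A_t| by half of |A_s|, hence |A_s| by twice the bound of A_t.\<close>

lemma has_unif_deriv_matrix_inv:
  fixes G :: "real \<Rightarrow> 'x \<Rightarrow> real^'n::finite^'n"
  assumes G: "has_unif_deriv S G G' t" "bounded (G' ` S)"
    and b: "bounded ((\<lambda>x. matrix_inv (G t x)) ` S)"
    and inv: "0 < e" "\<And>s x. \<bar>s - t\<bar> < e \<Longrightarrow> x \<in> S \<Longrightarrow> invertible (G s x)"
  shows "has_unif_deriv S (\<lambda>s x. matrix_inv (G s x))
     (\<lambda>x. - (matrix_inv (G t x) ** G' x ** matrix_inv (G t x))) t"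
proof -
  let ?A = "\<lambda>s x. matrix_inv (G s x)"
  obtain K where K: "0 < K" "\<And>(A :: real^'n^'n) (B :: real^'n^'n). norm (A ** B) \<le> norm A * norm B * K"
    using matrix_mult.pos_bounded by blast
  obtain C where C: "0 < C" "\<And>x. x \<in> S \<Longrightarrow> norm (?A t x) \<le> C"
    using b unfolding bounded_pos by auto
  have near: "\<forall>\<^sub>F s in at 0. \<bar>s\<bar> < e"
    using inv(1) unfolding eventually_at by (intro exI[of _ e]) auto
  have diff: "?A (t + s) x - ?A t x = - (?A (t + s) x ** (G (t + s) x - G t x) ** ?A t x)"
    if "\<bar>s\<bar> < e" "x \<in> S" for s x
  proof -
    have 1: "invertible (G (t + s) x)" "invertible (G t x)" using inv that by auto
    have "?A (t + s) x ** (G (t + s) x - G t x) ** ?A t x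
       = (?A (t + s) x ** G (t + s) x) ** ?A t x - ?A (t + s) x ** (G t x ** ?A t x)"
      by (simp add: matrix_mult.diff_left matrix_mult.diff_right matrix_mul_assoc)
    then show ?thesis using 1 by (simp add: matrix_inv_mult)
  qed
  have cont: "uniform_limit S (\<lambda>s. ?A (t + s)) (?A t) (at 0)"
  proof (rule uniform_limitI)
    fix d :: real assume d: "0 < d"
    \<comment> \<open>The first entry makes \<open>K * K * C * \<eta>\<close> at most 1/2, for the
      absorption; the second makes the resulting bound \<open>2 * C * (K * K * C * \<eta>)\<close>
      smaller than \<open>d\<close>. Here \<open>K\<close> bounds the norm of a matrix product and
      \<open>C\<close> the inverses at time \<open>t\<close>.\<close>
    define \<eta> where "\<eta> = min (1 / (2 * K * K * C)) (d / (4 * K * K * C * C))"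
    have \<eta>: "0 < \<eta>" using K C d by (simp add: \<eta>_def)
    have \<eta>1: "K * K * C * \<eta> \<le> 1 / 2"
    proof -
      have "K * K * C * \<eta> \<le> K * K * C * (1 / (2 * K * K * C))"
        using K C by (intro mult_left_mono) (auto simp: \<eta>_def)
      also have "\<dots> = 1 / 2" using K C by simp
      finally show ?thesis .
    qed
    have \<eta>2: "2 * C * (K * K * C * \<eta>) < d"
    proof -
      have "2 * C * (K * K * C * \<eta>) \<le> 2 * C * (K * K * C * (d / (4 * K * K * C * C)))"
        using K C by (intro mult_left_mono) (auto simp: \<eta>_def)
      also have "\<dots> = d / 2" using K C by (simp add: field_simps)
      finally show ?thesis using d by simp
    qed
    have "\<forall>\<^sub>F s in at 0. \<forall>x\<in>S. dist (G (t + s) x) (G t x) < \<eta>"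
      using has_unif_deriv_imp_continuous[OF G] \<eta> by (auto simp: uniform_limit_iff)
    with near show "\<forall>\<^sub>F s in at 0. \<forall>x\<in>S. dist (?A (t + s) x) (?A t x) < d"
    proof eventually_elim
      case (elim s)
      show ?case
      proof
        fix x assume x: "x \<in> S"
        define a where "a = norm (?A (t + s) x)"
        have "norm (?A (t + s) x - ?A t x) = norm (?A (t + s) x ** (G (t + s) x - G t x) ** ?A t x)"
          using diff elim x by simp
        also have "\<dots> \<le> norm (?A (t + s) x ** (G (t + s) x - G t x)) * norm (?A t x) * K"
          by (rule K(2))
        also have "\<dots> \<le> (a * norm (G (t + s) x - G t x) * K) * C * K"
          using K C(2)[OF x] by (intro mult_right_mono mult_mono) (auto simp: a_def)
        also have "\<dots> \<le> (a * \<eta> * K) * C * K"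
          using K C elim x by (intro mult_right_mono mult_left_mono) (auto simp: a_def dist_norm less_imp_le)
        finally have *: "norm (?A (t + s) x - ?A t x) \<le> a * (K * K * C * \<eta>)"
          by (simp add: mult_ac)
        also have "\<dots> \<le> a * (1 / 2)" using \<eta>1 by (intro mult_left_mono) (auto simp: a_def)
        finally have "a \<le> 2 * C"
          using C(2)[OF x] norm_triangle_ineq2[of "?A (t + s) x" "?A t x"] by (simp add: a_def)
        then have "a * (K * K * C * \<eta>) \<le> 2 * C * (K * K * C * \<eta>)"
          using K C \<eta> by (intro mult_right_mono) auto
        then show "dist (?A (t + s) x) (?A t x) < d"
          using * \<eta>2 by (simp add: dist_norm)
      qed
    qed
  qed
  have "uniform_limit S (\<lambda>s x. - (?A (t + s) x ** ((G (t + s) x - G t x) /\<^sub>R s) ** ?A t x))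
     (\<lambda>x. - (?A t x ** G' x ** ?A t x)) (at 0)"
    using G b cont
    by (intro uniform_limit_uminus matrix_mult.bounded_uniform_limit uniform_limit_const
          bounded_image_bilinear[OF bounded_bilinear_matrix_mult])
       (auto simp: has_unif_deriv_def)
  then show ?thesis
    unfolding has_unif_deriv_def
  proof (rule iffD1[OF uniform_limit_cong, rotated -1])
    show "\<forall>\<^sub>F s in at 0. \<forall>x\<in>S. - (?A (t + s) x ** ((G (t + s) x - G t x) /\<^sub>R s) ** ?A t x)
        = (?A (t + s) x - ?A t x) /\<^sub>R s"
      using near by eventually_elim (simp add: diff matrix_mult.scaleR_left matrix_mult.scaleR_right)
  qed auto
qed

text \<open>A permutation other than the identity moves at least two points. So even after one
  factor of its term has been differentiated, an off-diagonal entry of the identity matrix is left,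
  and the term vanishes.\<close>

lemma has_derivative_det_at_mat_1:
  fixes M :: "real \<Rightarrow> real^'n::finite^'n"
  assumes "(M has_vector_derivative M') (at t)" "M t = mat 1"
  shows "((\<lambda>s. det (M s)) has_real_derivative trace M') (at t)"
proof -
  let ?P = "{p. p permutes (UNIV :: 'n set)}"
  have e: "((\<lambda>s. M s $ i $ j) has_real_derivative M' $ i $ j) (at t)" for i j
    using bounded_linear.has_vector_derivative[OF bounded_linear_entry assms(1), of i j]
    by (simp add: has_real_derivative_iff_has_vector_derivative)
  have "((\<lambda>s. det (M s)) has_real_derivative
     (\<Sum>p\<in>?P. of_int (sign p) * (\<Sum>i\<in>UNIV. M' $ i $ p i * (\<Prod>j\<in>UNIV - {i}. M t $ j $ p j)))) (at t)"
    unfolding det_def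
    by (intro DERIV_sum DERIV_cmult) (auto intro!: has_field_derivative_prod[THEN DERIV_cong] e simp: mult.commute)
  moreover have "(\<Sum>p\<in>?P. of_int (sign p) * (\<Sum>i\<in>UNIV. M' $ i $ p i * (\<Prod>j\<in>UNIV - {i}. M t $ j $ p j)))
     = (\<Sum>p\<in>?P. if p = id then trace M' else 0)"
  proof (rule sum.cong)
    fix p assume p: "p \<in> ?P"
    show "of_int (sign p) * (\<Sum>i\<in>UNIV. M' $ i $ p i * (\<Prod>j\<in>UNIV - {i}. M t $ j $ p j))
       = (if p = id then trace M' else 0)"
    proof (cases "p = id")
      case True
      then show ?thesis by (simp add: assms(2) mat_def trace_def sign_id)
    next
      case False
      have z: "(\<Prod>j\<in>UNIV - {i}. M t $ j $ p j) = 0" for i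
      proof (rule ccontr)
        assume "(\<Prod>j\<in>UNIV - {i}. M t $ j $ p j) \<noteq> 0"
        then have fx: "p j = j" if "j \<noteq> i" for j
          using that by (auto simp: assms(2) mat_def split: if_splits)
        \<comment> \<open>If all other points are fixed, injectivity fixes the remaining point
          \<open>i\<close> as well.\<close>
        have "p i = i"
        proof (rule ccontr)
          assume "p i \<noteq> i"
          then have "p (p i) = p i" by (rule fx)
          moreover have "inj p" using p permutes_inj by auto
          ultimately show False using \<open>p i \<noteq> i\<close> by (auto dest: injD)
        qed
        with fx have "p x = x" for x by (cases "x = i") auto
        then have "p = id" by auto
        with False show False by simp
      qed
      show ?thesis by (simp only: z False mult_zero_right sum.neutral_const if_False)
    qed
  qed simp
  ultimately show ?thesis by (simp add: permutes_id)
qed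

text \<open>Jacobi's formula, reduced to the identity matrix by multiplying the curve with the
  constant inverse of \<open>G t\<close>.\<close>

lemma has_derivative_det:
  fixes G :: "real \<Rightarrow> real^'n::finite^'n"
  assumes G: "(G has_vector_derivative G') (at t)" and inv: "invertible (G t)"
  shows "((\<lambda>s. det (G s)) has_real_derivative det (G t) * trace (matrix_inv (G t) ** G')) (at t)"
proof -
  let ?A = "matrix_inv (G t)"
  have "((\<lambda>s. ?A ** G s) has_vector_derivative ?A ** G') (at t)"
    by (rule bounded_linear.has_vector_derivative[OF matrix_mult.bounded_linear_right G])
  then have "((\<lambda>s. det (?A ** G s)) has_real_derivative trace (?A ** G')) (at t)"
    by (rule has_derivative_det_at_mat_1) (simp add: matrix_inv_mult[OF inv])
  then have "((\<lambda>s. det (G t) * det (?A ** G s)) has_real_derivative det (G t) * trace (?A ** G')) (at t)"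
    by (rule DERIV_cmult)
  moreover have "det (G t) * det (?A ** G s) = det (G s)" for s
    using det_matrix_inv[OF inv] by (simp add: det_mul mult.assoc[symmetric])
  ultimately show ?thesis by simp
qed

text \<open>Uniformity comes from the permutation expansion, whose derivative is unwieldy. The
  closed form comes from Jacobi's formula at each point, and uniqueness of derivatives identifies
  the two.\<close>

lemma has_unif_deriv_det:
  fixes G :: "real \<Rightarrow> 'x \<Rightarrow> real^'n::finite^'n"
  assumes G: "has_unif_deriv S G G' t" "bounded (G t ` S)" "bounded (G' ` S)"
    and inv: "\<And>x. x \<in> S \<Longrightarrow> invertible (G t x)"
  shows "has_unif_deriv S (\<lambda>s x. det (G s x)) (\<lambda>x. det (G t x) * trace (matrix_inv (G t x) ** G' x)) t"
    and "bounded ((\<lambda>x. det (G t x) * trace (matrix_inv (G t x) ** G' x)) ` S)"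
proof -
  have e: "has_unif_deriv S (\<lambda>s x. G s x $ i $ j) (\<lambda>x. G' x $ i $ j) t"
      "bounded ((\<lambda>x. G t x $ i $ j) ` S)" "bounded ((\<lambda>x. G' x $ i $ j) ` S)" for i j
    by (rule bounded_linear.has_unif_deriv[OF bounded_linear_entry G(1)]
        bounded_image_linear[OF bounded_linear_entry G(2)]
        bounded_image_linear[OF bounded_linear_entry G(3)])+
  have "\<forall>p. \<exists>D. has_unif_deriv S (\<lambda>s x. \<Prod>i\<in>UNIV. G s x $ i $ p i) D t \<and> bounded (D ` S)"
    by (rule allI, rule conjunct2[OF has_unif_deriv_prod[OF finite e]])
  from choice[OF this] obtain D where
    D: "has_unif_deriv S (\<lambda>s x. \<Prod>i\<in>UNIV. G s x $ i $ p i) (D p) t" "bounded (D p ` S)" for p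
    by auto
  define E where "E = (\<lambda>x. \<Sum>p | p permutes (UNIV :: 'n set). of_int (sign p) * D p x)"
  have E: "has_unif_deriv S (\<lambda>s x. det (G s x)) E t"
    unfolding det_def E_def
    by (intro has_unif_deriv_sum bounded_linear.has_unif_deriv[OF bounded_linear_mult_right] D)
  have "bounded (E ` S)"
    unfolding E_def by (intro bounded_image_sum bounded_image_linear[OF bounded_linear_mult_right] D)
  moreover have eq: "E x = det (G t x) * trace (matrix_inv (G t x) ** G' x)" if "x \<in> S" for x
    using has_unif_deriv_pointwise[OF E that]
      has_derivative_det[OF has_unif_deriv_pointwise[OF G(1) that] inv[OF that]]
    by (simp add: has_real_derivative_iff_has_vector_derivative vector_derivative_unique_at)
  ultimately show "bounded ((\<lambda>x. det (G t x) * trace (matrix_inv (G t x) ** G' x)) ` S)"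
    by (metis (no_types, lifting) image_cong)
  show "has_unif_deriv S (\<lambda>s x. det (G s x)) (\<lambda>x. det (G t x) * trace (matrix_inv (G t x) ** G' x)) t"
    by (rule iffD1[OF has_unif_deriv_cong E]) (auto simp: eq)
qed

text \<open>The variation of the volume density. The factor 1/2 of the square root is the one that
  appears in \<Omega>.\<close>

lemma has_unif_deriv_sqrt_det:
  fixes G :: "real \<Rightarrow> 'x \<Rightarrow> real^'n::finite^'n"
  assumes G: "has_unif_deriv S G G' t" "bounded (G t ` S)" "bounded (G' ` S)"
    and b: "bounded ((\<lambda>x. matrix_inv (G t x)) ` S)"
    and inv: "\<And>x. x \<in> S \<Longrightarrow> invertible (G t x)"
  shows "has_unif_deriv S (\<lambda>s x. sqrt \<bar>det (G s x)\<bar>)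
     (\<lambda>x. 1/2 * trace (matrix_inv (G t x) ** G' x) * sqrt \<bar>det (G t x)\<bar>) t"
proof -
  obtain \<delta> where \<delta>: "0 < \<delta>" "\<And>x. x \<in> S \<Longrightarrow> \<delta> \<le> \<bar>det (G t x)\<bar>"
    using det_lower_bound[OF inv b] by blast
  show ?thesis
    using has_unif_deriv_sqrt_abs[OF has_unif_deriv_det[OF G inv] \<delta>]
  proof (rule iffD1[OF has_unif_deriv_cong, rotated -1])
    show "det (G t x) * trace (matrix_inv (G t x) ** G' x) * inverse (det (G t x)) * sqrt \<bar>det (G t x)\<bar> * (1/2)
      = 1/2 * trace (matrix_inv (G t x) ** G' x) * sqrt \<bar>det (G t x)\<bar>" if "x \<in> S" for x
      using \<delta>(1) \<delta>(2)[OF that] by (auto simp: field_simps)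
  qed auto
qed

lemma unif_C_det:
  fixes G :: "real \<Rightarrow> 'x \<Rightarrow> real^'n::finite^'n"
  assumes "unif_C n S G"
  shows "unif_C n S (\<lambda>t x. det (G t x))"
  unfolding det_def
  by (intro unif_C_sum unif_C_linear[OF bounded_linear_mult_right] unif_C_prod
      unif_C_linear[OF bounded_linear_entry] assms)

lemma unif_C_sqrt_det:
  fixes G :: "real \<Rightarrow> 'x \<Rightarrow> real^'n::finite^'n"
  assumes G: "unif_C n S G" and b: "\<And>t. bounded ((\<lambda>x. matrix_inv (G t x)) ` S)"
    and inv: "\<And>t x. x \<in> S \<Longrightarrow> invertible (G t x)"
  shows "unif_C n S (\<lambda>t x. sqrt \<bar>det (G t x)\<bar>)"
proof -
  have "\<forall>t. \<exists>\<delta>>0. \<forall>x\<in>S. \<delta> \<le> \<bar>det (G t x)\<bar>"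
    using det_lower_bound[OF inv b] by metis
  then obtain \<delta> where "\<And>t. 0 < \<delta> t" "\<And>t x. x \<in> S \<Longrightarrow> \<delta> t \<le> \<bar>det (G t x)\<bar>"
    by metis
  then show ?thesis using unif_C_det[OF G] by (intro unif_C_sqrt_abs)
qed

lemma unif_C_matrix_inv:
  fixes G :: "real \<Rightarrow> 'x \<Rightarrow> real^'n::finite^'n"
  assumes "unif_C n S G" and b: "\<And>t. bounded ((\<lambda>x. matrix_inv (G t x)) ` S)"
    and inv: "\<And>t x. x \<in> S \<Longrightarrow> invertible (G t x)"
  shows "unif_C n S (\<lambda>t x. matrix_inv (G t x))"
  using assms(1)
proof (induction n)
  case (Suc n)
  then obtain G' where *: "\<forall>t. has_unif_deriv S G (G' t) t" "unif_C n S G'" by auto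
  have "unif_C n S (\<lambda>t x. - (matrix_inv (G t x) ** G' t x ** matrix_inv (G t x)))"
    using * Suc.IH[OF unif_C_SucD[OF Suc.prems]]
    by (intro unif_C_uminus unif_C_bilinear[OF bounded_bilinear_matrix_mult])
  moreover have "has_unif_deriv S (\<lambda>s x. matrix_inv (G s x))
      (\<lambda>x. - (matrix_inv (G t x) ** G' t x ** matrix_inv (G t x))) t" for t
    using * b inv unif_C_bounded[OF *(2)] by (intro has_unif_deriv_matrix_inv[where e = 1]) auto
  ultimately show ?case using b by (intro unif_C_SucI)
qed (use b in auto)

section \<open>Signature of symmetric matrices under congruence and small perturbation\<close>

lemma has_signatureE:
  assumes "has_signature q (G :: real^'n::finite^'n)"
  obtains P D :: "real^'n^'n" where "invertible P" "transpose P ** G ** P = D" "D ** D = mat 1" "transpose D = D"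
    "\<forall>(Q :: real^'n^'n) (S :: real^'n^'n). invertible Q \<longrightarrow> transpose Q ** S ** Q = D \<longrightarrow> has_signature q S"
proof -
  obtain P :: "real^'n^'n" and N :: "'n set" where P: "invertible P" "card N = q"
    "transpose P ** G ** P = (\<chi> i j. if i = j then (if i \<in> N then - 1 else 1) else 0)"
    using assms by (auto simp: has_signature_def)
  let ?D = "(\<chi> i j. if i = j then (if i \<in> N then - 1 else 1) else 0) :: real^'n^'n"
  show thesis
  proof (rule that[of P ?D])
    show "?D ** ?D = mat 1"
    proof -
      have "(\<Sum>k\<in>UNIV. (if i = k then (if i \<in> N then - 1 else 1) else 0) *
         (if k = j then (if k \<in> N then - 1 else 1) else (0::real))) = (if i = j then 1 else 0)" for i j :: 'n
      proof -
        have "(\<Sum>k\<in>UNIV. (if i = k then (if i \<in> N then - 1 else 1) else 0) *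
         (if k = j then (if k \<in> N then - 1 else 1) else (0::real)))
         = (\<Sum>k\<in>UNIV. if i = k then (if i \<in> N then - 1 else 1) *
         (if i = j then (if i \<in> N then - 1 else 1) else (0::real)) else 0)"
          by (rule sum.cong) auto
        then show ?thesis by auto
      qed
      then show ?thesis by (simp add: matrix_matrix_mult_def mat_def vec_eq_iff)
    qed
    show "transpose ?D = ?D" by (auto simp: transpose_def vec_eq_iff)
    show "\<forall>(Q :: real^'n^'n) S. invertible Q \<longrightarrow> transpose Q ** S ** Q = ?D \<longrightarrow> has_signature q S"
      using P(2) by (auto simp: has_signature_def)
  qed (use P in auto)
qed

lemma invertible_matrix_mult:
  fixes A B :: "real^'n::finite^'n"
  shows "invertible A \<Longrightarrow> invertible B \<Longrightarrow> invertible (A ** B)"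
  by (simp add: invertible_det_nz det_mul)

lemma invertible_matrix_inv: "invertible (A :: real^'n::finite^'n) \<Longrightarrow> invertible (matrix_inv A)"
  using matrix_inv_mult[of A] by (auto simp: invertible_def)

lemma has_signature_invertible: "has_signature q (G :: real^'n::finite^'n) \<Longrightarrow> invertible G"
proof (erule has_signatureE)
  fix P D :: "real^'n^'n" assume "invertible P" "transpose P ** G ** P = D" "D ** D = mat 1"
  then have "det D * det D = 1" "det D = det P * det G * det P"
    by (metis det_mul det_I, metis det_mul det_transpose)
  then show "invertible G" by (auto simp: invertible_det_nz)
qed

lemma has_signature_congruent:
  fixes G J :: "real^'n::finite^'n"
  assumes "has_signature q G" "invertible J"
  shows "has_signature q (transpose J ** G ** J)"
proof -
  from assms(1) obtain P D :: "real^'n^'n" where P: "invertible P" "transpose P ** G ** P = D"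
    and D: "D ** D = mat 1" "transpose D = D"
    and sig: "\<forall>(Q :: real^'n^'n) (S :: real^'n^'n). invertible Q \<longrightarrow> transpose Q ** S ** Q = D \<longrightarrow> has_signature q S"
    by (rule has_signatureE) blast
  show ?thesis
  proof (rule sig[rule_format])
    show "invertible (matrix_inv J ** P)"
      using P(1) assms(2) by (intro invertible_matrix_mult invertible_matrix_inv)
    have "transpose (matrix_inv J) ** transpose J = mat 1"
      by (metis assms(2) matrix_inv_mult(1) matrix_transpose_mul transpose_mat)
    moreover have "transpose (matrix_inv J ** P) ** (transpose J ** G ** J) ** (matrix_inv J ** P)
      = transpose P ** (transpose (matrix_inv J) ** transpose J) ** G ** (J ** matrix_inv J) ** P"
      by (simp add: matrix_transpose_mul matrix_mul_assoc)
    ultimately show "transpose (matrix_inv J ** P) ** (transpose J ** G ** J) ** (matrix_inv J ** P) = D"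
      using P(2) by (simp add: matrix_inv_mult[OF assms(2)])
  qed
qed

text \<open>
  A symmetric matrix \<open>D + E\<close> near an involutive symmetric \<open>D\<close> is \<open>Y\<^sup>T D Y\<close>, where
  \<open>Y = 1 + X\<close> is the square root of \<open>1 + D E\<close>, obtained from the contraction \<open>X \<mapsto> (D E - X\<^sup>2) / 2\<close>.
\<close>

lemma has_signature_open:
  fixes G :: "real^'n::finite^'n"
  assumes "has_signature q G" "transpose G = G"
  obtains e where "0 < e" "\<And>S. transpose S = S \<Longrightarrow> norm (S - G) < e \<Longrightarrow> has_signature q S"
proof -
  from assms(1) obtain P D :: "real^'n^'n" where P: "invertible P" "transpose P ** G ** P = D"
    and D: "D ** D = mat 1" "transpose D = D"
    and sig: "\<forall>(Q :: real^'n^'n) (S :: real^'n^'n). invertible Q \<longrightarrow> transpose Q ** S ** Q = D \<longrightarrow> has_signature q S"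
    by (rule has_signatureE) blast
  obtain K where K: "0 < K" "\<And>(A :: real^'n^'n) (B :: real^'n^'n). norm (A ** B) \<le> norm A * norm B * K"
    using matrix_mult.pos_bounded by blast
  \<comment> \<open>Chosen with \<open>K * r = 1 / 2\<close>: on the ball of radius \<open>r\<close>
    the quadratic term \<open>X ** X\<close> has norm at most \<open>r / 2\<close>, and the
    iteration contracts with factor 1/2.\<close>
  define r where "r = 1 / (2 * K)"
  have r: "0 < r" "K * r = 1 / 2" using K(1) by (auto simp: r_def)
  have "bounded_linear (\<lambda>E :: real^'n^'n. D ** (transpose P ** E ** P))"
    by (intro bounded_linear_compose[OF matrix_mult.bounded_linear_right]
        bounded_linear_compose[OF matrix_mult.bounded_linear_left] matrix_mult.bounded_linear_right)
  then obtain C where C: "0 < C" "\<And>E :: real^'n^'n. norm (D ** (transpose P ** E ** P)) \<le> norm E * C"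
    using bounded_linear.pos_bounded by blast
  \<comment> \<open>Near \<open>G\<close> the determinant stays nonzero, which later forces
    \<open>Y\<close> to be invertible.\<close>
  have "open {S :: real^'n^'n. det S \<noteq> 0}"
    by (rule open_Collect_neq) (use continuous_on_det in auto)
  then obtain e0 where e0: "0 < e0" "\<And>S. dist S G < e0 \<Longrightarrow> det S \<noteq> 0"
    using has_signature_invertible[OF assms(1)] unfolding open_dist by (force simp: invertible_det_nz)
  show thesis
  proof (rule that[of "min e0 (r / C)"])
    show "0 < min e0 (r / C)" using e0 r C by simp
    fix S :: "real^'n^'n" assume S: "transpose S = S" "norm (S - G) < min e0 (r / C)"
    define E where "E = transpose P ** (S - G) ** P"
    define M where "M = D ** E"
    have "norm M \<le> norm (S - G) * C" unfolding M_def E_def by (rule C)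
    also have "\<dots> \<le> (r / C) * C" using S C by (intro mult_right_mono) auto
    finally have nM: "norm M \<le> r" using C by simp
    have tE: "transpose E = E"
    proof -
      have "transpose (S - G) = S - G" using S(1) assms(2) by (simp add: transpose_def vec_eq_iff)
      then show ?thesis by (simp add: E_def matrix_transpose_mul matrix_mul_assoc)
    qed
    have DM: "D ** M = E" by (simp add: M_def matrix_mul_assoc D)
    have tM: "transpose M ** D = D ** M"
    proof -
      have "transpose M ** D = E ** (D ** D)"
        by (simp add: M_def matrix_transpose_mul tE D(2) matrix_mul_assoc)
      then show ?thesis by (simp add: D(1) DM)
    qed
    define f where "f X = (1/2) *\<^sub>R (M - X ** X)" for X
    \<comment> \<open>The side condition says that \<open>X\<close> is self-adjoint for the form
      \<open>D\<close>. Since \<open>T\<close> is closed, the fixed point has this property too, and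
      it turns \<open>transpose Y ** D ** Y\<close> into \<open>D ** (Y ** Y)\<close>.\<close>
    define T where "T = {X :: real^'n^'n. norm X \<le> r \<and> transpose X ** D = D ** X}"
    have bt: "linear (transpose :: real^'n^'n \<Rightarrow> real^'n^'n)"
      by (auto simp: linear_iff transpose_def vec_eq_iff)
    have ct: "continuous_on UNIV (transpose :: real^'n^'n \<Rightarrow> real^'n^'n)"
      using bt by (rule linear_continuous_on[OF linear_conv_bounded_linear[THEN iffD1]])
    have "closed T"
      unfolding T_def
      by (intro closed_Collect_conj closed_Collect_le closed_Collect_eq continuous_intros
          bounded_bilinear.continuous_on[OF bounded_bilinear_matrix_mult] ct)
    then have "complete T" by (simp add: complete_eq_closed)
    moreover have "T \<noteq> {}"
      using r by (auto simp: T_def intro!: exI[of _ 0] simp: transpose_def matrix_matrix_mult_def vec_eq_iff)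
    moreover have "f ` T \<subseteq> T"
    proof safe
      fix X assume X: "X \<in> T"
      then have X': "norm X \<le> r" "transpose X ** D = D ** X" by (auto simp: T_def)
      have "norm (X ** X) \<le> norm X * norm X * K" by (rule K)
      also have "\<dots> \<le> r * r * K" using X'(1) r K by (intro mult_right_mono mult_mono) auto
      also have "\<dots> = r / 2" using r by (simp add: mult.commute mult.left_commute)
      finally have "norm (M - X ** X) \<le> 2 * r" using nM r norm_triangle_ineq4[of M "X ** X"] by linarith
      then have "norm (f X) \<le> r" by (simp add: f_def)
      moreover have "transpose (f X) ** D = D ** f X"
      proof -
        have "transpose X ** transpose X ** D = D ** X ** X"
          by (metis X'(2) matrix_mul_assoc)
        then show ?thesis
          using tM by (simp add: f_def linear_cmul[OF bt] linear_diff[OF bt] matrix_transpose_mul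
            matrix_mult.scaleR_left matrix_mult.scaleR_right matrix_mult.diff_left matrix_mult.diff_right
            matrix_mul_assoc)
      qed
      ultimately show "f X \<in> T" by (simp add: T_def)
    qed
    moreover have "dist (f X) (f Y) \<le> 1/2 * dist X Y" if "X \<in> T" "Y \<in> T" for X Y
    proof -
      have n: "norm X \<le> r" "norm Y \<le> r" using that by (auto simp: T_def)
      have "f X - f Y = (1/2) *\<^sub>R (Y ** (Y - X) + (Y - X) ** X)"
        by (simp add: f_def matrix_mult.diff_left matrix_mult.diff_right scaleR_diff_right[symmetric])
      then have "norm (f X - f Y) \<le> 1/2 * (norm (Y ** (Y - X)) + norm ((Y - X) ** X))"
        using norm_triangle_ineq[of "Y ** (Y - X)" "(Y - X) ** X"] by simp
      also have "\<dots> \<le> 1/2 * (norm Y * norm (Y - X) * K + norm (Y - X) * norm X * K)"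
        by (intro mult_left_mono add_mono K) auto
      also have "\<dots> \<le> 1/2 * (r * norm (Y - X) * K + norm (Y - X) * r * K)"
        using n K by (intro mult_left_mono add_mono mult_right_mono) auto
      also have "\<dots> = 1/2 * norm (Y - X) * (2 * (K * r))" by (simp add: algebra_simps)
      finally show ?thesis using r by (simp add: dist_norm norm_minus_commute)
    qed
    ultimately have "\<exists>!X\<in>T. f X = X"
      using Banach_fix[of T "1/2" f] by auto
    then obtain X where X: "X \<in> T" "f X = X" by auto
    define Y where "Y = mat 1 + X"
    have tX: "transpose X ** D = D ** X" using X by (simp add: T_def)
    have XX: "X + X + X ** X = M"
    proof -
      have "2 *\<^sub>R f X = M - X ** X" by (simp add: f_def)
      then show ?thesis using X(2) by (simp add: algebra_simps scaleR_2)
    qed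
    have YDY: "transpose Y ** D ** Y = transpose P ** S ** P"
    proof -
      have "transpose Y ** D = D ** Y"
        by (simp add: Y_def linear_add[OF bt] transpose_mat matrix_mult.add_left matrix_mult.add_right tX)
      then have "transpose Y ** D ** Y = D ** (Y ** Y)"
        by (simp add: matrix_mul_assoc)
      also have "Y ** Y = mat 1 + (X + X + X ** X)"
        by (simp add: Y_def matrix_mult.add_left matrix_mult.add_right)
      also have "D ** (mat 1 + (X + X + X ** X)) = D + E"
        unfolding XX by (simp add: matrix_mult.add_right DM)
      also have "\<dots> = transpose P ** S ** P"
        by (simp add: E_def P(2)[symmetric] matrix_mult.diff_left matrix_mult.diff_right)
      finally show ?thesis .
    qed
    have "det S \<noteq> 0" using e0(2)[of S] S(2) by (simp add: dist_norm)
    moreover have "det Y * det D * det Y = det P * det S * det P"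
      using arg_cong[OF YDY, of det] by (simp add: det_mul det_transpose)
    moreover have "det P \<noteq> 0" using P(1) by (simp add: invertible_det_nz)
    ultimately have iY: "invertible Y" by (auto simp: invertible_det_nz)
    show "has_signature q S"
    proof (rule sig[rule_format])
      show "invertible (P ** matrix_inv Y)" using P(1) iY by (intro invertible_matrix_mult invertible_matrix_inv)
      have "transpose (matrix_inv Y) ** transpose Y = mat 1"
        by (metis iY matrix_inv_mult(1) matrix_transpose_mul transpose_mat)
      moreover have "transpose (P ** matrix_inv Y) ** S ** (P ** matrix_inv Y)
         = transpose (matrix_inv Y) ** (transpose P ** S ** P) ** matrix_inv Y"
        by (simp add: matrix_transpose_mul matrix_mul_assoc)
      moreover have "\<dots> = (transpose (matrix_inv Y) ** transpose Y) ** D ** (Y ** matrix_inv Y)"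
        by (simp add: YDY[symmetric] matrix_mul_assoc)
      ultimately show "transpose (P ** matrix_inv Y) ** S ** (P ** matrix_inv Y) = D"
        by (simp add: matrix_inv_mult[OF iY])
    qed
  qed
qed

lemma matrix_inv_congruent:
  fixes G J :: "real^'n::finite^'n"
  assumes "invertible G" "invertible J"
  shows "matrix_inv (transpose J ** G ** J)
     = matrix_inv J ** matrix_inv G ** transpose (matrix_inv J)"
proof (rule matrix_inv_unique')
  have t: "transpose J ** transpose (matrix_inv J) = mat 1"
    by (metis assms(2) matrix_inv_mult(2) matrix_transpose_mul transpose_mat)
  have "(transpose J ** G ** J) ** (matrix_inv J ** matrix_inv G ** transpose (matrix_inv J))
     = transpose J ** (G ** ((J ** matrix_inv J) ** matrix_inv G)) ** transpose (matrix_inv J)"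
    by (simp add: matrix_mul_assoc)
  then show "(transpose J ** G ** J) ** (matrix_inv J ** matrix_inv G ** transpose (matrix_inv J)) = mat 1"
    by (simp add: matrix_inv_mult assms t)
qed

text \<open>The endomorphism g^-1 k, unlike g and k, changes by conjugation under a change of chart.
  This is why traces of products of such endomorphisms make sense globally.\<close>

lemma mixed_congruent:
  fixes G J K :: "real^'n::finite^'n"
  assumes "invertible G" "invertible J"
  shows "matrix_inv (transpose J ** G ** J) ** (transpose J ** K ** J)
     = matrix_inv J ** (matrix_inv G ** K) ** J"
proof -
  have t: "transpose (matrix_inv J) ** transpose J = mat 1"
    by (metis assms(2) matrix_inv_mult(1) matrix_transpose_mul transpose_mat)
  have "matrix_inv (transpose J ** G ** J) ** (transpose J ** K ** J)
      = matrix_inv J ** matrix_inv G ** (transpose (matrix_inv J) ** transpose J) ** K ** J"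
    by (simp add: matrix_inv_congruent[OF assms] matrix_mul_assoc)
  then show ?thesis by (simp add: t matrix_mul_assoc)
qed

lemma trace_conjugate:
  fixes A J :: "real^'n::finite^'n"
  assumes "invertible J"
  shows "trace (matrix_inv J ** A ** J) = trace A"
  by (metis assms matrix_inv_mult(1) matrix_mul_assoc matrix_mul_rid trace_mul_sym)

lemma conjugate_mult:
  fixes A B J :: "real^'n::finite^'n"
  assumes "invertible J"
  shows "(matrix_inv J ** A ** J) ** (matrix_inv J ** B ** J) = matrix_inv J ** (A ** B) ** J"
proof -
  have "(matrix_inv J ** A ** J) ** (matrix_inv J ** B ** J)
     = matrix_inv J ** A ** (J ** matrix_inv J) ** B ** J" by (simp add: matrix_mul_assoc)
  then show ?thesis by (simp add: matrix_inv_mult(1)[OF assms] matrix_mul_assoc)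
qed

subsection \<open>Smooth functions between normed spaces\<close>

text \<open>\<open>smooth_on\<close> cut off at finite order. The recursion peels off the innermost
  derivative, as \<open>iter_deriv\<close> does, so that closure under products and composition
  follows by induction on the order.\<close>

primrec diff_order :: "nat \<Rightarrow> 'b::real_normed_vector set \<Rightarrow> ('b \<Rightarrow> 'c::real_normed_vector) \<Rightarrow> bool" where
  "diff_order 0 S f \<longleftrightarrow> (\<forall>x\<in>S. f differentiable (at x))"
| "diff_order (Suc n) S f \<longleftrightarrow> (\<forall>x\<in>S. f differentiable (at x)) \<and>
     (\<forall>v. diff_order n S (\<lambda>x. frechet_derivative f (at x) v))"

lemma diff_order_iff_iter_deriv:
  "diff_order n S f \<longleftrightarrow> (\<forall>vs. length vs \<le> n \<longrightarrow> (\<forall>x\<in>S. iter_deriv vs f differentiable (at x)))"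
proof (induction n arbitrary: f)
  case (Suc n)
  have "(\<forall>vs. length vs \<le> Suc n \<longrightarrow> (\<forall>x\<in>S. iter_deriv vs f differentiable (at x))) \<longleftrightarrow>
    (\<forall>x\<in>S. iter_deriv [] f differentiable (at x)) \<and>
    (\<forall>v vs. length vs \<le> n \<longrightarrow> (\<forall>x\<in>S. iter_deriv (v # vs) f differentiable (at x)))"
    by (smt (verit, best) Suc_le_mono le0 length_Cons list.exhaust list.size(3))
  then show ?case using Suc by simp
qed auto

lemma smooth_on_iff_diff_order: "smooth_on S f \<longleftrightarrow> (\<forall>n. diff_order n S f)"
  unfolding smooth_on_def diff_order_iff_iter_deriv by blast

lemma diff_order_differentiable: "diff_order n S f \<Longrightarrow> x \<in> S \<Longrightarrow> f differentiable (at x)"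
  by (cases n) auto

lemma diff_order_has_derivative:
  "diff_order n S f \<Longrightarrow> x \<in> S \<Longrightarrow> (f has_derivative frechet_derivative f (at x)) (at x)"
  using diff_order_differentiable frechet_derivative_works by blast

lemma differentiable_transform_on_open:
  assumes "f differentiable (at x)" "open S" "x \<in> S" "\<And>y. y \<in> S \<Longrightarrow> f y = g y"
  shows "g differentiable (at x)"
  using assms has_derivative_transform_within_open[of f _ x UNIV S g] unfolding differentiable_def
  by blast

lemma diff_order_cong_open:
  assumes "open S" "\<And>x. x \<in> S \<Longrightarrow> f x = g x"
  shows "diff_order n S f \<longleftrightarrow> diff_order n S g"
  using assms(2)
proof (induction n arbitrary: f g)
  case 0
  show ?case
    using 0 differentiable_transform_on_open[OF _ assms(1), of _ _ g]
      differentiable_transform_on_open[OF _ assms(1), of _ _ f] by auto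
next
  case (Suc n)
  have d: "f differentiable (at x) \<longleftrightarrow> g differentiable (at x)" if "x \<in> S" for x
    using Suc.prems that differentiable_transform_on_open[OF _ assms(1), of _ _ g]
      differentiable_transform_on_open[OF _ assms(1), of _ _ f] by auto
  show ?case
  proof (cases "\<forall>x\<in>S. f differentiable (at x)")
    case True
    have "frechet_derivative f (at x) = frechet_derivative g (at x)" if "x \<in> S" for x
      using True Suc.prems that assms(1) by (intro frechet_derivative_transform_within_open) auto
    then have "diff_order n S (\<lambda>x. frechet_derivative f (at x) v) \<longleftrightarrow>
        diff_order n S (\<lambda>x. frechet_derivative g (at x) v)" for v
      by (intro Suc.IH) auto
    with d show ?thesis by simp
  next
    case False
    then have "\<not> (\<forall>x\<in>S. g differentiable (at x))" using d by blast
    with False show ?thesis by (simp only: diff_order.simps simp_thms)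
  qed
qed

lemma diff_order_SucI:
  assumes S: "open S" and f': "\<And>x. x \<in> S \<Longrightarrow> (f has_derivative f' x) (at x)"
    and "\<And>v. diff_order n S (\<lambda>x. f' x v)"
  shows "diff_order (Suc n) S f"
proof -
  have "frechet_derivative f (at x) = f' x" if "x \<in> S" for x
    using f'[OF that] frechet_derivative_at by metis
  then have "diff_order n S (\<lambda>x. frechet_derivative f (at x) v)" for v
    using assms(3)[of v] diff_order_cong_open[OF S, of "\<lambda>x. f' x v" "\<lambda>x. frechet_derivative f (at x) v" n]
    by simp
  then show ?thesis using f' by (auto simp: differentiable_def)
qed

lemma diff_order_SucD: "diff_order (Suc n) S f \<Longrightarrow> diff_order n S f"
proof (induction n arbitrary: f)
  case (Suc n)
  show ?case
    using Suc.prems Suc.IH unfolding diff_order.simps(2)[of "Suc n"] diff_order.simps(2)[of n S f]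
    by blast
qed auto

lemma diff_order_const: "diff_order n S (\<lambda>x. c)"
  by (induction n arbitrary: c) (auto simp: frechet_derivative_const)

lemma diff_order_linear:
  assumes S: "open S" and h: "bounded_linear h"
  shows "diff_order n S f \<Longrightarrow> diff_order n S (\<lambda>x. h (f x))"
proof (induction n arbitrary: f)
  case 0
  then show ?case using bounded_linear.has_derivative[OF h] unfolding differentiable_def diff_order.simps
    by blast
next
  case (Suc n)
  show ?case
    using Suc by (intro diff_order_SucI[OF S bounded_linear.has_derivative[OF h diff_order_has_derivative[OF Suc.prems]]] Suc.IH)
      auto
qed

lemma diff_order_ident: assumes "open S" shows "diff_order n S (\<lambda>x. x)"
proof (cases n)
  case (Suc m)
  then show ?thesis
    using diff_order_SucI[OF assms, of "\<lambda>x. x" "\<lambda>x h. h"] diff_order_const by (metis has_derivative_ident)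
qed simp

lemma diff_order_add:
  assumes S: "open S"
  shows "diff_order n S f \<Longrightarrow> diff_order n S g \<Longrightarrow> diff_order n S (\<lambda>x. f x + g x)"
proof (induction n arbitrary: f g)
  case (Suc n)
  show ?case
    using Suc by (intro diff_order_SucI[OF S has_derivative_add[OF
      diff_order_has_derivative[OF Suc.prems(1)] diff_order_has_derivative[OF Suc.prems(2)]]] Suc.IH) auto
qed auto

lemma diff_order_sum:
  assumes "open S" "\<And>i. i \<in> I \<Longrightarrow> diff_order n S (f i)"
  shows "diff_order n S (\<lambda>x. \<Sum>i\<in>I. f i x)"
proof (cases "finite I")
  case True
  then show ?thesis
    using assms by (induction I) (auto intro: diff_order_add diff_order_const)
qed (simp add: diff_order_const)

lemma diff_order_bilinear:
  assumes S: "open S" and bl: "bounded_bilinear bl"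
  shows "diff_order n S f \<Longrightarrow> diff_order n S g \<Longrightarrow> diff_order n S (\<lambda>x. bl (f x) (g x))"
proof (induction n arbitrary: f g)
  case 0
  then show ?case using bounded_bilinear.FDERIV[OF bl] unfolding differentiable_def diff_order.simps
    by blast
next
  case (Suc n)
  show ?case
  proof (rule diff_order_SucI[OF S bounded_bilinear.FDERIV[OF bl
      diff_order_has_derivative[OF Suc.prems(1)] diff_order_has_derivative[OF Suc.prems(2)]]])
    show "diff_order n S (\<lambda>x. bl (f x) (frechet_derivative g (at x) v) + bl (frechet_derivative f (at x) v) (g x))" for v
      using Suc.prems diff_order_SucD[OF Suc.prems(1)] diff_order_SucD[OF Suc.prems(2)]
      by (intro diff_order_add[OF S] Suc.IH) auto
  qed
qed

text \<open>The derivative f'(g x)(g'(x) v) is expanded over basis vectors b. The direction of f' is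
  then the constant b, and the derivative is a sum of products of components of g' with compositions
  of lower order, to which the induction applies.\<close>

lemma diff_order_compose:
  fixes f :: "'b::euclidean_space \<Rightarrow> 'c::real_normed_vector"
  assumes S: "open S"
  shows "diff_order n T f \<Longrightarrow> diff_order n S g \<Longrightarrow> g ` S \<subseteq> T \<Longrightarrow> diff_order n S (\<lambda>x. f (g x))"
proof (induction n arbitrary: f g)
  case 0
  then show ?case
    using differentiable_chain_at[of g _ f] by (auto simp: o_def image_subset_iff)
next
  case (Suc n)
  have d: "((\<lambda>x. f (g x)) has_derivative
      (\<lambda>v. \<Sum>b\<in>Basis. (frechet_derivative g (at x) v \<bullet> b) *\<^sub>R frechet_derivative f (at (g x)) b)) (at x)"
    if x: "x \<in> S" for x
  proof -
    have f: "(f has_derivative frechet_derivative f (at (g x))) (at (g x))"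
      using Suc.prems(3) x by (intro diff_order_has_derivative[OF Suc.prems(1)]) auto
    then have "linear (frechet_derivative f (at (g x)))"
      by (rule has_derivative_linear)
    then have lin: "frechet_derivative f (at (g x)) w =
        (\<Sum>b\<in>Basis. (w \<bullet> b) *\<^sub>R frechet_derivative f (at (g x)) b)" for w
      using linear_sum[of "frechet_derivative f (at (g x))" "\<lambda>b. (w \<bullet> b) *\<^sub>R b" Basis]
      by (simp only: linear_cmul[OF \<open>linear (frechet_derivative f (at (g x)))\<close>] euclidean_representation)
    have "((\<lambda>x. f (g x)) has_derivative
        (\<lambda>v. frechet_derivative f (at (g x)) (frechet_derivative g (at x) v))) (at x)"
      using diff_chain_at[OF diff_order_has_derivative[OF Suc.prems(2) x] f] by (simp add: o_def)
    then show ?thesis by (rule has_derivative_eq_rhs) (rule ext, rule lin)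
  qed
  show ?case
  proof (rule diff_order_SucI[OF S d])
    fix v
    show "diff_order n S (\<lambda>x. \<Sum>b\<in>Basis. (frechet_derivative g (at x) v \<bullet> b) *\<^sub>R frechet_derivative f (at (g x)) b)"
    proof (intro diff_order_sum[OF S] diff_order_bilinear[OF S bounded_bilinear_scaleR]
          diff_order_linear[OF S bounded_linear_inner_left])
      fix b :: 'b
      show "diff_order n S (\<lambda>x. frechet_derivative f (at (g x)) b)"
        using Suc.prems diff_order_SucD[OF Suc.prems(2)]
        by (intro Suc.IH[of "\<lambda>y. frechet_derivative f (at y) b" g]) auto
    qed (use Suc.prems in auto)
  qed
qed

lemma smooth_on_add: "open S \<Longrightarrow> smooth_on S f \<Longrightarrow> smooth_on S g \<Longrightarrow> smooth_on S (\<lambda>x. f x + g x)"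
  by (simp add: smooth_on_iff_diff_order diff_order_add)

lemma smooth_on_linear: "open S \<Longrightarrow> bounded_linear h \<Longrightarrow> smooth_on S f \<Longrightarrow> smooth_on S (\<lambda>x. h (f x))"
  by (simp add: smooth_on_iff_diff_order diff_order_linear)

lemma smooth_on_bilinear:
  "open S \<Longrightarrow> bounded_bilinear bl \<Longrightarrow> smooth_on S f \<Longrightarrow> smooth_on S g \<Longrightarrow> smooth_on S (\<lambda>x. bl (f x) (g x))"
  by (simp add: smooth_on_iff_diff_order diff_order_bilinear)

lemma smooth_on_const: "smooth_on S (\<lambda>x. c)"
  by (simp add: smooth_on_iff_diff_order diff_order_const)

lemma smooth_on_cong_open:
  "open S \<Longrightarrow> (\<And>x. x \<in> S \<Longrightarrow> f x = g x) \<Longrightarrow> smooth_on S f \<longleftrightarrow> smooth_on S g"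
  using diff_order_cong_open[of S f g] by (simp add: smooth_on_iff_diff_order)

lemma smooth_on_compose:
  fixes f :: "'b::euclidean_space \<Rightarrow> 'c::real_normed_vector"
  shows "open S \<Longrightarrow> smooth_on T f \<Longrightarrow> smooth_on S g \<Longrightarrow> g ` S \<subseteq> T \<Longrightarrow> smooth_on S (\<lambda>x. f (g x))"
  unfolding smooth_on_iff_diff_order using diff_order_compose by blast

lemma smooth_on_Un: "smooth_on S f \<Longrightarrow> smooth_on T f \<Longrightarrow> smooth_on (S \<union> T) f"
  by (auto simp: smooth_on_def)

lemma smooth_on_differentiable: "smooth_on S f \<Longrightarrow> x \<in> S \<Longrightarrow> f differentiable (at x)"
  by (metis smooth_on_iff_diff_order diff_order_differentiable)

lemma smooth_on_frechet_derivative: "smooth_on S f \<Longrightarrow> smooth_on S (\<lambda>x. frechet_derivative f (at x) v)"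
  unfolding smooth_on_def by (metis iter_deriv.simps(2))

lemma smooth_on_continuous_on: "smooth_on S f \<Longrightarrow> continuous_on S f"
  using smooth_on_differentiable differentiable_imp_continuous_within
  by (intro continuous_at_imp_continuous_on) blast

subsection \<open>A smooth bump function\<close>

text \<open>The functions t^(-m) exp(-1/t), extended by 0. The whole family is introduced because it
  is closed under differentiation up to linear combinations.\<close>

definition flat_fun :: "nat \<Rightarrow> real \<Rightarrow> real" where
  "flat_fun m t = (if 0 < t then inverse t ^ m * exp (- inverse t) else 0)"

text \<open>A single term x^(m+2)/(m+2)! of the exponential series at x = 1/t is at most exp x. The
  square that is left over makes the derivative at 0 vanish.\<close>

lemma flat_fun_bound: "\<bar>flat_fun m t\<bar> \<le> fact (m + 2) * t\<^sup>2"
proof (cases "0 < t")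
  case True
  define x where "x = inverse t"
  have x: "0 < x" using True by (simp add: x_def)
  have "(\<Sum>n\<in>{m + 2}. x ^ n /\<^sub>R fact n) \<le> exp x"
    unfolding exp_def using x summable_exp_generic[of x] by (intro sum_le_suminf) auto
  then have "x ^ (m + 2) \<le> fact (m + 2) * exp x"
    by (simp add: field_simps del: fact_Suc)
  then have "x ^ m * exp (- x) \<le> fact (m + 2) * inverse x ^ 2"
    using x by (simp add: exp_minus field_simps power_add power2_eq_square del: fact_Suc)
  then show ?thesis using True x by (simp add: flat_fun_def x_def del: fact_Suc)
qed (simp add: flat_fun_def)

lemma has_derivative_flat_fun:
  "(flat_fun m has_real_derivative flat_fun (m + 2) t - real m * flat_fun (m + 1) t) (at t)"
proof -
  consider "0 < t" | "t < 0" | "t = 0" by linarith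
  then show ?thesis
  proof cases
    case 1
    have "((\<lambda>t. inverse t ^ m * exp (- inverse t)) has_real_derivative
        (inverse t ^ m * (exp (- inverse t) * (inverse t)\<^sup>2) +
         - (real m * inverse t ^ (m - 1) * (inverse t)\<^sup>2) * exp (- inverse t))) (at t)"
      using 1 by (auto intro!: derivative_eq_intros simp: power2_eq_square)
    moreover have "inverse t ^ m * (exp (- inverse t) * (inverse t)\<^sup>2) +
         - (real m * inverse t ^ (m - 1) * (inverse t)\<^sup>2) * exp (- inverse t)
         = flat_fun (m + 2) t - real m * flat_fun (m + 1) t"
      using 1 by (cases m) (auto simp: flat_fun_def power2_eq_square algebra_simps)
    ultimately have "((\<lambda>t. inverse t ^ m * exp (- inverse t)) has_real_derivative
        flat_fun (m + 2) t - real m * flat_fun (m + 1) t) (at t)" by simp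
    then show ?thesis
      by (rule has_field_derivative_transform_within_open[of _ _ _ "{0<..}"])
         (use 1 in \<open>auto simp: flat_fun_def\<close>)
  next
    case 2
    have "((\<lambda>t. 0) has_real_derivative 0) (at t)" by simp
    then have "(flat_fun m has_real_derivative 0) (at t)"
      by (rule has_field_derivative_transform_within_open[of _ _ _ "{..<0}"])
         (use 2 in \<open>auto simp: flat_fun_def\<close>)
    then show ?thesis using 2 by (simp add: flat_fun_def)
  next
    case 3
    have "((\<lambda>h. (flat_fun m (0 + h) - flat_fun m 0) / h) \<longlongrightarrow> 0) (at 0)"
    proof (rule Lim_null_comparison)
      show "\<forall>\<^sub>F h in at 0. norm ((flat_fun m (0 + h) - flat_fun m 0) / h) \<le> fact (m + 2) * \<bar>h\<bar>"
        unfolding eventually_at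
      proof (intro exI[of _ 1] conjI ballI impI)
        fix h :: real assume h: "h \<noteq> 0 \<and> dist h 0 < 1"
        have "\<bar>flat_fun m h\<bar> \<le> fact (m + 2) * h\<^sup>2" by (rule flat_fun_bound)
        then have "\<bar>flat_fun m h\<bar> / \<bar>h\<bar> \<le> fact (m + 2) * h\<^sup>2 / \<bar>h\<bar>"
          by (intro divide_right_mono) auto
        also have "\<dots> = fact (m + 2) * \<bar>h\<bar>"
          using h by (simp add: power2_eq_square field_simps abs_if del: fact_Suc)
        finally show "norm ((flat_fun m (0 + h) - flat_fun m 0) / h) \<le> fact (m + 2) * \<bar>h\<bar>"
          by (simp add: flat_fun_def[of m 0] del: fact_Suc)
      qed simp
      show "((\<lambda>h. fact (m + 2) * \<bar>h\<bar>) \<longlongrightarrow> 0) (at (0::real))"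
        by (intro tendsto_mult_right_zero tendsto_rabs_zero tendsto_ident_at)
    qed
    then show ?thesis using 3 by (simp add: DERIV_def flat_fun_def[of _ 0])
  qed
qed

lemma smooth_on_flat_fun: "smooth_on UNIV (flat_fun m)"
proof -
  have d: "(flat_fun m has_derivative (\<lambda>v. v * (flat_fun (m + 2) t - real m * flat_fun (m + 1) t))) (at t)"
    for m t
    using has_derivative_flat_fun[of m t] unfolding has_field_derivative_def
    by (rule has_derivative_eq_rhs) (simp add: fun_eq_iff mult.commute)
  have "diff_order n UNIV (flat_fun m)" for n m
  proof (induction n arbitrary: m)
    case 0
    then show ?case using d by (auto simp: differentiable_def)
  next
    case (Suc n)
    have "diff_order n UNIV (\<lambda>t. v * (flat_fun (m + 2) t + - (real m * flat_fun (m + 1) t)))" for v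
      by (intro diff_order_linear[OF _ bounded_linear_mult_right] diff_order_add
          diff_order_linear[OF _ bounded_linear_minus[OF bounded_linear_ident]] Suc) auto
    then show ?case by (intro diff_order_SucI[OF _ d]) auto
  qed
  then show ?thesis by (simp add: smooth_on_iff_diff_order)
qed

lemma bump_function:
  fixes x\<^sub>0 :: "'b::euclidean_space"
  assumes "0 < r"
  obtains \<beta> :: "'b \<Rightarrow> real" where "smooth_on UNIV \<beta>" "\<And>x. 0 \<le> \<beta> x" "0 < \<beta> x\<^sub>0"
    "\<And>x. \<beta> x \<noteq> 0 \<Longrightarrow> dist x x\<^sub>0 < r"
proof
  \<comment> \<open>The argument is positive exactly on the open ball of radius \<open>r\<close>
    about the centre. Subtraction is written as addition of a negative so that the closure rules for
    sums and linear maps apply.\<close>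
  let ?\<beta> = "\<lambda>x. flat_fun 0 (r\<^sup>2 + - ((x + - x\<^sub>0) \<bullet> (x + - x\<^sub>0)))"
  show "smooth_on UNIV ?\<beta>"
  proof (rule smooth_on_compose[OF open_UNIV smooth_on_flat_fun])
    have d: "diff_order n UNIV (\<lambda>x. x + - x\<^sub>0)" for n
      by (intro diff_order_add diff_order_ident diff_order_const open_UNIV)
    show "smooth_on UNIV (\<lambda>x. r\<^sup>2 + - ((x + - x\<^sub>0) \<bullet> (x + - x\<^sub>0)))"
      unfolding smooth_on_iff_diff_order
      by (intro allI diff_order_add diff_order_const open_UNIV d
          diff_order_linear[OF open_UNIV bounded_linear_minus[OF bounded_linear_ident]]
          diff_order_bilinear[OF open_UNIV bounded_bilinear_inner])
  qed simp
  show "0 \<le> ?\<beta> x" for x by (simp add: flat_fun_def)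
  show "0 < ?\<beta> x\<^sub>0" using assms by (simp add: flat_fun_def)
  fix x assume "?\<beta> x \<noteq> 0"
  then have "(x - x\<^sub>0) \<bullet> (x - x\<^sub>0) < r\<^sup>2" by (simp add: flat_fun_def split: if_splits)
  then have "(dist x x\<^sub>0)\<^sup>2 < r\<^sup>2" by (simp add: dist_norm power2_norm_eq_inner)
  then show "dist x x\<^sub>0 < r" using assms by (simp add: power_less_imp_less_base)
qed

subsection \<open>Change of variables for nonnegative functions\<close>

lemma nn_integral_eq_iff_has_integral:
  fixes k :: "'b::euclidean_space \<Rightarrow> real"
  assumes "k \<in> borel_measurable borel" "\<And>x. 0 \<le> k x"
  shows "(\<integral>\<^sup>+x. ennreal (k x) \<partial>lborel) = ennreal b \<and> 0 \<le> b \<longleftrightarrow> (k has_integral b) UNIV"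
proof
  assume "(\<integral>\<^sup>+x. ennreal (k x) \<partial>lborel) = ennreal b \<and> 0 \<le> b"
  then have "integrable lborel k" "integral\<^sup>L lborel k = b"
    using assms nn_integral_eq_integrable[of k lborel b] by auto
  then show "(k has_integral b) UNIV" using has_integral_integral_lborel by blast
next
  assume "(k has_integral b) UNIV"
  then show "(\<integral>\<^sup>+x. ennreal (k x) \<partial>lborel) = ennreal b \<and> 0 \<le> b"
    using assms nn_integral_has_integral_lborel[of k b] has_integral_nonneg[of k b UNIV] by auto
qed

text \<open>For absolutely integrable functions the theorem says that one side is integrable with
  value b iff the other is. For nonnegative functions this compares finite integrals and forces both
  sides to be infinite together. The detour through \<open>real^1\<close> is due to the
  vector-valued form of the theorem.\<close>

lemma nn_integral_change_of_variables_wellorder: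
  fixes g :: "real^'m::{finite,wellorder} \<Rightarrow> real^'m::_" and w :: "real^'m::_ \<Rightarrow> real"
  assumes S: "S \<in> sets borel"
    and der: "\<And>x. x \<in> S \<Longrightarrow> (g has_derivative g' x) (at x)"
    and inj: "inj_on g S" and w: "\<And>y. 0 \<le> w y"
    and m1: "(\<lambda>y. w y * indicator (g ` S) y) \<in> borel_measurable borel"
    and m2: "(\<lambda>x. \<bar>det (matrix (g' x))\<bar> * w (g x) * indicator S x) \<in> borel_measurable borel"
  shows "(\<integral>\<^sup>+y. ennreal (w y * indicator (g ` S) y) \<partial>lborel)
     = (\<integral>\<^sup>+x. ennreal (\<bar>det (matrix (g' x))\<bar> * w (g x) * indicator S x) \<partial>lborel)"
proof -
  let ?D = "\<lambda>x. \<bar>det (matrix (g' x))\<bar> * w (g x)"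
  have der': "(g has_derivative g' x) (at x within S)" if "x \<in> S" for x
    using der[OF that] has_derivative_at_withinI by blast
  have "(\<lambda>x. \<bar>det (matrix (g' x))\<bar> *\<^sub>R (vec (w (g x)) :: real^1)) absolutely_integrable_on S \<and>
      integral S (\<lambda>x. \<bar>det (matrix (g' x))\<bar> *\<^sub>R vec (w (g x))) = (vec b :: real^1)
    \<longleftrightarrow> (\<lambda>x. vec (w x) :: real^1) absolutely_integrable_on g ` S \<and>
      integral (g ` S) (\<lambda>x. vec (w x)) = (vec b :: real^1)" for b
    by (rule has_absolute_integral_change_of_variables[OF _ der' inj]) (use S in auto)
  then have cov: "?D absolutely_integrable_on S \<and> integral S ?D = b
     \<longleftrightarrow> w absolutely_integrable_on g ` S \<and> integral (g ` S) w = b" for b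
    by (simp add: absolutely_integrable_on_1_iff integral_on_1_eq)
  have nn: "f absolutely_integrable_on T \<and> integral T f = b \<longleftrightarrow> (\<integral>\<^sup>+x. ennreal (f x * indicator T x) \<partial>lborel) = ennreal b \<and> 0 \<le> b"
    if "(\<lambda>x. f x * indicator T x) \<in> borel_measurable borel" "\<And>x. 0 \<le> f x"
    for f :: "real^'m::_ \<Rightarrow> real" and T b
  proof -
    have "f absolutely_integrable_on T \<longleftrightarrow> f integrable_on T"
      using that(2) nonnegative_absolutely_integrable_1[of f T] set_lebesgue_integral_eq_integral(1) by blast
    then have "f absolutely_integrable_on T \<and> integral T f = b \<longleftrightarrow> (f has_integral b) T"
      by (metis has_integral_iff)
    also have "\<dots> \<longleftrightarrow> ((\<lambda>x. f x * indicator T x) has_integral b) UNIV"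
    proof -
      have "(\<lambda>x. f x * indicator T x) = (\<lambda>x. if x \<in> T then f x else 0)" by auto
      then show ?thesis by (simp only: has_integral_restrict_UNIV)
    qed
    also have "\<dots> \<longleftrightarrow> (\<integral>\<^sup>+x. ennreal (f x * indicator T x) \<partial>lborel) = ennreal b \<and> 0 \<le> b"
      using that by (intro nn_integral_eq_iff_has_integral[symmetric]) auto
    finally show ?thesis .
  qed
  have eq: "((\<integral>\<^sup>+y. ennreal (w y * indicator (g ` S) y) \<partial>lborel) = ennreal b \<and> 0 \<le> b)
     \<longleftrightarrow> ((\<integral>\<^sup>+x. ennreal (?D x * indicator S x) \<partial>lborel) = ennreal b \<and> 0 \<le> b)" for b
    using cov[of b] nn[OF m1 w, of b] nn[of ?D S b] m2 w by simp
  show ?thesis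
  proof (cases "\<integral>\<^sup>+y. ennreal (w y * indicator (g ` S) y) \<partial>lborel" rule: ennreal_cases)
    case (real b)
    then show ?thesis using eq[of b] by simp
  next
    case top
    show ?thesis
    proof (cases "\<integral>\<^sup>+x. ennreal (?D x * indicator S x) \<partial>lborel" rule: ennreal_cases)
      case (real b)
      then have "(\<integral>\<^sup>+y. ennreal (w y * indicator (g ` S) y) \<partial>lborel) = ennreal b" using eq[of b] by simp
      with top show ?thesis by simp
    qed (use top in simp)
  qed
qed

text \<open>
  The change of variables theorem of the library needs a well-ordered index type. An arbitrary
  finite index type is replaced by a well-ordered copy of the same cardinality.
\<close>

typedef (overloaded) ('n::finite) ord_index = "{..<CARD('n)}"
  by (rule exI[of _ 0]) (simp add: zero_less_card_finite)

instance ord_index :: (finite) finite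
proof
  have "(UNIV :: 'a ord_index set) = Abs_ord_index ` {..<CARD('a)}"
    using type_definition.Abs_image[OF type_definition_ord_index] by metis
  then show "finite (UNIV :: 'a ord_index set)" by (metis finite_imageI finite_lessThan)
qed

instantiation ord_index :: (finite) linorder
begin

definition less_eq_ord_index :: "'a ord_index \<Rightarrow> 'a ord_index \<Rightarrow> bool"
  where "less_eq_ord_index i j \<longleftrightarrow> Rep_ord_index i \<le> Rep_ord_index j"

definition less_ord_index :: "'a ord_index \<Rightarrow> 'a ord_index \<Rightarrow> bool"
  where "less_ord_index i j \<longleftrightarrow> Rep_ord_index i < Rep_ord_index j"

instance
  by standard (auto simp: less_eq_ord_index_def less_ord_index_def Rep_ord_index_inject)

end

instance ord_index :: (finite) wellorder
proof
  fix P :: "'a ord_index \<Rightarrow> bool" and i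
  assume step: "\<And>i. (\<And>j. j < i \<Longrightarrow> P j) \<Longrightarrow> P i"
  show "P i"
  proof (induction "Rep_ord_index i" arbitrary: i rule: less_induct)
    case less
    show ?case by (rule step, rule less) (simp add: less_ord_index_def)
  qed
qed

lemma ex_bij_ord_index: "\<exists>e :: 'n::finite ord_index \<Rightarrow> 'n. bij e"
proof -
  have "CARD('n ord_index) = card {..<CARD('n)}"
    by (rule type_definition.card[OF type_definition_ord_index])
  then have "CARD('n ord_index) = CARD('n)" by simp
  then show ?thesis by (simp add: finite_same_card_bij)
qed

text \<open>Conjugation by \<open>e\<close> is a sign-preserving bijection between the permutations
  of the two index types, and it matches the terms of the two expansions.\<close>

lemma det_reindex:
  fixes M :: "real^'n::finite^'n" and e :: "'m::finite \<Rightarrow> 'n"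
  assumes "bij e"
  shows "det (\<chi> i j. M $ e i $ e j) = det M"
proof -
  have inj: "inj e" using assms by (rule bij_is_inj)
  have e: "bij_betw e UNIV UNIV" "bij_betw (inv e) UNIV UNIV"
    using assms bij_imp_bij_inv by auto
  have "(\<Sum>p | p permutes (UNIV :: 'm set). of_int (sign p) * (\<Prod>i\<in>UNIV. M $ e i $ e (p i)))
      = (\<Sum>p | p permutes (UNIV :: 'n set). of_int (sign p) * (\<Prod>i\<in>UNIV. M $ i $ p i))"
  proof (rule sum.reindex_bij_witness[where j = "map_permutation UNIV e" and i = "map_permutation UNIV (inv e)"])
    fix p :: "'m \<Rightarrow> 'm" assume "p \<in> {p. p permutes UNIV}"
    then have p: "p permutes UNIV" by simp
    show "map_permutation UNIV e p \<in> {p. p permutes UNIV}"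
      using map_permutation_permutes[OF e(1) p] by simp
    have *: "map_permutation UNIV e p (e i) = e (p i)" for i
      by (rule map_permutation_apply[OF inj]) simp
    show "map_permutation UNIV (inv e) (map_permutation UNIV e p) = p"
    proof
      fix i
      have "map_permutation UNIV (inv e) (map_permutation UNIV e p) (inv e (e i)) =
          inv e (map_permutation UNIV e p (e i))"
        by (rule map_permutation_apply) (use e(2) in \<open>auto dest: bij_betw_imp_inj_on\<close>)
      then show "map_permutation UNIV (inv e) (map_permutation UNIV e p) i = p i"
        by (simp add: * inj)
    qed
    have "(\<Prod>i\<in>UNIV. M $ i $ map_permutation UNIV e p i)
        = (\<Prod>i\<in>UNIV. M $ e i $ map_permutation UNIV e p (e i))"
      using prod.reindex_bij_betw[OF e(1), of "\<lambda>i. M $ i $ map_permutation UNIV e p i"] by simp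
    then show "of_int (sign (map_permutation UNIV e p)) * (\<Prod>i\<in>UNIV. M $ i $ map_permutation UNIV e p i)
        = of_int (sign p) * (\<Prod>i\<in>UNIV. M $ e i $ e (p i))"
      using sign_map_permutation[OF inj p] by (simp add: *)
  next
    fix p :: "'n \<Rightarrow> 'n" assume "p \<in> {p. p permutes UNIV}"
    then have p: "p permutes UNIV" by simp
    show "map_permutation UNIV (inv e) p \<in> {p. p permutes UNIV}"
      using map_permutation_permutes[OF e(2) p] by simp
    show "map_permutation UNIV e (map_permutation UNIV (inv e) p) = p"
    proof
      fix i
      have "map_permutation UNIV e (map_permutation UNIV (inv e) p) (e (inv e i)) =
          e (map_permutation UNIV (inv e) p (inv e i))"
        by (rule map_permutation_apply[OF inj]) simp
      moreover have "map_permutation UNIV (inv e) p (inv e i) = inv e (p i)"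
        by (rule map_permutation_apply) (use e(2) in \<open>auto dest: bij_betw_imp_inj_on\<close>)
      ultimately show "map_permutation UNIV e (map_permutation UNIV (inv e) p) i = p i"
        using assms by (simp add: bij_is_surj surj_f_inv_f)
    qed
  qed
  then show ?thesis by (simp add: det_def)
qed

definition reindex_vec :: "('m \<Rightarrow> 'n) \<Rightarrow> real^'n::finite \<Rightarrow> real^'m::finite" where
  "reindex_vec e x = (\<chi> i. x $ e i)"

lemma bounded_linear_reindex_vec: "bounded_linear (reindex_vec e)"
proof -
  have "linear (reindex_vec e)" by (auto simp: linear_iff reindex_vec_def vec_eq_iff)
  then show ?thesis by (simp add: linear_conv_bounded_linear)
qed

lemma reindex_vec_measurable [measurable]: "reindex_vec e \<in> borel_measurable borel"
  using bounded_linear_reindex_vec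
  by (intro borel_measurable_continuous_onI linear_continuous_on)

lemma reindex_vec_inverse:
  assumes "bij e"
  shows "reindex_vec e (reindex_vec (inv e) x) = x" "reindex_vec (inv e) (reindex_vec e y) = y"
  using assms by (auto simp: reindex_vec_def vec_eq_iff bij_is_inj bij_is_surj surj_f_inv_f)

text \<open>It suffices to compare volumes of boxes, and relabelling coordinates only permutes their
  side lengths.\<close>

lemma distr_reindex_vec:
  assumes "bij (e :: 'm::finite \<Rightarrow> 'n::finite)"
  shows "distr lborel borel (reindex_vec e) = (lborel :: (real^'m) measure)"
proof (rule lborel_eqI[symmetric])
  fix l u :: "real^'m" assume lu: "\<And>b. b \<in> Basis \<Longrightarrow> l \<bullet> b \<le> u \<bullet> b"
  have "reindex_vec e x \<in> box l u \<longleftrightarrow> x \<in> box (reindex_vec (inv e) l) (reindex_vec (inv e) u)" for x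
  proof
    assume "reindex_vec e x \<in> box l u"
    then have "l $ inv e i < x $ e (inv e i)" "x $ e (inv e i) < u $ inv e i" for i
      by (auto simp: mem_box_cart reindex_vec_def)
    then show "x \<in> box (reindex_vec (inv e) l) (reindex_vec (inv e) u)"
      using assms by (auto simp: mem_box_cart reindex_vec_def bij_is_surj surj_f_inv_f)
  next
    assume "x \<in> box (reindex_vec (inv e) l) (reindex_vec (inv e) u)"
    then have "l $ inv e (e i) < x $ e i" "x $ e i < u $ inv e (e i)" for i
      by (auto simp: mem_box_cart reindex_vec_def)
    then show "reindex_vec e x \<in> box l u"
      using assms by (auto simp: mem_box_cart reindex_vec_def bij_is_inj)
  qed
  then have "reindex_vec e -` box l u = box (reindex_vec (inv e) l) (reindex_vec (inv e) u)"
    by auto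
  then have "emeasure (distr lborel borel (reindex_vec e)) (box l u)
     = emeasure lborel (box (reindex_vec (inv e) l) (reindex_vec (inv e) u))"
    by (simp add: emeasure_distr)
  also have "\<dots> = (\<Prod>b\<in>Basis. (reindex_vec (inv e) u - reindex_vec (inv e) l) \<bullet> b)"
  proof (rule emeasure_lborel_box)
    fix b :: "real^'n" assume "b \<in> Basis"
    then obtain i where "b = axis i 1" by (auto simp: Basis_vec_def)
    then show "reindex_vec (inv e) l \<bullet> b \<le> reindex_vec (inv e) u \<bullet> b"
      using lu[of "axis (inv e i) 1"] by (simp add: inner_axis reindex_vec_def)
  qed
  also have "(\<Prod>b\<in>Basis. (reindex_vec (inv e) u - reindex_vec (inv e) l) \<bullet> b)
      = (\<Prod>i\<in>UNIV. u $ inv e i - l $ inv e i)"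
  proof -
    have B: "(Basis :: (real^'n) set) = (\<lambda>i. axis i 1) ` UNIV" by (auto simp: Basis_vec_def)
    show ?thesis
      unfolding B by (subst prod.reindex) (auto simp: inj_on_def axis_eq_axis inner_axis reindex_vec_def)
  qed
  also have "\<dots> = (\<Prod>i\<in>UNIV. u $ i - l $ i)"
    using prod.reindex_bij_betw[of "inv e" UNIV UNIV "\<lambda>i. u $ i - l $ i"] bij_imp_bij_inv[OF assms] by simp
  also have "\<dots> = (\<Prod>b\<in>Basis. (u - l) \<bullet> b)"
  proof -
    have B: "(Basis :: (real^'m) set) = (\<lambda>i. axis i 1) ` UNIV" by (auto simp: Basis_vec_def)
    show ?thesis
      unfolding B by (subst prod.reindex) (auto simp: inj_on_def axis_eq_axis inner_axis)
  qed
  finally show "emeasure (distr lborel borel (reindex_vec e)) (box l u) = ennreal (\<Prod>b\<in>Basis. (u - l) \<bullet> b)" .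
qed simp

lemma nn_integral_reindex_vec:
  assumes "bij (e :: 'm::finite \<Rightarrow> 'n::finite)" "f \<in> borel_measurable borel"
  shows "(\<integral>\<^sup>+x. f x \<partial>(lborel :: (real^'m) measure)) = (\<integral>\<^sup>+x. f (reindex_vec e x) \<partial>lborel)"
  by (subst distr_reindex_vec[OF assms(1), symmetric]) (use assms in \<open>simp add: nn_integral_distr\<close>)

text \<open>Conjugating \<open>g\<close> with the relabelling of coordinates changes neither
  Lebesgue integrals nor the Jacobian determinant, so the statement transfers from the well-ordered
  index type.\<close>

lemma nn_integral_change_of_variables:
  fixes g :: "real^'n::finite \<Rightarrow> real^'n" and w :: "real^'n \<Rightarrow> real"
  assumes S: "S \<in> sets borel"
    and der: "\<And>x. x \<in> S \<Longrightarrow> (g has_derivative g' x) (at x)"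
    and inj: "inj_on g S" and w: "\<And>y. 0 \<le> w y"
    and m1: "(\<lambda>y. w y * indicator (g ` S) y) \<in> borel_measurable borel"
    and m2: "(\<lambda>x. \<bar>det (matrix (g' x))\<bar> * w (g x) * indicator S x) \<in> borel_measurable borel"
  shows "(\<integral>\<^sup>+y. ennreal (w y * indicator (g ` S) y) \<partial>lborel)
     = (\<integral>\<^sup>+x. ennreal (\<bar>det (matrix (g' x))\<bar> * w (g x) * indicator S x) \<partial>lborel)"
proof -
  obtain e :: "'n ord_index \<Rightarrow> 'n" where e: "bij e" using ex_bij_ord_index by blast
  let ?P = "reindex_vec (inv e) :: real^'n ord_index \<Rightarrow> real^'n"
  let ?Q = "reindex_vec e :: real^'n \<Rightarrow> real^'n ord_index"
  have PQ: "?P (?Q x) = x" "?Q (?P y) = y" for x y using reindex_vec_inverse[OF e] by auto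
  have e': "bij (inv e)" using e by (rule bij_imp_bij_inv)
  define h where "h = (\<lambda>y. ?Q (g (?P y)))"
  define h' where "h' = (\<lambda>y v. ?Q (g' (?P y) (?P v)))"
  define T where "T = ?P -` S"
  have mem: "?P y \<in> g ` S \<longleftrightarrow> y \<in> h ` T" for y
  proof
    assume "?P y \<in> g ` S"
    then obtain x where x: "x \<in> S" "?P y = g x" by auto
    then have "y = h (?Q x)" using PQ by (metis h_def)
    moreover have "?Q x \<in> T" using x PQ by (simp add: T_def)
    ultimately show "y \<in> h ` T" by blast
  qed (auto simp: h_def T_def PQ)
  have mat: "det (matrix (h' y)) = det (matrix (g' (?P y)))" if "?P y \<in> S" for y
  proof -
    have "matrix (h' y) = (\<chi> i j. matrix (g' (?P y)) $ e i $ e j)"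
    proof -
      have "?P (axis j 1) = axis (e j) 1" for j
        using e by (auto simp: reindex_vec_def vec_eq_iff axis_def bij_is_inj bij_is_surj surj_f_inv_f
            bij_inv_eq_iff)
      then show ?thesis by (simp add: matrix_def h'_def vec_eq_iff) (simp add: reindex_vec_def)
    qed
    then show ?thesis using det_reindex[OF e] by metis
  qed
  have "(\<integral>\<^sup>+y. ennreal (w y * indicator (g ` S) y) \<partial>lborel)
      = (\<integral>\<^sup>+y. ennreal (w (?P y) * indicator (g ` S) (?P y)) \<partial>lborel)"
    using m1 by (intro nn_integral_reindex_vec[OF e']) auto
  also have "\<dots> = (\<integral>\<^sup>+y. ennreal (w (?P y) * indicator (h ` T) y) \<partial>lborel)"
    using mem by (simp add: indicator_def)
  also have "\<dots> = (\<integral>\<^sup>+x. ennreal (\<bar>det (matrix (h' x))\<bar> * w (?P (h x)) * indicator T x) \<partial>lborel)"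
  proof (rule nn_integral_change_of_variables_wellorder)
    show "T \<in> sets borel" unfolding T_def using S measurable_sets[OF reindex_vec_measurable] by auto
    show "(h has_derivative h' x) (at x)" if "x \<in> T" for x
      unfolding h_def h'_def
      using that
      by (intro bounded_linear.has_derivative[OF bounded_linear_reindex_vec]
          has_derivative_compose[of ?P ?P x UNIV g "g' (?P x)"] der
          bounded_linear_imp_has_derivative bounded_linear_reindex_vec) (auto simp: T_def)
    show "inj_on h T"
    proof (rule inj_onI)
      fix x y assume "x \<in> T" "y \<in> T" "h x = h y"
      then have "g (?P x) = g (?P y)" "?P x \<in> S" "?P y \<in> S" by (auto simp: h_def T_def) (metis PQ(1))
      then have "?P x = ?P y" using inj by (auto dest: inj_onD)
      then show "x = y" by (metis PQ(2))
    qed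
    show "(\<lambda>y. w (?P y) * indicator (h ` T) y) \<in> borel_measurable borel"
      using measurable_compose[OF reindex_vec_measurable m1, of "inv e"] mem by (simp add: indicator_def)
    have "(\<lambda>x. \<bar>det (matrix (g' (?P x)))\<bar> * w (g (?P x)) * indicator S (?P x)) \<in> borel_measurable borel"
      using measurable_compose[OF reindex_vec_measurable m2, of "inv e"] by simp
    then show "(\<lambda>x. \<bar>det (matrix (h' x))\<bar> * w (?P (h x)) * indicator T x) \<in> borel_measurable borel"
      by (rule iffD1[OF measurable_cong, rotated]) (auto simp: T_def h_def PQ mat split: split_indicator)
  qed (use w in auto)
  also have "\<dots> = (\<integral>\<^sup>+x. ennreal (\<bar>det (matrix (g' (?P x)))\<bar> * w (g (?P x)) * indicator S (?P x)) \<partial>lborel)"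
    by (rule nn_integral_cong) (auto simp: T_def h_def PQ mat split: split_indicator)
  also have "\<dots> = (\<integral>\<^sup>+x. ennreal (\<bar>det (matrix (g' x))\<bar> * w (g x) * indicator S x) \<partial>lborel)"
    using m2 by (intro nn_integral_reindex_vec[OF e', symmetric]) auto
  finally show ?thesis .
qed

subsection \<open>Charts and tensor fields\<close>

lemma plus_tensor [simp]: "(h + h') c p = h c p + h' c p"
  for h h' :: "('a, 'n::finite) tensor2"
  by simp

lemma scaleR_tensor [simp]: "(r *\<^sub>R h) c p = r *\<^sub>R h c p"
  for h :: "('a, 'n::finite) tensor2"
  by (simp add: scaleR_fun_def)

lemma zero_tensor [simp]: "(0 :: ('a, 'n::finite) tensor2) c p = 0"
  by simp

lemma minus_tensor [simp]: "(h - h') c p = h c p - h' c p"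
  for h h' :: "('a, 'n::finite) tensor2"
  by simp

locale smooth_mfd =
  fixes X :: "'a topology" and \<A> :: "('a, 'n::finite) chart set"
  assumes mfd: "smooth_manifold X \<A>"
begin

lemma Hausdorff: "Hausdorff_space X"
  and paracompact: "paracompact_space X"
  and charts_cover: "(\<Union>c\<in>\<A>. fst c) = topspace X"
  using mfd by (auto simp: smooth_manifold_def)

context
  fixes c assumes c: "c \<in> \<A>"
begin

lemma openin_chart: "openin X (fst c)"
  and open_chart_image: "open (snd c ` fst c)"
  and chart_homeomorphic: "homeomorphic_map (subtopology X (fst c)) (top_of_set (snd c ` fst c)) (snd c)"
  using mfd c by (auto simp: smooth_manifold_def)

lemma chart_subset: "fst c \<subseteq> topspace X"
  using openin_chart openin_subset by blast

lemma topspace_chart: "topspace (subtopology X (fst c)) = fst c"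
  using chart_subset by auto

lemma inj_on_chart: "inj_on (snd c) (fst c)"
  using homeomorphic_imp_injective_map[OF chart_homeomorphic, unfolded topspace_chart] .

lemma chart_inv_chart [simp]: "p \<in> fst c \<Longrightarrow> chart_inv c (snd c p) = p"
  using inj_on_chart by (simp add: chart_inv_def)

lemma chart_chart_inv [simp]: "y \<in> snd c ` fst c \<Longrightarrow> snd c (chart_inv c y) = y"
  by (simp add: chart_inv_def f_inv_into_f)

lemma chart_inv_in [simp]: "y \<in> snd c ` fst c \<Longrightarrow> chart_inv c y \<in> fst c"
  by (simp add: chart_inv_def inv_into_into)

lemma chart_inv_image: "B \<subseteq> fst c \<Longrightarrow> snd c ` B = {y \<in> snd c ` fst c. chart_inv c y \<in> B}"
  by (force simp: image_iff)

lemma continuous_map_chart_inv: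
  "continuous_map (top_of_set (snd c ` fst c)) (subtopology X (fst c)) (chart_inv c)"
proof -
  obtain g where g: "homeomorphic_maps (subtopology X (fst c)) (top_of_set (snd c ` fst c)) (snd c) g"
    using chart_homeomorphic by (auto simp: homeomorphic_map_maps)
  have "g y = chart_inv c y" if "y \<in> snd c ` fst c" for y
  proof -
    have "g y \<in> fst c" "snd c (g y) = y"
      using g that unfolding homeomorphic_maps_def continuous_map_def topspace_chart
      by (force simp: Pi_iff)+
    then show ?thesis using inj_on_chart that by (metis chart_inv_chart)
  qed
  then show ?thesis
    using g unfolding homeomorphic_maps_def topspace_euclidean_subtopology
    by (blast intro: continuous_map_eq[of "top_of_set (snd c ` fst c)" "subtopology X (fst c)" g "chart_inv c",
        unfolded topspace_euclidean_subtopology])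
qed

lemma openin_chart_preimage:
  assumes "open V"
  shows "openin X {p \<in> fst c. snd c p \<in> V}"
proof -
  have "continuous_map (subtopology X (fst c)) euclidean (snd c)"
    using homeomorphic_imp_continuous_map[OF chart_homeomorphic] continuous_map_in_subtopology by blast
  then have "openin (subtopology X (fst c)) {p \<in> fst c. snd c p \<in> V}"
    using assms openin_continuous_map_preimage[of "subtopology X (fst c)" euclidean "snd c" V,
        unfolded topspace_chart] by simp
  then show ?thesis using openin_chart openin_open_subtopology by blast
qed

lemma compactin_chart_inv:
  assumes "compact L" "L \<subseteq> snd c ` fst c"
  shows "compactin X (chart_inv c ` L)"
proof -
  have "compactin (top_of_set (snd c ` fst c)) L"
    using assms by (auto simp: compactin_subtopology)
  from image_compactin[OF this continuous_map_chart_inv] show ?thesis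
    by (simp add: compactin_subtopology)
qed

text \<open>The compact piece is a closed ball in coordinates. The open set serves covering
  arguments, the compact one seminorms.\<close>

lemma chart_neighbourhood:
  assumes "p \<in> fst c"
  obtains U L where "openin X U" "p \<in> U" "compact L" "L \<noteq> {}" "L \<subseteq> snd c ` fst c" "U \<subseteq> chart_inv c ` L"
proof -
  obtain e where e: "0 < e" "cball (snd c p) e \<subseteq> snd c ` fst c"
    using open_chart_image assms by (meson image_eqI open_contains_cball)
  show thesis
  proof
    show "openin X {q \<in> fst c. snd c q \<in> ball (snd c p) e}"
      by (rule openin_chart_preimage) simp
    show "{q \<in> fst c. snd c q \<in> ball (snd c p) e} \<subseteq> chart_inv c ` cball (snd c p) e"
    proof
      fix q assume "q \<in> {q \<in> fst c. snd c q \<in> ball (snd c p) e}"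
      then have "q = chart_inv c (snd c q)" "snd c q \<in> cball (snd c p) e" by auto
      then show "q \<in> chart_inv c ` cball (snd c p) e" by blast
    qed
  qed (use e assms in auto)
qed

end

lemma sym2_fields_0: "h \<in> sym2_fields \<A> \<Longrightarrow> c \<notin> \<A> \<or> p \<notin> fst c \<Longrightarrow> h c p = 0"
  unfolding sym2_fields_def by blast

lemma sym2_fields_smooth:
  "h \<in> sym2_fields \<A> \<Longrightarrow> c \<in> \<A> \<Longrightarrow> smooth_on (snd c ` fst c) (\<lambda>y. h c (chart_inv c y))"
  unfolding sym2_fields_def o_def by blast

lemma sym2_fields_sym: "h \<in> sym2_fields \<A> \<Longrightarrow> transpose (h c p) = h c p"
proof (cases "c \<in> \<A> \<and> p \<in> fst c")
  case False
  assume "h \<in> sym2_fields \<A>"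
  then show ?thesis using sym2_fields_0[of h c p] False by (auto simp: transpose_def vec_eq_iff)
next
  case True
  assume "h \<in> sym2_fields \<A>"
  with True show ?thesis unfolding sym2_fields_def by blast
qed

lemma sym2_fields_transform:
  "h \<in> sym2_fields \<A> \<Longrightarrow> c \<in> \<A> \<Longrightarrow> d \<in> \<A> \<Longrightarrow> p \<in> fst c \<Longrightarrow> p \<in> fst d \<Longrightarrow>
     h c p = transpose (transition_jacobian c d p) ** h d p ** transition_jacobian c d p"
  unfolding sym2_fields_def by blast

lemma sym2_fields_continuous:
  "h \<in> sym2_fields \<A> \<Longrightarrow> c \<in> \<A> \<Longrightarrow> continuous_on (snd c ` fst c) (\<lambda>y. h c (chart_inv c y))"
  by (rule smooth_on_continuous_on[OF sym2_fields_smooth])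

lemma sym2_fields_add:
  assumes "h \<in> sym2_fields \<A>" "k \<in> sym2_fields \<A>"
  shows "h + k \<in> sym2_fields \<A>"
proof -
  have "smooth_on (snd c ` fst c) ((h + k) c \<circ> chart_inv c)" if "c \<in> \<A>" for c
    using smooth_on_add[OF open_chart_image[OF that] sym2_fields_smooth[OF assms(1) that]
        sym2_fields_smooth[OF assms(2) that]]
    by (simp add: o_def)
  moreover have "transpose (h c p + k c p) = h c p + k c p" for c p
    using sym2_fields_sym[OF assms(1), of c p] sym2_fields_sym[OF assms(2), of c p]
    by (simp add: transpose_def vec_eq_iff)
  moreover have "(h + k) c p = transpose (transition_jacobian c d p) ** (h + k) d p ** transition_jacobian c d p"
    if "c \<in> \<A>" "d \<in> \<A>" "p \<in> fst c \<inter> fst d" for c d p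
    using that sym2_fields_transform[OF assms(1), of c d p] sym2_fields_transform[OF assms(2), of c d p]
    by (simp only: plus_tensor matrix_mult.add_left matrix_mult.add_right Int_iff)
  moreover have "(h + k) c p = 0" if "c \<notin> \<A> \<or> p \<notin> fst c" for c p
    using that sym2_fields_0[OF assms(1)] sym2_fields_0[OF assms(2)] by simp
  ultimately show ?thesis
    unfolding sym2_fields_def mem_Collect_eq by (metis plus_tensor)
qed

lemma sym2_fields_scaleR:
  assumes "h \<in> sym2_fields \<A>"
  shows "r *\<^sub>R h \<in> sym2_fields \<A>"
proof -
  have "smooth_on (snd c ` fst c) ((r *\<^sub>R h) c \<circ> chart_inv c)" if "c \<in> \<A>" for c
    using smooth_on_linear[OF open_chart_image[OF that] bounded_linear_scaleR_right sym2_fields_smooth[OF assms that]]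
    by (simp add: o_def)
  moreover have "transpose (r *\<^sub>R h c p) = r *\<^sub>R h c p" for c p
    using sym2_fields_sym[OF assms, of c p]
    by (simp add: transpose_def vec_eq_iff)
  moreover have "(r *\<^sub>R h) c p = transpose (transition_jacobian c d p) ** (r *\<^sub>R h) d p ** transition_jacobian c d p"
    if "c \<in> \<A>" "d \<in> \<A>" "p \<in> fst c \<inter> fst d" for c d p
    using that sym2_fields_transform[OF assms(1), of c d p]
    by (simp only: scaleR_tensor matrix_mult.scaleR_left matrix_mult.scaleR_right Int_iff)
  moreover have "(r *\<^sub>R h) c p = 0" if "c \<notin> \<A> \<or> p \<notin> fst c" for c p
    using that sym2_fields_0[OF assms(1)] by simp
  ultimately show ?thesis
    unfolding sym2_fields_def mem_Collect_eq by (metis scaleR_tensor)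
qed

lemma sym2_fields_zero: "0 \<in> sym2_fields \<A>"
  unfolding sym2_fields_def by (auto simp: o_def smooth_on_const transpose_def vec_eq_iff)

lemma sym2_fields_on_mono: "K \<subseteq> K' \<Longrightarrow> sym2_fields_on \<A> K \<subseteq> sym2_fields_on \<A> K'"
  by (auto simp: sym2_fields_on_def)

lemma sym2_fields_on_add:
  "h \<in> sym2_fields_on \<A> K \<Longrightarrow> k \<in> sym2_fields_on \<A> K \<Longrightarrow> h + k \<in> sym2_fields_on \<A> K"
  using sym2_fields_add by (auto simp: sym2_fields_on_def)

lemma sym2_fields_on_scaleR: "h \<in> sym2_fields_on \<A> K \<Longrightarrow> r *\<^sub>R h \<in> sym2_fields_on \<A> K"
  using sym2_fields_scaleR by (auto simp: sym2_fields_on_def)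

lemma sym2_fields_on_zero: "0 \<in> sym2_fields_on \<A> K"
  using sym2_fields_zero by (auto simp: sym2_fields_on_def)

lemma sym2_fields_c_iff:
  "h \<in> sym2_fields_c X \<A> \<longleftrightarrow> (\<exists>K. compactin X K \<and> h \<in> sym2_fields_on \<A> K)"
  by (auto simp: sym2_fields_c_def)

lemma sym2_fields_c_common:
  assumes "h \<in> sym2_fields_c X \<A>" "k \<in> sym2_fields_c X \<A>"
  obtains K where "compactin X K" "h \<in> sym2_fields_on \<A> K" "k \<in> sym2_fields_on \<A> K"
proof -
  obtain K K' where "compactin X K" "h \<in> sym2_fields_on \<A> K" "compactin X K'" "k \<in> sym2_fields_on \<A> K'"
    using assms by (auto simp: sym2_fields_c_iff)
  then show thesis
    using that[of "K \<union> K'"] sym2_fields_on_mono[of K "K \<union> K'"] sym2_fields_on_mono[of K' "K \<union> K'"]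
    by (auto simp: compactin_Un)
qed

lemma sym2_fields_c_add: "h \<in> sym2_fields_c X \<A> \<Longrightarrow> k \<in> sym2_fields_c X \<A> \<Longrightarrow> h + k \<in> sym2_fields_c X \<A>"
  by (metis sym2_fields_c_common sym2_fields_on_add sym2_fields_c_iff)

lemma sym2_fields_c_scaleR: "h \<in> sym2_fields_c X \<A> \<Longrightarrow> r *\<^sub>R h \<in> sym2_fields_c X \<A>"
  by (metis sym2_fields_on_scaleR sym2_fields_c_iff)

lemma sym2_fields_c_zero: "0 \<in> sym2_fields_c X \<A>"
  using sym2_fields_on_zero compactin_empty by (auto simp: sym2_fields_c_iff)

lemma sym2_fields_c_subset: "h \<in> sym2_fields_c X \<A> \<Longrightarrow> h \<in> sym2_fields \<A>"
  by (auto simp: sym2_fields_c_def sym2_fields_on_def)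

lemma fst_Gamma_c [simp]: "fst (Gamma_c X \<A>) = sym2_fields_c X \<A>"
  by (simp add: Gamma_c_def)

lemma sym2_fields_c_diff: "h \<in> sym2_fields_c X \<A> \<Longrightarrow> k \<in> sym2_fields_c X \<A> \<Longrightarrow> h - k \<in> sym2_fields_c X \<A>"
  using sym2_fields_c_add[of h "(-1) *\<^sub>R k"] sym2_fields_c_scaleR[of k "-1"] by simp

lemma cinf_seminorm_0: "cinf_seminorm (c, L, []) h = (SUP y\<in>L. norm (h c (chart_inv c y)))"
  by (simp add: cinf_seminorm_def)

lemma cinf_bdd_above:
  assumes "(c, L, []) \<in> cinf_indices \<A>" "h \<in> sym2_fields \<A>"
  shows "bdd_above ((\<lambda>y. norm (h c (chart_inv c y))) ` L)"
proof -
  have L: "c \<in> \<A>" "compact L" "L \<subseteq> snd c ` fst c" using assms(1) by (auto simp: cinf_indices_def)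
  have "compact ((\<lambda>y. norm (h c (chart_inv c y))) ` L)"
    using continuous_on_subset[OF sym2_fields_continuous[OF assms(2) L(1)] L(3)] L(2)
    by (intro compact_continuous_image continuous_intros)
  then show ?thesis by (simp add: bounded_imp_bdd_above compact_imp_bounded)
qed

lemma cinf_seminorm_upper:
  assumes "(c, L, []) \<in> cinf_indices \<A>" "h \<in> sym2_fields \<A>" "y \<in> L"
  shows "norm (h c (chart_inv c y)) \<le> cinf_seminorm (c, L, []) h"
  unfolding cinf_seminorm_0 using cinf_bdd_above[OF assms(1,2)] assms(3) by (rule cSUP_upper2) simp

text \<open>The supremum seminorms of order zero bound the coefficients that enter the integrals.
  Being continuous seminorms, they transfer convergence and boundedness in \<open>Gamma_c\<close> to
  uniform statements about matrices.\<close>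

lemma cinf_seminorm_mem:
  assumes "(c, L, []) \<in> cinf_indices \<A>"
  shows "cinf_seminorm (c, L, []) \<in> snd (Gamma_c X \<A>)"
proof -
  let ?p = "cinf_seminorm (c, L, [])"
  have L: "L \<noteq> {}" using assms by (auto simp: cinf_indices_def)
  have nn: "0 \<le> ?p h" if "h \<in> sym2_fields \<A>" for h
    using cinf_seminorm_upper[OF assms that] L by (meson norm_ge_zero order_trans ex_in_conv)
  have "?p (h + k) \<le> ?p h + ?p k" if "h \<in> sym2_fields \<A>" "k \<in> sym2_fields \<A>" for h k
    unfolding cinf_seminorm_0[of c L "h + k"]
    using cinf_seminorm_upper[OF assms that(1)] cinf_seminorm_upper[OF assms that(2)]
    by (intro cSUP_least L) (auto intro: norm_triangle_le add_mono)
  moreover have "?p (r *\<^sub>R h) = \<bar>r\<bar> * ?p h" if h: "h \<in> sym2_fields \<A>" for r h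
  proof -
    have le: "?p (r *\<^sub>R h) \<le> \<bar>r\<bar> * ?p h" if h: "h \<in> sym2_fields \<A>" for r h
      unfolding cinf_seminorm_0[of c L "r *\<^sub>R h"]
      using cinf_seminorm_upper[OF assms h] by (intro cSUP_least L) (auto intro: mult_left_mono)
    show ?thesis
    proof (cases "r = 0")
      case True
      then show ?thesis using L by (simp add: cinf_seminorm_0)
    next
      case False
      \<comment> \<open>The inequality for \<open>inverse r\<close>, applied to
        \<open>r *\<^sub>R h\<close>, gives the reverse inequality.\<close>
      have "?p (inverse r *\<^sub>R (r *\<^sub>R h)) \<le> \<bar>inverse r\<bar> * ?p (r *\<^sub>R h)"
        by (rule le[OF sym2_fields_scaleR[OF h]])
      then have "\<bar>r\<bar> * ?p h \<le> ?p (r *\<^sub>R h)" using False by (simp add: field_simps abs_inverse)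
      with le[OF h, of r] show ?thesis by linarith
    qed
  qed
  ultimately have "seminorm_on (sym2_fields_c X \<A>) ?p"
    using nn sym2_fields_c_subset by (auto simp: seminorm_on_def)
  moreover have "\<exists>C I. finite I \<and> I \<subseteq> cinf_indices \<A> \<and>
      (\<forall>h \<in> sym2_fields_on \<A> K. ?p h \<le> C * (\<Sum>i \<in> I. cinf_seminorm i h))" for K
    using assms by (intro exI[of _ 1] exI[of _ "{(c, L, [])}"]) auto
  ultimately show ?thesis by (simp add: Gamma_c_def)
qed

lemma Gamma_c_seminorm:
  assumes "p \<in> snd (Gamma_c X \<A>)"
  shows "seminorm_on (sym2_fields_c X \<A>) p"
  using assms by (simp add: Gamma_c_def)

text \<open>Paired with a seminorm of one factor, it yields a seminorm of the product space that
  looks at this factor alone.\<close>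

lemma zero_seminorm_mem: "(\<lambda>h. 0) \<in> snd (Gamma_c X \<A>)"
  by (auto simp: Gamma_c_def seminorm_on_def intro!: exI[of _ 0])

lemma compactin_chart_cover:
  assumes "compactin X K"
  obtains I where "finite I" "\<And>c L. (c, L) \<in> I \<Longrightarrow> (c, L, []) \<in> cinf_indices \<A>"
    "K \<subseteq> (\<Union>(c, L)\<in>I. chart_inv c ` L)"
proof -
  define \<U> where "\<U> = {U. openin X U \<and> (\<exists>c L. (c, L, []) \<in> cinf_indices \<A> \<and> U \<subseteq> chart_inv c ` L)}"
  have "K \<subseteq> \<Union>\<U>"
  proof
    fix p assume "p \<in> K"
    then obtain c where c: "c \<in> \<A>" "p \<in> fst c"
      using compactin_subset_topspace[OF assms] charts_cover by blast
    then obtain U L where "openin X U" "p \<in> U" "compact L" "L \<noteq> {}" "L \<subseteq> snd c ` fst c" "U \<subseteq> chart_inv c ` L"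
      using chart_neighbourhood by blast
    then have "U \<in> \<U>" using c(1) unfolding \<U>_def cinf_indices_def by blast
    then show "p \<in> \<Union>\<U>" using \<open>p \<in> U\<close> by blast
  qed
  moreover have "\<And>U. U \<in> \<U> \<Longrightarrow> openin X U" by (simp add: \<U>_def)
  ultimately obtain \<F> where F: "finite \<F>" "\<F> \<subseteq> \<U>" "K \<subseteq> \<Union>\<F>"
    using compactinD[OF assms] by metis
  have "\<forall>U\<in>\<F>. \<exists>cL. (fst cL, snd cL, []) \<in> cinf_indices \<A> \<and> U \<subseteq> chart_inv (fst cL) ` snd cL"
    using F(2) by (auto simp: \<U>_def)
  then obtain f where f: "\<And>U. U \<in> \<F> \<Longrightarrow> (fst (f U), snd (f U), []) \<in> cinf_indices \<A> \<and>
      U \<subseteq> chart_inv (fst (f U)) ` snd (f U)"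
    by metis
  show thesis
  proof (rule that[of "f ` \<F>"])
    show "finite (f ` \<F>)" using F by simp
    show "(c, L, []) \<in> cinf_indices \<A>" if "(c, L) \<in> f ` \<F>" for c L
      using f that by (metis fst_conv imageE snd_conv)
    show "K \<subseteq> (\<Union>(c, L)\<in>f ` \<F>. chart_inv c ` L)"
    proof
      fix p assume "p \<in> K"
      then obtain U where "U \<in> \<F>" "p \<in> U" using F by blast
      then show "p \<in> (\<Union>(c, L)\<in>f ` \<F>. chart_inv c ` L)"
        using f[of U] by (auto simp: case_prod_beta)
    qed
  qed
qed

subsection \<open>Bounded sets of sections have a common compact support\<close>

text \<open>Take a locally finite refinement of the cover by open sets lying in compact sets, and
  choose points greedily, each outside all members that contain an earlier point. A member then
  contains \<open>p n\<close> for at most one \<open>n\<close>, and a compact set is covered by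
  finitely many members.\<close>

lemma discrete_sequence:
  assumes S: "S \<subseteq> topspace X" and nc: "\<not> (\<exists>K. compactin X K \<and> S \<subseteq> K)"
  obtains p :: "nat \<Rightarrow> 'a" where "range p \<subseteq> S" "\<And>K. compactin X K \<Longrightarrow> finite {n. p n \<in> K}"
proof -
  define \<U> where "\<U> = {U. openin X U \<and> (\<exists>K. compactin X K \<and> U \<subseteq> K)}"
  have "\<Union>\<U> = topspace X"
  proof
    show "topspace X \<subseteq> \<Union>\<U>"
    proof
      fix p assume "p \<in> topspace X"
      then obtain c where c: "c \<in> \<A>" "p \<in> fst c" using charts_cover by blast
      then obtain U L where "openin X U" "p \<in> U" "compact L" "L \<noteq> {}" "L \<subseteq> snd c ` fst c" "U \<subseteq> chart_inv c ` L"
        using chart_neighbourhood by blast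
      then have "U \<in> \<U>" using compactin_chart_inv[OF c(1)] unfolding \<U>_def by blast
      then show "p \<in> \<Union>\<U>" using \<open>p \<in> U\<close> by blast
    qed
  qed (auto simp: \<U>_def dest: openin_subset)
  then obtain \<V> where V: "\<forall>V \<in> \<V>. openin X V" "\<Union>\<V> = topspace X" "\<forall>V \<in> \<V>. \<exists>U \<in> \<U>. V \<subseteq> U"
      "locally_finite_in X \<V>"
  proof -
    have "\<forall>U\<in>\<U>. openin X U" by (simp add: \<U>_def)
    then have "\<exists>\<V>. (\<forall>V \<in> \<V>. openin X V) \<and> \<Union>\<V> = topspace X \<and>
        (\<forall>V \<in> \<V>. \<exists>U \<in> \<U>. V \<subseteq> U) \<and> locally_finite_in X \<V>"
      using paracompact \<open>\<Union>\<U> = topspace X\<close> unfolding paracompact_space_def by (simp only: HOL.simp_thms)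
    then show thesis by (elim exE conjE) (rule that)
  qed
  have fin: "finite {V \<in> \<V>. p \<in> V}" if p: "p \<in> topspace X" for p
  proof -
    obtain W where W: "p \<in> W" "finite {V \<in> \<V>. V \<inter> W \<noteq> {}}"
      using V(4) p unfolding locally_finite_in_def by blast
    then show ?thesis by (intro finite_subset[OF _ W(2)]) auto
  qed
  have ex: "\<exists>p\<in>S. \<forall>q\<in>Q. \<forall>V\<in>\<V>. q \<in> V \<longrightarrow> p \<notin> V" if Q: "finite Q" "Q \<subseteq> S" for Q
  \<comment> \<open>If no point were left, \<open>S\<close> would lie in the finitely many members
    of \<open>\<V>\<close> that meet \<open>Q\<close>, hence in a finite union of compact
    sets.\<close>
  proof (rule ccontr)
    assume "\<not> ?thesis"
    then have sub: "S \<subseteq> \<Union>(\<Union>q\<in>Q. {V \<in> \<V>. q \<in> V})" by blast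
    have finQ: "finite (\<Union>q\<in>Q. {V \<in> \<V>. q \<in> V})"
      using Q S by (intro finite_UN_I fin) auto
    have "\<forall>V\<in>\<V>. \<exists>K. compactin X K \<and> V \<subseteq> K" using V(3) unfolding \<U>_def by fast
    from bchoice[OF this] obtain k where k: "\<And>V. V \<in> \<V> \<Longrightarrow> compactin X (k V) \<and> V \<subseteq> k V" by auto
    have "compactin X (\<Union>(k ` (\<Union>q\<in>Q. {V \<in> \<V>. q \<in> V})))"
      using finQ k by (intro compactin_Union) auto
    moreover have "S \<subseteq> \<Union>(k ` (\<Union>q\<in>Q. {V \<in> \<V>. q \<in> V}))"
    proof
      fix x assume "x \<in> S"
      with sub obtain V where V: "V \<in> (\<Union>q\<in>Q. {V \<in> \<V>. q \<in> V})" "x \<in> V" by (meson UnionE subsetD)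
      then have "x \<in> k V" using k[of V] by auto
      with V(1) show "x \<in> \<Union>(k ` (\<Union>q\<in>Q. {V \<in> \<V>. q \<in> V}))" by (meson UN_I)
    qed
    ultimately show False using nc by blast
  qed
  define pick where "pick Q = (SOME p. p \<in> S \<and> (\<forall>q\<in>Q. \<forall>V\<in>\<V>. q \<in> V \<longrightarrow> p \<notin> V))" for Q
  have pick: "pick Q \<in> S" "\<And>q V. q \<in> Q \<Longrightarrow> V \<in> \<V> \<Longrightarrow> q \<in> V \<Longrightarrow> pick Q \<notin> V"
    if "finite Q" "Q \<subseteq> S" for Q
    using someI_ex[of "\<lambda>p. p \<in> S \<and> (\<forall>q\<in>Q. \<forall>V\<in>\<V>. q \<in> V \<longrightarrow> p \<notin> V)"] ex[OF that]
    unfolding pick_def by blast+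
  define Q where "Q = rec_nat {} (\<lambda>n Q. insert (pick Q) Q)"
  have Q: "Q 0 = {}" "Q (Suc n) = insert (pick (Q n)) (Q n)" for n by (auto simp: Q_def)
  have Qf: "finite (Q n) \<and> Q n \<subseteq> S" for n
    by (induction n) (auto simp: Q pick)
  define p where "p n = pick (Q n)" for n
  have mono: "p i \<in> Q n" if "i < n" for i n
    using that by (induction n) (auto simp: Q p_def less_Suc_eq)
  have sep: "p n \<notin> V" if "i < n" "V \<in> \<V>" "p i \<in> V" for i n V
    using pick(2)[of "Q n" "p i" V] Qf mono that unfolding p_def by blast
  show thesis
  proof
    show "range p \<subseteq> S" using Qf pick by (auto simp: p_def)
    fix K assume K: "compactin X K"
    then obtain \<F> where F: "finite \<F>" "\<F> \<subseteq> \<V>" "K \<subseteq> \<Union>\<F>"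
      using compactinD[OF K, of \<V>] V compactin_subset_topspace[OF K] by metis
    have "finite {n. p n \<in> V}" if V: "V \<in> \<V>" for V
    proof (cases "{n. p n \<in> V} = {}")
      case False
      then obtain i where "p i \<in> V" by blast
      then have "{n. p n \<in> V} \<subseteq> {..i}" using sep[OF _ V \<open>p i \<in> V\<close>] not_le by auto
      then show ?thesis using finite_subset by blast
    qed simp
    then have "finite (\<Union>V\<in>\<F>. {n. p n \<in> V})" using F by blast
    then show "finite {n. p n \<in> K}"
      by (rule finite_subset[rotated]) (use F in auto)
  qed
qed

text \<open>Regularity of the inductive limit. If no compact set contains all supports, there is a
  discrete sequence of points with sections in \<open>B\<close> that do not vanish there. A weighted
  sum of norms of values at these points is a continuous seminorm, as it is a finite sum on the
  sections supported in a given compact set, but suitable weights make it unbounded on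
  \<open>B\<close>.\<close>

lemma bounded_common_support:
  assumes B: "lcs_bounded (Gamma_c X \<A>) B"
  obtains K where "compactin X K" "B \<subseteq> sym2_fields_on \<A> K"
proof (rule ccontr)
  assume no: "\<not> thesis"
  define S where "S = {p. \<exists>h\<in>B. \<exists>c. h c p \<noteq> 0}"
  have Bc: "B \<subseteq> sym2_fields_c X \<A>" using B by (simp add: lcs_bounded_def)
  have "S \<subseteq> topspace X"
  proof
    fix p assume "p \<in> S"
    then obtain h c where "h \<in> B" "h c p \<noteq> 0" by (auto simp: S_def)
    then have "c \<in> \<A>" "p \<in> fst c" using sym2_fields_0[of h c p] Bc sym2_fields_c_subset by auto
    then show "p \<in> topspace X" using chart_subset by blast
  qed
  moreover have "\<not> (\<exists>K. compactin X K \<and> S \<subseteq> K)"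
  proof
    assume "\<exists>K. compactin X K \<and> S \<subseteq> K"
    then obtain K where K: "compactin X K" "S \<subseteq> K" by blast
    then have "B \<subseteq> sym2_fields_on \<A> K"
      using Bc sym2_fields_c_subset by (auto simp: sym2_fields_on_def S_def)
    with K(1) no that show False by blast
  qed
  ultimately obtain p :: "nat \<Rightarrow> 'a" where p: "range p \<subseteq> S" "\<And>K. compactin X K \<Longrightarrow> finite {n. p n \<in> K}"
    using discrete_sequence by blast
  have "\<forall>n. \<exists>h c. h \<in> B \<and> h c (p n) \<noteq> 0" using p(1) unfolding S_def by blast
  then obtain h c where hc: "\<And>n. h n \<in> B" "\<And>n. h n (c n) (p n) \<noteq> 0" by metis
  have cA: "c n \<in> \<A>" "p n \<in> fst (c n)" for n
    using sym2_fields_0[of "h n" "c n" "p n"] hc[of n] Bc sym2_fields_c_subset by blast+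
  \<comment> \<open>Normalised so that the \<open>n\<close>-th summand of \<open>P (h n)\<close>
    equals \<open>n\<close>.\<close>
  define w where "w n = real n / norm (h n (c n) (p n))" for n
  have w: "0 \<le> w n" for n by (simp add: w_def)
  define P where "P k = (\<Sum>n. w n * norm (k (c n) (p n)))" for k :: "('a, 'n) tensor2"
  have P: "P k = (\<Sum>n | p n \<in> K. w n * norm (k (c n) (p n)))"
    if "compactin X K" "k \<in> sym2_fields_on \<A> K" for K k
  proof -
    have "k (c n) (p n) = 0" if "p n \<notin> K" for n
      using that \<open>k \<in> sym2_fields_on \<A> K\<close> unfolding sym2_fields_on_def by blast
    then show ?thesis
      unfolding P_def using p(2)[OF that(1)] by (intro suminf_finite) auto
  qed
  have "P \<in> snd (Gamma_c X \<A>)"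
  proof -
    have "0 \<le> P k" if "k \<in> sym2_fields_c X \<A>" for k
      using that w by (auto simp: sym2_fields_c_iff P intro!: sum_nonneg)
    moreover have "P (k + l) \<le> P k + P l" if kl: "k \<in> sym2_fields_c X \<A>" "l \<in> sym2_fields_c X \<A>" for k l
    proof -
      obtain K where K: "compactin X K" "k \<in> sym2_fields_on \<A> K" "l \<in> sym2_fields_on \<A> K"
        using sym2_fields_c_common[OF kl] by blast
      show ?thesis
        unfolding P[OF K(1,2)] P[OF K(1,3)] P[OF K(1) sym2_fields_on_add[OF K(2,3)]] sum.distrib[symmetric]
        using w by (intro sum_mono) (simp add: norm_triangle_ineq mult_left_mono flip: distrib_left)
    qed
    moreover have "P (r *\<^sub>R k) = \<bar>r\<bar> * P k" if k: "k \<in> sym2_fields_c X \<A>" for r k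
    proof -
      obtain K where K: "compactin X K" "k \<in> sym2_fields_on \<A> K" using k by (auto simp: sym2_fields_c_iff)
      show ?thesis
        unfolding P[OF K] P[OF K(1) sym2_fields_on_scaleR[OF K(2)]]
        by (simp add: sum_distrib_left mult_ac)
    qed
    moreover have "\<exists>C I. finite I \<and> I \<subseteq> cinf_indices \<A> \<and>
        (\<forall>k \<in> sym2_fields_on \<A> K. P k \<le> C * (\<Sum>i \<in> I. cinf_seminorm i k))" if K: "compactin X K" for K
    proof -
      let ?N = "{n. p n \<in> K}"
      \<comment> \<open>Evaluation at a point is the order-zero seminorm of a one-point compact
        set.\<close>
      let ?i = "\<lambda>n. (c n, {snd (c n) (p n)}, [])"
      have i: "?i n \<in> cinf_indices \<A>" for n using cA[of n] by (auto simp: cinf_indices_def)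
      show ?thesis
      proof (intro exI conjI ballI)
        show "finite (?i ` ?N)" using p(2)[OF K] by simp
        show "?i ` ?N \<subseteq> cinf_indices \<A>" using i by blast
        fix k assume k: "k \<in> sym2_fields_on \<A> K"
        then have k': "k \<in> sym2_fields \<A>" by (simp add: sym2_fields_on_def)
        have nn: "0 \<le> cinf_seminorm j k" if j: "j \<in> ?i ` ?N" for j
          using j by (auto simp: cinf_seminorm_0)
        have "P k = (\<Sum>n\<in>?N. w n * cinf_seminorm (?i n) k)"
          unfolding P[OF K k] using cA by (intro sum.cong) (auto simp: cinf_seminorm_0)
        also have "\<dots> \<le> (\<Sum>n\<in>?N. w n * (\<Sum>j\<in>?i ` ?N. cinf_seminorm j k))"
        proof (intro sum_mono mult_left_mono w)
          fix n assume "n \<in> ?N"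
          then show "cinf_seminorm (?i n) k \<le> (\<Sum>j\<in>?i ` ?N. cinf_seminorm j k)"
            using p(2)[OF K] nn by (intro member_le_sum) auto
        qed
        finally show "P k \<le> (\<Sum>n\<in>?N. w n) * (\<Sum>j\<in>?i ` ?N. cinf_seminorm j k)"
          by (simp add: sum_distrib_right)
      qed
    qed
    ultimately show ?thesis by (auto simp: Gamma_c_def seminorm_on_def)
  qed
  then have "bounded (P ` B)" using B by (auto simp: lcs_bounded_def)
  then obtain C where C: "\<And>k. k \<in> B \<Longrightarrow> \<bar>P k\<bar> \<le> C" by (auto simp: bounded_iff)
  obtain n where n: "C < real n" using reals_Archimedean2 by blast
  obtain K where K: "compactin X K" "h n \<in> sym2_fields_on \<A> K"
    using subsetD[OF Bc hc(1)[of n]] unfolding sym2_fields_c_iff by blast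
  have "p n \<in> K" using hc(2)[of n] K(2) unfolding sym2_fields_on_def by blast
  have "real n = w n * norm (h n (c n) (p n))" using hc(2)[of n] by (simp add: w_def)
  also have "\<dots> \<le> P (h n)"
    unfolding P[OF K] using p(2)[OF K(1)] \<open>p n \<in> K\<close> w
    by (intro member_le_sum[of n "{n. p n \<in> K}" "\<lambda>i. w i * norm (h n (c i) (p i))"]) auto
  finally show False using C[OF hc(1), of n] n by linarith
qed

end

subsection \<open>The density of a metric\<close>

context smooth_mfd
begin

definition borelX :: "'a measure" where
  "borelX = sigma (topspace X) {U. openin X U}"

lemma space_borelX [simp]: "space borelX = topspace X"
  unfolding borelX_def by (rule space_measure_of) (auto dest: openin_subset)

lemma sets_borelX: "sets borelX = sigma_sets (topspace X) {U. openin X U}"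
  unfolding borelX_def by (rule sets_measure_of) (auto dest: openin_subset)

lemma openin_sets: "openin X U \<Longrightarrow> U \<in> sets borelX"
  by (auto simp: sets_borelX)

lemma chart_sets: "c \<in> \<A> \<Longrightarrow> fst c \<in> sets borelX"
  by (rule openin_sets[OF openin_chart])

lemma compactin_sets:
  assumes "compactin X K" shows "K \<in> sets borelX"
proof -
  have "openin X (topspace X - K)"
    using compactin_imp_closedin[OF Hausdorff assms] by (simp add: closedin_def)
  then have "space borelX - (topspace X - K) \<in> sets borelX"
    by (intro sets.compl_sets openin_sets)
  moreover have "space borelX - (topspace X - K) = K"
    using compactin_subset_topspace[OF assms] by auto
  ultimately show ?thesis by simp
qed

lemma chart_function_measurable:
  fixes k :: "real^'n \<Rightarrow> 'b::topological_space"
  assumes c: "c \<in> \<A>" and k: "continuous_on (snd c ` fst c) k"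
  shows "(\<lambda>p. if p \<in> fst c then k (snd c p) else a) \<in> borel_measurable borelX"
proof (rule borel_measurableI)
  fix V :: "'b set" assume V: "open V"
  have "open {y \<in> snd c ` fst c. k y \<in> V}"
    using continuous_open_preimage[OF k open_chart_image[OF c] V] by (simp add: vimage_def Int_def)
  then have "openin X {p \<in> fst c. snd c p \<in> {y \<in> snd c ` fst c. k y \<in> V}}"
    by (rule openin_chart_preimage[OF c])
  then have *: "{p \<in> fst c. k (snd c p) \<in> V} \<in> sets borelX"
    by (intro openin_sets) (auto elim!: back_subst[of "openin X"])
  have "(\<lambda>p. if p \<in> fst c then k (snd c p) else a) -` V \<inter> space borelX =
      {p \<in> fst c. k (snd c p) \<in> V} \<union> (if a \<in> V then space borelX - fst c else {})"
    using chart_subset[OF c] by (auto split: if_splits)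
  then show "(\<lambda>p. if p \<in> fst c then k (snd c p) else a) -` V \<inter> space borelX \<in> sets borelX"
    using * sets.compl_sets[OF chart_sets[OF c]] by (auto intro!: sets.Un)
qed

lemma tensor_measurable:
  assumes "h \<in> sym2_fields \<A>"
  shows "h c \<in> borel_measurable borelX"
proof (cases "c \<in> \<A>")
  case True
  have "(\<lambda>p. if p \<in> fst c then h c (chart_inv c (snd c p)) else 0) \<in> borel_measurable borelX"
    by (rule chart_function_measurable[OF True sym2_fields_continuous[OF assms True]])
  moreover have "(\<lambda>p. if p \<in> fst c then h c (chart_inv c (snd c p)) else 0) = h c"
    using chart_inv_chart[OF True] sym2_fields_0[OF assms, of c] by (intro ext) simp
  ultimately show ?thesis by simp
next
  case False
  then have "h c = (\<lambda>p. 0)" using sym2_fields_0[OF assms] by (intro ext) simp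
  then show ?thesis by simp
qed

context
  fixes c assumes c: "c \<in> \<A>"
begin

lemma chart_inv_measurable: "chart_inv c \<in> restrict_space borel (snd c ` fst c) \<rightarrow>\<^sub>M borelX"
  unfolding borelX_def
proof (rule measurable_measure_of)
  show "chart_inv c \<in> space (restrict_space borel (snd c ` fst c)) \<rightarrow> topspace X"
    using chart_subset[OF c] chart_inv_in[OF c] by (auto simp: space_restrict_space)
  fix U assume "U \<in> {U. openin X U}"
  then have "openin (subtopology X (fst c)) (fst c \<inter> U)" by (auto simp: openin_subtopology)
  then have "openin (top_of_set (snd c ` fst c)) {y \<in> snd c ` fst c. chart_inv c y \<in> fst c \<inter> U}"
    using openin_continuous_map_preimage[OF continuous_map_chart_inv[OF c], of "fst c \<inter> U"] by simp
  then have "open {y \<in> snd c ` fst c. chart_inv c y \<in> fst c \<inter> U}"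
    using open_chart_image[OF c] openin_open_trans by blast
  moreover have "chart_inv c -` U \<inter> space (restrict_space borel (snd c ` fst c)) =
     {y \<in> snd c ` fst c. chart_inv c y \<in> fst c \<inter> U}"
    using chart_inv_in[OF c] by (auto simp: space_restrict_space)
  moreover have "{y \<in> snd c ` fst c. chart_inv c y \<in> fst c \<inter> U} \<subseteq> snd c ` fst c" by blast
  ultimately show "chart_inv c -` U \<inter> space (restrict_space borel (snd c ` fst c)) \<in> sets (restrict_space borel (snd c ` fst c))"
    using open_chart_image[OF c]
    by (simp only: sets_restrict_space_iff borel_open sets.Int space_borel Int_UNIV_right HOL.simp_thms)
qed (auto dest: openin_subset)

lemma chart_image_sets:
  assumes "B \<in> sets borelX" "B \<subseteq> fst c"
  shows "snd c ` B \<in> sets borel"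
proof -
  have "chart_inv c -` B \<inter> space (restrict_space borel (snd c ` fst c)) \<in> sets (restrict_space borel (snd c ` fst c))"
    using chart_inv_measurable assms(1) by (rule measurable_sets)
  moreover have "chart_inv c -` B \<inter> space (restrict_space borel (snd c ` fst c)) = snd c ` B"
    unfolding chart_inv_image[OF c assms(2)] by (auto simp: space_restrict_space)
  ultimately show ?thesis
    using open_chart_image[OF c] by (auto simp: sets_restrict_space)
qed

end

definition chart_density :: "('a, 'n) tensor2 \<Rightarrow> ('a, 'n) chart \<Rightarrow> real^'n \<Rightarrow> real" where
  "chart_density g c y = sqrt \<bar>det (g c (chart_inv c y))\<bar>"

lemma chart_density_nonneg [simp]: "0 \<le> chart_density g c y"
  by (simp add: chart_density_def)

lemma chart_density_measurable:
  assumes "c \<in> \<A>" "g \<in> sym2_fields \<A>"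
  shows "chart_density g c \<in> borel_measurable (restrict_space borel (snd c ` fst c))"
  unfolding chart_density_def
  by (intro borel_measurable_continuous_on_restrict continuous_intros
      continuous_on_compose2[OF continuous_on_det sym2_fields_continuous[OF assms(2,1)]]) auto

lemma chart_density_indicator_measurable:
  assumes "c \<in> \<A>" "g \<in> sym2_fields \<A>" "S \<in> sets borel" "S \<subseteq> snd c ` fst c"
  shows "(\<lambda>y. chart_density g c y * indicator S y) \<in> borel_measurable borel"
proof -
  have "chart_density g c \<in> borel_measurable (restrict_space borel S)"
    using measurable_restrict_mono[OF chart_density_measurable[OF assms(1,2)] assms(4)] by simp
  then show ?thesis
    using assms(3) by (subst (asm) borel_measurable_restrict_space_iff) (auto simp: mult.commute)
qed

definition chart_measure :: "('a, 'n) tensor2 \<Rightarrow> ('a, 'n) chart \<Rightarrow> 'a measure" where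
  "chart_measure g c = distr (density (restrict_space lborel (snd c ` fst c))
      (\<lambda>y. ennreal (chart_density g c y))) borelX (chart_inv c)"

lemma sets_chart_measure [simp]: "sets (chart_measure g c) = sets borelX"
  by (simp add: chart_measure_def)

lemma nn_integral_chart_measure:
  assumes c: "c \<in> \<A>" and g: "g \<in> sym2_fields \<A>" and F: "F \<in> borel_measurable borelX"
  shows "(\<integral>\<^sup>+p. F p \<partial>chart_measure g c) =
     (\<integral>\<^sup>+y. ennreal (chart_density g c y) * F (chart_inv c y) * indicator (snd c ` fst c) y \<partial>lborel)"
proof -
  let ?R = "restrict_space lborel (snd c ` fst c)"
  have sR: "sets ?R = sets (restrict_space borel (snd c ` fst c))"
    by (intro sets_restrict_space_cong) simp
  have mi: "chart_inv c \<in> ?R \<rightarrow>\<^sub>M borelX"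
    using chart_inv_measurable[OF c] measurable_cong_sets[OF sR refl] by auto
  have md: "(\<lambda>y. ennreal (chart_density g c y)) \<in> borel_measurable ?R"
    using chart_density_measurable[OF c g] measurable_cong_sets[OF sR refl, of borel] by auto
  have mF: "(\<lambda>y. F (chart_inv c y)) \<in> borel_measurable ?R"
    using mi F by (rule measurable_compose)
  have "(\<integral>\<^sup>+p. F p \<partial>chart_measure g c)
     = (\<integral>\<^sup>+y. F (chart_inv c y) \<partial>density ?R (\<lambda>y. ennreal (chart_density g c y)))"
    unfolding chart_measure_def using mi F by (intro nn_integral_distr) auto
  also have "\<dots> = (\<integral>\<^sup>+y. ennreal (chart_density g c y) * F (chart_inv c y) \<partial>?R)"
    using md mF by (rule nn_integral_density)
  also have "\<dots> = (\<integral>\<^sup>+y. ennreal (chart_density g c y) * F (chart_inv c y) * indicator (snd c ` fst c) y \<partial>lborel)"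
    using open_chart_image[OF c] by (intro nn_integral_restrict_space) simp
  finally show ?thesis .
qed

lemma emeasure_chart_measure:
  assumes c: "c \<in> \<A>" and g: "g \<in> sym2_fields \<A>" and B: "B \<in> sets borelX"
  shows "emeasure (chart_measure g c) B =
     (\<integral>\<^sup>+y. ennreal (chart_density g c y * indicator (snd c ` (B \<inter> fst c)) y) \<partial>lborel)"
proof -
  have "emeasure (chart_measure g c) B = (\<integral>\<^sup>+p. indicator B p \<partial>chart_measure g c)"
    using B by simp
  also have "\<dots> = (\<integral>\<^sup>+y. ennreal (chart_density g c y) * indicator B (chart_inv c y) * indicator (snd c ` fst c) y \<partial>lborel)"
    using B by (intro nn_integral_chart_measure[OF c g]) simp
  also have "\<dots> = (\<integral>\<^sup>+y. ennreal (chart_density g c y * indicator (snd c ` (B \<inter> fst c)) y) \<partial>lborel)"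
  proof (rule nn_integral_cong)
    fix y
    have "y \<in> snd c ` (B \<inter> fst c) \<longleftrightarrow> y \<in> snd c ` fst c \<and> chart_inv c y \<in> B"
      using chart_inv_image[OF c, of "B \<inter> fst c"] chart_inv_in[OF c] by auto
    then show "ennreal (chart_density g c y) * indicator B (chart_inv c y) * indicator (snd c ` fst c) y =
        ennreal (chart_density g c y * indicator (snd c ` (B \<inter> fst c)) y)"
      by (auto simp: indicator_def)
  qed
  finally show ?thesis .
qed

lemma transition_derivative:
  assumes "c \<in> \<A>" "d \<in> \<A>" "p \<in> fst c" "p \<in> fst d"
  shows "((snd d \<circ> chart_inv c) has_derivative frechet_derivative (snd d \<circ> chart_inv c) (at (snd c p))) (at (snd c p))"
proof -
  have "smooth_on (snd c ` (fst c \<inter> fst d)) (snd d \<circ> chart_inv c)"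
    using mfd assms(1,2) by (auto simp: smooth_manifold_def)
  then have "(snd d \<circ> chart_inv c) differentiable (at (snd c p))"
    by (rule smooth_on_differentiable) (use assms in blast)
  then show ?thesis by (simp add: frechet_derivative_works)
qed

text \<open>Taking determinants in the transformation rule shows that the density picks up exactly
  the factor |det J| that a change of variables asks for.\<close>

lemma det_transform:
  assumes "g \<in> sym2_fields \<A>" "c \<in> \<A>" "d \<in> \<A>" "p \<in> fst c" "p \<in> fst d"
  shows "\<bar>det (transition_jacobian c d p)\<bar> * sqrt \<bar>det (g d p)\<bar> = sqrt \<bar>det (g c p)\<bar>"
proof -
  have "det (g c p) = det (transition_jacobian c d p) * det (g d p) * det (transition_jacobian c d p)"
    using arg_cong[OF sym2_fields_transform[OF assms], of det] by (simp only: det_mul det_transpose)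
  then have "\<bar>det (g c p)\<bar> = (det (transition_jacobian c d p))\<^sup>2 * \<bar>det (g d p)\<bar>"
    by (simp add: abs_mult power2_eq_square)
  then show ?thesis by (simp add: real_sqrt_mult)
qed

text \<open>The change of variables along the transition map produces a Jacobian factor, and the
  transformation of the density absorbs it.\<close>

lemma chart_measure_compatible:
  assumes c: "c \<in> \<A>" and d: "d \<in> \<A>" and g: "g \<in> sym2_fields \<A>"
    and B: "B \<in> sets borelX" "B \<subseteq> fst c" "B \<subseteq> fst d"
  shows "emeasure (chart_measure g c) B = emeasure (chart_measure g d) B"
proof -
  let ?\<tau> = "snd d \<circ> chart_inv c"
  let ?\<tau>' = "\<lambda>x. frechet_derivative ?\<tau> (at x)"
  have im: "?\<tau> ` snd c ` B = snd d ` B"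
    unfolding image_image using chart_inv_chart[OF c] B(2) by (intro image_cong) auto
  have jac: "\<bar>det (matrix (?\<tau>' x))\<bar> * chart_density g d (?\<tau> x) = chart_density g c x" if "x \<in> snd c ` B" for x
  proof -
    from that obtain p where p: "p \<in> B" "x = snd c p" by blast
    then have "p \<in> fst c" "p \<in> fst d" using B by auto
    then show ?thesis
      using det_transform[OF g c d] p chart_inv_chart[OF c, of p] chart_inv_chart[OF d, of p]
      by (simp add: chart_density_def transition_jacobian_def)
  qed
  have "(\<integral>\<^sup>+y. ennreal (chart_density g d y * indicator (?\<tau> ` snd c ` B) y) \<partial>lborel)
     = (\<integral>\<^sup>+x. ennreal (\<bar>det (matrix (?\<tau>' x))\<bar> * chart_density g d (?\<tau> x) * indicator (snd c ` B) x) \<partial>lborel)"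
  proof (rule nn_integral_change_of_variables)
    show "snd c ` B \<in> sets borel" by (rule chart_image_sets[OF c B(1,2)])
    show "(?\<tau> has_derivative ?\<tau>' x) (at x)" if "x \<in> snd c ` B" for x
      using that B transition_derivative[OF c d] by blast
    show "inj_on ?\<tau> (snd c ` B)"
    proof (rule inj_onI)
      fix x y assume "x \<in> snd c ` B" "y \<in> snd c ` B" and eq: "?\<tau> x = ?\<tau> y"
      then obtain p r where p: "p \<in> B" "x = snd c p" "r \<in> B" "y = snd c r" by blast
      then have "snd d p = snd d r" using eq B(2) chart_inv_chart[OF c] by (auto simp: subset_iff)
      then have "p = r" using p B(3) inj_on_chart[OF d] by (auto dest!: inj_onD)
      then show "x = y" using p by simp
    qed
    show "(\<lambda>y. chart_density g d y * indicator (?\<tau> ` snd c ` B) y) \<in> borel_measurable borel"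
      unfolding im using B by (intro chart_density_indicator_measurable[OF d g] chart_image_sets[OF d]) auto
    have "(\<lambda>y. chart_density g c y * indicator (snd c ` B) y) \<in> borel_measurable borel"
      using B by (intro chart_density_indicator_measurable[OF c g] chart_image_sets[OF c]) auto
    then show "(\<lambda>x. \<bar>det (matrix (?\<tau>' x))\<bar> * chart_density g d (?\<tau> x) * indicator (snd c ` B) x) \<in> borel_measurable borel"
      by (rule iffD1[OF measurable_cong, rotated]) (simp add: jac indicator_def del: o_apply)
  qed simp
  also have "\<dots> = (\<integral>\<^sup>+x. ennreal (chart_density g c x * indicator (snd c ` B) x) \<partial>lborel)"
    by (rule nn_integral_cong) (simp add: jac indicator_def del: o_apply)
  finally show ?thesis
    unfolding emeasure_chart_measure[OF c g B(1)] emeasure_chart_measure[OF d g B(1)] im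
    using B by (simp add: Int_absorb2)
qed

text \<open>
  The density is the supremum of the chart measures in the lattice of measures. On the domain of a
  chart it agrees with the chart measure, as all of them are bounded by the measure which is this
  chart measure on the domain and infinite elsewhere.
\<close>

lemma ex_metric_measure:
  assumes g: "g \<in> sym2_fields \<A>"
  shows "\<exists>\<nu>. sets \<nu> = sets borelX \<and>
    (\<forall>c\<in>\<A>. \<forall>B\<in>sets \<nu>. B \<subseteq> fst c \<longrightarrow> emeasure \<nu> B = emeasure (chart_measure g c) B)"
proof -
  \<comment> \<open>\<open>borelX\<close> is the zero measure; including it keeps the family
    nonempty when there are no charts.\<close>
  define \<M> where "\<M> = insert borelX (chart_measure g ` \<A>)"
  have sM: "sets M = sets borelX" if "M \<in> \<M>" for M using that by (auto simp: \<M>_def)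
  have s: "sets (Sup \<M>) = sets borelX"
  proof -
    have "sets (SUP M\<in>\<M>. M) = sets borelX"
      by (rule sets_SUP[OF sM]) (auto simp: \<M>_def)
    then show ?thesis by simp
  qed
  have "emeasure (Sup \<M>) B = emeasure (chart_measure g c) B"
    if c: "c \<in> \<A>" and B: "B \<in> sets borelX" "B \<subseteq> fst c" for c B
  proof (rule antisym)
    have "chart_measure g c \<le> Sup \<M>" by (rule Sup_upper) (simp add: \<M>_def c)
    then show "emeasure (chart_measure g c) B \<le> emeasure (Sup \<M>) B"
      by (rule le_measureD3) (simp add: s)
    let ?I = "\<lambda>B. if B \<subseteq> fst c then 0 else \<infinity> :: ennreal"
    define N where "N = measure_of (topspace X) (sets borelX) (\<lambda>B. emeasure (chart_measure g c) B + ?I B)"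
    have sN: "sets N = sets borelX"
      unfolding N_def using sets.space_closed[of borelX] sets.sigma_sets_eq[of borelX] by simp
    have eN: "emeasure N B = emeasure (chart_measure g c) B + ?I B" if B: "B \<in> sets borelX" for B
    proof (rule emeasure_measure_of[OF N_def])
      show "countably_additive (sets N) (\<lambda>B. emeasure (chart_measure g c) B + ?I B)"
      proof (rule countably_additiveI)
        fix B :: "nat \<Rightarrow> 'a set" assume *: "range B \<subseteq> sets N" "disjoint_family B" "(\<Union>i. B i) \<in> sets N"
        \<comment> \<open>The term that is infinite off \<open>fst c\<close> is additive because a
          union lies in \<open>fst c\<close> iff each of its parts does.\<close>
        have I: "(\<Sum>i. ?I (B i)) = ?I (\<Union>i. B i)"
        proof (cases "(\<Union>i. B i) \<subseteq> fst c")
          case True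
          then have "?I (B i) = 0" for i by auto
          then show ?thesis using True by simp
        next
          case False
          then obtain i where i: "\<not> B i \<subseteq> fst c" by blast
          have "?I (B i) \<le> (\<Sum>i. ?I (B i))"
            using sum_le_suminf[of "\<lambda>i. ?I (B i)" "{i}"] by simp
          then show ?thesis using False i by (simp add: top.extremum_unique)
        qed
        have "(\<Sum>i. emeasure (chart_measure g c) (B i)) = emeasure (chart_measure g c) (\<Union>i. B i)"
          using * sN by (intro suminf_emeasure) auto
        with I show "(\<Sum>i. emeasure (chart_measure g c) (B i) + ?I (B i)) =
            emeasure (chart_measure g c) (\<Union>i. B i) + ?I (\<Union>i. B i)"
          by (simp add: suminf_add[symmetric])
      qed
      show "positive (sets N) (\<lambda>B. emeasure (chart_measure g c) B + ?I B)"
        by (simp add: positive_def)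
    qed (use B sets.space_closed[of borelX] sN in auto)
    have "M \<le> N" if M: "M \<in> \<M>" for M
    proof -
      have "emeasure M B \<le> emeasure N B" if B: "B \<in> sets borelX" for B
      proof (cases "M = borelX")
        case True
        then show ?thesis by (simp add: borelX_def emeasure_sigma)
      next
        case False
        then obtain d where d: "d \<in> \<A>" "M = chart_measure g d" using M by (auto simp: \<M>_def)
        show ?thesis
        proof (cases "B \<subseteq> fst c")
          case True
          \<comment> \<open>\<open>chart_measure g d\<close> charges only \<open>fst d\<close>, so
            \<open>B\<close> may be cut down to the overlap, where the two chart measures
            agree.\<close>
          have Bd: "B \<inter> fst d \<in> sets borelX" using B chart_sets[OF d(1)] by auto
          have "emeasure M B = emeasure M (B \<inter> fst d)"
            unfolding d(2) emeasure_chart_measure[OF d(1) g B] emeasure_chart_measure[OF d(1) g Bd]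
            by (simp add: Int_assoc)
          also have "\<dots> = emeasure (chart_measure g c) (B \<inter> fst d)"
            unfolding d(2) using True by (intro chart_measure_compatible[OF d(1) c g Bd]) auto
          also have "\<dots> \<le> emeasure (chart_measure g c) B"
            using B by (intro emeasure_mono) auto
          finally show ?thesis using eN[OF B] True by simp
        qed (simp add: eN[OF B])
      qed
      then show ?thesis using sM[OF M] sN by (simp add: le_measure)
    qed
    then have "Sup \<M> \<le> N" by (intro Sup_least)
    then have "emeasure (Sup \<M>) B \<le> emeasure N B" by (rule le_measureD3) (simp add: s sN)
    then show "emeasure (Sup \<M>) B \<le> emeasure (chart_measure g c) B"
      using eN[OF B(1)] B(2) by simp
  qed
  with s show ?thesis by blast
qed

lemma metric_measure:
  assumes g: "g \<in> sym2_fields \<A>"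
  shows "sets (metric_measure X \<A> g) = sets borelX"
    and "\<And>c B. c \<in> \<A> \<Longrightarrow> B \<in> sets borelX \<Longrightarrow> B \<subseteq> fst c \<Longrightarrow>
      emeasure (metric_measure X \<A> g) B = emeasure (chart_measure g c) B"
proof -
  have eq: "emeasure (chart_measure g c) B =
      (\<integral>\<^sup>+ y \<in> snd c ` B. ennreal (sqrt \<bar>det (g c (chart_inv c y))\<bar>) \<partial>lborel)"
    if "c \<in> \<A>" "B \<in> sets borelX" "B \<subseteq> fst c" for c B
    unfolding emeasure_chart_measure[OF that(1) g that(2)] Int_absorb2[OF that(3)]
    by (rule nn_integral_cong) (simp add: chart_density_def split: split_indicator)
  have "\<exists>\<nu>. sets \<nu> = sets (sigma (topspace X) {U. openin X U}) \<and>
        (\<forall>c \<in> \<A>. \<forall>B \<in> sets \<nu>. B \<subseteq> fst c \<longrightarrow> emeasure \<nu> B =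
             (\<integral>\<^sup>+ y \<in> snd c ` B. ennreal (sqrt \<bar>det (g c (chart_inv c y))\<bar>) \<partial>lborel))"
  proof -
    obtain \<nu> where \<nu>: "sets \<nu> = sets borelX"
      "\<forall>c\<in>\<A>. \<forall>B\<in>sets \<nu>. B \<subseteq> fst c \<longrightarrow> emeasure \<nu> B = emeasure (chart_measure g c) B"
      using ex_metric_measure[OF g] by blast
    show ?thesis
    proof (intro exI[of _ \<nu>] conjI ballI impI)
      show "sets \<nu> = sets (sigma (topspace X) {U. openin X U})" using \<nu>(1) by (simp only: borelX_def)
      fix c B assume "c \<in> \<A>" "B \<in> sets \<nu>" "B \<subseteq> fst c"
      then show "emeasure \<nu> B =
             (\<integral>\<^sup>+ y \<in> snd c ` B. ennreal (sqrt \<bar>det (g c (chart_inv c y))\<bar>) \<partial>lborel)"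
        using \<nu> eq[of c B] by simp
    qed
  qed
  from someI_ex[OF this]
  have *: "sets (metric_measure X \<A> g) = sets borelX"
    "\<forall>c \<in> \<A>. \<forall>B \<in> sets (metric_measure X \<A> g). B \<subseteq> fst c \<longrightarrow> emeasure (metric_measure X \<A> g) B =
             (\<integral>\<^sup>+ y \<in> snd c ` B. ennreal (sqrt \<bar>det (g c (chart_inv c y))\<bar>) \<partial>lborel)"
    unfolding metric_measure_def borelX_def by blast+
  show "sets (metric_measure X \<A> g) = sets borelX" by (rule *)
  show "emeasure (metric_measure X \<A> g) B = emeasure (chart_measure g c) B"
    if "c \<in> \<A>" "B \<in> sets borelX" "B \<subseteq> fst c" for c B
    using that *(1) *(2)[rule_format, of c B] eq[OF that] by simp
qed

text \<open>Restricted to a set inside the chart, the global measure and the chart measure coincide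
  as measures, so their integrals agree as well.\<close>

lemma nn_integral_metric_measure:
  assumes g: "g \<in> sym2_fields \<A>" and c: "c \<in> \<A>" and B: "B \<in> sets borelX" "B \<subseteq> fst c"
    and F: "F \<in> borel_measurable borelX"
  shows "(\<integral>\<^sup>+p. F p * indicator B p \<partial>metric_measure X \<A> g) =
     (\<integral>\<^sup>+y. ennreal (chart_density g c y) * F (chart_inv c y) * indicator (snd c ` B) y \<partial>lborel)"
proof -
  note mm = metric_measure[OF g]
  have sp: "space (metric_measure X \<A> g) = topspace X" "space (chart_measure g c) = topspace X"
    using sets_eq_imp_space_eq[OF mm(1)] by (auto simp: chart_measure_def)
  have "restrict_space (metric_measure X \<A> g) B = restrict_space (chart_measure g c) B"
  proof (rule measure_eqI)
    show "sets (restrict_space (metric_measure X \<A> g) B) = sets (restrict_space (chart_measure g c) B)"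
      by (intro sets_restrict_space_cong) (simp add: mm)
    fix A assume "A \<in> sets (restrict_space (metric_measure X \<A> g) B)"
    then have A: "A \<in> sets borelX" "A \<subseteq> B"
      using B(1) by (auto simp: sets_restrict_space mm)
    have "emeasure (restrict_space (metric_measure X \<A> g) B) A = emeasure (metric_measure X \<A> g) A"
      using A B sets.sets_into_space[OF B(1)] by (intro emeasure_restrict_space) (auto simp: mm sp Int_absorb2)
    moreover have "emeasure (restrict_space (chart_measure g c) B) A = emeasure (chart_measure g c) A"
      using A B sets.sets_into_space[OF B(1)] by (intro emeasure_restrict_space) (auto simp: sp Int_absorb2)
    ultimately show "emeasure (restrict_space (metric_measure X \<A> g) B) A = emeasure (restrict_space (chart_measure g c) B) A"
      using mm(2)[OF c A(1)] A B by auto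
  qed
  then have "(\<integral>\<^sup>+p. F p * indicator B p \<partial>metric_measure X \<A> g) = (\<integral>\<^sup>+p. F p * indicator B p \<partial>chart_measure g c)"
    using B(1) sets.sets_into_space[OF B(1)]
    by (subst (1 2) nn_integral_restrict_space[symmetric]) (auto simp: mm sp Int_absorb2)
  also have "\<dots> = (\<integral>\<^sup>+y. ennreal (chart_density g c y) * (F (chart_inv c y) * indicator B (chart_inv c y)) *
      indicator (snd c ` fst c) y \<partial>lborel)"
    using F B(1) by (intro nn_integral_chart_measure[OF c g]) auto
  also have "\<dots> = (\<integral>\<^sup>+y. ennreal (chart_density g c y) * F (chart_inv c y) * indicator (snd c ` B) y \<partial>lborel)"
    by (rule nn_integral_cong) (subst chart_inv_image[OF c B(2)], auto simp: indicator_def)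
  finally show ?thesis .
qed

end

section \<open>Metrics in charts, chart independence of the traces, patches of compact sets\<close>

context smooth_mfd
begin

lemma Met_sym2_fields: "g \<in> Met \<A> q \<Longrightarrow> g \<in> sym2_fields \<A>"
  by (simp add: Met_def)

lemma Met_signature: "g \<in> Met \<A> q \<Longrightarrow> c \<in> \<A> \<Longrightarrow> p \<in> fst c \<Longrightarrow> has_signature q (g c p)"
  by (simp add: Met_def)

lemma Met_invertible: "g \<in> Met \<A> q \<Longrightarrow> c \<in> \<A> \<Longrightarrow> p \<in> fst c \<Longrightarrow> invertible (g c p)"
  using Met_signature has_signature_invertible by blast

text \<open>Read off from the metric: its determinant in the chart \<open>c\<close> is nonzero and
  has the determinant of the Jacobian as a factor.\<close>

lemma invertible_jacobian:
  assumes "g \<in> Met \<A> q" "c \<in> \<A>" "d \<in> \<A>" "p \<in> fst c" "p \<in> fst d"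
  shows "invertible (transition_jacobian c d p)"
proof -
  have "det (g c p) \<noteq> 0" using Met_invertible[OF assms(1,2,4)] by (simp add: invertible_det_nz)
  then show ?thesis
    using det_transform[OF Met_sym2_fields[OF assms(1)] assms(2-)] by (auto simp: invertible_det_nz)
qed

lemma mixed_transform:
  assumes g: "g \<in> Met \<A> q" and k: "k \<in> sym2_fields \<A>"
    and *: "c \<in> \<A>" "d \<in> \<A>" "p \<in> fst c" "p \<in> fst d"
  shows "matrix_inv (g c p) ** k c p =
    matrix_inv (transition_jacobian c d p) ** (matrix_inv (g d p) ** k d p) ** transition_jacobian c d p"
  using mixed_congruent[OF Met_invertible[OF g *(2,4)] invertible_jacobian[OF g *], of "k d p"]
    sym2_fields_transform[OF Met_sym2_fields[OF g] *] sym2_fields_transform[OF k *]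
  by metis

lemma chart_at:
  assumes "c \<in> \<A>" "p \<in> fst c"
  shows "chart_at \<A> p \<in> \<A>" "p \<in> fst (chart_at \<A> p)"
  using someI_ex[of "\<lambda>c. c \<in> \<A> \<and> p \<in> fst c"] assms unfolding chart_at_def by blast+

text \<open>\<open>tr1\<close> uses an arbitrarily chosen chart; conjugation invariance of the trace
  permits any chart instead.\<close>

lemma tr1_chart:
  assumes g: "g \<in> Met \<A> q" and k: "k \<in> sym2_fields \<A>" and c: "c \<in> \<A>" "p \<in> fst c"
  shows "tr1 \<A> g k p = trace (matrix_inv (g c p) ** k c p)"
proof -
  note d = chart_at[OF c]
  show ?thesis
    using trace_conjugate[OF invertible_jacobian[OF g d(1) c(1) d(2) c(2)]]
      mixed_transform[OF g k d(1) c(1) d(2) c(2)]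
    by (simp add: tr1_def Let_def)
qed

lemma tr2_chart:
  assumes g: "g \<in> Met \<A> q" and k: "k \<in> sym2_fields \<A>" and h: "h \<in> sym2_fields \<A>" and c: "c \<in> \<A>" "p \<in> fst c"
  shows "tr2 \<A> g k h p = trace (matrix_inv (g c p) ** k c p ** (matrix_inv (g c p) ** h c p))"
proof -
  note d = chart_at[OF c]
  note J = invertible_jacobian[OF g d(1) c(1) d(2) c(2)]
  have "tr2 \<A> g k h p = trace ((matrix_inv (g (chart_at \<A> p) p) ** k (chart_at \<A> p) p) **
      (matrix_inv (g (chart_at \<A> p) p) ** h (chart_at \<A> p) p))"
    by (simp add: tr2_def Let_def matrix_mul_assoc)
  then show ?thesis
    unfolding mixed_transform[OF g k d(1) c(1) d(2) c(2)] mixed_transform[OF g h d(1) c(1) d(2) c(2)]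
      conjugate_mult[OF J] trace_conjugate[OF J] .
qed

end

text \<open>
  A compact set \<open>K\<close> is covered by finitely many compact pieces of charts. Choosing a piece \<open>ix p\<close>
  for each point, tensor fields become bounded measurable matrix-valued functions on \<open>K\<close>.
\<close>

locale mfd_patch = smooth_mfd X \<A> for X :: "'a topology" and \<A> :: "('a, 'n::finite) chart set" +
  fixes K :: "'a set" and m :: nat and cs :: "nat \<Rightarrow> ('a, 'n) chart" and Ls :: "nat \<Rightarrow> (real^'n) set"
    and ix :: "'a \<Rightarrow> nat"
  assumes compact_K: "compactin X K"
    and piece_index: "\<And>i. i < m \<Longrightarrow> (cs i, Ls i, []) \<in> cinf_indices \<A>"
    and ix_less: "\<And>p. p \<in> K \<Longrightarrow> ix p < m"
    and ix_chart: "\<And>p. p \<in> K \<Longrightarrow> p \<in> fst (cs (ix p))"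
    and ix_piece: "\<And>p. p \<in> K \<Longrightarrow> snd (cs (ix p)) p \<in> Ls (ix p)"
    and piece_sets: "\<And>i. i < m \<Longrightarrow> {p \<in> K. ix p = i} \<in> sets (smooth_mfd.borelX X)"

context smooth_mfd
begin

text \<open>Each point gets the least index of a compact piece containing it. The sets of constant
  index are then differences of compact sets and finite unions of compact sets, hence Borel.\<close>

lemma ex_patch:
  assumes K: "compactin X K"
  obtains m cs Ls ix where "mfd_patch X \<A> K m cs Ls ix"
proof -
  obtain I where I: "finite I" "\<And>c L. (c, L) \<in> I \<Longrightarrow> (c, L, []) \<in> cinf_indices \<A>"
    "K \<subseteq> (\<Union>(c, L)\<in>I. chart_inv c ` L)"
    using compactin_chart_cover[OF K] by blast
  obtain f and m :: nat where f: "I = f ` {i. i < m}"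
    using finite_imp_nat_seg_image_inj_on[OF I(1)] by blast
  define N where "N i = chart_inv (fst (f i)) ` snd (f i)" for i
  define ix where "ix p = (LEAST i. i < m \<and> p \<in> N i)" for p
  have idx: "(fst (f i), snd (f i), []) \<in> cinf_indices \<A>" if "i < m" for i
    using I(2)[of "fst (f i)" "snd (f i)"] that f by auto
  have ex: "ix p < m \<and> p \<in> N (ix p)" if p: "p \<in> K" for p
  proof -
    obtain i where "i < m" "p \<in> N i" using I(3) p unfolding f by (auto simp: N_def case_prod_beta)
    then show ?thesis unfolding ix_def by (intro LeastI) auto
  qed
  have NB: "N i \<in> sets borelX" if "i < m" for i
    unfolding N_def using idx[OF that] by (intro compactin_sets compactin_chart_inv) (auto simp: cinf_indices_def)
  have L: "fst (f i) \<in> \<A>" "snd (f i) \<subseteq> snd (fst (f i)) ` fst (fst (f i))" if "i < m" for i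
    using idx[OF that] by (auto simp: cinf_indices_def)
  show thesis
  proof (rule that, unfold_locales)
    show "compactin X K" by (rule K)
    show "i < m \<Longrightarrow> ((\<lambda>i. fst (f i)) i, (\<lambda>i. snd (f i)) i, []) \<in> cinf_indices \<A>" for i
      using idx by simp
    show "ix p < m" if "p \<in> K" for p using ex[OF that] by simp
    show "p \<in> fst (fst (f (ix p)))" if p: "p \<in> K" for p
    proof -
      obtain y where y: "y \<in> snd (f (ix p))" "p = chart_inv (fst (f (ix p))) y"
        using ex[OF p] by (auto simp: N_def)
      then have "y \<in> snd (fst (f (ix p))) ` fst (fst (f (ix p)))" using ex[OF p] L[of "ix p"] by blast
      with chart_inv_in[OF L(1)] ex[OF p]
      have "chart_inv (fst (f (ix p))) y \<in> fst (fst (f (ix p)))" by blast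
      then show ?thesis unfolding y(2)[symmetric] .
    qed
    show "snd (fst (f (ix p))) p \<in> snd (f (ix p))" if p: "p \<in> K" for p
    proof -
      obtain y where y: "y \<in> snd (f (ix p))" "p = chart_inv (fst (f (ix p))) y"
        using ex[OF p] by (auto simp: N_def)
      have ip: "ix p < m" using ex[OF p] by simp
      have "snd (fst (f (ix p))) (chart_inv (fst (f (ix p))) y) = y"
        by (rule chart_chart_inv[OF L(1)[OF ip]]) (use y(1) L(2)[OF ip] in blast)
      then have "snd (fst (f (ix p))) p = y" unfolding y(2)[symmetric] .
      then show ?thesis using y by simp
    qed
    show "{p \<in> K. ix p = i} \<in> sets (smooth_mfd.borelX X)" if i: "i < m" for i
    proof -
      have "{p \<in> K. ix p = i} = (K \<inter> N i) - (\<Union>j<i. N j)"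
      proof (intro set_eqI iffI)
        fix p assume "p \<in> {p \<in> K. ix p = i}"
        then have p: "p \<in> K" "ix p = i" by auto
        have "p \<notin> N j" if "j < i" for j
          using not_less_Least[of j "\<lambda>i. i < m \<and> p \<in> N i"] that p i by (auto simp: ix_def)
        then show "p \<in> (K \<inter> N i) - (\<Union>j<i. N j)" using ex[OF p(1)] p by auto
      next
        fix p assume "p \<in> (K \<inter> N i) - (\<Union>j<i. N j)"
        then have p: "p \<in> K" "p \<in> N i" "\<And>j. j < i \<Longrightarrow> p \<notin> N j" by auto
        have "ix p = i"
          unfolding ix_def using p i by (intro Least_equality) (auto simp: not_less[symmetric])
        then show "p \<in> {p \<in> K. ix p = i}" using p by auto
      qed
      also have "\<dots> \<in> sets borelX"
        using NB i compactin_sets[OF K] by (intro sets.Diff sets.Int sets.finite_UN) auto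
      finally show ?thesis .
    qed
  qed
qed

end

context mfd_patch
begin

text \<open>Coefficients in the chart assigned to \<open>p\<close>. They may jump between pieces;
  they are nevertheless bounded and Borel on \<open>K\<close>, and the traces formed from them do
  not depend on the chart.\<close>

definition R :: "('a, 'n) tensor2 \<Rightarrow> 'a \<Rightarrow> real^'n^'n" where
  "R h p = h (cs (ix p)) p"

lemma cs_in: "p \<in> K \<Longrightarrow> cs (ix p) \<in> \<A>"
  using piece_index ix_less by (auto simp: cinf_indices_def)

lemma K_sets: "K \<in> sets borelX"
  by (rule compactin_sets[OF compact_K])

lemma K_subset: "K \<subseteq> topspace X"
  by (rule compactin_subset_topspace[OF compact_K])

lemma R_bound:
  assumes "h \<in> sym2_fields \<A>" "p \<in> K"
  shows "norm (R h p) \<le> (\<Sum>i<m. cinf_seminorm (cs i, Ls i, []) h)"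
proof -
  have "norm (h (cs (ix p)) (chart_inv (cs (ix p)) (snd (cs (ix p)) p))) \<le> cinf_seminorm (cs (ix p), Ls (ix p), []) h"
    by (rule cinf_seminorm_upper[OF piece_index[OF ix_less[OF assms(2)]] assms(1) ix_piece[OF assms(2)]])
  then have "norm (R h p) \<le> cinf_seminorm (cs (ix p), Ls (ix p), []) h"
    using chart_inv_chart[OF cs_in ix_chart, OF assms(2,2)] by (simp add: R_def)
  also have "\<dots> \<le> (\<Sum>i<m. cinf_seminorm (cs i, Ls i, []) h)"
  proof (rule member_le_sum)
    show "0 \<le> cinf_seminorm (cs i, Ls i, []) h" if i: "i \<in> {..<m} - {ix p}" for i
    proof -
      obtain y where "y \<in> Ls i" using piece_index[of i] i by (auto simp: cinf_indices_def)
      then show ?thesis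
        using cinf_seminorm_upper[OF piece_index[of i] assms(1), of y] i norm_ge_zero order_trans by blast
    qed
  qed (use ix_less[OF assms(2)] in auto)
  finally show ?thesis .
qed

text \<open>Continuity of \<open>\<Phi>\<close> along the compact pieces \<open>Ls i\<close> gives
  the bound. With matrix inversion as \<open>\<Phi>\<close> it yields bounded inverses of a metric
  over \<open>K\<close>, the hypothesis of the results on inverses and square roots of
  determinants.\<close>

lemma R_image_bounded:
  assumes h: "h \<in> sym2_fields \<A>" and \<Phi>: "continuous_on S \<Phi>"
    and S: "\<And>c p. c \<in> \<A> \<Longrightarrow> p \<in> fst c \<Longrightarrow> h c p \<in> S"
  shows "bounded ((\<lambda>p. \<Phi> (R h p) :: 'b::metric_space) ` K)"
proof -
  have "bounded (\<Union>i\<in>{..<m}. (\<lambda>y. \<Phi> (h (cs i) (chart_inv (cs i) y))) ` Ls i)"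
  proof (rule bounded_UN[OF finite_lessThan ballI])
    fix i assume "i \<in> {..<m}"
    then have L: "cs i \<in> \<A>" "compact (Ls i)" "Ls i \<subseteq> snd (cs i) ` fst (cs i)"
      using piece_index[of i] by (auto simp: cinf_indices_def)
    have "continuous_on (Ls i) (\<lambda>y. \<Phi> (h (cs i) (chart_inv (cs i) y)))"
      by (rule continuous_on_compose2[OF \<Phi> continuous_on_subset[OF sym2_fields_continuous[OF h L(1)] L(3)]])
         (use S L chart_inv_in[OF L(1)] in blast)
    then show "bounded ((\<lambda>y. \<Phi> (h (cs i) (chart_inv (cs i) y))) ` Ls i)"
      using L(2) by (intro compact_imp_bounded compact_continuous_image)
  qed
  moreover have "(\<lambda>p. \<Phi> (R h p)) ` K \<subseteq> (\<Union>i\<in>{..<m}. (\<lambda>y. \<Phi> (h (cs i) (chart_inv (cs i) y))) ` Ls i)"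
  proof
    fix z assume "z \<in> (\<lambda>p. \<Phi> (R h p)) ` K"
    then obtain p where p: "p \<in> K" "z = \<Phi> (R h p)" by blast
    then have "z = \<Phi> (h (cs (ix p)) (chart_inv (cs (ix p)) (snd (cs (ix p)) p)))"
      using chart_inv_chart[OF cs_in ix_chart, OF p(1) p(1)] by (simp add: R_def)
    then show "z \<in> (\<Union>i\<in>{..<m}. (\<lambda>y. \<Phi> (h (cs i) (chart_inv (cs i) y))) ` Ls i)"
      using ix_less[OF p(1)] ix_piece[OF p(1)] by blast
  qed
  ultimately show ?thesis by (rule bounded_subset)
qed

lemma R_bounded: "h \<in> sym2_fields \<A> \<Longrightarrow> bounded (R h ` K)"
  using R_image_bounded[of h UNIV "\<lambda>A. A"] by simp

lemma R_inv_bounded: "g \<in> Met \<A> q \<Longrightarrow> bounded ((\<lambda>p. matrix_inv (R g p)) ` K)"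
  by (rule R_image_bounded[OF Met_sym2_fields continuous_on_matrix_inv]) (auto intro: Met_invertible)

lemma R_invertible: "g \<in> Met \<A> q \<Longrightarrow> p \<in> K \<Longrightarrow> invertible (R g p)"
  unfolding R_def by (rule Met_invertible[OF _ cs_in ix_chart])

text \<open>\<open>R h\<close> is a finite sum of coefficient functions in fixed charts, cut off by
  indicators of the pieces.\<close>

lemma R_measurable:
  assumes h: "h \<in> sym2_fields \<A>"
  shows "R h \<in> borel_measurable (restrict_space borelX K)"
proof -
  have "(\<lambda>p. \<Sum>i<m. indicator {p \<in> K. ix p = i} p *\<^sub>R h (cs i) p) \<in> borel_measurable borelX"
    using piece_sets tensor_measurable[OF h]
    by (intro borel_measurable_sum borel_measurable_scaleR borel_measurable_indicator) auto
  then have "(\<lambda>p. \<Sum>i<m. indicator {p \<in> K. ix p = i} p *\<^sub>R h (cs i) p) \<in> borel_measurable (restrict_space borelX K)"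
    by (rule measurable_restrict_space1)
  then show ?thesis
  proof (rule iffD1[OF measurable_cong, rotated])
    fix p assume "p \<in> space (restrict_space borelX K)"
    then have p: "p \<in> K" by (auto simp: space_restrict_space)
    have "(\<Sum>i<m. indicator {p \<in> K. ix p = i} p *\<^sub>R h (cs i) p) = (\<Sum>i<m. if i = ix p then R h p else 0)"
      using p by (intro sum.cong) (auto simp: R_def)
    then show "(\<Sum>i<m. indicator {p \<in> K. ix p = i} p *\<^sub>R h (cs i) p) = R h p"
      using ix_less[OF p] by simp
  qed
qed

lemma nn_integral_pieces:
  assumes g: "g \<in> sym2_fields \<A>" and F: "F \<in> borel_measurable borelX"
  shows "(\<integral>\<^sup>+p. F p * indicator K p \<partial>metric_measure X \<A> g) = (\<Sum>i<m. \<integral>\<^sup>+y. ennreal (chart_density g (cs i) y) *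
     F (chart_inv (cs i) y) * indicator (snd (cs i) ` {p \<in> K. ix p = i}) y \<partial>lborel)"
proof -
  have F': "F \<in> borel_measurable (metric_measure X \<A> g)"
    using F measurable_cong_sets[OF metric_measure(1)[OF g] refl] by blast
  have "(\<integral>\<^sup>+p. F p * indicator K p \<partial>metric_measure X \<A> g) =
      (\<integral>\<^sup>+p. (\<Sum>i<m. F p * indicator {p \<in> K. ix p = i} p) \<partial>metric_measure X \<A> g)"
  proof (rule nn_integral_cong)
    fix p
    have "(\<Sum>i<m. F p * indicator {p \<in> K. ix p = i} p) = (\<Sum>i<m. if i = ix p then F p * indicator K p else 0)"
      by (intro sum.cong) (auto simp: indicator_def)
    then show "F p * indicator K p = (\<Sum>i<m. F p * indicator {p \<in> K. ix p = i} p)"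
      using ix_less[of p] by (auto simp: indicator_def)
  qed
  also have "\<dots> = (\<Sum>i<m. \<integral>\<^sup>+p. F p * indicator {p \<in> K. ix p = i} p \<partial>metric_measure X \<A> g)"
    using F' piece_sets metric_measure(1)[OF g]
    by (intro nn_integral_sum borel_measurable_times_ennreal borel_measurable_indicator) auto
  also have "\<dots> = (\<Sum>i<m. \<integral>\<^sup>+y. ennreal (chart_density g (cs i) y) *
     F (chart_inv (cs i) y) * indicator (snd (cs i) ` {p \<in> K. ix p = i}) y \<partial>lborel)"
    using piece_index ix_chart
    by (intro sum.cong refl nn_integral_metric_measure[OF g _ piece_sets _ F]) (auto simp: cinf_indices_def)
  finally show ?thesis .
qed

lemma piece_point:
  assumes i: "i < m" and y: "y \<in> snd (cs i) ` {p \<in> K. ix p = i}"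
  shows "chart_inv (cs i) y \<in> K" "ix (chart_inv (cs i) y) = i" "y \<in> Ls i"
    "chart_density g (cs i) y = sqrt \<bar>det (R g (chart_inv (cs i) y))\<bar>"
proof -
  obtain p where p: "p \<in> K" "ix p = i" "y = snd (cs i) p" using y by blast
  have "chart_inv (cs i) y = p" using chart_inv_chart[OF cs_in ix_chart, OF p(1) p(1)] p by simp
  then show "chart_inv (cs i) y \<in> K" "ix (chart_inv (cs i) y) = i" "y \<in> Ls i"
    "chart_density g (cs i) y = sqrt \<bar>det (R g (chart_inv (cs i) y))\<bar>"
    using p ix_piece[OF p(1)] by (auto simp: chart_density_def R_def)
qed

end

text \<open>The reference measure is Lebesgue measure in the chosen charts, obtained from a metric \<open>g\<^sub>0\<close>.\<close>

locale mfd_patch_ref = mfd_patch X \<A> K m cs Ls ix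
  for X :: "'a topology" and \<A> :: "('a, 'n::finite) chart set" and K m cs Ls ix +
  fixes g\<^sub>0 :: "('a, 'n) tensor2" and q :: nat
  assumes g0: "g\<^sub>0 \<in> Met \<A> q"
begin

definition ref :: "'a measure" where
  "ref = density (restrict_space (metric_measure X \<A> g\<^sub>0) K) (\<lambda>p. ennreal (1 / sqrt \<bar>det (R g\<^sub>0 p)\<bar>))"

lemma sets_restrict_metric_measure:
  "g \<in> sym2_fields \<A> \<Longrightarrow> sets (restrict_space (metric_measure X \<A> g) K) = sets (restrict_space borelX K)"
  by (intro sets_restrict_space_cong metric_measure(1))

lemma sets_ref: "sets ref = sets (restrict_space borelX K)"
  unfolding ref_def using sets_restrict_metric_measure[OF Met_sym2_fields[OF g0]] by simp

lemma space_ref: "space ref = K"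
  using sets_eq_imp_space_eq[OF sets_ref] K_subset by (auto simp: space_restrict_space)

lemma measurable_ref: "borel_measurable ref = borel_measurable (restrict_space borelX K)"
  by (intro measurable_cong_sets sets_ref refl)

lemma R_measurable_ref [measurable]: "h \<in> sym2_fields \<A> \<Longrightarrow> R h \<in> borel_measurable ref"
  unfolding measurable_ref by (rule R_measurable)

text \<open>The density of \<open>g\<^sub>0\<close> in each chart cancels against the normalising
  factor in \<open>ref\<close>, which leaves Lebesgue measure on the coordinate images of the
  pieces.\<close>

lemma nn_integral_ref:
  assumes F: "F \<in> borel_measurable (restrict_space borelX K)"
  shows "(\<integral>\<^sup>+p. F p \<partial>ref) = (\<Sum>i<m. \<integral>\<^sup>+y. F (chart_inv (cs i) y) * indicator (snd (cs i) ` {p \<in> K. ix p = i}) y \<partial>lborel)"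
proof -
  let ?s = "\<lambda>p. ennreal (1 / sqrt \<bar>det (R g\<^sub>0 p)\<bar>)"
  let ?M = "metric_measure X \<A> g\<^sub>0"
  note g0' = Met_sym2_fields[OF g0]
  have det: "det \<in> borel_measurable (borel :: (real^'n^'n) measure)"
    by (rule borel_measurable_continuous_onI[OF continuous_on_det])
  have s: "?s \<in> borel_measurable (restrict_space borelX K)"
    using measurable_compose[OF R_measurable[OF g0'] det] by measurable
  have KM: "K \<inter> space ?M \<in> sets ?M"
    using K_sets K_subset metric_measure(1)[OF g0'] sets_eq_imp_space_eq[OF metric_measure(1)[OF g0']]
    by (simp add: Int_absorb2)
  have eqm: "borel_measurable (restrict_space ?M K) = borel_measurable (restrict_space borelX K)"
    by (intro measurable_cong_sets sets_restrict_metric_measure g0' refl)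
  have mF: "(\<lambda>p. ?s p * F p * indicator K p) \<in> borel_measurable borelX"
    using borel_measurable_restrict_space_iff_ennreal[of K borelX "\<lambda>p. ?s p * F p"] K_sets K_subset s F
    by (simp add: Int_absorb2 borel_measurable_times_ennreal)
  have "(\<integral>\<^sup>+p. F p \<partial>ref) = (\<integral>\<^sup>+p. ?s p * F p \<partial>restrict_space ?M K)"
    unfolding ref_def using s F by (intro nn_integral_density) (simp_all only: eqm)
  also have "\<dots> = (\<integral>\<^sup>+p. ?s p * F p * indicator K p * indicator K p \<partial>?M)"
    by (subst nn_integral_restrict_space[OF KM]) (auto intro!: nn_integral_cong simp: indicator_def)
  also have "\<dots> = (\<Sum>i<m. \<integral>\<^sup>+y. ennreal (chart_density g\<^sub>0 (cs i) y) *
     (?s (chart_inv (cs i) y) * F (chart_inv (cs i) y) * indicator K (chart_inv (cs i) y)) *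
     indicator (snd (cs i) ` {p \<in> K. ix p = i}) y \<partial>lborel)"
    by (rule nn_integral_pieces[OF g0' mF])
  also have "\<dots> = (\<Sum>i<m. \<integral>\<^sup>+y. F (chart_inv (cs i) y) * indicator (snd (cs i) ` {p \<in> K. ix p = i}) y \<partial>lborel)"
  proof (intro sum.cong refl nn_integral_cong)
    fix i y assume "i \<in> {..<m}"
    then have i: "i < m" by simp
    show "ennreal (chart_density g\<^sub>0 (cs i) y) *
     (?s (chart_inv (cs i) y) * F (chart_inv (cs i) y) * indicator K (chart_inv (cs i) y)) *
     indicator (snd (cs i) ` {p \<in> K. ix p = i}) y = F (chart_inv (cs i) y) * indicator (snd (cs i) ` {p \<in> K. ix p = i}) y"
    proof (cases "y \<in> snd (cs i) ` {p \<in> K. ix p = i}")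
      case True
      note pp = piece_point[OF i True]
      have "det (R g\<^sub>0 (chart_inv (cs i) y)) \<noteq> 0"
        using R_invertible[OF g0 pp(1)] by (simp add: invertible_det_nz)
      then have "ennreal (chart_density g\<^sub>0 (cs i) y) * ?s (chart_inv (cs i) y) = 1"
        unfolding pp(4) by (subst ennreal_mult[symmetric]) auto
      then show ?thesis using True pp(1) by (simp flip: mult.assoc)
    qed simp
  qed
  finally show ?thesis .
qed

lemma finite_ref: "finite_measure ref"
proof
  have "emeasure ref (space ref) = (\<integral>\<^sup>+p. 1 \<partial>ref)" by simp
  also have "\<dots> = (\<Sum>i<m. \<integral>\<^sup>+y. 1 * indicator (snd (cs i) ` {p \<in> K. ix p = i}) y \<partial>lborel)"
    by (rule nn_integral_ref) simp
  also have "\<dots> \<le> (\<Sum>i<m. \<integral>\<^sup>+y. indicator (Ls i) y \<partial>lborel)"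
    using piece_point(3) by (intro sum_mono nn_integral_mono) (auto simp: indicator_def)
  also have "\<dots> = (\<Sum>i<m. emeasure lborel (Ls i))"
    using piece_index by (intro sum.cong refl nn_integral_indicator) (auto simp: cinf_indices_def compact_imp_closed)
  also have "\<dots> < \<infinity>"
  proof -
    have "emeasure lborel (Ls i) < top" if "i < m" for i
      using emeasure_bounded_finite[OF compact_imp_bounded, of "Ls i"] piece_index[OF that]
      by (simp add: cinf_indices_def)
    then show ?thesis by simp
  qed
  finally show "emeasure ref (space ref) \<noteq> \<infinity>" by simp
qed

text \<open>Over \<open>K\<close> every \<mu>(g) becomes a density with respect to the same measure,
  so the dependence on g moves entirely into the integrand. A moving metric can thus be
  differentiated under a fixed integral.\<close>

lemma restrict_metric_measure:
  assumes g: "g \<in> sym2_fields \<A>"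
  shows "restrict_space (metric_measure X \<A> g) K = density ref (\<lambda>p. ennreal (sqrt \<bar>det (R g p)\<bar>))"
proof (rule measure_eqI)
  show "sets (restrict_space (metric_measure X \<A> g) K) = sets (density ref (\<lambda>p. ennreal (sqrt \<bar>det (R g p)\<bar>)))"
    by (simp add: sets_ref sets_restrict_metric_measure[OF g])
  let ?M = "metric_measure X \<A> g"
  have KM: "K \<inter> space ?M \<in> sets ?M"
    using K_sets K_subset metric_measure(1)[OF g] sets_eq_imp_space_eq[OF metric_measure(1)[OF g]]
    by (simp add: Int_absorb2)
  have det: "det \<in> borel_measurable (borel :: (real^'n^'n) measure)"
    by (rule borel_measurable_continuous_onI[OF continuous_on_det])
  fix B assume "B \<in> sets (restrict_space ?M K)"
  then have B: "B \<in> sets (restrict_space borelX K)" by (simp add: sets_restrict_metric_measure[OF g])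
  then have B': "B \<in> sets borelX" "B \<subseteq> K"
    using K_sets by (auto simp: sets_restrict_space)
  have s: "(\<lambda>p. ennreal (sqrt \<bar>det (R g p)\<bar>)) \<in> borel_measurable (restrict_space borelX K)"
    using measurable_compose[OF R_measurable[OF g] det] by measurable
  have "emeasure (restrict_space ?M K) B = (\<integral>\<^sup>+p. indicator B p * indicator K p \<partial>?M)"
    using B' KM metric_measure(1)[OF g]
    by (subst emeasure_restrict_space) (auto simp flip: nn_integral_indicator intro!: nn_integral_cong simp: indicator_def)
  also have "\<dots> = (\<Sum>i<m. \<integral>\<^sup>+y. ennreal (chart_density g (cs i) y) *
     indicator B (chart_inv (cs i) y) * indicator (snd (cs i) ` {p \<in> K. ix p = i}) y \<partial>lborel)"
    using B' by (intro nn_integral_pieces[OF g]) simp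
  also have "\<dots> = (\<Sum>i<m. \<integral>\<^sup>+y. ennreal (sqrt \<bar>det (R g (chart_inv (cs i) y))\<bar>) *
     indicator B (chart_inv (cs i) y) * indicator (snd (cs i) ` {p \<in> K. ix p = i}) y \<partial>lborel)"
  proof (intro sum.cong refl nn_integral_cong)
    fix i y assume "i \<in> {..<m}"
    then show "ennreal (chart_density g (cs i) y) *
     indicator B (chart_inv (cs i) y) * indicator (snd (cs i) ` {p \<in> K. ix p = i}) y =
     ennreal (sqrt \<bar>det (R g (chart_inv (cs i) y))\<bar>) *
     indicator B (chart_inv (cs i) y) * indicator (snd (cs i) ` {p \<in> K. ix p = i}) y"
      using piece_point(4)[of i y g] by (cases "y \<in> snd (cs i) ` {p \<in> K. ix p = i}") simp_all
  qed
  also have "\<dots> = (\<integral>\<^sup>+p. ennreal (sqrt \<bar>det (R g p)\<bar>) * indicator B p \<partial>ref)"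
    using B s by (intro nn_integral_ref[symmetric] borel_measurable_times_ennreal) auto
  also have "\<dots> = emeasure (density ref (\<lambda>p. ennreal (sqrt \<bar>det (R g p)\<bar>))) B"
    using B s by (intro emeasure_density[symmetric]) (auto simp: sets_ref measurable_ref)
  finally show "emeasure (restrict_space ?M K) B = emeasure (density ref (\<lambda>p. ennreal (sqrt \<bar>det (R g p)\<bar>))) B" .
qed

lemma integral_metric_measure:
  fixes F :: "'a \<Rightarrow> real"
  assumes g: "g \<in> sym2_fields \<A>" and F: "F \<in> borel_measurable ref" and supp: "\<And>p. p \<notin> K \<Longrightarrow> F p = 0"
  shows "(\<integral>p. F p \<partial>metric_measure X \<A> g) = (\<integral>p. sqrt \<bar>det (R g p)\<bar> * F p \<partial>ref)"
proof -
  let ?M = "metric_measure X \<A> g"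
  have KM: "K \<inter> space ?M \<in> sets ?M"
    using K_sets K_subset metric_measure(1)[OF g] sets_eq_imp_space_eq[OF metric_measure(1)[OF g]]
    by (simp add: Int_absorb2)
  have det: "det \<in> borel_measurable (borel :: (real^'n^'n) measure)"
    by (rule borel_measurable_continuous_onI[OF continuous_on_det])
  have "F = (\<lambda>p. indicator K p *\<^sub>R F p)" by (rule ext) (use supp in \<open>auto simp: indicator_def\<close>)
  then have "(\<integral>p. F p \<partial>?M) = (\<integral>p. F p \<partial>restrict_space ?M K)"
    using integral_restrict_space[OF KM, of F] by simp
  also have "\<dots> = (\<integral>p. sqrt \<bar>det (R g p)\<bar> *\<^sub>R F p \<partial>ref)"
    unfolding restrict_metric_measure[OF g]
    using measurable_compose[OF R_measurable_ref[OF g] det] F by (intro integral_density) auto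
  finally show ?thesis by simp
qed

end

subsection \<open>Smooth curves of forms\<close>

text \<open>Each order \<open>n\<close> comes with its own witness. Uniqueness of pointwise
  derivatives makes all of them equal to \<open>deriv\<close> on \<open>S\<close>, so a single
  derivative is uniformly differentiable to every order.\<close>

lemma unif_C_deriv:
  fixes f :: "real \<Rightarrow> 'x \<Rightarrow> real"
  assumes "\<And>n. unif_C n S f"
  shows "has_unif_deriv S f (\<lambda>x. deriv (\<lambda>s. f s x) t) t"
    and "unif_C n S (\<lambda>t x. deriv (\<lambda>s. f s x) t)"
proof -
  have "\<exists>f'. (\<forall>t. has_unif_deriv S f (f' t) t) \<and> unif_C n S f'" for n
    using assms[of "Suc n"] by simp
  then obtain f' where f': "\<And>n t. has_unif_deriv S f (f' n t) t" "\<And>n. unif_C n S (f' n)"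
    by metis
  have eq: "f' n t x = deriv (\<lambda>s. f s x) t" if "x \<in> S" for n t x
    using has_unif_deriv_pointwise[OF f'(1) that]
    by (metis DERIV_imp_deriv has_real_derivative_iff_has_vector_derivative)
  show "has_unif_deriv S f (\<lambda>x. deriv (\<lambda>s. f s x) t) t"
    using f'(1)[where n = 0] by (rule iffD1[OF has_unif_deriv_cong, rotated -1]) (auto simp: eq)
  show "unif_C n S (\<lambda>t x. deriv (\<lambda>s. f s x) t)"
    using f'(2)[of n] by (rule iffD1[OF unif_C_cong, rotated -1]) (auto simp: eq)
qed

text \<open>Iterated pointwise derivatives, a choice that depends neither on the order nor on a
  bounded set. It can therefore serve as the one derivative sequence that
  \<open>smooth_curve\<close> demands.\<close>

definition deriv_seq :: "(real \<Rightarrow> 'x \<Rightarrow> real) \<Rightarrow> nat \<Rightarrow> real \<Rightarrow> 'x \<Rightarrow> real" where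
  "deriv_seq f j = ((\<lambda>f t x. deriv (\<lambda>s. f s x) t) ^^ j) f"

lemma deriv_seq_0 [simp]: "deriv_seq f 0 = f"
  by (simp add: deriv_seq_def)

lemma deriv_seq_Suc: "deriv_seq f (Suc j) t x = deriv (\<lambda>s. deriv_seq f j s x) t"
  by (simp add: deriv_seq_def)

lemma unif_C_deriv_seq:
  assumes "\<And>n. unif_C n S f"
  shows "unif_C n S (deriv_seq f j)"
    and "has_unif_deriv S (deriv_seq f j) (deriv_seq f (Suc j) t) t"
proof -
  have *: "unif_C n S (deriv_seq f j)" for n
  proof (induction j arbitrary: n)
    case (Suc j)
    have "deriv_seq f (Suc j) = (\<lambda>t x. deriv (\<lambda>s. deriv_seq f j s x) t)"
      by (intro ext) (rule deriv_seq_Suc)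
    then show ?case using unif_C_deriv(2)[OF Suc, of n] by simp
  qed (use assms in simp)
  show "unif_C n S (deriv_seq f j)" by (rule *)
  have "deriv_seq f (Suc j) t = (\<lambda>x. deriv (\<lambda>s. deriv_seq f j s x) t)"
    by (intro ext) (rule deriv_seq_Suc)
  then show "has_unif_deriv S (deriv_seq f j) (deriv_seq f (Suc j) t) t"
    using unif_C_deriv(1)[OF *, of t] by simp
qed

text \<open>Additivity is the case a = b = 1, homogeneity the case b = 0, vanishing the case a = b =
  0. So the algebraic identities of forms pass to all derivatives, under control of the two-point
  set \<open>{y, z}\<close> alone.\<close>

lemma deriv_seq_combination:
  assumes f: "\<And>t. f t x = a * f t y + b * f t z" and S: "\<And>n. unif_C n {y, z} f"
  shows "deriv_seq f j t x = a * deriv_seq f j t y + b * deriv_seq f j t z"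
proof (induction j arbitrary: t)
  case (Suc j)
  have d: "((\<lambda>s. deriv_seq f j s w) has_real_derivative deriv_seq f (Suc j) t w) (at t)" if "w \<in> {y, z}" for w
    using has_unif_deriv_pointwise[OF unif_C_deriv_seq(2)[OF S] that]
    by (simp add: has_real_derivative_iff_has_vector_derivative)
  have "((\<lambda>s. a * deriv_seq f j s y + b * deriv_seq f j s z) has_real_derivative
      a * deriv_seq f (Suc j) t y + b * deriv_seq f (Suc j) t z) (at t)"
    by (intro DERIV_add DERIV_cmult d) auto
  then show ?case unfolding deriv_seq_Suc[of f j t x] Suc by (rule DERIV_imp_deriv)
qed (simp add: f)

text \<open>Uniform convergence over \<open>S\<close>, restated for the supremum seminorms of forms.
  The proof aims at e/2 because a supremum of values below a number may be equal to that
  number.\<close>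

lemma tendsto_SUP_uniform:
  fixes f :: "real \<Rightarrow> 'x \<Rightarrow> real"
  assumes "has_unif_deriv S f f' t" "S \<noteq> {}"
  shows "((\<lambda>s. SUP x\<in>S. \<bar>(f (t + s) x - f t x) /\<^sub>R s - f' x\<bar>) \<longlongrightarrow> 0) (at 0)"
proof (rule tendstoI)
  fix e :: real assume "0 < e"
  then have "\<forall>\<^sub>F s in at 0. \<forall>x\<in>S. dist ((f (t + s) x - f t x) /\<^sub>R s) (f' x) < e / 2"
    using assms(1) unfolding has_unif_deriv_def uniform_limit_iff by (simp only: half_gt_zero)
  then show "\<forall>\<^sub>F s in at 0. dist (SUP x\<in>S. \<bar>(f (t + s) x - f t x) /\<^sub>R s - f' x\<bar>) 0 < e"
  proof eventually_elim
    case (elim s)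
    let ?g = "\<lambda>x. \<bar>(f (t + s) x - f t x) /\<^sub>R s - f' x\<bar>"
    have le: "?g x \<le> e / 2" if "x \<in> S" for x using elim that by (simp add: dist_real_def less_imp_le)
    have "(SUP x\<in>S. ?g x) \<le> e / 2" by (rule cSUP_least[OF assms(2) le])
    moreover have "0 \<le> (SUP x\<in>S. ?g x)"
    proof -
      obtain x where "x \<in> S" using assms(2) by blast
      then show ?thesis using le by (intro cSUP_upper2[of _ S x]) (auto intro!: bdd_aboveI2[where M = "e / 2"] le)
    qed
    ultimately show ?case using \<open>0 < e\<close> by (simp add: dist_real_def)
  qed
qed

lemma lcs_bounded_finite: "finite B \<Longrightarrow> B \<subseteq> fst E \<Longrightarrow> lcs_bounded E B"
  by (auto simp: lcs_bounded_def finite_imp_bounded)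

text \<open>\<open>deriv_seq\<close> supplies the derivatives. Their linearity is checked on finite
  sets of vectors, which are bounded, and convergence in a seminorm of the space of forms is uniform
  convergence on the bounded set defining it.\<close>

lemma smooth_curve_forms1:
  assumes form: "\<And>t. \<omega> t \<in> fst (bounded_forms1 E)"
    and U: "\<And>B n. lcs_bounded E B \<Longrightarrow> unif_C n B \<omega>"
    and lin: "\<And>v w. v \<in> fst E \<Longrightarrow> w \<in> fst E \<Longrightarrow> v + w \<in> fst E" "\<And>r v. v \<in> fst E \<Longrightarrow> r *\<^sub>R v \<in> fst E"
  shows "smooth_curve (bounded_forms1 E) \<omega>"
  unfolding smooth_curve_def
proof (intro exI[of _ "deriv_seq \<omega>"] conjI allI)
  have lf: "linear_form_on (fst E) (\<omega> t)" for t using form by (auto simp: bounded_forms1_def)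
  show "deriv_seq \<omega> j t \<in> fst (bounded_forms1 E)" for j t
  proof -
    have "deriv_seq \<omega> j t (v + w) = 1 * deriv_seq \<omega> j t v + 1 * deriv_seq \<omega> j t w"
      if "v \<in> fst E" "w \<in> fst E" for v w
      using that lf by (intro deriv_seq_combination U lcs_bounded_finite) (auto simp: linear_form_on_def)
    moreover have "deriv_seq \<omega> j t (r *\<^sub>R v) = r * deriv_seq \<omega> j t v + 0 * deriv_seq \<omega> j t v"
      if "v \<in> fst E" for r v
      using that lf by (intro deriv_seq_combination U lcs_bounded_finite) (auto simp: linear_form_on_def)
    ultimately show ?thesis
      using unif_C_bounded[OF unif_C_deriv_seq(1)[OF U]]
      by (auto simp: bounded_forms1_def linear_form_on_def)
  qed
  show "lcs_tendsto (bounded_forms1 E) (\<lambda>s. (deriv_seq \<omega> j (t + s) - deriv_seq \<omega> j t) /\<^sub>R s)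
      (deriv_seq \<omega> (Suc j) t) (at 0)" for j t
    unfolding lcs_tendsto_def
  proof
    fix p assume "p \<in> snd (bounded_forms1 E)"
    then obtain B where B: "lcs_bounded E B" "B \<noteq> {}" "p = (\<lambda>\<omega>. SUP v \<in> B. \<bar>\<omega> v\<bar>)"
      by (auto simp: bounded_forms1_def)
    show "((\<lambda>s. p ((deriv_seq \<omega> j (t + s) - deriv_seq \<omega> j t) /\<^sub>R s - deriv_seq \<omega> (Suc j) t)) \<longlongrightarrow> 0) (at 0)"
      using tendsto_SUP_uniform[OF unif_C_deriv_seq(2)[OF U[OF B(1)]] B(2)]
      by (simp add: B(3) scaleR_fun_def)
  qed
qed simp

lemma smooth_curve_forms2:
  assumes form: "\<And>t. \<omega> t \<in> fst (bounded_forms2 E)"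
    and U: "\<And>B n. lcs_bounded E B \<Longrightarrow> unif_C n (B \<times> B) (\<lambda>t (v, w). \<omega> t v w)"
    and lin: "\<And>v w. v \<in> fst E \<Longrightarrow> w \<in> fst E \<Longrightarrow> v + w \<in> fst E" "\<And>r v. v \<in> fst E \<Longrightarrow> r *\<^sub>R v \<in> fst E"
  shows "smooth_curve (bounded_forms2 E) \<omega>"
proof -
  let ?f = "\<lambda>t (v, w). \<omega> t v w"
  define d where "d j t v w = deriv_seq ?f j t (v, w)" for j t v w
  have U': "unif_C n S ?f" if "finite S" "S \<subseteq> fst E \<times> fst E" for S n
  proof -
    \<comment> \<open>A finite set of pairs lies in the square of the finite, hence bounded, set of
      its components.\<close>
    have "lcs_bounded E (fst ` S \<union> snd ` S)" using that by (intro lcs_bounded_finite) auto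
    from U[OF this] have "unif_C n S (\<lambda>t x. ?f t (id x))"
      by (rule unif_C_reindex) force
    then show ?thesis by simp
  qed
  have lf: "linear_form_on (fst E) (\<lambda>w. \<omega> t v w)" "linear_form_on (fst E) (\<lambda>w. \<omega> t w v)" "\<omega> t v v = 0"
    if "v \<in> fst E" for t v using form[of t] that by (auto simp: bounded_forms2_def)
  have dd: "d j t v w = a * d j t v' w' + b * d j t v'' w''"
    if "\<And>t. \<omega> t v w = a * \<omega> t v' w' + b * \<omega> t v'' w''" "{(v', w'), (v'', w'')} \<subseteq> fst E \<times> fst E"
    for j t v w v' w' v'' w'' a b
    unfolding d_def using that by (intro deriv_seq_combination U') auto
  show ?thesis
    unfolding smooth_curve_def
  proof (intro exI[of _ d] conjI allI)
    show "d 0 = \<omega>" by (simp add: d_def fun_eq_iff)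
    show "d j t \<in> fst (bounded_forms2 E)" for j t
    proof -
      have "linear_form_on (fst E) (\<lambda>w. d j t v w)" if v: "v \<in> fst E" for v
        unfolding linear_form_on_def
      proof (intro conjI ballI allI)
        fix w w' assume "w \<in> fst E" "w' \<in> fst E"
        then show "d j t v (w + w') = d j t v w + d j t v w'"
          using dd[of v "w + w'" 1 v w 1 v w' j t] v lf(1)[OF v] by (auto simp: linear_form_on_def)
      next
        fix r w assume "w \<in> fst E"
        then show "d j t v (r *\<^sub>R w) = r * d j t v w"
          using dd[of v "r *\<^sub>R w" r v w 0 v w j t] v lf(1)[OF v] by (auto simp: linear_form_on_def)
      qed
      moreover have "linear_form_on (fst E) (\<lambda>w. d j t w v)" if v: "v \<in> fst E" for v
        unfolding linear_form_on_def
      proof (intro conjI ballI allI)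
        fix w w' assume "w \<in> fst E" "w' \<in> fst E"
        then show "d j t (w + w') v = d j t w v + d j t w' v"
          using dd[of "w + w'" v 1 w v 1 w' v j t] v lf(2)[OF v] by (auto simp: linear_form_on_def)
      next
        fix r w assume "w \<in> fst E"
        then show "d j t (r *\<^sub>R w) v = r * d j t w v"
          using dd[of "r *\<^sub>R w" v r w v 0 w v j t] v lf(2)[OF v] by (auto simp: linear_form_on_def)
      qed
      moreover have "d j t v v = 0" if v: "v \<in> fst E" for v
        using dd[of v v 0 v v 0 v v j t] v lf(3)[OF v] by simp
      moreover have "bounded ((\<lambda>(v, w). d j t v w) ` (B \<times> B))" if "lcs_bounded E B" for B
        using unif_C_bounded[OF unif_C_deriv_seq(1)[OF U[OF that]], of j t]
        by (simp add: d_def case_prod_beta)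
      ultimately show ?thesis by (simp add: bounded_forms2_def)
    qed
    show "lcs_tendsto (bounded_forms2 E) (\<lambda>s. (d j (t + s) - d j t) /\<^sub>R s) (d (Suc j) t) (at 0)" for j t
      unfolding lcs_tendsto_def
    proof
      fix p assume "p \<in> snd (bounded_forms2 E)"
      then obtain B where B: "lcs_bounded E B" "B \<noteq> {}" "p = (\<lambda>\<omega>. SUP (v, w) \<in> B \<times> B. \<bar>\<omega> v w\<bar>)"
        by (auto simp: bounded_forms2_def)
      have "B \<times> B \<noteq> {}" using B(2) by auto
      from tendsto_SUP_uniform[OF unif_C_deriv_seq(2)[OF U[OF B(1)], of j t] this]
      show "((\<lambda>s. p ((d j (t + s) - d j t) /\<^sub>R s - d (Suc j) t)) \<longlongrightarrow> 0) (at 0)"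
        by (simp add: B(3) scaleR_fun_def d_def case_prod_beta)
    qed
  qed
qed

subsection \<open>The integrands\<close>

text \<open>The integrand of \<Theta> at one point, with the density of the metric included, so that
  it is to be integrated against the reference measure.\<close>

definition theta_density :: "real^'n::finite^'n \<Rightarrow> real^'n^'n \<Rightarrow> real^'n^'n \<Rightarrow> real" where
  "theta_density G H k = sqrt \<bar>det G\<bar> * trace (matrix_inv G ** k ** (matrix_inv G ** H))"

definition omega_density ::
    "real^'n::finite^'n \<Rightarrow> real^'n^'n \<Rightarrow> (real^'n^'n) \<times> (real^'n^'n) \<Rightarrow> (real^'n^'n) \<times> (real^'n^'n) \<Rightarrow> real" where
  "omega_density G H = (\<lambda>(k\<^sub>1, l\<^sub>1) (k\<^sub>2, l\<^sub>2). sqrt \<bar>det G\<bar> *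
     (1/2 * (trace (matrix_inv G ** k\<^sub>1 ** (matrix_inv G ** H)) * trace (matrix_inv G ** k\<^sub>2)
           - trace (matrix_inv G ** k\<^sub>2 ** (matrix_inv G ** H)) * trace (matrix_inv G ** k\<^sub>1))
      + trace (matrix_inv G ** k\<^sub>1 ** (matrix_inv G ** l\<^sub>2))
      - trace (matrix_inv G ** k\<^sub>2 ** (matrix_inv G ** l\<^sub>1))))"

lemma unif_C_diff: "unif_C n S f \<Longrightarrow> unif_C n S g \<Longrightarrow> unif_C n S (\<lambda>t x. f t x - g t x)"
  using unif_C_add[OF _ unif_C_uminus, of n S f g] by simp

lemma unif_C_theta_density:
  fixes G :: "real \<Rightarrow> 'x \<Rightarrow> real^'n::finite^'n"
  assumes G: "unif_C n S G" "\<And>t. bounded ((\<lambda>x. matrix_inv (G t x)) ` S)" "\<And>t x. x \<in> S \<Longrightarrow> invertible (G t x)"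
    and *: "unif_C n S H" "unif_C n S k"
  shows "unif_C n S (\<lambda>t x. theta_density (G t x) (H t x) (k t x))"
  unfolding theta_density_def
  by (intro unif_C_mult unif_C_sqrt_det[OF G] unif_C_linear[OF bounded_linear_trace]
      unif_C_bilinear[OF bounded_bilinear_matrix_mult] unif_C_matrix_inv[OF G] *)

lemma unif_C_omega_density:
  fixes G :: "real \<Rightarrow> 'x \<Rightarrow> real^'n::finite^'n"
  assumes G: "unif_C n S G" "\<And>t. bounded ((\<lambda>x. matrix_inv (G t x)) ` S)" "\<And>t x. x \<in> S \<Longrightarrow> invertible (G t x)"
    and *: "unif_C n S H" "unif_C n S k\<^sub>1" "unif_C n S l\<^sub>1" "unif_C n S k\<^sub>2" "unif_C n S l\<^sub>2"
  shows "unif_C n S (\<lambda>t x. omega_density (G t x) (H t x) (k\<^sub>1 t x, l\<^sub>1 t x) (k\<^sub>2 t x, l\<^sub>2 t x))"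
  unfolding omega_density_def prod.case
  by (intro unif_C_mult unif_C_diff unif_C_add unif_C_sqrt_det[OF G] unif_C_linear[OF bounded_linear_trace]
      unif_C_bilinear[OF bounded_bilinear_matrix_mult] unif_C_matrix_inv[OF G] *
      unif_C_linear[OF bounded_linear_mult_right])

lemma matrix_inv_measurable:
  fixes G :: "'x \<Rightarrow> real^'n::finite^'n"
  assumes "G \<in> borel_measurable M" "\<And>x. x \<in> space M \<Longrightarrow> invertible (G x)"
  shows "(\<lambda>x. matrix_inv (G x)) \<in> borel_measurable M"
proof -
  have "G \<in> M \<rightarrow>\<^sub>M restrict_space borel {A. invertible A}"
    using assms by (intro measurable_restrict_space2) auto
  moreover have "matrix_inv \<in> restrict_space borel {A :: real^'n^'n. invertible A} \<rightarrow>\<^sub>M borel"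
    by (rule borel_measurable_continuous_on_restrict[OF continuous_on_matrix_inv])
  ultimately show ?thesis by (rule measurable_compose)
qed

lemma matrix_mult_measurable:
  fixes f g :: "'x \<Rightarrow> real^'n::finite^'n"
  assumes "f \<in> borel_measurable M" "g \<in> borel_measurable M"
  shows "(\<lambda>x. f x ** g x) \<in> borel_measurable M"
  using assms
  by (rule borel_measurable_continuous_Pair)
     (intro bounded_bilinear.continuous_on[OF bounded_bilinear_matrix_mult] continuous_intros)

lemma trace_measurable:
  "f \<in> borel_measurable M \<Longrightarrow> (\<lambda>x. trace (f x :: real^'n::finite^'n)) \<in> borel_measurable M"
  by (rule measurable_compose[OF _ borel_measurable_continuous_onI[OF linear_continuous_on[OF bounded_linear_trace]]])

lemma det_measurable:
  "f \<in> borel_measurable M \<Longrightarrow> (\<lambda>x. det (f x :: real^'n::finite^'n)) \<in> borel_measurable M"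
  by (rule measurable_compose[OF _ borel_measurable_continuous_onI[OF continuous_on_det]])

lemma sqrt_abs_det_measurable:
  "f \<in> borel_measurable M \<Longrightarrow> (\<lambda>x. sqrt \<bar>det (f x :: real^'n::finite^'n)\<bar>) \<in> borel_measurable M"
  by (rule measurable_compose[OF det_measurable, where g = "\<lambda>d. sqrt \<bar>d\<bar>"]) auto

lemma theta_density_measurable:
  fixes G :: "'x \<Rightarrow> real^'n::finite^'n"
  assumes "G \<in> borel_measurable M" "\<And>x. x \<in> space M \<Longrightarrow> invertible (G x)"
    "H \<in> borel_measurable M" "k \<in> borel_measurable M"
  shows "(\<lambda>x. theta_density (G x) (H x) (k x)) \<in> borel_measurable M"
  unfolding theta_density_def
  by (intro borel_measurable_times sqrt_abs_det_measurable trace_measurable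
      matrix_mult_measurable matrix_inv_measurable assms)

lemma omega_density_measurable:
  fixes G :: "'x \<Rightarrow> real^'n::finite^'n"
  assumes "G \<in> borel_measurable M" "\<And>x. x \<in> space M \<Longrightarrow> invertible (G x)" "H \<in> borel_measurable M"
    "k\<^sub>1 \<in> borel_measurable M" "l\<^sub>1 \<in> borel_measurable M" "k\<^sub>2 \<in> borel_measurable M" "l\<^sub>2 \<in> borel_measurable M"
  shows "(\<lambda>x. omega_density (G x) (H x) (k\<^sub>1 x, l\<^sub>1 x) (k\<^sub>2 x, l\<^sub>2 x)) \<in> borel_measurable M"
  unfolding omega_density_def prod.case
  by (intro borel_measurable_times sqrt_abs_det_measurable trace_measurable
      borel_measurable_add borel_measurable_diff borel_measurable_const
      matrix_mult_measurable matrix_inv_measurable assms)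

subsection \<open>Smoothness of the forms\<close>

context smooth_mfd
begin

abbreviation TE :: "(('a, 'n) tensor2 \<times> ('a, 'n) tensor2) lcs" where
  "TE \<equiv> T_Met_mw X \<A>"

lemma fst_TE: "fst TE = sym2_fields_c X \<A> \<times> sym2_fields_c X \<A>"
  by (simp add: T_Met_mw_def lcs_prod_def)

lemma TE_add: "v \<in> fst TE \<Longrightarrow> w \<in> fst TE \<Longrightarrow> v + w \<in> fst TE"
  by (auto simp: fst_TE sym2_fields_c_add)

lemma TE_scaleR: "v \<in> fst TE \<Longrightarrow> r *\<^sub>R v \<in> fst TE"
  by (auto simp: fst_TE sym2_fields_c_scaleR)

lemma Met_mw_iff: "x \<in> Met_mw X \<A> q \<longleftrightarrow> fst x \<in> Met \<A> q \<and> snd x \<in> sym2_fields_c X \<A>"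
  by (simp add: Met_mw_def mem_Times_iff)

lemma TE_seminorm_fst: "p \<in> snd (Gamma_c X \<A>) \<Longrightarrow> (\<lambda>x. p (fst x)) \<in> snd TE"
proof -
  assume p: "p \<in> snd (Gamma_c X \<A>)"
  have eq: "(\<lambda>x. p (fst x)) = (\<lambda>(x, y). p x + (\<lambda>h. 0) y)" by (simp add: fun_eq_iff)
  show ?thesis
    unfolding T_Met_mw_def lcs_prod_def snd_conv
    by (intro CollectI exI[of _ p] exI[of _ "\<lambda>h. 0"] conjI eq p zero_seminorm_mem)
qed

lemma TE_seminorm_snd: "p \<in> snd (Gamma_c X \<A>) \<Longrightarrow> (\<lambda>x. p (snd x)) \<in> snd TE"
proof -
  assume p: "p \<in> snd (Gamma_c X \<A>)"
  have eq: "(\<lambda>x. p (snd x)) = (\<lambda>(x, y). (\<lambda>h. 0) x + p y)" by (simp add: fun_eq_iff)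
  show ?thesis
    unfolding T_Met_mw_def lcs_prod_def snd_conv
    by (intro CollectI exI[of _ "\<lambda>h. 0"] exI[of _ p] conjI eq p zero_seminorm_mem)
qed

lemma TE_tendstoD:
  assumes "lcs_tendsto TE f l F"
  shows "lcs_tendsto (Gamma_c X \<A>) (\<lambda>s. fst (f s)) (fst l) F"
    and "lcs_tendsto (Gamma_c X \<A>) (\<lambda>s. snd (f s)) (snd l) F"
  using assms TE_seminorm_fst TE_seminorm_snd unfolding lcs_tendsto_def by force+

lemma TE_boundedD:
  assumes "lcs_bounded TE B"
  shows "lcs_bounded (Gamma_c X \<A>) (fst ` B)" "lcs_bounded (Gamma_c X \<A>) (snd ` B)"
proof -
  have "bounded (p ` fst ` B)" if "p \<in> snd (Gamma_c X \<A>)" for p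
    using assms TE_seminorm_fst[OF that] by (auto simp: lcs_bounded_def image_image)
  moreover have "bounded (p ` snd ` B)" if "p \<in> snd (Gamma_c X \<A>)" for p
    using assms TE_seminorm_snd[OF that] by (auto simp: lcs_bounded_def image_image)
  ultimately show "lcs_bounded (Gamma_c X \<A>) (fst ` B)" "lcs_bounded (Gamma_c X \<A>) (snd ` B)"
    using assms by (auto simp: lcs_bounded_def fst_TE)
qed

lemma TE_bounded_support:
  assumes "lcs_bounded TE B"
  obtains K where "compactin X K" "B \<subseteq> sym2_fields_on \<A> K \<times> sym2_fields_on \<A> K"
proof -
  obtain K K' where K: "compactin X K" "fst ` B \<subseteq> sym2_fields_on \<A> K" "compactin X K'" "snd ` B \<subseteq> sym2_fields_on \<A> K'"
    using TE_boundedD[OF assms] bounded_common_support by metis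
  then have "fst ` B \<subseteq> sym2_fields_on \<A> (K \<union> K')" "snd ` B \<subseteq> sym2_fields_on \<A> (K \<union> K')"
    using sym2_fields_on_mono[of K "K \<union> K'"] sym2_fields_on_mono[of K' "K \<union> K'"] by blast+
  then show thesis
    using K by (intro that[of "K \<union> K'"] compactin_Un) (auto simp: image_subset_iff)
qed

end

context mfd_patch
begin

lemma R_add: "R (h + k) p = R h p + R k p"
  and R_diff: "R (h - k) p = R h p - R k p"
  and R_scaleR: "R (r *\<^sub>R h) p = r *\<^sub>R R h p"
  by (simp_all add: R_def)

lemma R_uniform_limit:
  assumes lim: "lcs_tendsto (Gamma_c X \<A>) f l F"
    and mem: "\<And>s. f s \<in> sym2_fields_c X \<A>" "l \<in> sym2_fields_c X \<A>"
  shows "uniform_limit K (\<lambda>s. R (f s)) (R l) F"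
proof (rule uniform_limitI)
  fix e :: real assume e: "0 < e"
  have "((\<lambda>s. \<Sum>i<m. cinf_seminorm (cs i, Ls i, []) (f s - l)) \<longlongrightarrow> (\<Sum>i<m. 0)) F"
    using lim cinf_seminorm_mem[OF piece_index] unfolding lcs_tendsto_def by (intro tendsto_sum) auto
  then have "\<forall>\<^sub>F s in F. dist (\<Sum>i<m. cinf_seminorm (cs i, Ls i, []) (f s - l)) 0 < e"
    using e by (auto dest: tendstoD)
  then show "\<forall>\<^sub>F s in F. \<forall>p\<in>K. dist (R (f s) p) (R l p) < e"
  proof eventually_elim
    case (elim s)
    show ?case
    proof
      fix p assume "p \<in> K"
      then have "norm (R (f s - l) p) \<le> (\<Sum>i<m. cinf_seminorm (cs i, Ls i, []) (f s - l))"
        using mem by (intro R_bound sym2_fields_c_subset sym2_fields_c_diff)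
      with elim show "dist (R (f s) p) (R l p) < e"
        by (simp add: dist_norm R_diff)
    qed
  qed
qed

text \<open>The support condition is put on differences of the curve, since a metric itself lies
  outside \<open>Gamma_c\<close> in general.\<close>

lemma R_has_unif_deriv:
  assumes lim: "lcs_tendsto (Gamma_c X \<A>) (\<lambda>s. (f (t + s) - f t) /\<^sub>R s) l (at 0)"
    and mem: "\<And>s. f s - f t \<in> sym2_fields_c X \<A>" "l \<in> sym2_fields_c X \<A>"
  shows "has_unif_deriv K (\<lambda>s. R (f s)) (R l) t"
proof -
  have "uniform_limit K (\<lambda>s. R ((f (t + s) - f t) /\<^sub>R s)) (R l) (at 0)"
    by (intro R_uniform_limit lim sym2_fields_c_scaleR mem)
  moreover have "(\<lambda>s. R ((f (t + s) - f t) /\<^sub>R s)) = (\<lambda>s x. (R (f (t + s)) x - R (f t) x) /\<^sub>R s)"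
    by (intro ext) (simp only: R_scaleR R_diff)
  ultimately show ?thesis unfolding has_unif_deriv_def by simp
qed

lemma unif_C_R:
  assumes "smooth_curve (Gamma_c X \<A>) f"
  shows "unif_C n K (\<lambda>t. R (f t))"
proof -
  obtain d where d: "d 0 = f" "\<And>j t. d j t \<in> sym2_fields_c X \<A>"
      "\<And>j t. lcs_tendsto (Gamma_c X \<A>) (\<lambda>s. (d j (t + s) - d j t) /\<^sub>R s) (d (Suc j) t) (at 0)"
    using assms unfolding smooth_curve_def by auto
  have "unif_C n K (\<lambda>t. R (d 0 t))"
  proof (rule unif_C_sequence[where d = "\<lambda>j t. R (d j t)"])
    show "bounded (R (d j t) ` K)" for j t
      by (rule R_bounded[OF sym2_fields_c_subset[OF d(2)]])
    show "has_unif_deriv K (\<lambda>t. R (d j t)) (R (d (Suc j) t)) t" for j t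
      by (intro R_has_unif_deriv d sym2_fields_c_diff)
  qed
  then show ?thesis using d(1) by simp
qed

lemma smooth_curve_TE_D:
  assumes "smooth_curve TE f"
  shows "smooth_curve (Gamma_c X \<A>) (\<lambda>t. fst (f t))" "smooth_curve (Gamma_c X \<A>) (\<lambda>t. snd (f t))"
proof -
  obtain d where d: "d 0 = f" "\<And>j t. d j t \<in> fst TE"
      "\<And>j t. lcs_tendsto TE (\<lambda>s. (d j (t + s) - d j t) /\<^sub>R s) (d (Suc j) t) (at 0)"
    using assms unfolding smooth_curve_def by auto
  have m: "fst (d j t) \<in> sym2_fields_c X \<A>" "snd (d j t) \<in> sym2_fields_c X \<A>" for j t
    using d(2)[of j t] by (auto simp: fst_TE)
  show "smooth_curve (Gamma_c X \<A>) (\<lambda>t. fst (f t))"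
    unfolding smooth_curve_def using d(1) m TE_tendstoD(1)[OF d(3)]
    by (intro exI[of _ "\<lambda>j t. fst (d j t)"]) (auto simp: fst_diff)
  show "smooth_curve (Gamma_c X \<A>) (\<lambda>t. snd (f t))"
    unfolding smooth_curve_def using d(1) m TE_tendstoD(2)[OF d(3)]
    by (intro exI[of _ "\<lambda>j t. snd (d j t)"]) (auto simp: snd_diff)
qed

text \<open>The modelling space sees \<open>\<gamma> t - \<gamma> 0\<close>. The starting point,
  whose metric need not have compact support, is added back as a constant curve.\<close>

lemma unif_C_curve:
  assumes "smooth_curve_in (Met_mw X \<A> q) TE \<gamma>"
  shows "unif_C n K (\<lambda>t. R (fst (\<gamma> t)))" "unif_C n K (\<lambda>t. R (snd (\<gamma> t)))"
proof -
  have mem: "fst (\<gamma> t) \<in> sym2_fields \<A>" "snd (\<gamma> t) \<in> sym2_fields \<A>" for t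
    using assms Met_sym2_fields sym2_fields_c_subset by (auto simp: smooth_curve_in_def Met_mw_iff)
  have "smooth_curve TE (\<lambda>t. \<gamma> t - \<gamma> 0)" using assms by (simp add: smooth_curve_in_def)
  from smooth_curve_TE_D[OF this]
  have "unif_C n K (\<lambda>t. R (fst (\<gamma> t - \<gamma> 0)))" "unif_C n K (\<lambda>t. R (snd (\<gamma> t - \<gamma> 0)))"
    by (auto intro: unif_C_R)
  then have "unif_C n K (\<lambda>t p. R (fst (\<gamma> 0)) p + R (fst (\<gamma> t - \<gamma> 0)) p)"
    "unif_C n K (\<lambda>t p. R (snd (\<gamma> 0)) p + R (snd (\<gamma> t - \<gamma> 0)) p)"
    using mem by (auto intro!: unif_C_add unif_C_const R_bounded)
  then show "unif_C n K (\<lambda>t. R (fst (\<gamma> t)))" "unif_C n K (\<lambda>t. R (snd (\<gamma> t)))"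
    by (simp_all add: fst_diff snd_diff R_diff)
qed

lemma R_bounded_set:
  assumes "lcs_bounded (Gamma_c X \<A>) B"
  shows "bounded ((\<lambda>(p, h). R h p) ` (K \<times> B))"
proof -
  have "\<exists>C. \<forall>h\<in>B. cinf_seminorm (cs i, Ls i, []) h \<le> C" if "i < m" for i
    using assms cinf_seminorm_mem[OF piece_index[OF that]] unfolding lcs_bounded_def bounded_iff
    by (fastforce simp: abs_le_iff)
  then obtain C where C: "\<And>i h. i < m \<Longrightarrow> h \<in> B \<Longrightarrow> cinf_seminorm (cs i, Ls i, []) h \<le> C i" by metis
  have "norm (R h p) \<le> (\<Sum>i<m. C i)" if "p \<in> K" "h \<in> B" for p h
  proof -
    have "h \<in> sym2_fields \<A>" using assms that sym2_fields_c_subset by (auto simp: lcs_bounded_def)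
    then have "norm (R h p) \<le> (\<Sum>i<m. cinf_seminorm (cs i, Ls i, []) h)" using that by (intro R_bound)
    also have "\<dots> \<le> (\<Sum>i<m. C i)" using C that by (intro sum_mono) auto
    finally show ?thesis .
  qed
  then show ?thesis unfolding bounded_iff by (intro exI[of _ "\<Sum>i<m. C i"]) auto
qed

end

context smooth_mfd
begin

lemma ex_patch_ref:
  assumes "compactin X K" "g \<in> Met \<A> q"
  obtains m cs Ls ix where "mfd_patch_ref X \<A> K m cs Ls ix g q"
proof -
  obtain m cs Ls ix where "mfd_patch X \<A> K m cs Ls ix" using ex_patch[OF assms(1)] by blast
  then have "mfd_patch_ref X \<A> K m cs Ls ix g q"
    by (simp add: mfd_patch_ref_def mfd_patch_ref_axioms_def assms(2))
  then show thesis by (rule that)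
qed

end

lemma theta_density_add: "theta_density G H (k + k') = theta_density G H k + theta_density G H k'"
  by (simp add: theta_density_def matrix_mult.add_right matrix_mult.add_left trace_add distrib_left)

lemma trace_scaleR: "trace (r *\<^sub>R A) = r * trace (A :: real^'n::finite^'n)"
  by (simp add: trace_def sum_distrib_left)

lemma theta_density_scaleR: "theta_density G H (r *\<^sub>R k) = r * theta_density G H k"
  by (simp add: theta_density_def matrix_mult.scaleR_right matrix_mult.scaleR_left trace_scaleR)

lemma omega_density_add:
  "omega_density G H (k + k', l + l') w = omega_density G H (k, l) w + omega_density G H (k', l') w"
  by (cases w) (simp add: omega_density_def matrix_mult.add_right matrix_mult.add_left trace_add algebra_simps add_divide_distrib)

lemma omega_density_scaleR:
  "omega_density G H (r *\<^sub>R k, r *\<^sub>R l) w = r * omega_density G H (k, l) w"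
  by (cases w) (simp add: omega_density_def matrix_mult.scaleR_right matrix_mult.scaleR_left trace_scaleR algebra_simps)

lemma omega_density_swap: "omega_density G H v w = - omega_density G H w v"
  by (cases v; cases w) (simp add: omega_density_def algebra_simps)

context mfd_patch_ref
begin

abbreviation TK :: "(('a, 'n) tensor2 \<times> ('a, 'n) tensor2) set" where
  "TK \<equiv> sym2_fields_on \<A> K \<times> sym2_fields_on \<A> K"

definition R2 :: "('a, 'n) tensor2 \<times> ('a, 'n) tensor2 \<Rightarrow> 'a \<Rightarrow> (real^'n^'n) \<times> (real^'n^'n)" where
  "R2 v p = (R (fst v) p, R (snd v) p)"

lemma sym2_fields_on_subset: "k \<in> sym2_fields_on \<A> K \<Longrightarrow> k \<in> sym2_fields \<A>"
  by (simp add: sym2_fields_on_def)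

lemma sym2_fields_on_0: "k \<in> sym2_fields_on \<A> K \<Longrightarrow> p \<notin> K \<Longrightarrow> k c p = 0"
  unfolding sym2_fields_on_def by blast

lemma Met_mw_sym2:
  "x \<in> Met_mw X \<A> q \<Longrightarrow> fst x \<in> sym2_fields \<A>" "x \<in> Met_mw X \<A> q \<Longrightarrow> snd x \<in> sym2_fields \<A>"
  using Met_sym2_fields sym2_fields_c_subset by (auto simp: Met_mw_iff)

lemma tr_zero [simp]: "trace (0 :: real^'n^'n) = 0"
  by (simp add: trace_def)

text \<open>The support of \<open>v\<close> confines the integral to \<open>K\<close>, where the
  chart independence of the traces allows all data to be expressed by \<open>R\<close> and the
  reference measure.\<close>

lemma Theta_integral:
  assumes x: "x \<in> Met_mw X \<A> q" and v: "v \<in> TK"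
  shows "Theta X \<A> x v = (\<integral>p. theta_density (R (fst x) p) (R (snd x) p) (R (fst v) p) \<partial>ref)"
proof -
  obtain g h k l where eq: "x = (g, h)" "v = (k, l)" by (cases x; cases v)
  have g: "g \<in> Met \<A> q" using x by (simp add: eq Met_mw_iff)
  note s = Met_mw_sym2[OF x, unfolded eq fst_conv snd_conv]
  have k: "k \<in> sym2_fields_on \<A> K" "k \<in> sym2_fields \<A>" using v sym2_fields_on_subset by (auto simp: eq)
  let ?T = "\<lambda>p. trace (matrix_inv (R g p) ** R k p ** (matrix_inv (R g p) ** R h p))"
  have tr: "tr2 \<A> g k h p = ?T p" if "p \<in> K" for p
    using tr2_chart[OF g k(2) s(2) cs_in[OF that] ix_chart[OF that]] by (simp add: R_def)
  have "?T \<in> borel_measurable ref"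
    using R_invertible[OF g] s k
    by (intro trace_measurable matrix_mult_measurable matrix_inv_measurable R_measurable_ref) (auto simp: space_ref)
  then have meas: "tr2 \<A> g k h \<in> borel_measurable ref"
    by (rule iffD1[OF measurable_cong, rotated]) (simp add: tr space_ref)
  have "tr2 \<A> g k h p = 0" if "p \<notin> K" for p
    using sym2_fields_on_0[OF k(1) that] by (simp add: tr2_def Let_def)
  then have "Theta X \<A> x v = (\<integral>p. sqrt \<bar>det (R g p)\<bar> * tr2 \<A> g k h p \<partial>ref)"
    unfolding Theta_def eq prod.case by (intro integral_metric_measure s meas)
  also have "\<dots> = (\<integral>p. theta_density (R g p) (R h p) (R k p) \<partial>ref)"
    by (intro Bochner_Integration.integral_cong refl) (simp add: space_ref tr theta_density_def)
  finally show ?thesis by (simp add: eq)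
qed

lemma Omega_integral:
  assumes x: "x \<in> Met_mw X \<A> q" and v: "v \<in> TK" and w: "w \<in> TK"
  shows "Omega X \<A> x v w = (\<integral>p. omega_density (R (fst x) p) (R (snd x) p) (R2 v p) (R2 w p) \<partial>ref)"
proof -
  obtain g h k\<^sub>1 l\<^sub>1 k\<^sub>2 l\<^sub>2 where eq: "x = (g, h)" "v = (k\<^sub>1, l\<^sub>1)" "w = (k\<^sub>2, l\<^sub>2)" by (cases x; cases v; cases w)
  have g: "g \<in> Met \<A> q" using x by (simp add: eq Met_mw_iff)
  note s = Met_mw_sym2[OF x, unfolded eq fst_conv snd_conv]
  have k: "k\<^sub>1 \<in> sym2_fields_on \<A> K" "l\<^sub>1 \<in> sym2_fields_on \<A> K" "k\<^sub>2 \<in> sym2_fields_on \<A> K" "l\<^sub>2 \<in> sym2_fields_on \<A> K"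
    using v w by (auto simp: eq)
  note k' = k[THEN sym2_fields_on_subset]
  let ?F = "\<lambda>p. 1/2 * (tr2 \<A> g k\<^sub>1 h p * tr1 \<A> g k\<^sub>2 p - tr2 \<A> g k\<^sub>2 h p * tr1 \<A> g k\<^sub>1 p)
           + tr2 \<A> g k\<^sub>1 l\<^sub>2 p - tr2 \<A> g k\<^sub>2 l\<^sub>1 p"
  let ?T2 = "\<lambda>k h p. trace (matrix_inv (R g p) ** R k p ** (matrix_inv (R g p) ** R h p))"
  let ?T1 = "\<lambda>k p. trace (matrix_inv (R g p) ** R k p)"
  let ?T = "\<lambda>p. 1/2 * (?T2 k\<^sub>1 h p * ?T1 k\<^sub>2 p - ?T2 k\<^sub>2 h p * ?T1 k\<^sub>1 p) + ?T2 k\<^sub>1 l\<^sub>2 p - ?T2 k\<^sub>2 l\<^sub>1 p"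
  have t2: "tr2 \<A> g k h p = ?T2 k h p" if "p \<in> K" "k \<in> sym2_fields \<A>" "h \<in> sym2_fields \<A>" for p k h
    using tr2_chart[OF g that(2,3) cs_in[OF that(1)] ix_chart[OF that(1)]] by (simp add: R_def)
  have t1: "tr1 \<A> g k p = ?T1 k p" if "p \<in> K" "k \<in> sym2_fields \<A>" for p k
    using tr1_chart[OF g that(2) cs_in[OF that(1)] ix_chart[OF that(1)]] by (simp add: R_def)
  have tr: "?F p = ?T p" if "p \<in> K" for p
    using that k' s by (simp only: t1 t2)
  have "?T \<in> borel_measurable ref"
    using R_invertible[OF g] s k'
    by (intro borel_measurable_times borel_measurable_add borel_measurable_diff borel_measurable_const
        trace_measurable matrix_mult_measurable matrix_inv_measurable R_measurable_ref) (auto simp: space_ref)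
  then have meas: "?F \<in> borel_measurable ref"
    by (rule iffD1[OF measurable_cong, rotated]) (simp only: tr space_ref)
  have z: "?F p = 0" if "p \<notin> K" for p
    using k[THEN sym2_fields_on_0, OF that] by (simp add: tr1_def tr2_def Let_def)
  have "Omega X \<A> x v w = (\<integral>p. sqrt \<bar>det (R g p)\<bar> * ?F p \<partial>ref)"
    unfolding Omega_def eq prod.case by (intro integral_metric_measure s meas z)
  also have "\<dots> = (\<integral>p. omega_density (R g p) (R h p) (R k\<^sub>1 p, R l\<^sub>1 p) (R k\<^sub>2 p, R l\<^sub>2 p) \<partial>ref)"
    by (intro Bochner_Integration.integral_cong refl) (simp only: space_ref tr omega_density_def prod.case)
  finally show ?thesis by (simp add: eq R2_def)
qed

lemma integrable_bounded_ref:
  fixes F :: "'a \<Rightarrow> real"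
  assumes "F \<in> borel_measurable ref" "bounded (F ` K)"
  shows "integrable ref F"
proof -
  interpret finite_measure ref by (rule finite_ref)
  obtain C where "\<And>p. p \<in> K \<Longrightarrow> norm (F p) \<le> C" using assms(2) by (auto simp: bounded_iff)
  then show ?thesis using assms(1) by (intro integrable_const_bound[of _ C]) (auto simp: space_ref)
qed

lemma theta_bounded:
  assumes x: "x \<in> Met_mw X \<A> q" and k: "k \<in> sym2_fields \<A>"
  shows "bounded ((\<lambda>p. theta_density (R (fst x) p) (R (snd x) p) (R k p)) ` K)"
proof -
  have g: "fst x \<in> Met \<A> q" using x by (simp add: Met_mw_iff)
  have "unif_C 0 K (\<lambda>t p. theta_density (R (fst x) p) (R (snd x) p) (R k p))"
    using R_invertible[OF g]
    by (intro unif_C_theta_density unif_C_const R_bounded R_inv_bounded[OF g] Met_mw_sym2 x k)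
  then show ?thesis by simp
qed

lemma theta_integrable:
  assumes x: "x \<in> Met_mw X \<A> q" and k: "k \<in> sym2_fields \<A>"
  shows "integrable ref (\<lambda>p. theta_density (R (fst x) p) (R (snd x) p) (R k p))"
proof (rule integrable_bounded_ref[OF _ theta_bounded[OF x k]])
  have g: "fst x \<in> Met \<A> q" using x by (simp add: Met_mw_iff)
  show "(\<lambda>p. theta_density (R (fst x) p) (R (snd x) p) (R k p)) \<in> borel_measurable ref"
    using R_invertible[OF g] by (intro theta_density_measurable R_measurable_ref Met_mw_sym2 x k) (simp add: space_ref)
qed

lemma omega_bounded:
  assumes x: "x \<in> Met_mw X \<A> q" and vw: "v \<in> TK" "w \<in> TK"
  shows "bounded ((\<lambda>p. omega_density (R (fst x) p) (R (snd x) p) (R2 v p) (R2 w p)) ` K)"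
  unfolding R2_def
proof -
  have g: "fst x \<in> Met \<A> q" using x by (simp add: Met_mw_iff)
  have vw': "fst v \<in> sym2_fields \<A>" "snd v \<in> sym2_fields \<A>" "fst w \<in> sym2_fields \<A>" "snd w \<in> sym2_fields \<A>"
    using vw sym2_fields_on_subset by auto
  have "unif_C 0 K (\<lambda>t p. omega_density (R (fst x) p) (R (snd x) p) (R (fst v) p, R (snd v) p) (R (fst w) p, R (snd w) p))"
    using R_invertible[OF g]
    by (intro unif_C_omega_density unif_C_const R_bounded R_inv_bounded[OF g] Met_mw_sym2 x vw')
  then show "bounded ((\<lambda>p. omega_density (R (fst x) p) (R (snd x) p) (R (fst v) p, R (snd v) p) (R (fst w) p, R (snd w) p)) ` K)"
    by simp
qed

lemma omega_integrable:
  assumes x: "x \<in> Met_mw X \<A> q" and vw: "v \<in> TK" "w \<in> TK"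
  shows "integrable ref (\<lambda>p. omega_density (R (fst x) p) (R (snd x) p) (R2 v p) (R2 w p))"
proof (rule integrable_bounded_ref[OF _ omega_bounded[OF x vw]])
  have g: "fst x \<in> Met \<A> q" using x by (simp add: Met_mw_iff)
  have vw': "fst v \<in> sym2_fields \<A>" "snd v \<in> sym2_fields \<A>" "fst w \<in> sym2_fields \<A>" "snd w \<in> sym2_fields \<A>"
    using vw sym2_fields_on_subset by auto
  show "(\<lambda>p. omega_density (R (fst x) p) (R (snd x) p) (R2 v p) (R2 w p)) \<in> borel_measurable ref"
    unfolding R2_def using R_invertible[OF g]
    by (intro omega_density_measurable R_measurable_ref Met_mw_sym2 x vw') (simp add: space_ref)
qed

lemma TK_add: "v \<in> TK \<Longrightarrow> w \<in> TK \<Longrightarrow> v + w \<in> TK"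
  by (auto simp: sym2_fields_on_add)

lemma TK_scaleR: "v \<in> TK \<Longrightarrow> r *\<^sub>R v \<in> TK"
  by (auto simp: sym2_fields_on_scaleR)

lemma Theta_add:
  assumes "x \<in> Met_mw X \<A> q" "v \<in> TK" "w \<in> TK"
  shows "Theta X \<A> x (v + w) = Theta X \<A> x v + Theta X \<A> x w"
proof -
  have "fst v \<in> sym2_fields \<A>" "fst w \<in> sym2_fields \<A>" using assms sym2_fields_on_subset by auto
  then show ?thesis
    unfolding Theta_integral[OF assms(1) TK_add[OF assms(2,3)]] Theta_integral[OF assms(1,2)] Theta_integral[OF assms(1,3)]
    using theta_integrable[OF assms(1)]
    by (simp add: fst_add R_add theta_density_add)
qed

lemma Theta_scaleR:
  assumes "x \<in> Met_mw X \<A> q" "v \<in> TK"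
  shows "Theta X \<A> x (r *\<^sub>R v) = r * Theta X \<A> x v"
  unfolding Theta_integral[OF assms(1) TK_scaleR[OF assms(2)]] Theta_integral[OF assms(1,2)]
  by (simp add: fst_scaleR R_scaleR theta_density_scaleR)

lemma Omega_swap:
  assumes "x \<in> Met_mw X \<A> q" "v \<in> TK" "w \<in> TK"
  shows "Omega X \<A> x v w = - Omega X \<A> x w v"
  unfolding Omega_integral[OF assms(1,2,3)] Omega_integral[OF assms(1,3,2)]
  by (subst omega_density_swap) simp

lemma Omega_add:
  assumes "x \<in> Met_mw X \<A> q" "v \<in> TK" "v' \<in> TK" "w \<in> TK"
  shows "Omega X \<A> x (v + v') w = Omega X \<A> x v w + Omega X \<A> x v' w"
proof -
  have "omega_density G H (R2 (v + v') p) z = omega_density G H (R2 v p) z + omega_density G H (R2 v' p) z" for G H p z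
    by (simp add: R2_def fst_add snd_add R_add omega_density_add)
  then show ?thesis
    unfolding Omega_integral[OF assms(1) TK_add[OF assms(2,3)] assms(4)] Omega_integral[OF assms(1,2,4)]
      Omega_integral[OF assms(1,3,4)]
    using omega_integrable[OF assms(1)] assms by simp
qed

lemma Omega_scaleR:
  assumes "x \<in> Met_mw X \<A> q" "v \<in> TK" "w \<in> TK"
  shows "Omega X \<A> x (r *\<^sub>R v) w = r * Omega X \<A> x v w"
proof -
  have "omega_density G H (R2 (r *\<^sub>R v) p) z = r * omega_density G H (R2 v p) z" for G H p z
    by (simp add: R2_def fst_scaleR snd_scaleR R_scaleR omega_density_scaleR)
  then show ?thesis
    unfolding Omega_integral[OF assms(1) TK_scaleR[OF assms(2)] assms(3)] Omega_integral[OF assms] by simp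
qed

lemma R_bounded_pairs:
  assumes "lcs_bounded TE B"
  shows "bounded ((\<lambda>z. R (fst (snd z)) (fst z)) ` (K \<times> B))" "bounded ((\<lambda>z. R (snd (snd z)) (fst z)) ` (K \<times> B))"
  using bounded_image_reindex[OF R_bounded_set[OF TE_boundedD(1)[OF assms]], of "\<lambda>z. (fst z, fst (snd z))" "K \<times> B"]
    bounded_image_reindex[OF R_bounded_set[OF TE_boundedD(2)[OF assms]], of "\<lambda>z. (fst z, snd (snd z))" "K \<times> B"]
  by (auto simp: image_subset_iff)

text \<open>Pairs of a point of \<open>K\<close> and a tangent vector of \<open>B\<close> form one
  index set. The curve depends on the first component, the tangent vector is constant in time, and
  the integral removes the point.\<close>

lemma unif_C_Theta:
  assumes \<gamma>: "smooth_curve_in (Met_mw X \<A> q) TE \<gamma>" and B: "lcs_bounded TE B" "B \<subseteq> TK"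
  shows "unif_C n B (\<lambda>t v. Theta X \<A> (\<gamma> t) v)"
proof -
  have x: "\<gamma> t \<in> Met_mw X \<A> q" for t using \<gamma> by (simp add: smooth_curve_in_def)
  have g: "fst (\<gamma> t) \<in> Met \<A> q" for t using x[of t] by (simp add: Met_mw_iff)
  let ?F = "\<lambda>t z. theta_density (R (fst (\<gamma> t)) (fst z)) (R (snd (\<gamma> t)) (fst z)) (R (fst (snd z)) (fst z))"
  have "unif_C n (space ref \<times> B) ?F"
    unfolding space_ref
  proof (rule unif_C_theta_density)
    show "unif_C n (K \<times> B) (\<lambda>t z. R (fst (\<gamma> t)) (fst z))" "unif_C n (K \<times> B) (\<lambda>t z. R (snd (\<gamma> t)) (fst z))"
      by (rule unif_C_reindex[where \<pi> = fst, OF unif_C_curve(1)[OF \<gamma>]], auto)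
         (rule unif_C_reindex[where \<pi> = fst, OF unif_C_curve(2)[OF \<gamma>]], auto)
    show "bounded ((\<lambda>z. matrix_inv (R (fst (\<gamma> t)) (fst z))) ` (K \<times> B))" for t
      using bounded_image_reindex[OF R_inv_bounded[OF g], of fst "K \<times> B" t] by auto
    show "invertible (R (fst (\<gamma> t)) (fst z))" if "z \<in> K \<times> B" for t z
      using that R_invertible[OF g] by auto
    show "unif_C n (K \<times> B) (\<lambda>t z. R (fst (snd z)) (fst z))"
      by (intro unif_C_const R_bounded_pairs B)
  qed
  then have "unif_C n B (\<lambda>t v. \<integral>p. ?F t (p, v) \<partial>ref)"
  proof (rule unif_C_integral[OF finite_ref])
    fix t v assume v: "v \<in> B"
    then have "fst v \<in> sym2_fields \<A>" using B(2) sym2_fields_on_subset by auto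
    then show "(\<lambda>p. ?F t (p, v)) \<in> borel_measurable ref"
      using borel_measurable_integrable[OF theta_integrable[OF x]] by simp
  qed
  then show ?thesis
  proof (rule iffD1[OF unif_C_cong, rotated])
    fix t v assume "v \<in> B"
    then show "(\<integral>p. ?F t (p, v) \<partial>ref) = Theta X \<A> (\<gamma> t) v"
      using Theta_integral[OF x, of v t] B(2) by auto
  qed
qed

lemma unif_C_Omega:
  assumes \<gamma>: "smooth_curve_in (Met_mw X \<A> q) TE \<gamma>" and B: "lcs_bounded TE B" "B \<subseteq> TK"
  shows "unif_C n (B \<times> B) (\<lambda>t (v, w). Omega X \<A> (\<gamma> t) v w)"
proof -
  have x: "\<gamma> t \<in> Met_mw X \<A> q" for t using \<gamma> by (simp add: smooth_curve_in_def)
  have g: "fst (\<gamma> t) \<in> Met \<A> q" for t using x[of t] by (simp add: Met_mw_iff)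
  let ?B = "K \<times> (B \<times> B)"
  let ?F = "\<lambda>t z. omega_density (R (fst (\<gamma> t)) (fst z)) (R (snd (\<gamma> t)) (fst z))
     (R (fst (fst (snd z))) (fst z), R (snd (fst (snd z))) (fst z))
     (R (fst (snd (snd z))) (fst z), R (snd (snd (snd z))) (fst z))"
  have "unif_C n (space ref \<times> (B \<times> B)) ?F"
    unfolding space_ref
  proof (rule unif_C_omega_density)
    show "unif_C n ?B (\<lambda>t z. R (fst (\<gamma> t)) (fst z))" "unif_C n ?B (\<lambda>t z. R (snd (\<gamma> t)) (fst z))"
      by (rule unif_C_reindex[where \<pi> = fst, OF unif_C_curve(1)[OF \<gamma>]], auto)
         (rule unif_C_reindex[where \<pi> = fst, OF unif_C_curve(2)[OF \<gamma>]], auto)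
    show "bounded ((\<lambda>z. matrix_inv (R (fst (\<gamma> t)) (fst z))) ` ?B)" for t
      using bounded_image_reindex[OF R_inv_bounded[OF g], of fst ?B t] by auto
    show "invertible (R (fst (\<gamma> t)) (fst z))" if "z \<in> ?B" for t z
      using that R_invertible[OF g] by auto
    show "unif_C n ?B (\<lambda>t z. R (fst (fst (snd z))) (fst z))"
      using bounded_image_reindex[OF R_bounded_pairs(1)[OF B(1)], of "\<lambda>z. (fst z, fst (snd z))" ?B]
      by (intro unif_C_const) (force simp: image_subset_iff)
    show "unif_C n ?B (\<lambda>t z. R (snd (fst (snd z))) (fst z))"
      using bounded_image_reindex[OF R_bounded_pairs(2)[OF B(1)], of "\<lambda>z. (fst z, fst (snd z))" ?B]
      by (intro unif_C_const) (force simp: image_subset_iff)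
    show "unif_C n ?B (\<lambda>t z. R (fst (snd (snd z))) (fst z))"
      using bounded_image_reindex[OF R_bounded_pairs(1)[OF B(1)], of "\<lambda>z. (fst z, snd (snd z))" ?B]
      by (intro unif_C_const) (force simp: image_subset_iff)
    show "unif_C n ?B (\<lambda>t z. R (snd (snd (snd z))) (fst z))"
      using bounded_image_reindex[OF R_bounded_pairs(2)[OF B(1)], of "\<lambda>z. (fst z, snd (snd z))" ?B]
      by (intro unif_C_const) (force simp: image_subset_iff)
  qed
  then have "unif_C n (B \<times> B) (\<lambda>t vw. \<integral>p. ?F t (p, vw) \<partial>ref)"
  proof (rule unif_C_integral[OF finite_ref])
    fix t vw assume v: "vw \<in> B \<times> B"
    then have "fst vw \<in> TK" "snd vw \<in> TK" using B(2) by auto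
    then show "(\<lambda>p. ?F t (p, vw)) \<in> borel_measurable ref"
      using borel_measurable_integrable[OF omega_integrable[OF x, of "fst vw" "snd vw" t]]
      by (simp add: R2_def)
  qed
  then show ?thesis
  proof (rule iffD1[OF unif_C_cong, rotated])
    fix t vw assume "vw \<in> B \<times> B"
    then have "fst vw \<in> TK" "snd vw \<in> TK" using B(2) by auto
    then show "(\<integral>p. ?F t (p, vw) \<partial>ref) = (case vw of (v, w) \<Rightarrow> Omega X \<A> (\<gamma> t) v w)"
      using Omega_integral[OF x, of "fst vw" "snd vw" t] by (simp add: R2_def case_prod_beta)
  qed
qed

end

context smooth_mfd
begin

lemma TE_support:
  assumes "finite V" "V \<subseteq> fst TE"
  obtains K where "compactin X K" "V \<subseteq> sym2_fields_on \<A> K \<times> sym2_fields_on \<A> K"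
  using TE_bounded_support[OF lcs_bounded_finite[OF assms]] by blast

text \<open>Each identity involves finitely many tangent vectors; a patch containing their supports
  reduces it to linearity of the integrand.\<close>

lemma Theta_linear:
  assumes "x \<in> Met_mw X \<A> q"
  shows "linear_form_on (fst TE) (Theta X \<A> x)"
  unfolding linear_form_on_def
proof (intro conjI ballI allI)
  have g: "fst x \<in> Met \<A> q" using assms by (simp add: Met_mw_iff)
  show "Theta X \<A> x (v + w) = Theta X \<A> x v + Theta X \<A> x w" if vw: "v \<in> fst TE" "w \<in> fst TE" for v w
  proof -
    obtain K where K: "compactin X K" "{v, w} \<subseteq> sym2_fields_on \<A> K \<times> sym2_fields_on \<A> K"
      using TE_support[of "{v, w}"] vw by auto
    obtain m cs Ls ix where "mfd_patch_ref X \<A> K m cs Ls ix (fst x) q" using ex_patch_ref[OF K(1) g] .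
    then interpret mfd_patch_ref X \<A> K m cs Ls ix "fst x" q .
    show ?thesis using K(2) by (intro Theta_add assms) auto
  qed
  show "Theta X \<A> x (r *\<^sub>R v) = r * Theta X \<A> x v" if v: "v \<in> fst TE" for r v
  proof -
    obtain K where K: "compactin X K" "{v} \<subseteq> sym2_fields_on \<A> K \<times> sym2_fields_on \<A> K"
      using TE_support[of "{v}"] v by auto
    obtain m cs Ls ix where "mfd_patch_ref X \<A> K m cs Ls ix (fst x) q" using ex_patch_ref[OF K(1) g] .
    then interpret mfd_patch_ref X \<A> K m cs Ls ix "fst x" q .
    show ?thesis using K(2) by (intro Theta_scaleR assms) auto
  qed
qed

lemma Omega_antisym:
  assumes x: "x \<in> Met_mw X \<A> q" and vw: "v \<in> fst TE" "w \<in> fst TE"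
  shows "Omega X \<A> x v w = - Omega X \<A> x w v"
proof -
  have g: "fst x \<in> Met \<A> q" using x by (simp add: Met_mw_iff)
  obtain K where K: "compactin X K" "{v, w} \<subseteq> sym2_fields_on \<A> K \<times> sym2_fields_on \<A> K"
    using TE_support[of "{v, w}"] vw by auto
  obtain m cs Ls ix where "mfd_patch_ref X \<A> K m cs Ls ix (fst x) q" using ex_patch_ref[OF K(1) g] .
  then interpret mfd_patch_ref X \<A> K m cs Ls ix "fst x" q .
  show ?thesis using K(2) by (intro Omega_swap x) auto
qed

lemma Omega_linear:
  assumes x: "x \<in> Met_mw X \<A> q" and w: "w \<in> fst TE"
  shows "linear_form_on (fst TE) (\<lambda>v. Omega X \<A> x v w)"
  unfolding linear_form_on_def
proof (intro conjI ballI allI)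
  have g: "fst x \<in> Met \<A> q" using x by (simp add: Met_mw_iff)
  show "Omega X \<A> x (v + v') w = Omega X \<A> x v w + Omega X \<A> x v' w" if v: "v \<in> fst TE" "v' \<in> fst TE" for v v'
  proof -
    obtain K where K: "compactin X K" "{v, v', w} \<subseteq> sym2_fields_on \<A> K \<times> sym2_fields_on \<A> K"
      using TE_support[of "{v, v', w}"] v w by auto
    obtain m cs Ls ix where "mfd_patch_ref X \<A> K m cs Ls ix (fst x) q" using ex_patch_ref[OF K(1) g] .
    then interpret mfd_patch_ref X \<A> K m cs Ls ix "fst x" q .
    show ?thesis using K(2) by (intro Omega_add x) auto
  qed
  show "Omega X \<A> x (r *\<^sub>R v) w = r * Omega X \<A> x v w" if v: "v \<in> fst TE" for r v
  proof -
    obtain K where K: "compactin X K" "{v, w} \<subseteq> sym2_fields_on \<A> K \<times> sym2_fields_on \<A> K"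
      using TE_support[of "{v, w}"] v w by auto
    obtain m cs Ls ix where "mfd_patch_ref X \<A> K m cs Ls ix (fst x) q" using ex_patch_ref[OF K(1) g] .
    then interpret mfd_patch_ref X \<A> K m cs Ls ix "fst x" q .
    show ?thesis using K(2) by (intro Omega_scaleR x) auto
  qed
qed

lemma Omega_linear2:
  assumes x: "x \<in> Met_mw X \<A> q" and v: "v \<in> fst TE"
  shows "linear_form_on (fst TE) (\<lambda>w. Omega X \<A> x v w)"
  using Omega_linear[OF x v] Omega_antisym[OF x v] TE_add TE_scaleR
  unfolding linear_form_on_def by simp

text \<open>The factor \<open>r\<close> allows one argument to serve both \<Theta> and the primitive
  - \<Theta> of \<Omega>.\<close>

lemma one_form_smult_Theta: "one_form (Met_mw X \<A> q) TE (\<lambda>x v. r * Theta X \<A> x v)"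
  unfolding one_form_def smooth_map_def
proof (intro allI impI)
  fix \<gamma> assume \<gamma>: "smooth_curve_in (Met_mw X \<A> q) TE \<gamma>"
  then have x: "\<gamma> t \<in> Met_mw X \<A> q" for t by (simp add: smooth_curve_in_def)
  have g: "fst (\<gamma> 0) \<in> Met \<A> q" using x[of 0] by (simp add: Met_mw_iff)
  have U: "unif_C n B (\<lambda>t v. r * Theta X \<A> (\<gamma> t) v)" if B: "lcs_bounded TE B" for B n
  proof -
    obtain K where K: "compactin X K" "B \<subseteq> sym2_fields_on \<A> K \<times> sym2_fields_on \<A> K"
      using TE_bounded_support[OF B] .
    obtain m cs Ls ix where "mfd_patch_ref X \<A> K m cs Ls ix (fst (\<gamma> 0)) q" using ex_patch_ref[OF K(1) g] .
    then interpret mfd_patch_ref X \<A> K m cs Ls ix "fst (\<gamma> 0)" q .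
    show ?thesis by (intro unif_C_linear[OF bounded_linear_mult_right] unif_C_Theta \<gamma> B K)
  qed
  show "smooth_curve (bounded_forms1 TE) (\<lambda>t v. r * Theta X \<A> (\<gamma> t) v)"
  proof (rule smooth_curve_forms1)
    show "(\<lambda>v. r * Theta X \<A> (\<gamma> t) v) \<in> fst (bounded_forms1 TE)" for t
      using Theta_linear[OF x[of t]] unif_C_bounded[OF U[where n = 0], where t = t]
      by (auto simp: bounded_forms1_def linear_form_on_def algebra_simps)
  qed (use U TE_add TE_scaleR in auto)
qed

lemma two_form_Omega: "two_form (Met_mw X \<A> q) TE (Omega X \<A>)"
  unfolding two_form_def smooth_map_def
proof (intro allI impI)
  fix \<gamma> assume \<gamma>: "smooth_curve_in (Met_mw X \<A> q) TE \<gamma>"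
  then have x: "\<gamma> t \<in> Met_mw X \<A> q" for t by (simp add: smooth_curve_in_def)
  have g: "fst (\<gamma> 0) \<in> Met \<A> q" using x[of 0] by (simp add: Met_mw_iff)
  have U: "unif_C n (B \<times> B) (\<lambda>t (v, w). Omega X \<A> (\<gamma> t) v w)" if B: "lcs_bounded TE B" for B n
  proof -
    obtain K where K: "compactin X K" "B \<subseteq> sym2_fields_on \<A> K \<times> sym2_fields_on \<A> K"
      using TE_bounded_support[OF B] .
    obtain m cs Ls ix where "mfd_patch_ref X \<A> K m cs Ls ix (fst (\<gamma> 0)) q" using ex_patch_ref[OF K(1) g] .
    then interpret mfd_patch_ref X \<A> K m cs Ls ix "fst (\<gamma> 0)" q .
    show ?thesis by (intro unif_C_Omega \<gamma> B K)
  qed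
  show "smooth_curve (bounded_forms2 TE) (\<lambda>t. Omega X \<A> (\<gamma> t))"
  proof (rule smooth_curve_forms2)
    show "Omega X \<A> (\<gamma> t) \<in> fst (bounded_forms2 TE)" for t
    proof -
      have "Omega X \<A> (\<gamma> t) v v = 0" if "v \<in> fst TE" for v
        using Omega_antisym[OF x that that, of t] by simp
      then show ?thesis
        using Omega_linear[OF x[of t]] Omega_linear2[OF x[of t]] unif_C_bounded[OF U[where n = 0], where t = t]
        by (simp add: bounded_forms2_def)
    qed
  qed (use U TE_add TE_scaleR in auto)
qed

end

subsection \<open>First variations\<close>

text \<open>The derivative bundled with the bounds that the product rule asks for, so that the rules
  can be nested without collecting side conditions.\<close>

definition unif_deriv_bd ::
    "'x set \<Rightarrow> (real \<Rightarrow> 'x \<Rightarrow> 'b::real_normed_vector) \<Rightarrow> ('x \<Rightarrow> 'b) \<Rightarrow> real \<Rightarrow> bool" where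
  "unif_deriv_bd S f f' t \<longleftrightarrow> has_unif_deriv S f f' t \<and> bounded (f t ` S) \<and> bounded (f' ` S)"

lemma unif_deriv_bd_bilinear:
  assumes "bounded_bilinear bl" "unif_deriv_bd S f f' t" "unif_deriv_bd S g g' t"
  shows "unif_deriv_bd S (\<lambda>s x. bl (f s x) (g s x)) (\<lambda>x. bl (f t x) (g' x) + bl (f' x) (g t x)) t"
  using assms unfolding unif_deriv_bd_def
  by (auto intro!: bounded_bilinear.has_unif_deriv[OF assms(1)] bounded_image_bilinear[OF assms(1)] bounded_image_add)

lemma unif_deriv_bd_linear:
  assumes "bounded_linear h" "unif_deriv_bd S f f' t"
  shows "unif_deriv_bd S (\<lambda>s x. h (f s x)) (\<lambda>x. h (f' x)) t"
  using assms unfolding unif_deriv_bd_def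
  by (auto intro!: bounded_linear.has_unif_deriv[OF assms(1)] bounded_image_linear[OF assms(1)])

lemma unif_deriv_bd_add:
  "unif_deriv_bd S f f' t \<Longrightarrow> unif_deriv_bd S g g' t \<Longrightarrow>
    unif_deriv_bd S (\<lambda>s x. f s x + g s x) (\<lambda>x. f' x + g' x) t"
  unfolding unif_deriv_bd_def by (auto intro!: has_unif_deriv_add bounded_image_add)

lemma unif_deriv_bd_diff:
  assumes "unif_deriv_bd S f f' t" "unif_deriv_bd S g g' t"
  shows "unif_deriv_bd S (\<lambda>s x. f s x - g s x) (\<lambda>x. f' x - g' x) t"
  using unif_deriv_bd_add[OF assms(1) unif_deriv_bd_linear[OF bounded_linear_minus[OF bounded_linear_ident] assms(2)]]
  by simp

lemma unif_deriv_bd_eq: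
  assumes "unif_deriv_bd S f f' t" "\<And>x. x \<in> S \<Longrightarrow> f' x = f'' x"
  shows "unif_deriv_bd S f f'' t"
proof -
  have "f'' ` S = f' ` S" using assms(2) by (auto simp: image_iff)
  moreover have "has_unif_deriv S f f'' t"
    using assms(1) has_unif_deriv_cong[of S f f f' f'' t] assms(2) by (simp add: unif_deriv_bd_def)
  ultimately show ?thesis using assms(1) by (simp add: unif_deriv_bd_def)
qed

lemma has_unif_deriv_affine: "has_unif_deriv S (\<lambda>s x. a x + s *\<^sub>R b x) b t"
proof -
  have "uniform_limit S (\<lambda>s. b) b (at (0::real))" by (rule uniform_limit_const)
  then show ?thesis
    unfolding has_unif_deriv_def
    by (rule iffD1[OF uniform_limit_cong, rotated -1])
       (auto simp: eventually_at algebra_simps intro!: exI[of _ 1])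
qed

context
  fixes S :: "'x set" and G :: "real \<Rightarrow> 'x \<Rightarrow> real^'n::finite^'n" and G' t
  assumes G: "unif_deriv_bd S G G' t" and b: "bounded ((\<lambda>x. matrix_inv (G t x)) ` S)"
    and inv: "\<exists>e>0. \<forall>s x. \<bar>s - t\<bar> < e \<longrightarrow> x \<in> S \<longrightarrow> invertible (G s x)"
begin

text \<open>The derivative of g^-1 k is g^-1 k' - (g^-1 g')(g^-1 k). It again involves mixed
  endomorphisms only, the form in which the trace identities are stated.\<close>

lemma unif_deriv_bd_mixed:
  assumes k: "unif_deriv_bd S k k' t"
  shows "unif_deriv_bd S (\<lambda>s x. matrix_inv (G s x) ** k s x)
    (\<lambda>x. matrix_inv (G t x) ** k' x - (matrix_inv (G t x) ** G' x) ** (matrix_inv (G t x) ** k t x)) t"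
proof -
  obtain e where e: "0 < e" "\<And>s x. \<bar>s - t\<bar> < e \<Longrightarrow> x \<in> S \<Longrightarrow> invertible (G s x)" using inv by blast
  have "has_unif_deriv S (\<lambda>s x. matrix_inv (G s x)) (\<lambda>x. - (matrix_inv (G t x) ** G' x ** matrix_inv (G t x))) t"
    using G b e by (intro has_unif_deriv_matrix_inv) (auto simp: unif_deriv_bd_def)
  moreover have "bounded ((\<lambda>x. - (matrix_inv (G t x) ** G' x ** matrix_inv (G t x))) ` S)"
    using G b
    by (intro bounded_image_linear[OF bounded_linear_minus[OF bounded_linear_ident]]
        bounded_image_bilinear[OF bounded_bilinear_matrix_mult]) (auto simp: unif_deriv_bd_def)
  ultimately have "unif_deriv_bd S (\<lambda>s x. matrix_inv (G s x))
      (\<lambda>x. - (matrix_inv (G t x) ** G' x ** matrix_inv (G t x))) t"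
    using b by (simp add: unif_deriv_bd_def)
  from unif_deriv_bd_bilinear[OF bounded_bilinear_matrix_mult this k] show ?thesis
    by (rule unif_deriv_bd_eq) (simp add: matrix_mult.minus_left matrix_mul_assoc)
qed

lemma unif_deriv_bd_sqrt_det:
  "unif_deriv_bd S (\<lambda>s x. sqrt \<bar>det (G s x)\<bar>)
     (\<lambda>x. 1/2 * trace (matrix_inv (G t x) ** G' x) * sqrt \<bar>det (G t x)\<bar>) t"
proof -
  have i: "invertible (G t x)" if "x \<in> S" for x using inv that by auto
  have bs: "bounded ((\<lambda>x. sqrt \<bar>det (G t x)\<bar>) ` S)"
    using unif_C_sqrt_det[of 0 S "\<lambda>s. G t"] G b i by (simp add: unif_deriv_bd_def)
  have bt: "bounded ((\<lambda>x. 1/2 * trace (matrix_inv (G t x) ** G' x) * sqrt \<bar>det (G t x)\<bar>) ` S)"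
    using G b bs
    by (intro bounded_image_bilinear[OF bounded_bilinear_mult] bounded_image_linear[OF bounded_linear_mult_right]
        bounded_image_linear[OF bounded_linear_trace] bounded_image_bilinear[OF bounded_bilinear_matrix_mult])
       (auto simp: unif_deriv_bd_def)
  have "has_unif_deriv S (\<lambda>s x. sqrt \<bar>det (G s x)\<bar>)
     (\<lambda>x. 1/2 * trace (matrix_inv (G t x) ** G' x) * sqrt \<bar>det (G t x)\<bar>) t"
    using G b i by (intro has_unif_deriv_sqrt_det) (auto simp: unif_deriv_bd_def)
  with bs bt show ?thesis by (simp add: unif_deriv_bd_def)
qed

end

text \<open>The derivatives of the densities in the direction \<open>(G', H')\<close> of the base point.\<close>

definition Dtheta ::
    "real^'n::finite^'n \<Rightarrow> real^'n^'n \<Rightarrow> real^'n^'n \<Rightarrow> (real^'n^'n) \<times> (real^'n^'n) \<Rightarrow> real" where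
  "Dtheta G H k = (\<lambda>(G', H').
     let a = matrix_inv G ** k; b = matrix_inv G ** H; e = matrix_inv G ** G'; d = matrix_inv G ** H'
     in sqrt \<bar>det G\<bar> * (1/2 * trace e * trace (a ** b) - trace (e ** a ** b) - trace (a ** e ** b) + trace (a ** d)))"

definition Domega ::
    "real^'n::finite^'n \<Rightarrow> real^'n^'n \<Rightarrow> (real^'n^'n) \<times> (real^'n^'n) \<Rightarrow> (real^'n^'n) \<times> (real^'n^'n) \<Rightarrow>
      (real^'n^'n) \<times> (real^'n^'n) \<Rightarrow> real" where
  "Domega G H = (\<lambda>(k\<^sub>1, l\<^sub>1) (k\<^sub>2, l\<^sub>2) (G', H').
     let a\<^sub>1 = matrix_inv G ** k\<^sub>1; a\<^sub>2 = matrix_inv G ** k\<^sub>2; c\<^sub>1 = matrix_inv G ** l\<^sub>1; c\<^sub>2 = matrix_inv G ** l\<^sub>2;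
         b = matrix_inv G ** H; e = matrix_inv G ** G'; d = matrix_inv G ** H'
     in sqrt \<bar>det G\<bar> *
       (1/2 * trace e * (1/2 * (trace (a\<^sub>1 ** b) * trace a\<^sub>2 - trace (a\<^sub>2 ** b) * trace a\<^sub>1)
           + trace (a\<^sub>1 ** c\<^sub>2) - trace (a\<^sub>2 ** c\<^sub>1))
        + 1/2 * ((trace (a\<^sub>1 ** d) - trace (e ** a\<^sub>1 ** b) - trace (a\<^sub>1 ** e ** b)) * trace a\<^sub>2
               - trace (a\<^sub>1 ** b) * trace (e ** a\<^sub>2)
               - (trace (a\<^sub>2 ** d) - trace (e ** a\<^sub>2 ** b) - trace (a\<^sub>2 ** e ** b)) * trace a\<^sub>1
               + trace (a\<^sub>2 ** b) * trace (e ** a\<^sub>1))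
        - trace (e ** a\<^sub>1 ** c\<^sub>2) - trace (a\<^sub>1 ** e ** c\<^sub>2)
        + trace (e ** a\<^sub>2 ** c\<^sub>1) + trace (a\<^sub>2 ** e ** c\<^sub>1)))"

lemma unif_deriv_bd_theta:
  fixes G :: "real \<Rightarrow> 'x \<Rightarrow> real^'n::finite^'n"
  assumes G: "unif_deriv_bd S G G' t" "bounded ((\<lambda>x. matrix_inv (G t x)) ` S)"
      "\<exists>e>0. \<forall>s x. \<bar>s - t\<bar> < e \<longrightarrow> x \<in> S \<longrightarrow> invertible (G s x)"
    and H: "unif_deriv_bd S H H' t" and k: "unif_deriv_bd S k k' t"
  shows "unif_deriv_bd S (\<lambda>s x. theta_density (G s x) (H s x) (k s x))
     (\<lambda>x. Dtheta (G t x) (H t x) (k t x) (G' x, H' x) + theta_density (G t x) (H t x) (k' x)) t"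
  unfolding theta_density_def
  by (rule unif_deriv_bd_eq[OF unif_deriv_bd_bilinear[OF bounded_bilinear_mult unif_deriv_bd_sqrt_det[OF G]
      unif_deriv_bd_linear[OF bounded_linear_trace unif_deriv_bd_bilinear[OF bounded_bilinear_matrix_mult
        unif_deriv_bd_mixed[OF G k] unif_deriv_bd_mixed[OF G H]]]]])
     (simp add: Dtheta_def Let_def matrix_mult.diff_left matrix_mult.diff_right trace_add trace_sub
       matrix_mul_assoc algebra_simps)

lemma unif_deriv_bd_omega:
  fixes G :: "real \<Rightarrow> 'x \<Rightarrow> real^'n::finite^'n"
  assumes G: "unif_deriv_bd S G G' t" "bounded ((\<lambda>x. matrix_inv (G t x)) ` S)"
      "\<exists>e>0. \<forall>s x. \<bar>s - t\<bar> < e \<longrightarrow> x \<in> S \<longrightarrow> invertible (G s x)"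
    and H: "unif_deriv_bd S H H' t"
    and k: "unif_deriv_bd S k\<^sub>1 k\<^sub>1' t" "unif_deriv_bd S k\<^sub>2 k\<^sub>2' t"
    and l: "unif_deriv_bd S l\<^sub>1 l\<^sub>1' t" "unif_deriv_bd S l\<^sub>2 l\<^sub>2' t"
  shows "unif_deriv_bd S (\<lambda>s x. omega_density (G s x) (H s x) (k\<^sub>1 s x, l\<^sub>1 s x) (k\<^sub>2 s x, l\<^sub>2 s x))
     (\<lambda>x. Domega (G t x) (H t x) (k\<^sub>1 t x, l\<^sub>1 t x) (k\<^sub>2 t x, l\<^sub>2 t x) (G' x, H' x)
        + omega_density (G t x) (H t x) (k\<^sub>1' x, l\<^sub>1' x) (k\<^sub>2 t x, l\<^sub>2 t x)
        + omega_density (G t x) (H t x) (k\<^sub>1 t x, l\<^sub>1 t x) (k\<^sub>2' x, l\<^sub>2' x)) t"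
proof -
  note mx = unif_deriv_bd_mixed[OF G]
  note tr = unif_deriv_bd_linear[OF bounded_linear_trace]
  note mm = unif_deriv_bd_bilinear[OF bounded_bilinear_matrix_mult]
  note m = unif_deriv_bd_bilinear[OF bounded_bilinear_mult]
  show ?thesis
    unfolding omega_density_def prod.case
    by (rule unif_deriv_bd_eq[OF m[OF unif_deriv_bd_sqrt_det[OF G]
        unif_deriv_bd_diff[OF unif_deriv_bd_add[OF
          unif_deriv_bd_linear[OF bounded_linear_mult_right unif_deriv_bd_diff[OF
            m[OF tr[OF mm[OF mx[OF k(1)] mx[OF H]]] tr[OF mx[OF k(2)]]]
            m[OF tr[OF mm[OF mx[OF k(2)] mx[OF H]]] tr[OF mx[OF k(1)]]]]]
          tr[OF mm[OF mx[OF k(1)] mx[OF l(2)]]]]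
          tr[OF mm[OF mx[OF k(2)] mx[OF l(1)]]]]]])
       (simp add: Domega_def Let_def matrix_mult.diff_left matrix_mult.diff_right trace_add trace_sub
         matrix_mul_assoc algebra_simps add_divide_distrib diff_divide_distrib)
qed

text \<open>The triple traces are symmetric in \<open>k\<^sub>1\<close> and \<open>k\<^sub>2\<close>
  and cancel in the difference. What is left is the variation of the density, with its factor 1/2,
  and the variation in \<open>H\<close>.\<close>

lemma Dtheta_antisym:
  "Dtheta G H k\<^sub>2 (k\<^sub>1, l\<^sub>1) - Dtheta G H k\<^sub>1 (k\<^sub>2, l\<^sub>2) = - omega_density G H (k\<^sub>1, l\<^sub>1) (k\<^sub>2, l\<^sub>2)"
  by (simp add: Dtheta_def omega_density_def Let_def matrix_mul_assoc algebra_simps)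

text \<open>All terms cancel in pairs. Traces of three factors cancel as they stand; cyclicity is
  used for tr(a_i a_j) = tr(a_j a_i). The coefficient 1/2 in \<open>omega_density\<close> is
  balanced by the 1/2 that comes from differentiating the density.\<close>

lemma Domega_cyclic:
  fixes G :: "real^'n::finite^'n"
  shows "Domega G H v\<^sub>2 v\<^sub>3 v\<^sub>1 - Domega G H v\<^sub>1 v\<^sub>3 v\<^sub>2 + Domega G H v\<^sub>1 v\<^sub>2 v\<^sub>3 = 0"
proof -
  obtain k\<^sub>1 l\<^sub>1 k\<^sub>2 l\<^sub>2 k\<^sub>3 l\<^sub>3 where v: "v\<^sub>1 = (k\<^sub>1, l\<^sub>1)" "v\<^sub>2 = (k\<^sub>2, l\<^sub>2)" "v\<^sub>3 = (k\<^sub>3, l\<^sub>3)"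
    by (cases v\<^sub>1; cases v\<^sub>2; cases v\<^sub>3)
  let ?a = "\<lambda>k. matrix_inv G ** (k :: real^'n^'n)"
  have s: "trace (?a k\<^sub>2 ** ?a k\<^sub>1) = trace (?a k\<^sub>1 ** ?a k\<^sub>2)" "trace (?a k\<^sub>3 ** ?a k\<^sub>1) = trace (?a k\<^sub>1 ** ?a k\<^sub>3)"
    "trace (?a k\<^sub>3 ** ?a k\<^sub>2) = trace (?a k\<^sub>2 ** ?a k\<^sub>3)"
    by (rule trace_mul_sym)+
  show ?thesis
    unfolding v Domega_def Let_def prod.case s by (simp add: algebra_simps)
qed

section \<open>Derivatives of the integrals along straight lines\<close>

context mfd_patch_ref
begin

lemma R_unif_deriv_bd_line:
  assumes "g \<in> sym2_fields \<A>" "k \<in> sym2_fields \<A>"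
  shows "unif_deriv_bd K (\<lambda>s. R (g + s *\<^sub>R k)) (R k) 0"
  unfolding unif_deriv_bd_def
proof (intro conjI)
  have "(\<lambda>s. R (g + s *\<^sub>R k)) = (\<lambda>s p. R g p + s *\<^sub>R R k p)"
    by (intro ext) (simp only: R_add R_scaleR)
  then show "has_unif_deriv K (\<lambda>s. R (g + s *\<^sub>R k)) (R k) 0"
    by (simp add: has_unif_deriv_affine)
  show "bounded (R (g + 0 *\<^sub>R k) ` K)" "bounded (R k ` K)"
    using assms by (auto intro!: R_bounded sym2_fields_add sym2_fields_scaleR)
qed

lemma R_unif_deriv_bd:
  assumes "lcs_tendsto (Gamma_c X \<A>) (\<lambda>s. (f s - f 0) /\<^sub>R s) l (at 0)"
    and "\<And>s. f s \<in> sym2_fields_on \<A> K" "l \<in> sym2_fields_on \<A> K"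
  shows "unif_deriv_bd K (\<lambda>s. R (f s)) (R l) 0"
  unfolding unif_deriv_bd_def
proof (intro conjI)
  have c: "k \<in> sym2_fields_c X \<A>" if "k \<in> sym2_fields_on \<A> K" for k
    using that compact_K by (auto simp: sym2_fields_c_iff)
  show "has_unif_deriv K (\<lambda>s. R (f s)) (R l) 0"
    using assms c by (intro R_has_unif_deriv sym2_fields_c_diff) auto
  show "bounded (R (f 0) ` K)" "bounded (R l ` K)"
    using assms sym2_fields_on_subset by (auto intro: R_bounded)
qed

lemma line_sym2:
  assumes "x \<in> Met_mw X \<A> q" "u \<in> TK"
  shows "unif_deriv_bd K (\<lambda>s. R (fst (x + s *\<^sub>R u))) (R (fst u)) 0"
    "unif_deriv_bd K (\<lambda>s. R (snd (x + s *\<^sub>R u))) (R (snd u)) 0"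
proof -
  have "fst u \<in> sym2_fields \<A>" "snd u \<in> sym2_fields \<A>" using assms(2) sym2_fields_on_subset by auto
  then show "unif_deriv_bd K (\<lambda>s. R (fst (x + s *\<^sub>R u))) (R (fst u)) 0"
    "unif_deriv_bd K (\<lambda>s. R (snd (x + s *\<^sub>R u))) (R (snd u)) 0"
    unfolding fst_add snd_add fst_scaleR snd_scaleR
    using Met_mw_sym2[OF assms(1)] by (auto intro!: R_unif_deriv_bd_line)
qed

text \<open>The hypotheses are restricted to small \<open>s\<close>, as the line \<open>s \<mapsto> x + s u\<close> may leave the set of metrics.\<close>

lemma integral_line_deriv:
  fixes F :: "real \<Rightarrow> 'a \<Rightarrow> real"
  assumes d: "unif_deriv_bd K F F' 0" and \<delta>: "0 < \<delta>"
    and F: "\<And>s. \<bar>s\<bar> < \<delta> \<Longrightarrow> integrable ref (F s)" "\<And>s. \<bar>s\<bar> < \<delta> \<Longrightarrow> bounded (F s ` K)"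
    and f: "\<And>s. \<bar>s\<bar> < \<delta> \<Longrightarrow> f s = (\<integral>p. F s p \<partial>ref)"
  shows "(f has_real_derivative (\<integral>p. F' p \<partial>ref)) (at 0)" "integrable ref F'"
proof -
  \<comment> \<open>The value 0 off the small parameters supplies the bounds and the measurability
    that differentiation under the integral asks for at every \<open>s\<close>.\<close>
  define F0 where "F0 s p = (if \<bar>s\<bar> < \<delta> then F s p else 0)" for s p
  have "has_unif_deriv K F0 F' 0"
    by (rule has_unif_deriv_transform[of _ F _ _ \<delta>]) (use d \<delta> in \<open>auto simp: F0_def unif_deriv_bd_def\<close>)
  \<comment> \<open>A one-point parameter set turns the result on families of integrals into one
    about a single integral.\<close>
  then have d0: "has_unif_deriv (space ref \<times> {()}) (\<lambda>s z. F0 s (fst z)) (\<lambda>z. F' (fst z)) 0"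
    by (rule has_unif_deriv_reindex) (auto simp: space_ref)
  have b': "bounded ((\<lambda>z. F' (fst z)) ` (space ref \<times> {()}))"
    by (rule bounded_image_reindex[of F' K]) (use d in \<open>auto simp: unif_deriv_bd_def space_ref\<close>)
  have "bounded (F0 s ` K)" for s
    using F(2)[of s] by (cases "\<bar>s\<bar> < \<delta>") (simp_all add: F0_def[abs_def] image_constant_conv)
  then have b0: "bounded ((\<lambda>z. F0 s (fst z)) ` (space ref \<times> {()}))" for s
    by (rule bounded_image_reindex) (auto simp: space_ref)
  have m0: "(\<lambda>p. F0 s (fst (p, v))) \<in> borel_measurable ref" if "v \<in> {()}" for s v
    using borel_measurable_integrable[OF F(1), of s] by (cases "\<bar>s\<bar> < \<delta>") (simp_all add: F0_def)
  note I = has_unif_deriv_integral[OF finite_ref d0 b' b0 m0]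
  have "((\<lambda>s. \<integral>p. F0 s p \<partial>ref) has_real_derivative (\<integral>p. F' p \<partial>ref)) (at 0)"
    using has_unif_deriv_pointwise[OF I(1), of "()"] by (simp add: has_real_derivative_iff_has_vector_derivative)
  then show "(f has_real_derivative (\<integral>p. F' p \<partial>ref)) (at 0)"
    by (rule has_field_derivative_transform_within_open[of _ _ _ "{-\<delta><..<\<delta>}"])
       (use \<delta> f in \<open>auto simp: F0_def abs_less_iff\<close>)
  show "integrable ref F'"
    using I(2)[of "()"] d by (intro integrable_bounded_ref) (auto simp: unif_deriv_bd_def)
qed

context
  fixes x u \<delta>
  assumes x: "x \<in> Met_mw X \<A> q" and u: "u \<in> TK" and \<delta>: "0 < \<delta>"
    and line_all: "\<forall>s. \<bar>s\<bar> < \<delta> \<longrightarrow> x + s *\<^sub>R u \<in> Met_mw X \<A> q"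
begin

lemmas line = line_all[rule_format]

lemma line_invertible:
  "\<exists>e>0. \<forall>s p. \<bar>s - 0\<bar> < e \<longrightarrow> p \<in> K \<longrightarrow> invertible (R (fst (x + s *\<^sub>R u)) p)"
  using \<delta> line R_invertible by (intro exI[of _ \<delta>]) (auto simp: Met_mw_iff)

lemma line_inv_bounded: "bounded ((\<lambda>p. matrix_inv (R (fst (x + 0 *\<^sub>R u)) p)) ` K)"
  using R_inv_bounded[of "fst x" q] x by (simp add: Met_mw_iff)

text \<open>Product rule for a moving tangent vector \<open>V s\<close> over a moving base point:
  the variation of the integrand in the base point, plus \<Theta> of the derivative of
  \<open>V\<close>. The values of \<open>V\<close> share the support \<open>K\<close>, so that one
  patch serves for all \<open>s\<close>.\<close>

lemma Theta_line_deriv: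
  assumes V: "\<And>s. V s \<in> TK" "w \<in> TK" "lcs_tendsto TE (\<lambda>s. (V s - V 0) /\<^sub>R s) w (at 0)"
  shows "((\<lambda>s. Theta X \<A> (x + s *\<^sub>R u) (V s)) has_real_derivative
      (\<integral>p. Dtheta (R (fst x) p) (R (snd x) p) (R (fst (V 0)) p) (R2 u p)
         + theta_density (R (fst x) p) (R (snd x) p) (R (fst w) p) \<partial>ref)) (at 0)" (is ?D)
    and "integrable ref (\<lambda>p. Dtheta (R (fst x) p) (R (snd x) p) (R (fst (V 0)) p) (R2 u p))" (is ?I)
proof -
  let ?F = "\<lambda>s p. theta_density (R (fst (x + s *\<^sub>R u)) p) (R (snd (x + s *\<^sub>R u)) p) (R (fst (V s)) p)"
  let ?F' = "\<lambda>p. Dtheta (R (fst x) p) (R (snd x) p) (R (fst (V 0)) p) (R2 u p)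
         + theta_density (R (fst x) p) (R (snd x) p) (R (fst w) p)"
  have k: "unif_deriv_bd K (\<lambda>s. R (fst (V s))) (R (fst w)) 0"
  proof (rule R_unif_deriv_bd)
    show "lcs_tendsto (Gamma_c X \<A>) (\<lambda>s. (fst (V s) - fst (V 0)) /\<^sub>R s) (fst w) (at 0)"
      using TE_tendstoD(1)[OF V(3)] by (simp add: fst_diff fst_scaleR)
    show "fst (V s) \<in> sym2_fields_on \<A> K" for s using V(1)[of s] by auto
  qed (use V(2) in auto)
  have d: "unif_deriv_bd K ?F ?F' 0"
    using unif_deriv_bd_theta[OF line_sym2(1)[OF x u] line_inv_bounded line_invertible line_sym2(2)[OF x u] k]
    by (simp add: R2_def)
  have Vs: "fst (V s) \<in> sym2_fields \<A>" for s using V(1)[of s] sym2_fields_on_subset by auto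
  note D = integral_line_deriv[OF d \<delta> theta_integrable[OF line Vs] theta_bounded[OF line Vs], of "\<lambda>s. Theta X \<A> (x + s *\<^sub>R u) (V s)"]
  show ?D using D(1) Theta_integral[OF line V(1)] by simp
  have "fst w \<in> sym2_fields \<A>" using V(2) sym2_fields_on_subset by auto
  from Bochner_Integration.integrable_diff[OF D(2) theta_integrable[OF x this]] show ?I
    using Theta_integral[OF line V(1)] by simp
qed

lemma Omega_line_deriv:
  assumes V: "\<And>s. V s \<in> TK" "w \<in> TK" "lcs_tendsto TE (\<lambda>s. (V s - V 0) /\<^sub>R s) w (at 0)"
    and V': "\<And>s. V' s \<in> TK" "w' \<in> TK" "lcs_tendsto TE (\<lambda>s. (V' s - V' 0) /\<^sub>R s) w' (at 0)"
  shows "((\<lambda>s. Omega X \<A> (x + s *\<^sub>R u) (V s) (V' s)) has_real_derivative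
      (\<integral>p. Domega (R (fst x) p) (R (snd x) p) (R2 (V 0) p) (R2 (V' 0) p) (R2 u p) \<partial>ref)
       + Omega X \<A> x w (V' 0) + Omega X \<A> x (V 0) w') (at 0)" (is ?D)
    and "integrable ref (\<lambda>p. Domega (R (fst x) p) (R (snd x) p) (R2 (V 0) p) (R2 (V' 0) p) (R2 u p))" (is ?I)
proof -
  let ?F = "\<lambda>s p. omega_density (R (fst (x + s *\<^sub>R u)) p) (R (snd (x + s *\<^sub>R u)) p) (R2 (V s) p) (R2 (V' s) p)"
  let ?D = "\<lambda>p. Domega (R (fst x) p) (R (snd x) p) (R2 (V 0) p) (R2 (V' 0) p) (R2 u p)"
  let ?o = "\<lambda>v w p. omega_density (R (fst x) p) (R (snd x) p) (R2 v p) (R2 w p)"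
  have comp: "unif_deriv_bd K (\<lambda>s. R (fst (V s))) (R (fst w)) 0" "unif_deriv_bd K (\<lambda>s. R (snd (V s))) (R (snd w)) 0"
    if V: "\<And>s. V s \<in> TK" "w \<in> TK" "lcs_tendsto TE (\<lambda>s. (V s - V 0) /\<^sub>R s) w (at 0)" for V w
  proof -
    have "lcs_tendsto (Gamma_c X \<A>) (\<lambda>s. (fst (V s) - fst (V 0)) /\<^sub>R s) (fst w) (at 0)"
      "lcs_tendsto (Gamma_c X \<A>) (\<lambda>s. (snd (V s) - snd (V 0)) /\<^sub>R s) (snd w) (at 0)"
      using TE_tendstoD[OF V(3)] by (simp_all add: fst_diff fst_scaleR snd_diff snd_scaleR)
    moreover have "fst (V s) \<in> sym2_fields_on \<A> K" "snd (V s) \<in> sym2_fields_on \<A> K" for s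
      using V(1)[of s] by auto
    moreover have "fst w \<in> sym2_fields_on \<A> K" "snd w \<in> sym2_fields_on \<A> K" using V(2) by auto
    ultimately show "unif_deriv_bd K (\<lambda>s. R (fst (V s))) (R (fst w)) 0" "unif_deriv_bd K (\<lambda>s. R (snd (V s))) (R (snd w)) 0"
      by (auto intro: R_unif_deriv_bd)
  qed
  have d: "unif_deriv_bd K ?F (\<lambda>p. ?D p + ?o w (V' 0) p + ?o (V 0) w' p) 0"
    using unif_deriv_bd_omega[OF line_sym2(1)[OF x u] line_inv_bounded line_invertible line_sym2(2)[OF x u]
       comp(1)[OF V] comp(1)[OF V'] comp(2)[OF V] comp(2)[OF V']]
    by (simp add: R2_def)
  note D = integral_line_deriv[OF d \<delta> omega_integrable[OF line V(1) V'(1)] omega_bounded[OF line V(1) V'(1)],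
      of "\<lambda>s. Omega X \<A> (x + s *\<^sub>R u) (V s) (V' s)"]
  have o: "integrable ref (?o w (V' 0))" "integrable ref (?o (V 0) w')"
    using V V' by (auto intro!: omega_integrable x)
  have "integrable ref (\<lambda>p. ?D p + ?o w (V' 0) p + ?o (V 0) w' p)"
    using D(2) Omega_integral[OF line V(1) V'(1)] by simp
  from Bochner_Integration.integrable_diff[OF Bochner_Integration.integrable_diff[OF this o(2)] o(1)]
  show i: ?I by simp
  have "(\<integral>p. ?D p + ?o w (V' 0) p + ?o (V 0) w' p \<partial>ref)
      = (\<integral>p. ?D p \<partial>ref) + Omega X \<A> x w (V' 0) + Omega X \<A> x (V 0) w'"
    using i o Omega_integral[OF x V(2) V'(1)] Omega_integral[OF x V(1) V'(2)] by simp
  then show "((\<lambda>s. Omega X \<A> (x + s *\<^sub>R u) (V s) (V' s)) has_real_derivative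
      (\<integral>p. ?D p \<partial>ref) + Omega X \<A> x w (V' 0) + Omega X \<A> x (V 0) w') (at 0)"
    using D(1) Omega_integral[OF line V(1) V'(1)] by simp
qed

end

end

section \<open>Uniqueness of limits, and short lines in the space of metrics\<close>

context smooth_mfd
begin

lemma TE_seminorm:
  assumes "p \<in> snd TE" shows "seminorm_on (fst TE) p"
proof -
  obtain p1 p2 where p: "p = (\<lambda>(x, y). p1 x + p2 y)" "p1 \<in> snd (Gamma_c X \<A>)" "p2 \<in> snd (Gamma_c X \<A>)"
    using assms by (auto simp: T_Met_mw_def lcs_prod_def)
  note s = Gamma_c_seminorm[OF p(2)] Gamma_c_seminorm[OF p(3)]
  have "p (v + w) \<le> p v + p w" if "v \<in> fst TE" "w \<in> fst TE" for v w
  proof -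
    have "p1 (fst v + fst w) \<le> p1 (fst v) + p1 (fst w)" "p2 (snd v + snd w) \<le> p2 (snd v) + p2 (snd w)"
      using s that unfolding seminorm_on_def fst_TE by (auto simp: mem_Times_iff)
    then show ?thesis by (simp add: p(1) case_prod_beta fst_add snd_add)
  qed
  moreover have "p (r *\<^sub>R v) = \<bar>r\<bar> * p v" if "v \<in> fst TE" for r v
    using s that unfolding seminorm_on_def fst_TE
    by (auto simp: mem_Times_iff p(1) case_prod_beta fst_scaleR snd_scaleR distrib_left)
  moreover have "0 \<le> p v" if "v \<in> fst TE" for v
    using s that unfolding seminorm_on_def fst_TE by (auto simp: mem_Times_iff p(1) case_prod_beta)
  ultimately show ?thesis by (simp add: seminorm_on_def)
qed

lemma TE_diff: "v \<in> fst TE \<Longrightarrow> w \<in> fst TE \<Longrightarrow> v - w \<in> fst TE"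
  using TE_add[of v "(-1) *\<^sub>R w"] TE_scaleR[of w "-1"] by simp

text \<open>The seminorms of one-point compact sets detect the coefficients at each point. This is
  the Hausdorff property behind uniqueness of limits.\<close>

lemma TE_point_seminorms_separate:
  assumes "v \<in> fst TE" "\<And>p. p \<in> snd TE \<Longrightarrow> p v = 0"
  shows "v = 0"
proof -
  have z: "h = 0" if h: "h \<in> sym2_fields_c X \<A>" "\<And>p. p \<in> snd (Gamma_c X \<A>) \<Longrightarrow> p h = 0" for h
  proof (intro ext)
    fix c p
    show "h c p = 0 c p"
    proof (cases "c \<in> \<A> \<and> p \<in> fst c")
      case True
      then have i: "(c, {snd c p}, []) \<in> cinf_indices \<A>" by (auto simp: cinf_indices_def)
      have "norm (h c (chart_inv c (snd c p))) \<le> cinf_seminorm (c, {snd c p}, []) h"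
        by (rule cinf_seminorm_upper[OF i sym2_fields_c_subset[OF h(1)]]) simp
      then show ?thesis using h(2)[OF cinf_seminorm_mem[OF i]] True chart_inv_chart[of c p] by simp
    next
      case False
      then show ?thesis using sym2_fields_0[OF sym2_fields_c_subset[OF h(1)], of c p] by simp
    qed
  qed
  have "fst v = 0" using assms TE_seminorm_fst by (intro z) (auto simp: fst_TE)
  moreover have "snd v = 0" using assms TE_seminorm_snd by (intro z) (auto simp: fst_TE)
  ultimately show ?thesis by (simp add: prod_eq_iff)
qed

text \<open>It gives meaning to the definite description in \<open>dir_deriv\<close>.\<close>

lemma TE_tendsto_unique:
  assumes "lcs_tendsto TE f v (at 0)" "lcs_tendsto TE f w (at 0)"
    and mem: "\<forall>\<^sub>F s in at 0. f s \<in> fst TE" "v \<in> fst TE" "w \<in> fst TE"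
  shows "v = w"
proof -
  have "p (v - w) = 0" if p: "p \<in> snd TE" for p
  proof -
    note sp = TE_seminorm[OF p, unfolded seminorm_on_def]
    have "((\<lambda>s. p (f s - v) + p (f s - w)) \<longlongrightarrow> 0 + 0) (at 0)"
      using assms p unfolding lcs_tendsto_def by (intro tendsto_add) auto
    moreover have "\<forall>\<^sub>F s in at 0. p (v - w) \<le> p (f s - v) + p (f s - w)"
      using mem(1)
    proof eventually_elim
      case (elim s)
      have "p (v - w) = p ((-1) *\<^sub>R (f s - v) + (f s - w))" by simp
      also have "\<dots> \<le> p ((-1) *\<^sub>R (f s - v)) + p (f s - w)"
        using sp elim mem TE_diff TE_scaleR by blast
      also have "p ((-1) *\<^sub>R (f s - v)) = \<bar>-1\<bar> * p (f s - v)"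
        using sp elim mem TE_diff by blast
      finally show ?case by simp
    qed
    ultimately have "p (v - w) \<le> 0 + 0"
      by (intro tendsto_lowerbound[where F = "at (0::real)"]) auto
    moreover have "0 \<le> p (v - w)" using sp mem TE_diff by blast
    ultimately show ?thesis by simp
  qed
  then have "v - w = 0" by (intro TE_point_seminorms_separate TE_diff mem)
  then show ?thesis by simp
qed

text \<open>Having a given signature is an open condition on symmetric matrices, and off the compact
  support of \<open>k\<close> nothing changes, so finitely many local step sizes suffice. Each of
  them refers to one chart; congruence carries the signature to the others.\<close>

lemma line_in_Met:
  assumes g: "g \<in> Met \<A> q" and k: "k \<in> sym2_fields_c X \<A>"
  obtains \<epsilon> where "0 < \<epsilon>" "\<And>s. \<bar>s\<bar> \<le> \<epsilon> \<Longrightarrow> g + s *\<^sub>R k \<in> Met \<A> q"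
proof -
  obtain K where K: "compactin X K" "k \<in> sym2_fields_on \<A> K" using k by (auto simp: sym2_fields_c_iff)
  note g' = Met_sym2_fields[OF g] and k' = sym2_fields_c_subset[OF k]
  define \<U> where "\<U> = {U. openin X U \<and> (\<exists>c\<in>\<A>. \<exists>\<epsilon>>0. U \<subseteq> fst c \<and>
     (\<forall>p\<in>U. \<forall>s. \<bar>s\<bar> \<le> \<epsilon> \<longrightarrow> has_signature q (g c p + s *\<^sub>R k c p)))}"
  have "K \<subseteq> \<Union>\<U>"
  proof
    fix p assume "p \<in> K"
    then obtain c where c: "c \<in> \<A>" "p \<in> fst c"
      using compactin_subset_topspace[OF K(1)] charts_cover by blast
    obtain e where e: "0 < e" "\<And>S. transpose S = S \<Longrightarrow> norm (S - g c p) < e \<Longrightarrow> has_signature q S"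
      using has_signature_open[OF Met_signature[OF g c] sym2_fields_sym[OF g']] by blast
    define V where "V = {y \<in> snd c ` fst c. norm (g c (chart_inv c y) - g c p) < e / 2 \<and>
        norm (k c (chart_inv c y)) < norm (k c p) + 1}"
    have "open V"
    proof -
      have "open {y \<in> snd c ` fst c. norm (g c (chart_inv c y) - g c p) < e / 2}"
      proof -
        have "continuous_on (snd c ` fst c) (\<lambda>y. norm (g c (chart_inv c y) - g c p))"
          by (intro continuous_intros sym2_fields_continuous[OF g' c(1)])
        from continuous_open_preimage[OF this open_chart_image[OF c(1)] open_lessThan]
        show ?thesis by (simp only: vimage_def Int_def lessThan_iff mem_Collect_eq)
      qed
      moreover have "open {y \<in> snd c ` fst c. norm (k c (chart_inv c y)) < norm (k c p) + 1}"
      proof -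
        have "continuous_on (snd c ` fst c) (\<lambda>y. norm (k c (chart_inv c y)))"
          by (intro continuous_intros sym2_fields_continuous[OF k' c(1)])
        from continuous_open_preimage[OF this open_chart_image[OF c(1)] open_lessThan]
        show ?thesis by (simp only: vimage_def Int_def lessThan_iff mem_Collect_eq)
      qed
      moreover have "V = {y \<in> snd c ` fst c. norm (g c (chart_inv c y) - g c p) < e / 2} \<inter>
          {y \<in> snd c ` fst c. norm (k c (chart_inv c y)) < norm (k c p) + 1}" by (auto simp: V_def)
      ultimately show ?thesis by (simp only: open_Int)
    qed
    \<comment> \<open>The deviation of \<open>g\<close> from its value at \<open>p\<close> and the
      perturbation \<open>s *\<^sub>R k\<close> each take up at most half of
      \<open>e\<close>.\<close>
    define \<epsilon> where "\<epsilon> = e / (2 * (norm (k c p) + 1))"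
    have pos: "0 < norm (k c p) + 1" using norm_ge_zero[of "k c p"] by linarith
    have \<epsilon>: "0 < \<epsilon>" using e pos by (simp add: \<epsilon>_def)
    have "has_signature q (g c r + s *\<^sub>R k c r)" if r: "r \<in> fst c" "snd c r \<in> V" and s: "\<bar>s\<bar> \<le> \<epsilon>" for r s
    proof (rule e(2))
      have n: "norm (g c r - g c p) < e / 2" "norm (k c r) < norm (k c p) + 1"
        using r chart_inv_chart[OF c(1) r(1)] by (auto simp: V_def)
      have "norm (s *\<^sub>R k c r) \<le> \<epsilon> * (norm (k c p) + 1)"
        using s n \<epsilon> by (auto intro!: mult_mono)
      also have "\<dots> = e / 2"
      proof -
        have "e / (2 * N) * N = e / 2" if "0 < N" for N :: real using that by simp
        from this[OF pos] show ?thesis by (simp only: \<epsilon>_def)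
      qed
      finally have "norm ((g c r - g c p) + s *\<^sub>R k c r) < e"
        using n norm_triangle_ineq[of "g c r - g c p" "s *\<^sub>R k c r"] by linarith
      then show "norm (g c r + s *\<^sub>R k c r - g c p) < e" by (simp add: algebra_simps)
      show "transpose (g c r + s *\<^sub>R k c r) = g c r + s *\<^sub>R k c r"
        using sym2_fields_sym[OF g', of c r] sym2_fields_sym[OF k', of c r]
        by (simp add: transpose_def vec_eq_iff)
    qed
    then have "{r \<in> fst c. snd c r \<in> V} \<in> \<U>"
      unfolding \<U>_def using openin_chart_preimage[OF c(1) \<open>open V\<close>] c(1) \<epsilon>
      by (intro CollectI conjI bexI[of _ c] exI[of _ \<epsilon>]) auto
    moreover have "p \<in> {r \<in> fst c. snd c r \<in> V}"
      using c e chart_inv_chart[OF c] by (auto simp: V_def)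
    ultimately show "p \<in> \<Union>\<U>" by blast
  qed
  then obtain \<F> where F: "finite \<F>" "\<F> \<subseteq> \<U>" "K \<subseteq> \<Union>\<F>"
    using compactinD[OF K(1), of \<U>] by (auto simp: \<U>_def)
  have "\<forall>U\<in>\<F>. \<exists>\<epsilon>>0. \<exists>c\<in>\<A>. U \<subseteq> fst c \<and>
     (\<forall>p\<in>U. \<forall>s. \<bar>s\<bar> \<le> \<epsilon> \<longrightarrow> has_signature q (g c p + s *\<^sub>R k c p))"
    using F(2) unfolding \<U>_def by blast
  from bchoice[OF this] obtain ee where ee: "\<And>U. U \<in> \<F> \<Longrightarrow> 0 < ee U"
    "\<And>U. U \<in> \<F> \<Longrightarrow> \<exists>c\<in>\<A>. U \<subseteq> fst c \<and> (\<forall>p\<in>U. \<forall>s. \<bar>s\<bar> \<le> ee U \<longrightarrow> has_signature q (g c p + s *\<^sub>R k c p))"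
    by blast
  \<comment> \<open>The element 1 makes the minimum well defined when the cover is empty.\<close>
  define \<epsilon> where "\<epsilon> = Min (insert 1 (ee ` \<F>))"
  have \<epsilon>: "0 < \<epsilon>" "\<And>U. U \<in> \<F> \<Longrightarrow> \<epsilon> \<le> ee U" using F(1) ee(1) by (auto simp: \<epsilon>_def)
  show thesis
  proof (rule that[OF \<epsilon>(1)])
    fix s :: real assume s: "\<bar>s\<bar> \<le> \<epsilon>"
    have gk: "g + s *\<^sub>R k \<in> sym2_fields \<A>" by (intro sym2_fields_add sym2_fields_scaleR g' k')
    have "has_signature q ((g + s *\<^sub>R k) d p)" if d: "d \<in> \<A>" "p \<in> fst d" for d p
    proof (cases "p \<in> K")
      case True
      then obtain U where U: "U \<in> \<F>" "p \<in> U" using F(3) by blast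
      then obtain c where c: "c \<in> \<A>" "p \<in> fst c" "has_signature q (g c p + s *\<^sub>R k c p)"
        using ee(2)[OF U(1)] s \<epsilon>(2)[OF U(1)] by (meson order_trans subsetD)
      have "has_signature q (transpose (transition_jacobian d c p) ** (g + s *\<^sub>R k) c p ** transition_jacobian d c p)"
        using c by (intro has_signature_congruent invertible_jacobian[OF g d(1) c(1) d(2) c(2)]) simp
      then show ?thesis using sym2_fields_transform[OF gk d(1) c(1) d(2) c(2)] by simp
    next
      case False
      then have "k d p = 0" using K(2) unfolding sym2_fields_on_def by blast
      then show ?thesis using Met_signature[OF g d] by simp
    qed
    with gk show "g + s *\<^sub>R k \<in> Met \<A> q" by (simp add: Met_def)
  qed
qed

lemma line_in_Met_mw:
  assumes x: "x \<in> Met_mw X \<A> q" and u: "u \<in> fst TE"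
  obtains \<epsilon> where "0 < \<epsilon>" "\<And>s. \<bar>s\<bar> \<le> \<epsilon> \<Longrightarrow> x + s *\<^sub>R u \<in> Met_mw X \<A> q"
proof -
  have "fst x \<in> Met \<A> q" "fst u \<in> sym2_fields_c X \<A>" using x u by (auto simp: Met_mw_iff fst_TE)
  then obtain \<epsilon> where "0 < \<epsilon>" "\<And>s. \<bar>s\<bar> \<le> \<epsilon> \<Longrightarrow> fst x + s *\<^sub>R fst u \<in> Met \<A> q"
    using line_in_Met by blast
  then show thesis
    using x u by (intro that[of \<epsilon>])
      (auto simp: Met_mw_iff fst_TE fst_add snd_add fst_scaleR snd_scaleR intro!: sym2_fields_c_add sym2_fields_c_scaleR)
qed

end

subsection \<open>Exterior derivatives\<close>

context smooth_mfd
begin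

lemma smooth_curve_scaled:
  assumes \<phi>: "\<And>j t. (\<phi> j has_real_derivative \<phi> (Suc j) t) (at t)" and v: "v \<in> fst TE"
  shows "smooth_curve TE (\<lambda>t. \<phi> 0 t *\<^sub>R v)"
  unfolding smooth_curve_def
proof (intro exI[of _ "\<lambda>j t. \<phi> j t *\<^sub>R v"] conjI allI)
  show "\<phi> j t *\<^sub>R v \<in> fst TE" for j t by (rule TE_scaleR[OF v])
  show "lcs_tendsto TE (\<lambda>s. (\<phi> j (t + s) *\<^sub>R v - \<phi> j t *\<^sub>R v) /\<^sub>R s) (\<phi> (Suc j) t *\<^sub>R v) (at 0)" for j t
    unfolding lcs_tendsto_def
  proof
    fix p assume p: "p \<in> snd TE"
    have "p ((\<phi> j (t + s) *\<^sub>R v - \<phi> j t *\<^sub>R v) /\<^sub>R s - \<phi> (Suc j) t *\<^sub>R v) =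
        \<bar>(\<phi> j (t + s) - \<phi> j t) / s - \<phi> (Suc j) t\<bar> * p v" for s
    proof -
      have "(\<phi> j (t + s) *\<^sub>R v - \<phi> j t *\<^sub>R v) /\<^sub>R s - \<phi> (Suc j) t *\<^sub>R v =
          ((\<phi> j (t + s) - \<phi> j t) / s - \<phi> (Suc j) t) *\<^sub>R v"
        by (simp add: scaleR_diff_left[symmetric] divide_inverse mult.commute)
      then show ?thesis using TE_seminorm[OF p] v unfolding seminorm_on_def by simp
    qed
    moreover have "((\<lambda>s. \<bar>(\<phi> j (t + s) - \<phi> j t) / s - \<phi> (Suc j) t\<bar> * p v) \<longlongrightarrow> \<bar>\<phi> (Suc j) t - \<phi> (Suc j) t\<bar> * p v) (at 0)"
      using \<phi>[of j t] unfolding DERIV_def by (intro tendsto_intros)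
    ultimately show "((\<lambda>s. p ((\<phi> j (t + s) *\<^sub>R v - \<phi> j t *\<^sub>R v) /\<^sub>R s - \<phi> (Suc j) t *\<^sub>R v)) \<longlongrightarrow> 0) (at 0)"
      by simp
  qed
qed simp

text \<open>\<open>smooth_map\<close> tests curves defined on the whole real line. The segment is
  therefore traversed with parameter \<epsilon> sin(t/\<epsilon>), which never leaves
  [-\<epsilon>, \<epsilon>] and has derivative 1 at t = 0.\<close>

lemma sine_curve:
  assumes \<epsilon>: "0 < \<epsilon>" and line: "\<And>s. \<bar>s\<bar> \<le> \<epsilon> \<Longrightarrow> x + s *\<^sub>R u \<in> W" and u: "u \<in> fst TE"
  shows "smooth_curve_in W TE (\<lambda>t. x + (\<epsilon> * sin (t / \<epsilon>)) *\<^sub>R u)"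
proof -
  \<comment> \<open>The \<open>j\<close>-th derivative of
    \<open>\<epsilon> * sin (t / \<epsilon>)\<close>: each differentiation divides by
    \<open>\<epsilon>\<close> and shifts the phase by a quarter turn.\<close>
  define \<phi> where "\<phi> j t = \<epsilon> * inverse \<epsilon> ^ j * sin (t / \<epsilon> + real j * (pi / 2))" for j t
  have "(\<phi> j has_real_derivative \<phi> (Suc j) t) (at t)" for j t
  proof -
    have "(\<phi> j has_real_derivative \<epsilon> * inverse \<epsilon> ^ j * (cos (t / \<epsilon> + real j * (pi / 2)) * (1 / \<epsilon>))) (at t)"
      unfolding \<phi>_def[abs_def] using \<epsilon> by (auto intro!: derivative_eq_intros)
    moreover have "cos (t / \<epsilon> + real j * (pi / 2)) = sin (t / \<epsilon> + real (Suc j) * (pi / 2))"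
      by (simp add: algebra_simps sin_add cos_add add_divide_distrib)
    moreover have "\<epsilon> * inverse \<epsilon> ^ j * (C * (1 / \<epsilon>)) = \<epsilon> * inverse \<epsilon> ^ Suc j * C" for C
      by (simp add: divide_inverse)
    ultimately show ?thesis by (simp only: \<phi>_def[of "Suc j"])
  qed
  from smooth_curve_scaled[of \<phi>, OF this u] have "smooth_curve TE (\<lambda>t. (\<epsilon> * sin (t / \<epsilon>)) *\<^sub>R u)"
    by (simp add: \<phi>_def)
  moreover have "x + (\<epsilon> * sin (t / \<epsilon>)) *\<^sub>R u \<in> W" for t
    using \<epsilon> abs_sin_le_one[of "t / \<epsilon>"] by (intro line) (simp add: abs_mult)
  ultimately show ?thesis by (simp add: smooth_curve_in_def)
qed

text \<open>A differentiable curve is continuous for each seminorm, and [-1, 1] is compact.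
  Boundedness then provides a common compact support for the values of the curve near 0.\<close>

lemma smooth_curve_bounded:
  assumes "smooth_curve TE c"
  shows "lcs_bounded TE (c ` {-1..1})"
proof -
  obtain d where d: "d 0 = c" "\<And>j t. d j t \<in> fst TE"
      "\<And>j t. lcs_tendsto TE (\<lambda>s. (d j (t + s) - d j t) /\<^sub>R s) (d (Suc j) t) (at 0)"
    using assms unfolding smooth_curve_def by blast
  have "bounded (p ` c ` {-1..1})" if p: "p \<in> snd TE" for p
  proof -
    note sp = TE_seminorm[OF p, unfolded seminorm_on_def]
    have "isCont (\<lambda>t. p (c t)) t" for t
      unfolding isCont_iff
    proof (rule LIM_zero_cancel, rule Lim_null_comparison)
      let ?q = "\<lambda>s. (c (t + s) - c t) /\<^sub>R s"
      have "((\<lambda>s. \<bar>s\<bar> * (p (?q s - d 1 t) + p (d 1 t))) \<longlongrightarrow> \<bar>0\<bar> * (0 + p (d 1 t))) (at 0)"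
        using d(3)[of 0 t] p unfolding lcs_tendsto_def by (intro tendsto_intros) (auto simp: d(1))
      then show "((\<lambda>s. \<bar>s\<bar> * (p (?q s - d 1 t) + p (d 1 t))) \<longlongrightarrow> 0) (at 0)" by simp
      have m: "c r \<in> fst TE" for r using d(2)[of 0 r] d(1) by simp
      have "norm (p (c (t + s)) - p (c t)) \<le> \<bar>s\<bar> * (p (?q s - d 1 t) + p (d 1 t))" if s: "s \<noteq> 0" for s
      proof -
        have mq: "?q s \<in> fst TE" by (intro TE_scaleR TE_diff m)
        have e: "c (t + s) = c t + s *\<^sub>R ?q s" "c t = c (t + s) + (- s) *\<^sub>R ?q s" using s by simp_all
        have "p (c (t + s)) \<le> p (c t) + p (s *\<^sub>R ?q s)"
          by (subst e(1)) (use sp m mq TE_scaleR in blast)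
        moreover have "p (c t) \<le> p (c (t + s)) + p ((- s) *\<^sub>R ?q s)"
          by (subst e(2)) (use sp m mq TE_scaleR in blast)
        moreover have "p (s *\<^sub>R ?q s) = \<bar>s\<bar> * p (?q s)" "p ((- s) *\<^sub>R ?q s) = \<bar>- s\<bar> * p (?q s)" using sp mq by blast+
        ultimately have "norm (p (c (t + s)) - p (c t)) \<le> \<bar>s\<bar> * p (?q s)" by (simp add: abs_le_iff)
        also have "p (?q s) \<le> p (?q s - d 1 t) + p (d 1 t)"
        proof -
          have "p ((?q s - d 1 t) + d 1 t) \<le> p (?q s - d 1 t) + p (d 1 t)"
            using sp mq d(2) TE_diff by blast
          then show ?thesis by simp
        qed
        finally show ?thesis by (simp add: mult_left_mono)
      qed
      then show "\<forall>\<^sub>F s in at 0. norm (p (c (t + s)) - p (c t)) \<le> \<bar>s\<bar> * (p (?q s - d 1 t) + p (d 1 t))"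
        unfolding eventually_at by (intro exI[of _ 1]) auto
    qed
    then have "compact ((\<lambda>t. p (c t)) ` {-1..1})"
      by (intro compact_continuous_image continuous_at_imp_continuous_on) auto
    then show ?thesis by (simp add: image_image compact_imp_bounded)
  qed
  then show ?thesis using d(1,2) by (auto simp: lcs_bounded_def)
qed

text \<open>The field is smooth along the sine curve; the rescaled arcsine, whose derivative at 0 is
  1, carries its derivative over to the line. The curve \<open>V\<close> agrees with the field for
  small \<open>s\<close> and is constant otherwise, so that all its values share the support
  \<open>K\<close>.\<close>

lemma vector_field_along_line:
  assumes \<eta>: "vector_field (Met_mw X \<A> q) TE \<eta>" and x: "x \<in> Met_mw X \<A> q" and u: "u \<in> fst TE"
  obtains \<delta> K V where "0 < \<delta>" "compactin X K" "V 0 = \<eta> x" "\<forall>s. V s \<in> sym2_fields_on \<A> K \<times> sym2_fields_on \<A> K"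
    "dir_deriv TE \<eta> x u \<in> sym2_fields_on \<A> K \<times> sym2_fields_on \<A> K"
    "lcs_tendsto TE (\<lambda>s. (V s - V 0) /\<^sub>R s) (dir_deriv TE \<eta> x u) (at 0)"
    "\<forall>s. \<bar>s\<bar> < \<delta> \<longrightarrow> V s = \<eta> (x + s *\<^sub>R u)"
    "\<forall>s. \<bar>s\<bar> < \<delta> \<longrightarrow> x + s *\<^sub>R u \<in> Met_mw X \<A> q"
proof -
  obtain \<epsilon> where \<epsilon>: "0 < \<epsilon>" "\<And>s. \<bar>s\<bar> \<le> \<epsilon> \<Longrightarrow> x + s *\<^sub>R u \<in> Met_mw X \<A> q"
    using line_in_Met_mw[OF x u] by blast
  define c where "c t = \<eta> (x + (\<epsilon> * sin (t / \<epsilon>)) *\<^sub>R u)" for t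
  have sc: "smooth_curve TE c"
    using \<eta> sine_curve[OF \<epsilon> u] unfolding vector_field_def smooth_map_def c_def by blast
  then obtain d where d: "d 0 = c" "\<And>j t. d j t \<in> fst TE"
      "\<And>j t. lcs_tendsto TE (\<lambda>s. (d j (t + s) - d j t) /\<^sub>R s) (d (Suc j) t) (at 0)"
    unfolding smooth_curve_def by blast
  define w where "w = d 1 0"
  have w: "w \<in> fst TE" by (simp add: w_def d)
  have m: "c t \<in> fst TE" for t using d(2)[of 0 t] d(1) by simp
  define \<psi> where "\<psi> s = \<epsilon> * arcsin (s / \<epsilon>)" for s
  have \<psi>: "\<epsilon> * sin (\<psi> s / \<epsilon>) = s" if "\<bar>s\<bar> \<le> \<epsilon>" for s
  proof -
    have "- 1 \<le> s / \<epsilon>" "s / \<epsilon> \<le> 1" using that \<epsilon>(1) by (auto simp: field_simps abs_le_iff)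
    then show ?thesis using \<epsilon>(1) by (simp add: \<psi>_def)
  qed
  have c\<psi>: "c (\<psi> s) = \<eta> (x + s *\<^sub>R u)" if "\<bar>s\<bar> \<le> \<epsilon>" for s using \<psi>[OF that] by (simp add: c_def)
  have \<psi>0: "\<psi> 0 = 0" by (simp add: \<psi>_def)
  have d\<psi>: "(\<psi> has_real_derivative 1) (at 0)"
    unfolding \<psi>_def[abs_def] using \<epsilon>(1) by (auto intro!: derivative_eq_intros)
  then have ratio: "((\<lambda>s. \<psi> s / s) \<longlongrightarrow> 1) (at 0)" using \<psi>0 by (simp add: DERIV_def)
  have t\<psi>: "(\<psi> \<longlongrightarrow> 0) (at 0)" using DERIV_isCont[OF d\<psi>] \<psi>0 by (simp add: isCont_def)
  have nz: "\<forall>\<^sub>F s in at 0. s \<noteq> 0 \<and> \<bar>s\<bar> < \<epsilon> \<and> \<psi> s \<noteq> 0"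
    unfolding eventually_at
  proof (intro exI[of _ \<epsilon>] conjI ballI impI \<epsilon>(1))
    fix s :: real assume s: "s \<noteq> 0 \<and> dist s 0 < \<epsilon>"
    then have "\<epsilon> * sin (\<psi> s / \<epsilon>) = s" by (intro \<psi>) simp
    then show "s \<noteq> 0" "\<bar>s\<bar> < \<epsilon>" "\<psi> s \<noteq> 0" using s by auto
  qed
  have l\<psi>: "filterlim \<psi> (at 0) (at 0)"
    unfolding filterlim_at using t\<psi> nz by (auto elim: eventually_mono)
  have lim: "lcs_tendsto TE (\<lambda>s. (\<eta> (x + s *\<^sub>R u) - \<eta> x) /\<^sub>R s) w (at 0)"
    unfolding lcs_tendsto_def
  proof
    fix p assume p: "p \<in> snd TE"
    note sp = TE_seminorm[OF p, unfolded seminorm_on_def]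
    let ?Q = "\<lambda>t. (c (0 + t) - c 0) /\<^sub>R t"
    have mq: "?Q t \<in> fst TE" for t by (intro TE_scaleR TE_diff m)
    have "((\<lambda>t. p (?Q t - w)) \<longlongrightarrow> 0) (at 0)"
      using d(3)[of 0 0] p unfolding lcs_tendsto_def w_def by (simp add: d(1))
    then have "((\<lambda>s. p (?Q (\<psi> s) - w)) \<longlongrightarrow> 0) (at 0)" using l\<psi> by (rule filterlim_compose)
    \<comment> \<open>The quotient along the line is \<open>\<psi> s / s\<close> times the quotient
      \<open>?Q\<close> of the sine curve at \<open>\<psi> s\<close>. Both converge, and the error
      splits accordingly.\<close>
    then have "((\<lambda>s. \<bar>\<psi> s / s\<bar> * p (?Q (\<psi> s) - w) + \<bar>\<psi> s / s - 1\<bar> * p w) \<longlongrightarrow> \<bar>1\<bar> * 0 + \<bar>1 - 1\<bar> * p w) (at 0)"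
      by (intro tendsto_intros ratio)
    then have "((\<lambda>s. \<bar>\<psi> s / s\<bar> * p (?Q (\<psi> s) - w) + \<bar>\<psi> s / s - 1\<bar> * p w) \<longlongrightarrow> 0) (at 0)" by simp
    then show "((\<lambda>s. p ((\<eta> (x + s *\<^sub>R u) - \<eta> x) /\<^sub>R s - w)) \<longlongrightarrow> 0) (at 0)"
    proof (rule Lim_null_comparison[rotated])
      show "\<forall>\<^sub>F s in at 0. norm (p ((\<eta> (x + s *\<^sub>R u) - \<eta> x) /\<^sub>R s - w)) \<le>
          \<bar>\<psi> s / s\<bar> * p (?Q (\<psi> s) - w) + \<bar>\<psi> s / s - 1\<bar> * p w"
        using nz
      proof eventually_elim
        case (elim s)
        let ?r = "\<psi> s / s"
        have "(\<eta> (x + s *\<^sub>R u) - \<eta> x) /\<^sub>R s = (c (\<psi> s) - c 0) /\<^sub>R s"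
          using elim c\<psi>[of s] c\<psi>[of 0] \<epsilon>(1) \<psi>0 by simp
        also have "\<dots> = ?r *\<^sub>R ?Q (\<psi> s)" using elim by (simp add: field_simps)
        finally have e: "(\<eta> (x + s *\<^sub>R u) - \<eta> x) /\<^sub>R s - w = ?r *\<^sub>R (?Q (\<psi> s) - w) + (?r - 1) *\<^sub>R w"
          by (simp add: algebra_simps)
        have a: "?r *\<^sub>R (?Q (\<psi> s) - w) \<in> fst TE" "(?r - 1) *\<^sub>R w \<in> fst TE" "?Q (\<psi> s) - w \<in> fst TE"
          using mq w by (auto intro: TE_scaleR TE_diff)
        have "p (?r *\<^sub>R (?Q (\<psi> s) - w) + (?r - 1) *\<^sub>R w) \<le> p (?r *\<^sub>R (?Q (\<psi> s) - w)) + p ((?r - 1) *\<^sub>R w)"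
          using sp a by blast
        also have "p (?r *\<^sub>R (?Q (\<psi> s) - w)) = \<bar>?r\<bar> * p (?Q (\<psi> s) - w)" using sp a(3) by blast
        also have "p ((?r - 1) *\<^sub>R w) = \<bar>?r - 1\<bar> * p w" using sp w by blast
        finally have "p (?r *\<^sub>R (?Q (\<psi> s) - w) + (?r - 1) *\<^sub>R w) \<le> \<bar>?r\<bar> * p (?Q (\<psi> s) - w) + \<bar>?r - 1\<bar> * p w" .
        moreover have "0 \<le> p (?r *\<^sub>R (?Q (\<psi> s) - w) + (?r - 1) *\<^sub>R w)" using sp a TE_add by blast
        ultimately show ?case unfolding e by simp
      qed
    qed
  qed
  have memq: "\<forall>\<^sub>F s in at 0. (\<eta> (x + s *\<^sub>R u) - \<eta> x) /\<^sub>R s \<in> fst TE"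
    using nz
  proof eventually_elim
    case (elim s)
    then have "(\<eta> (x + s *\<^sub>R u) - \<eta> x) /\<^sub>R s = (c (\<psi> s) - c (\<psi> 0)) /\<^sub>R s"
      using c\<psi>[of s] c\<psi>[of 0] \<epsilon>(1) by simp
    then show ?case using TE_scaleR[OF TE_diff[OF m m]] by (simp only:)
  qed
  have dw: "dir_deriv TE \<eta> x u = w"
    unfolding dir_deriv_def
    by (rule the_equality) (use w lim TE_tendsto_unique[OF _ lim memq _ w] in blast)+
  \<comment> \<open>Small enough for \<open>\<psi> s\<close> to stay in [-1, 1], where the values of
    the curve have a common support.\<close>
  obtain \<delta>1 where \<delta>1: "0 < \<delta>1" "\<And>s. s \<noteq> 0 \<Longrightarrow> \<bar>s\<bar> < \<delta>1 \<Longrightarrow> \<bar>\<psi> s\<bar> < 1"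
    using tendstoD[OF t\<psi>, of 1] by (auto simp: eventually_at)
  define \<delta> where "\<delta> = min \<delta>1 \<epsilon>"
  have \<delta>: "0 < \<delta>" using \<delta>1 \<epsilon> by (simp add: \<delta>_def)
  have "lcs_bounded TE (c ` {-1..1} \<union> {w})"
    using smooth_curve_bounded[OF sc] w by (auto simp: lcs_bounded_def)
  then obtain K where K: "compactin X K" "c ` {-1..1} \<union> {w} \<subseteq> sym2_fields_on \<A> K \<times> sym2_fields_on \<A> K"
    using TE_bounded_support by blast
  define V where "V s = (if \<bar>s\<bar> < \<delta> then \<eta> (x + s *\<^sub>R u) else \<eta> x)" for s
  have V0: "V 0 = \<eta> x" by (simp add: V_def)
  have Vc: "\<exists>t\<in>{-1..1}. V s = c t" for s
  proof (cases "\<bar>s\<bar> < \<delta>")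
    case True
    then have "V s = c (\<psi> s)" using c\<psi>[of s] by (simp add: V_def \<delta>_def)
    moreover have "\<psi> s \<in> {-1..1}" using \<delta>1(2)[of s] True \<psi>0 by (cases "s = 0") (auto simp: \<delta>_def abs_less_iff)
    ultimately show ?thesis by blast
  next
    case False
    then have "V s = c 0" by (simp add: V_def c_def)
    then show ?thesis by (intro bexI[of _ 0]) auto
  qed
  show thesis
  proof (rule that[of \<delta> K V])
    show "0 < \<delta>" "compactin X K" "V 0 = \<eta> x" by (fact \<delta> K(1) V0)+
    show "\<forall>s. V s \<in> sym2_fields_on \<A> K \<times> sym2_fields_on \<A> K" 
    proof
      fix s
      obtain t where "t \<in> {-1..1}" "V s = c t" using Vc by blast
      then show "V s \<in> sym2_fields_on \<A> K \<times> sym2_fields_on \<A> K" using K(2) by blast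
    qed
    show "dir_deriv TE \<eta> x u \<in> sym2_fields_on \<A> K \<times> sym2_fields_on \<A> K" using K(2) unfolding dw by blast
    have ev: "\<forall>\<^sub>F s in at 0. (V s - V 0) /\<^sub>R s = (\<eta> (x + s *\<^sub>R u) - \<eta> x) /\<^sub>R s"
      unfolding eventually_at using \<delta> by (intro exI[of _ \<delta>]) (auto simp: V_def)
    show "lcs_tendsto TE (\<lambda>s. (V s - V 0) /\<^sub>R s) (dir_deriv TE \<eta> x u) (at 0)"
      unfolding dw lcs_tendsto_def
    proof
      fix p assume "p \<in> snd TE"
      then have "((\<lambda>s. p ((\<eta> (x + s *\<^sub>R u) - \<eta> x) /\<^sub>R s - w)) \<longlongrightarrow> 0) (at 0)"
        using lim unfolding lcs_tendsto_def by blast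
      moreover have "\<forall>\<^sub>F s in at 0. p ((\<eta> (x + s *\<^sub>R u) - \<eta> x) /\<^sub>R s - w) = p ((V s - V 0) /\<^sub>R s - w)"
        using ev by eventually_elim (simp only:)
      ultimately show "((\<lambda>s. p ((V s - V 0) /\<^sub>R s - w)) \<longlongrightarrow> 0) (at 0)"
        by (rule Lim_transform_eventually)
    qed
    show "\<forall>s. \<bar>s\<bar> < \<delta> \<longrightarrow> V s = \<eta> (x + s *\<^sub>R u)" by (simp add: V_def)
    show "\<forall>s. \<bar>s\<bar> < \<delta> \<longrightarrow> x + s *\<^sub>R u \<in> Met_mw X \<A> q" using \<epsilon>(2) by (simp add: \<delta>_def)
  qed
qed

lemma zero_TE: "(0 :: ('a, 'n) tensor2 \<times> ('a, 'n) tensor2) \<in> fst TE"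
  using sym2_fields_c_zero by (auto simp: fst_TE zero_prod_def)

text \<open>The line in direction 0 stays at \<open>x\<close>, so the common support of the values
  along it is a support of \<open>\<eta> x\<close>.\<close>

lemma vector_field_TE:
  assumes "vector_field (Met_mw X \<A> q) TE \<eta>" "x \<in> Met_mw X \<A> q"
  shows "\<eta> x \<in> fst TE"
proof -
  obtain \<delta> K V where V: "0 < \<delta>" "compactin X K" "V 0 = \<eta> x"
    "\<forall>s. V s \<in> sym2_fields_on \<A> K \<times> sym2_fields_on \<A> K"
    "dir_deriv TE \<eta> x 0 \<in> sym2_fields_on \<A> K \<times> sym2_fields_on \<A> K"
    "lcs_tendsto TE (\<lambda>s. (V s - V 0) /\<^sub>R s) (dir_deriv TE \<eta> x 0) (at 0)"
    "\<forall>s. \<bar>s\<bar> < \<delta> \<longrightarrow> V s = \<eta> (x + s *\<^sub>R 0)"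
    "\<forall>s. \<bar>s\<bar> < \<delta> \<longrightarrow> x + s *\<^sub>R 0 \<in> Met_mw X \<A> q"
    by (rule vector_field_along_line[OF assms zero_TE])
  have "\<eta> x \<in> sym2_fields_on \<A> K \<times> sym2_fields_on \<A> K" using V(3) V(4) by (metis)
  then show ?thesis using V(2) unfolding fst_TE by (auto simp: mem_Times_iff sym2_fields_c_iff)
qed

lemma dir_deriv_TE:
  assumes "vector_field (Met_mw X \<A> q) TE \<eta>" "x \<in> Met_mw X \<A> q" "u \<in> fst TE"
  shows "dir_deriv TE \<eta> x u \<in> fst TE"
proof -
  obtain \<delta> K V where V: "0 < \<delta>" "compactin X K" "V 0 = \<eta> x"
    "\<forall>s. V s \<in> sym2_fields_on \<A> K \<times> sym2_fields_on \<A> K"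
    "dir_deriv TE \<eta> x u \<in> sym2_fields_on \<A> K \<times> sym2_fields_on \<A> K"
    "lcs_tendsto TE (\<lambda>s. (V s - V 0) /\<^sub>R s) (dir_deriv TE \<eta> x u) (at 0)"
    "\<forall>s. \<bar>s\<bar> < \<delta> \<longrightarrow> V s = \<eta> (x + s *\<^sub>R u)"
    "\<forall>s. \<bar>s\<bar> < \<delta> \<longrightarrow> x + s *\<^sub>R u \<in> Met_mw X \<A> q"
    by (rule vector_field_along_line[OF assms])
  show ?thesis using V(5,2) unfolding fst_TE by (auto simp: mem_Times_iff sym2_fields_c_iff)
qed

text \<open>The support is enlarged to contain the given compact sets as well as the supports of the
  given tangent vectors, so that one patch carries a whole computation.\<close>

lemma patch_for:
  assumes x: "x \<in> Met_mw X \<A> q" and V: "finite V" "V \<subseteq> fst TE" and K: "finite \<K>" "\<And>K. K \<in> \<K> \<Longrightarrow> compactin X K"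
  obtains K m cs Ls ix where "mfd_patch_ref X \<A> K m cs Ls ix (fst x) q"
    "V \<subseteq> sym2_fields_on \<A> K \<times> sym2_fields_on \<A> K"
    "\<And>K'. K' \<in> \<K> \<Longrightarrow> sym2_fields_on \<A> K' \<times> sym2_fields_on \<A> K' \<subseteq> sym2_fields_on \<A> K \<times> sym2_fields_on \<A> K"
proof -
  have g: "fst x \<in> Met \<A> q" using x by (simp add: Met_mw_iff)
  obtain K0 where K0: "compactin X K0" "V \<subseteq> sym2_fields_on \<A> K0 \<times> sym2_fields_on \<A> K0"
    using TE_support[OF V] .
  let ?K = "K0 \<union> \<Union>\<K>"
  have "compactin X ?K" using K0 K by (intro compactin_Un compactin_Union) auto
  then obtain m cs Ls ix where "mfd_patch_ref X \<A> ?K m cs Ls ix (fst x) q" using ex_patch_ref[OF _ g] by blast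
  moreover have "V \<subseteq> sym2_fields_on \<A> ?K \<times> sym2_fields_on \<A> ?K"
    using K0(2) sym2_fields_on_mono[of K0 ?K] by blast
  moreover have "sym2_fields_on \<A> K' \<times> sym2_fields_on \<A> K' \<subseteq> sym2_fields_on \<A> ?K \<times> sym2_fields_on \<A> ?K"
    if "K' \<in> \<K>" for K'
    using that by (intro Sigma_mono sym2_fields_on_mono) auto
  ultimately show thesis by (rule that)
qed

text \<open>A constant curve has derivative 0; so the formulas for moving tangent vectors also cover
  fixed ones.\<close>

lemma lcs_tendsto_const_zero: "lcs_tendsto TE (\<lambda>s. (v - v) /\<^sub>R s) 0 F"
proof -
  have z: "p 0 = 0" if "p \<in> snd TE" for p
  proof -
    have "p (0 *\<^sub>R 0) = \<bar>0\<bar> * p 0" using TE_seminorm[OF that] zero_TE unfolding seminorm_on_def by blast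
    then show ?thesis by simp
  qed
  show ?thesis
    unfolding lcs_tendsto_def
  proof
    fix p assume "p \<in> snd TE"
    from z[OF this] show "((\<lambda>s. p ((v - v) /\<^sub>R s - 0)) \<longlongrightarrow> 0) F" by simp
  qed
qed

text \<open>The derivative in the base point with the tangent vector kept fixed. Its definition
  mentions no patch, so values computed in different patches can be compared.\<close>

definition DTheta :: "('a, 'n) tensor2 \<times> ('a, 'n) tensor2 \<Rightarrow> ('a, 'n) tensor2 \<times> ('a, 'n) tensor2 \<Rightarrow>
    ('a, 'n) tensor2 \<times> ('a, 'n) tensor2 \<Rightarrow> real" where
  "DTheta x v u = deriv (\<lambda>s. Theta X \<A> (x + s *\<^sub>R u) v) 0"

definition DOmega :: "('a, 'n) tensor2 \<times> ('a, 'n) tensor2 \<Rightarrow> ('a, 'n) tensor2 \<times> ('a, 'n) tensor2 \<Rightarrow>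
    ('a, 'n) tensor2 \<times> ('a, 'n) tensor2 \<Rightarrow> ('a, 'n) tensor2 \<times> ('a, 'n) tensor2 \<Rightarrow> real" where
  "DOmega x v w u = deriv (\<lambda>s. Omega X \<A> (x + s *\<^sub>R u) v w) 0"

end

context mfd_patch_ref
begin

lemma DTheta_integral:
  assumes x: "x \<in> Met_mw X \<A> q" and u: "u \<in> TK" and v: "v \<in> TK"
  shows "DTheta x v u = (\<integral>p. Dtheta (R (fst x) p) (R (snd x) p) (R (fst v) p) (R2 u p) \<partial>ref)"
    and "integrable ref (\<lambda>p. Dtheta (R (fst x) p) (R (snd x) p) (R (fst v) p) (R2 u p))"
proof -
  have u': "u \<in> fst TE" using u compact_K by (auto simp: fst_TE sym2_fields_c_iff)
  obtain \<epsilon> where \<epsilon>: "0 < \<epsilon>" "\<And>s. \<bar>s\<bar> \<le> \<epsilon> \<Longrightarrow> x + s *\<^sub>R u \<in> Met_mw X \<A> q"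
    using line_in_Met_mw[OF x u'] by blast
  have 0: "(0 :: ('a, 'n) tensor2 \<times> ('a, 'n) tensor2) \<in> TK"
    using sym2_fields_on_zero by (auto simp: zero_prod_def)
  have line: "\<forall>s. \<bar>s\<bar> < \<epsilon> \<longrightarrow> x + s *\<^sub>R u \<in> Met_mw X \<A> q" using \<epsilon>(2) by simp
  note D = Theta_line_deriv[OF x u \<epsilon>(1) line, of "\<lambda>s. v" 0, OF v 0 lcs_tendsto_const_zero]
  show "integrable ref (\<lambda>p. Dtheta (R (fst x) p) (R (snd x) p) (R (fst v) p) (R2 u p))"
    using D(2) .
  have "R 0 = (\<lambda>p. 0)" using R_scaleR[of 0 0] by (intro ext) simp
  then have "theta_density G H (R (fst (0 :: ('a, 'n) tensor2 \<times> ('a, 'n) tensor2)) p) = 0" for G H p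
    by (simp add: theta_density_def)
  then show "DTheta x v u = (\<integral>p. Dtheta (R (fst x) p) (R (snd x) p) (R (fst v) p) (R2 u p) \<partial>ref)"
    unfolding DTheta_def using DERIV_imp_deriv[OF D(1)] by simp
qed

lemma DOmega_integral:
  assumes x: "x \<in> Met_mw X \<A> q" and u: "u \<in> TK" and v: "v \<in> TK" and w: "w \<in> TK"
  shows "DOmega x v w u = (\<integral>p. Domega (R (fst x) p) (R (snd x) p) (R2 v p) (R2 w p) (R2 u p) \<partial>ref)"
    and "integrable ref (\<lambda>p. Domega (R (fst x) p) (R (snd x) p) (R2 v p) (R2 w p) (R2 u p))"
proof -
  have u': "u \<in> fst TE" using u compact_K by (auto simp: fst_TE sym2_fields_c_iff)
  obtain \<epsilon> where \<epsilon>: "0 < \<epsilon>" "\<And>s. \<bar>s\<bar> \<le> \<epsilon> \<Longrightarrow> x + s *\<^sub>R u \<in> Met_mw X \<A> q"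
    using line_in_Met_mw[OF x u'] by blast
  have 0: "(0 :: ('a, 'n) tensor2 \<times> ('a, 'n) tensor2) \<in> TK"
    using sym2_fields_on_zero by (auto simp: zero_prod_def)
  have line: "\<forall>s. \<bar>s\<bar> < \<epsilon> \<longrightarrow> x + s *\<^sub>R u \<in> Met_mw X \<A> q" using \<epsilon>(2) by simp
  note D = Omega_line_deriv[OF x u \<epsilon>(1) line, of "\<lambda>s. v" 0 "\<lambda>s. w" 0,
      OF v 0 lcs_tendsto_const_zero w 0 lcs_tendsto_const_zero]
  show "integrable ref (\<lambda>p. Domega (R (fst x) p) (R (snd x) p) (R2 v p) (R2 w p) (R2 u p))"
    using D(2) .
  have z: "Omega X \<A> x 0 w = 0" using Omega_scaleR[OF x 0 w, of 0] by simp
  have "Omega X \<A> x 0 v = 0" using Omega_scaleR[OF x 0 v, of 0] by simp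
  then have "Omega X \<A> x v 0 = 0" using Omega_swap[OF x v 0] by simp
  with z show "DOmega x v w u = (\<integral>p. Domega (R (fst x) p) (R (snd x) p) (R2 v p) (R2 w p) (R2 u p) \<partial>ref)"
    unfolding DOmega_def using DERIV_imp_deriv[OF D(1)] by simp
qed

end

context smooth_mfd
begin

lemma DTheta_antisym:
  assumes x: "x \<in> Met_mw X \<A> q" and v: "v\<^sub>1 \<in> fst TE" "v\<^sub>2 \<in> fst TE"
  shows "DTheta x v\<^sub>2 v\<^sub>1 - DTheta x v\<^sub>1 v\<^sub>2 = - Omega X \<A> x v\<^sub>1 v\<^sub>2"
proof -
  obtain K m cs Ls ix where P: "mfd_patch_ref X \<A> K m cs Ls ix (fst x) q"
    "{v\<^sub>1, v\<^sub>2} \<subseteq> sym2_fields_on \<A> K \<times> sym2_fields_on \<A> K"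
    by (rule patch_for[OF x, of "{v\<^sub>1, v\<^sub>2}" "{}"]) (use v in auto)
  interpret mfd_patch_ref X \<A> K m cs Ls ix "fst x" q by (rule P)
  have v: "v\<^sub>1 \<in> TK" "v\<^sub>2 \<in> TK" using P(2) by auto
  show ?thesis
    unfolding DTheta_integral(1)[OF x v] DTheta_integral(1)[OF x v(2,1)] Omega_integral[OF x v]
    using DTheta_integral(2)[OF x v] DTheta_integral(2)[OF x v(2,1)]
    by (simp add: Dtheta_antisym R2_def flip: Bochner_Integration.integral_diff)
qed

lemma DOmega_cyclic:
  assumes x: "x \<in> Met_mw X \<A> q" and v: "v\<^sub>1 \<in> fst TE" "v\<^sub>2 \<in> fst TE" "v\<^sub>3 \<in> fst TE"
  shows "DOmega x v\<^sub>2 v\<^sub>3 v\<^sub>1 - DOmega x v\<^sub>1 v\<^sub>3 v\<^sub>2 + DOmega x v\<^sub>1 v\<^sub>2 v\<^sub>3 = 0"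
proof -
  obtain K m cs Ls ix where P: "mfd_patch_ref X \<A> K m cs Ls ix (fst x) q"
    "{v\<^sub>1, v\<^sub>2, v\<^sub>3} \<subseteq> sym2_fields_on \<A> K \<times> sym2_fields_on \<A> K"
    by (rule patch_for[OF x, of "{v\<^sub>1, v\<^sub>2, v\<^sub>3}" "{}"]) (use v in auto)
  interpret mfd_patch_ref X \<A> K m cs Ls ix "fst x" q by (rule P)
  have v: "v\<^sub>1 \<in> TK" "v\<^sub>2 \<in> TK" "v\<^sub>3 \<in> TK" using P(2) by auto
  note i = DOmega_integral(2)[OF x v(1,2,3)] DOmega_integral(2)[OF x v(2,1,3)] DOmega_integral(2)[OF x v(3,1,2)]
  let ?D = "\<lambda>u v w p. Domega (R (fst x) p) (R (snd x) p) (R2 v p) (R2 w p) (R2 u p)"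
  have "(\<integral>p. ?D v\<^sub>1 v\<^sub>2 v\<^sub>3 p - ?D v\<^sub>2 v\<^sub>1 v\<^sub>3 p + ?D v\<^sub>3 v\<^sub>1 v\<^sub>2 p \<partial>ref) = 0"
    by (simp add: Domega_cyclic)
  then show ?thesis
    unfolding DOmega_integral(1)[OF x v(1,2,3)] DOmega_integral(1)[OF x v(2,1,3)] DOmega_integral(1)[OF x v(3,1,2)]
    using i by simp
qed

lemma field_apply_Theta:
  assumes \<eta>: "vector_field (Met_mw X \<A> q) TE \<eta>" and x: "x \<in> Met_mw X \<A> q" and u: "\<xi> x \<in> fst TE"
  shows "field_apply \<xi> (\<lambda>y. r * Theta X \<A> y (\<eta> y)) x =
    r * (DTheta x (\<eta> x) (\<xi> x) + Theta X \<A> x (dir_deriv TE \<eta> x (\<xi> x)))"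
proof -
  obtain \<delta> K V where V: "0 < \<delta>" "compactin X K" "V 0 = \<eta> x"
    "\<forall>s. V s \<in> sym2_fields_on \<A> K \<times> sym2_fields_on \<A> K"
    "dir_deriv TE \<eta> x (\<xi> x) \<in> sym2_fields_on \<A> K \<times> sym2_fields_on \<A> K"
    "lcs_tendsto TE (\<lambda>s. (V s - V 0) /\<^sub>R s) (dir_deriv TE \<eta> x (\<xi> x)) (at 0)"
    "\<forall>s. \<bar>s\<bar> < \<delta> \<longrightarrow> V s = \<eta> (x + s *\<^sub>R \<xi> x)"
    "\<forall>s. \<bar>s\<bar> < \<delta> \<longrightarrow> x + s *\<^sub>R \<xi> x \<in> Met_mw X \<A> q"
    by (rule vector_field_along_line[OF \<eta> x u])
  obtain K' m cs Ls ix where P: "mfd_patch_ref X \<A> K' m cs Ls ix (fst x) q"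
    "{\<xi> x} \<subseteq> sym2_fields_on \<A> K' \<times> sym2_fields_on \<A> K'"
    "\<And>K''. K'' \<in> {K} \<Longrightarrow> sym2_fields_on \<A> K'' \<times> sym2_fields_on \<A> K'' \<subseteq> sym2_fields_on \<A> K' \<times> sym2_fields_on \<A> K'"
    by (rule patch_for[OF x, of "{\<xi> x}" "{K}"]) (use V(2) u in auto)
  interpret mfd_patch_ref X \<A> K' m cs Ls ix "fst x" q by (rule P)
  have uK: "\<xi> x \<in> TK" using P(2) by simp
  have VK: "V s \<in> TK" "dir_deriv TE \<eta> x (\<xi> x) \<in> TK" for s 
    using subsetD[OF P(3)[of K]] V(4)[rule_format, of s] V(5) by simp_all
  have \<eta>K: "\<eta> x \<in> TK" using VK(1)[of 0] V(3) by simp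
  let ?w = "dir_deriv TE \<eta> x (\<xi> x)"
  have line: "\<forall>s. \<bar>s\<bar> < \<delta> \<longrightarrow> x + s *\<^sub>R \<xi> x \<in> Met_mw X \<A> q" using V(8) by simp
  note D = Theta_line_deriv(1)[OF x uK V(1) line VK V(6)]
  have "((\<lambda>s. Theta X \<A> (x + s *\<^sub>R \<xi> x) (\<eta> (x + s *\<^sub>R \<xi> x))) has_real_derivative
      (\<integral>p. Dtheta (R (fst x) p) (R (snd x) p) (R (fst (V 0)) p) (R2 (\<xi> x) p)
         + theta_density (R (fst x) p) (R (snd x) p) (R (fst ?w) p) \<partial>ref)) (at 0)"
    by (rule has_field_derivative_transform_within_open[OF D, of "{-\<delta><..<\<delta>}"])
       (use V(1,7) in \<open>auto simp: abs_less_iff\<close>)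
  from DERIV_imp_deriv[OF DERIV_cmult[OF this, of r]]
  have "field_apply \<xi> (\<lambda>y. r * Theta X \<A> y (\<eta> y)) x = r *
      (\<integral>p. Dtheta (R (fst x) p) (R (snd x) p) (R (fst (\<eta> x)) p) (R2 (\<xi> x) p)
         + theta_density (R (fst x) p) (R (snd x) p) (R (fst ?w) p) \<partial>ref)"
    by (simp add: field_apply_def V(3))
  also have "\<dots> = r * (DTheta x (\<eta> x) (\<xi> x) + Theta X \<A> x ?w)"
  proof -
    have "fst ?w \<in> sym2_fields \<A>" using VK(2) sym2_fields_on_subset by auto
    then show ?thesis
      using DTheta_integral[OF x uK \<eta>K] theta_integrable[OF x] Theta_integral[OF x VK(2)] by simp
  qed
  finally show ?thesis .
qed

lemma field_apply_Omega:
  assumes \<eta>: "vector_field (Met_mw X \<A> q) TE \<eta>" and \<zeta>: "vector_field (Met_mw X \<A> q) TE \<zeta>"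
    and x: "x \<in> Met_mw X \<A> q" and u: "\<xi> x \<in> fst TE"
  shows "field_apply \<xi> (\<lambda>y. Omega X \<A> y (\<eta> y) (\<zeta> y)) x = DOmega x (\<eta> x) (\<zeta> x) (\<xi> x)
     + Omega X \<A> x (dir_deriv TE \<eta> x (\<xi> x)) (\<zeta> x) + Omega X \<A> x (\<eta> x) (dir_deriv TE \<zeta> x (\<xi> x))"
proof -
  obtain \<delta> K V where V: "0 < \<delta>" "compactin X K" "V 0 = \<eta> x"
    "\<forall>s. V s \<in> sym2_fields_on \<A> K \<times> sym2_fields_on \<A> K"
    "dir_deriv TE \<eta> x (\<xi> x) \<in> sym2_fields_on \<A> K \<times> sym2_fields_on \<A> K"
    "lcs_tendsto TE (\<lambda>s. (V s - V 0) /\<^sub>R s) (dir_deriv TE \<eta> x (\<xi> x)) (at 0)"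
    "\<forall>s. \<bar>s\<bar> < \<delta> \<longrightarrow> V s = \<eta> (x + s *\<^sub>R \<xi> x)"
    "\<forall>s. \<bar>s\<bar> < \<delta> \<longrightarrow> x + s *\<^sub>R \<xi> x \<in> Met_mw X \<A> q"
    by (rule vector_field_along_line[OF \<eta> x u])
  obtain \<delta>' L V' where V': "0 < \<delta>'" "compactin X L" "V' 0 = \<zeta> x"
    "\<forall>s. V' s \<in> sym2_fields_on \<A> L \<times> sym2_fields_on \<A> L"
    "dir_deriv TE \<zeta> x (\<xi> x) \<in> sym2_fields_on \<A> L \<times> sym2_fields_on \<A> L"
    "lcs_tendsto TE (\<lambda>s. (V' s - V' 0) /\<^sub>R s) (dir_deriv TE \<zeta> x (\<xi> x)) (at 0)"
    "\<forall>s. \<bar>s\<bar> < \<delta>' \<longrightarrow> V' s = \<zeta> (x + s *\<^sub>R \<xi> x)"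
    "\<forall>s. \<bar>s\<bar> < \<delta>' \<longrightarrow> x + s *\<^sub>R \<xi> x \<in> Met_mw X \<A> q"
    by (rule vector_field_along_line[OF \<zeta> x u])
  obtain K' m cs Ls ix where P: "mfd_patch_ref X \<A> K' m cs Ls ix (fst x) q"
    "{\<xi> x} \<subseteq> sym2_fields_on \<A> K' \<times> sym2_fields_on \<A> K'"
    "\<And>K''. K'' \<in> {K, L} \<Longrightarrow> sym2_fields_on \<A> K'' \<times> sym2_fields_on \<A> K'' \<subseteq> sym2_fields_on \<A> K' \<times> sym2_fields_on \<A> K'"
    by (rule patch_for[OF x, of "{\<xi> x}" "{K, L}"]) (use V(2) V'(2) u in auto)
  interpret mfd_patch_ref X \<A> K' m cs Ls ix "fst x" q by (rule P)
  have uK: "\<xi> x \<in> TK" using P(2) by simp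
  have VK: "V s \<in> TK" "dir_deriv TE \<eta> x (\<xi> x) \<in> TK" for s 
    using subsetD[OF P(3)[of K]] V(4)[rule_format, of s] V(5) by simp_all
  have VK': "V' s \<in> TK" "dir_deriv TE \<zeta> x (\<xi> x) \<in> TK" for s 
    using subsetD[OF P(3)[of L]] V'(4)[rule_format, of s] V'(5) by simp_all
  have \<eta>K: "\<eta> x \<in> TK" "\<zeta> x \<in> TK" using VK(1)[of 0] V(3) VK'(1)[of 0] V'(3) by simp_all
  have line: "\<forall>s. \<bar>s\<bar> < \<delta> \<longrightarrow> x + s *\<^sub>R \<xi> x \<in> Met_mw X \<A> q" using V(8) by simp
  note D = Omega_line_deriv(1)[OF x uK V(1) line VK V(6) VK' V'(6)]
  have "((\<lambda>s. Omega X \<A> (x + s *\<^sub>R \<xi> x) (\<eta> (x + s *\<^sub>R \<xi> x)) (\<zeta> (x + s *\<^sub>R \<xi> x))) has_real_derivative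
      (\<integral>p. Domega (R (fst x) p) (R (snd x) p) (R2 (V 0) p) (R2 (V' 0) p) (R2 (\<xi> x) p) \<partial>ref)
       + Omega X \<A> x (dir_deriv TE \<eta> x (\<xi> x)) (V' 0) + Omega X \<A> x (V 0) (dir_deriv TE \<zeta> x (\<xi> x))) (at 0)"
    by (rule has_field_derivative_transform_within_open[OF D, of "{- min \<delta> \<delta>'<..<min \<delta> \<delta>'}"])
       (use V(1,7) V'(1,7) in \<open>auto simp: abs_less_iff\<close>)
  from DERIV_imp_deriv[OF this] show ?thesis
    using DOmega_integral(1)[OF x uK \<eta>K] by (simp add: field_apply_def V(3) V'(3))
qed

lemma ext_d1_Theta:
  assumes \<xi>: "vector_field (Met_mw X \<A> q) TE \<xi>" and \<eta>: "vector_field (Met_mw X \<A> q) TE \<eta>"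
    and x: "x \<in> Met_mw X \<A> q"
  shows "ext_d1 TE (\<lambda>x v. r * Theta X \<A> x v) \<xi> \<eta> x = - r * Omega X \<A> x (\<xi> x) (\<eta> x)"
proof -
  note T = vector_field_TE[OF \<xi> x] vector_field_TE[OF \<eta> x]
  note D = dir_deriv_TE[OF \<eta> x T(1)] dir_deriv_TE[OF \<xi> x T(2)]
  have "Theta X \<A> x (dir_deriv TE \<eta> x (\<xi> x) + (-1) *\<^sub>R dir_deriv TE \<xi> x (\<eta> x)) =
      Theta X \<A> x (dir_deriv TE \<eta> x (\<xi> x)) + (-1) * Theta X \<A> x (dir_deriv TE \<xi> x (\<eta> x))"
    using Theta_linear[OF x] D TE_scaleR unfolding linear_form_on_def by metis
  then have b: "Theta X \<A> x (bracket TE \<xi> \<eta> x) =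
      Theta X \<A> x (dir_deriv TE \<eta> x (\<xi> x)) - Theta X \<A> x (dir_deriv TE \<xi> x (\<eta> x))"
    by (simp add: bracket_def)
  have "ext_d1 TE (\<lambda>x v. r * Theta X \<A> x v) \<xi> \<eta> x = r * (DTheta x (\<eta> x) (\<xi> x) - DTheta x (\<xi> x) (\<eta> x))"
    unfolding ext_d1_def field_apply_Theta[where \<xi> = \<xi>, OF \<eta> x T(1)]
      field_apply_Theta[where \<xi> = \<eta>, OF \<xi> x T(2)] b
    by (simp add: algebra_simps)
  then show ?thesis unfolding DTheta_antisym[OF x T] by simp
qed

text \<open>The six terms with a derivative of a field match the six from the brackets once
  antisymmetry has put their arguments in the same order. The derivatives of \<Omega> in the base
  point cancel by the cyclic identity.\<close>

lemma ext_d2_Omega: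
  assumes \<xi>: "vector_field (Met_mw X \<A> q) TE \<xi>" and \<eta>: "vector_field (Met_mw X \<A> q) TE \<eta>"
    and \<zeta>: "vector_field (Met_mw X \<A> q) TE \<zeta>" and x: "x \<in> Met_mw X \<A> q"
  shows "ext_d2 TE (Omega X \<A>) \<xi> \<eta> \<zeta> x = 0"
proof -
  note T = vector_field_TE[OF \<xi> x] vector_field_TE[OF \<eta> x] vector_field_TE[OF \<zeta> x]
  note D = dir_deriv_TE[OF \<xi> x T(2)] dir_deriv_TE[OF \<xi> x T(3)] dir_deriv_TE[OF \<eta> x T(1)]
    dir_deriv_TE[OF \<eta> x T(3)] dir_deriv_TE[OF \<zeta> x T(1)] dir_deriv_TE[OF \<zeta> x T(2)]
  have diff: "Omega X \<A> x (v - v') w = Omega X \<A> x v w - Omega X \<A> x v' w"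
    if "v \<in> fst TE" "v' \<in> fst TE" "w \<in> fst TE" for v v' w
  proof -
    have "Omega X \<A> x (v + (-1) *\<^sub>R v') w = Omega X \<A> x v w + (-1) * Omega X \<A> x v' w"
      using Omega_linear[OF x that(3)] that TE_scaleR unfolding linear_form_on_def by metis
    then show ?thesis by simp
  qed
  show ?thesis
    unfolding ext_d2_def bracket_def
      field_apply_Omega[where \<xi> = \<xi>, OF \<eta> \<zeta> x T(1)] field_apply_Omega[where \<xi> = \<eta>, OF \<xi> \<zeta> x T(2)]
      field_apply_Omega[where \<xi> = \<zeta>, OF \<xi> \<eta> x T(3)]
      diff[OF D(3) D(1) T(3)] diff[OF D(5) D(2) T(2)] diff[OF D(6) D(4) T(1)]
    using DOmega_cyclic[OF x T] Omega_antisym[OF x T(2) D(5)] Omega_antisym[OF x T(1) D(6)] Omega_antisym[OF x T(1) D(4)]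
    by simp
qed

end

subsection \<open>Nondegeneracy\<close>

context smooth_mfd
begin

lemma open_chart_image_Int:
  assumes c: "c \<in> \<A>" and U: "openin X U"
  shows "open (snd c ` (fst c \<inter> U))"
proof -
  have "openin (subtopology X (fst c)) (fst c \<inter> U)"
    using U by (auto simp: openin_subtopology)
  then have "openin (top_of_set (snd c ` fst c)) (snd c ` (fst c \<inter> U))"
    using homeomorphic_imp_open_map[OF chart_homeomorphic[OF c]] by (simp add: open_map_def)
  then show ?thesis using open_chart_image[OF c] openin_open_trans by blast
qed

lemma transition_jacobian_derivative:
  assumes "c \<in> \<A>" "d \<in> \<A>" "p \<in> fst c" "p \<in> fst d"
  shows "((snd d \<circ> chart_inv c) has_derivative (*v) (transition_jacobian c d p)) (at (snd c p))"
proof -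
  note D = transition_derivative[OF assms]
  have "(*v) (transition_jacobian c d p) = frechet_derivative (snd d \<circ> chart_inv c) (at (snd c p))"
    unfolding transition_jacobian_def
    using has_derivative_linear[OF D] by (simp add: fun_eq_iff matrix_works linear_matrix_vector_mul_eq)
  then show ?thesis using D by simp
qed

lemma transition_jacobian_eqI:
  assumes "((snd d \<circ> chart_inv c) has_derivative (*v) J) (at (snd c p))"
  shows "transition_jacobian c d p = J"
  unfolding transition_jacobian_def frechet_derivative_at[OF assms, symmetric] by simp

text \<open>Chain rule for the transition maps. It makes the transformation rule consistent for a
  tensor field that is defined from a single chart.\<close>

lemma transition_jacobian_cocycle:
  assumes c: "c \<in> \<A>" "p \<in> fst c" and d: "d \<in> \<A>" "p \<in> fst d" and e: "e \<in> \<A>" "p \<in> fst e"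
  shows "transition_jacobian d c p = transition_jacobian e c p ** transition_jacobian d e p"
proof (rule transition_jacobian_eqI)
  let ?W = "snd d ` (fst d \<inter> (fst e \<inter> fst c))"
  have D: "((snd e \<circ> chart_inv d) has_derivative (*v) (transition_jacobian d e p)) (at (snd d p))"
    by (rule transition_jacobian_derivative[OF d(1) e(1) d(2) e(2)])
  have "(snd e \<circ> chart_inv d) (snd d p) = snd e p" using chart_inv_chart[OF d] by simp
  then have "((snd c \<circ> chart_inv e) has_derivative (*v) (transition_jacobian e c p))
      (at ((snd e \<circ> chart_inv d) (snd d p)))"
    using transition_jacobian_derivative[OF e(1) c(1) e(2) c(2)] by (simp only:)
  from diff_chain_at[OF D this]
  have "((snd c \<circ> chart_inv e) \<circ> (snd e \<circ> chart_inv d) has_derivative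
      (*v) (transition_jacobian e c p ** transition_jacobian d e p)) (at (snd d p))"
    by (simp add: o_def matrix_vector_mul_assoc)
  then show "((snd c \<circ> chart_inv d) has_derivative
      (*v) (transition_jacobian e c p ** transition_jacobian d e p)) (at (snd d p))"
  proof (rule has_derivative_transform_within_open)
    show "open ?W" by (intro open_chart_image_Int openin_Int openin_chart c d e)
    show "snd d p \<in> ?W" using c d e by blast
    show "((snd c \<circ> chart_inv e) \<circ> (snd e \<circ> chart_inv d)) y = (snd c \<circ> chart_inv d) y" if y: "y \<in> ?W" for y
    proof -
      obtain r where r: "r \<in> fst d" "r \<in> fst e" "r \<in> fst c" "y = snd d r" using y by blast
      show ?thesis unfolding r(4) o_apply chart_inv_chart[OF d(1) r(1)] chart_inv_chart[OF e(1) r(2)] ..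
    qed
  qed
qed

lemma transition_jacobian_self:
  assumes c: "c \<in> \<A>" "p \<in> fst c"
  shows "transition_jacobian c c p = mat 1"
proof (rule transition_jacobian_eqI)
  have "((\<lambda>y. y) has_derivative (*v) (mat 1)) (at (snd c p))" by (simp add: matrix_vector_mul_lid[abs_def])
  then show "((snd c \<circ> chart_inv c) has_derivative (*v) (mat 1)) (at (snd c p))"
    by (rule has_derivative_transform_within_open[OF _ open_chart_image[OF c(1)]]) (use c in auto)
qed

lemma smooth_on_transition_jacobian:
  assumes c: "c \<in> \<A>" and d: "d \<in> \<A>"
  shows "smooth_on (snd d ` (fst d \<inter> fst c)) (\<lambda>y. matrix (frechet_derivative (snd c \<circ> chart_inv d) (at y)))"
proof -
  let ?W = "snd d ` (fst d \<inter> fst c)"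
  let ?\<tau> = "snd c \<circ> chart_inv d"
  have W: "open ?W" by (intro open_chart_image_Int openin_chart c d)
  have \<tau>: "smooth_on ?W ?\<tau>" using mfd c d by (auto simp: smooth_manifold_def)
  \<comment> \<open>\<open>E j\<close> places a vector in column \<open>j\<close>; the Jacobian is
    the sum of these linear images of the partial derivatives, hence smooth.\<close>
  define E :: "'n \<Rightarrow> real^'n \<Rightarrow> real^'n^'n" where "E j v = (\<chi> i j'. if j' = j then v $ i else 0)" for j v
  have E: "bounded_linear (E j)" for j
    unfolding linear_conv_bounded_linear[symmetric] by (rule linearI) (simp_all add: E_def vec_eq_iff)
  have *: "smooth_on ?W (\<lambda>y. E j (frechet_derivative ?\<tau> (at y) (axis j 1)))" for j
    by (intro smooth_on_linear[OF W E] smooth_on_frechet_derivative \<tau>)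
  have "smooth_on ?W (\<lambda>y. \<Sum>j\<in>UNIV. E j (frechet_derivative ?\<tau> (at y) (axis j 1)))"
    unfolding smooth_on_iff_diff_order
    by (intro allI diff_order_sum[OF W] *[unfolded smooth_on_iff_diff_order, rule_format])
  moreover have "matrix F = (\<Sum>j\<in>UNIV. E j (F (axis j 1)))" for F :: "real^'n \<Rightarrow> real^'n"
    by (simp add: matrix_def E_def vec_eq_iff)
  ultimately show ?thesis by (simp only:)
qed

text \<open>The constant matrix \<open>C\<close> is cut off by a bump function in the chart
  \<open>c\<close>, carried to every other chart by the transformation rule, and set to 0 outside
  \<open>fst c\<close>. The support is compact, hence closed by the Hausdorff property, so the field
  vanishes on an open set that together with \<open>fst c\<close> covers each chart.\<close>

lemma bump_tensor:
  assumes c: "c \<in> \<A>" "p\<^sub>0 \<in> fst c" and C: "transpose C = C" and r: "0 < r"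
  obtains l \<beta> where "l \<in> sym2_fields_c X \<A>" "\<And>p. p \<in> fst c \<Longrightarrow> l c p = \<beta> (snd c p) *\<^sub>R C"
    "\<And>d p. p \<notin> fst c \<Longrightarrow> l d p = 0" "continuous_on UNIV \<beta>" "\<And>y. 0 \<le> (\<beta> y :: real)" "0 < \<beta> (snd c p\<^sub>0)"
    "\<And>y. \<beta> y \<noteq> 0 \<Longrightarrow> dist y (snd c p\<^sub>0) < r"
proof -
  \<comment> \<open>A closed ball inside the coordinate domain makes the support compact in the
    manifold.\<close>
  obtain r' where r': "0 < r'" "cball (snd c p\<^sub>0) r' \<subseteq> snd c ` fst c"
    using open_contains_cball open_chart_image[OF c(1)] c(2) by (metis imageI)
  have rr': "0 < min r r'" using r r' by simp
  obtain \<beta> :: "real^'n \<Rightarrow> real" where \<beta>: "smooth_on UNIV \<beta>" "\<And>y. 0 \<le> \<beta> y" "0 < \<beta> (snd c p\<^sub>0)"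
      "\<And>y. \<beta> y \<noteq> 0 \<Longrightarrow> dist y (snd c p\<^sub>0) < min r r'"
    by (rule bump_function[OF rr', of "snd c p\<^sub>0"]) blast
  define S where "S = chart_inv c ` cball (snd c p\<^sub>0) r'"
  have S: "compactin X S" unfolding S_def by (intro compactin_chart_inv c r') simp
  define l :: "('a, 'n) tensor2" where "l d p =
    (if d \<in> \<A> \<and> p \<in> fst d \<and> p \<in> fst c
     then transpose (transition_jacobian d c p) ** (\<beta> (snd c p) *\<^sub>R C) ** transition_jacobian d c p
     else 0)" for d p
  have supp: "l d p = 0" if "p \<notin> S" for d p
  proof (cases "p \<in> fst c")
    case True
    have "\<beta> (snd c p) = 0"
    proof (rule ccontr)
      assume "\<beta> (snd c p) \<noteq> 0"
      then have "snd c p \<in> cball (snd c p\<^sub>0) r'" using \<beta>(4)[of "snd c p"] by (simp add: dist_commute)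
      then have "chart_inv c (snd c p) \<in> S" by (simp add: S_def)
      then show False using that True c by simp
    qed
    then show ?thesis by (simp add: l_def)
  qed (simp add: l_def)
  have smooth: "smooth_on (snd d ` fst d) (l d \<circ> chart_inv d)" if d: "d \<in> \<A>" for d
  proof -
    let ?W = "snd d ` (fst d \<inter> fst c)"
    let ?W' = "snd d ` (fst d \<inter> (topspace X - S))"
    let ?\<tau> = "snd c \<circ> chart_inv d"
    let ?J = "\<lambda>y. matrix (frechet_derivative ?\<tau> (at y))"
    have W: "open ?W" by (intro open_chart_image_Int openin_chart c d)
    have \<tau>: "smooth_on ?W ?\<tau>" using mfd c d by (auto simp: smooth_manifold_def)
    have J: "smooth_on ?W ?J" by (rule smooth_on_transition_jacobian[OF c(1) d])
    have tr: "bounded_linear (transpose :: real^'n^'n \<Rightarrow> real^'n^'n)"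
      unfolding linear_conv_bounded_linear[symmetric] by (rule linearI) (simp_all add: transpose_def vec_eq_iff)
    have "smooth_on ?W (\<lambda>y. \<beta> (?\<tau> y))" by (rule smooth_on_compose[OF W \<beta>(1) \<tau>]) simp
    then have "smooth_on ?W (\<lambda>y. transpose (?J y) ** (\<beta> (?\<tau> y) *\<^sub>R C) ** ?J y)"
      by (intro smooth_on_bilinear[OF W bounded_bilinear_matrix_mult] smooth_on_linear[OF W tr]
          smooth_on_bilinear[OF W bounded_bilinear_scaleR] smooth_on_const J)
    moreover have "transpose (?J y) ** (\<beta> (?\<tau> y) *\<^sub>R C) ** ?J y = (l d \<circ> chart_inv d) y" if y: "y \<in> ?W" for y
    proof -
      obtain p where p: "p \<in> fst d" "p \<in> fst c" "y = snd d p" using y by blast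
      show ?thesis
        using d p(1,2) unfolding p(3) o_apply chart_inv_chart[OF d p(1)]
        by (simp add: l_def transition_jacobian_def o_def)
    qed
    ultimately have s1: "smooth_on ?W (l d \<circ> chart_inv d)"
      using smooth_on_cong_open[OF W, of "\<lambda>y. transpose (?J y) ** (\<beta> (?\<tau> y) *\<^sub>R C) ** ?J y"] by blast
    have "closedin X S" by (rule compactin_imp_closedin[OF Hausdorff S])
    then have W': "open ?W'" by (intro open_chart_image_Int d) auto
    have "(l d \<circ> chart_inv d) y = 0" if y: "y \<in> ?W'" for y
    proof -
      obtain p where p: "p \<in> fst d" "p \<notin> S" "y = snd d p" using y by blast
      show ?thesis unfolding p(3) o_apply chart_inv_chart[OF d p(1)] by (rule supp[OF p(2)])
    qed
    then have s2: "smooth_on ?W' (l d \<circ> chart_inv d)"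
      using smooth_on_cong_open[OF W', of "\<lambda>y. 0"] smooth_on_const by metis
    have "S \<subseteq> fst c" using chart_inv_in[OF c(1)] r'(2) by (auto simp: S_def)
    then have "?W \<union> ?W' = snd d ` fst d" using chart_subset[OF d] by blast
    then show ?thesis using smooth_on_Un[OF s1 s2] by simp
  qed
  have sym: "transpose (l d p) = l d p" for d p
    by (simp add: l_def matrix_transpose_mul matrix_mul_assoc transpose_scalar C)
       (simp add: transpose_def vec_eq_iff)
  have trans: "l d p = transpose (transition_jacobian d e p) ** l e p ** transition_jacobian d e p"
    if d: "d \<in> \<A>" "p \<in> fst d" and e: "e \<in> \<A>" "p \<in> fst e" for d e p
  proof (cases "p \<in> fst c")
    case True
    show ?thesis
      using d e True by (simp add: l_def transition_jacobian_cocycle[OF c(1) True d e]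
          matrix_transpose_mul matrix_mul_assoc)
  qed (simp add: l_def)
  have "l \<in> sym2_fields \<A>"
    unfolding sym2_fields_def mem_Collect_eq
    by (intro conjI ballI allI impI smooth sym trans) (auto simp: l_def)
  then have "l \<in> sym2_fields_on \<A> S" using supp by (auto simp: sym2_fields_on_def)
  then have l: "l \<in> sym2_fields_c X \<A>" using S sym2_fields_c_iff by blast
  show thesis
  proof (rule that[OF l, of \<beta>])
    show "l c p = \<beta> (snd c p) *\<^sub>R C" if "p \<in> fst c" for p
      using c that by (simp add: l_def transition_jacobian_self)
    show "l d p = 0" if "p \<notin> fst c" for d p using that by (simp add: l_def)
    show "continuous_on UNIV \<beta>" by (rule smooth_on_continuous_on[OF \<beta>(1)])
    show "0 \<le> \<beta> y" for y by (rule \<beta>(2))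
    show "0 < \<beta> (snd c p\<^sub>0)" by (rule \<beta>(3))
    show "dist y (snd c p\<^sub>0) < r" if "\<beta> y \<noteq> 0" for y using \<beta>(4)[OF that] by simp
  qed
qed

text \<open>In coordinates a nonempty open set is not negligible, and the density of a metric is
  positive.\<close>

lemma metric_measure_open_pos:
  assumes g: "g \<in> Met \<A> q" and c: "c \<in> \<A>" "p \<in> B" and B: "openin X B" "B \<subseteq> fst c"
  shows "emeasure (metric_measure X \<A> g) B \<noteq> 0"
proof
  note g' = Met_sym2_fields[OF g]
  have Bs: "B \<in> sets borelX" by (rule openin_sets[OF B(1)])
  have Beq: "B \<inter> fst c = B" "fst c \<inter> B = B" using B(2) by blast+
  have o: "open (snd c ` B)" using open_chart_image_Int[OF c(1) B(1)] by (simp add: Beq)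
  assume "emeasure (metric_measure X \<A> g) B = 0"
  then have "(\<integral>\<^sup>+y. ennreal (chart_density g c y * indicator (snd c ` B) y) \<partial>lborel) = 0"
    using metric_measure(2)[OF g' c(1) Bs B(2)] emeasure_chart_measure[OF c(1) g' Bs] by (simp add: Beq)
  moreover have "(\<lambda>y. chart_density g c y * indicator (snd c ` B) y) \<in> borel_measurable borel"
    using o B(2) by (intro chart_density_indicator_measurable c g') auto
  ultimately have "AE y in lborel. ennreal (chart_density g c y * indicator (snd c ` B) y) = 0"
    by (subst (asm) nn_integral_0_iff_AE) auto
  moreover have "0 < chart_density g c y" if y: "y \<in> snd c ` B" for y
  proof -
    have "y \<in> snd c ` fst c" using y B(2) by blast
    then have "invertible (g c (chart_inv c y))" by (intro Met_invertible[OF g c(1)] chart_inv_in c)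
    then show ?thesis by (simp add: chart_density_def invertible_det_nz)
  qed
  ultimately have "AE y in lborel. y \<notin> snd c ` B"
    by (auto elim!: eventually_mono simp: indicator_def) force
  then have "snd c ` B \<in> null_sets lborel" using o by (simp add: AE_iff_null_sets)
  then have "negligible (snd c ` B)"
    using null_sets_completionI negligible_iff_null_sets by blast
  then show False using open_not_negligible[OF o] c(2) by blast
qed

text \<open>
  At a point where \<open>k\<close> does not vanish, with the matrices \<open>G\<close> and \<open>K\<close> of \<open>g\<close> and \<open>k\<close> in a chart, the
  matrix \<open>C = G K G\<close> gives \<open>Tr(G\<^sup>-\<^sup>1 K G\<^sup>-\<^sup>1 C) = Tr(K\<^sup>2) > 0\<close>; note that \<open>l = k\<close> need not work
  when the signature is indefinite.
\<close>

lemma trace_form_nondegenerate: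
  assumes g: "g \<in> Met \<A> q" and k: "k \<in> sym2_fields_c X \<A>" "k \<noteq> 0"
  obtains l where "l \<in> sym2_fields_c X \<A>" "Theta X \<A> (g, l) (k, 0) \<noteq> 0"
proof -
  have k': "k \<in> sym2_fields \<A>" by (rule sym2_fields_c_subset[OF k(1)])
  obtain c p0 where "k c p0 \<noteq> 0" using k(2) by (metis ext zero_tensor)
  then have c: "c \<in> \<A>" "p0 \<in> fst c" and kp: "k c p0 \<noteq> 0" using sym2_fields_0[OF k'] by blast+
  define C where "C = g c p0 ** k c p0 ** g c p0"
  have C: "transpose C = C"
    by (simp add: C_def matrix_transpose_mul matrix_mul_assoc sym2_fields_sym[OF k']
        sym2_fields_sym[OF Met_sym2_fields[OF g]])
  define f where "f y = trace (matrix_inv (g c (chart_inv c y)) ** k c (chart_inv c y) **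
      (matrix_inv (g c (chart_inv c y)) ** C))" for y
  have "f (snd c p0) = trace (matrix_inv (g c p0) ** k c p0 ** (matrix_inv (g c p0) ** C))"
    using c by (simp add: f_def)
  also have "matrix_inv (g c p0) ** C = k c p0 ** g c p0"
    using matrix_inv_mult(2)[OF Met_invertible[OF g c]] by (simp add: C_def matrix_mul_assoc)
  also have "trace (matrix_inv (g c p0) ** k c p0 ** (k c p0 ** g c p0)) =
      trace ((k c p0 ** g c p0) ** (matrix_inv (g c p0) ** k c p0))"
    by (rule trace_mul_sym)
  also have "(k c p0 ** g c p0) ** (matrix_inv (g c p0) ** k c p0) = k c p0 ** (g c p0 ** matrix_inv (g c p0)) ** k c p0"
    by (simp only: matrix_mul_assoc)
  also have "\<dots> = transpose (k c p0) ** k c p0"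
    using matrix_inv_mult(1)[OF Met_invertible[OF g c]] by (simp add: sym2_fields_sym[OF k'])
  also have "trace \<dots> = (\<Sum>i\<in>UNIV. \<Sum>j\<in>UNIV. (k c p0 $ j $ i)\<^sup>2)"
    by (simp add: trace_def matrix_matrix_mult_def transpose_def power2_eq_square)
  also have "\<dots> > 0"
  proof -
    obtain j i where ij: "k c p0 $ j $ i \<noteq> 0" using kp by (metis vec_eq_iff zero_index)
    have "0 < (\<Sum>j\<in>UNIV. (k c p0 $ j $ i)\<^sup>2)"
      by (rule sum_pos2[of _ j]) (use ij in auto)
    then show ?thesis by (intro sum_pos2[of UNIV i "\<lambda>i. \<Sum>j\<in>UNIV. (k c p0 $ j $ i)\<^sup>2"]) (auto intro: sum_nonneg)
  qed
  finally have f0: "0 < f (snd c p0)" .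
  let ?U = "snd c ` fst c"
  have cont: "continuous_on ?U f"
  proof -
    have i: "continuous_on ?U (\<lambda>y. matrix_inv (g c (chart_inv c y)))"
      using Met_invertible[OF g c(1)] chart_inv_in[OF c(1)]
      by (intro continuous_on_compose2[OF continuous_on_matrix_inv
          sym2_fields_continuous[OF Met_sym2_fields[OF g] c(1)]]) auto
    show ?thesis
      unfolding f_def[abs_def]
      by (intro bounded_linear.continuous_on[OF bounded_linear_trace]
          bounded_bilinear.continuous_on[OF bounded_bilinear_matrix_mult]
          i sym2_fields_continuous[OF k' c(1)] continuous_on_const)
  qed
  \<comment> \<open>The bump is to be supported in a ball on which the trace stays positive, so that
    the integrand is nonnegative.\<close>
  have "open (?U \<inter> f -` {0<..})" by (rule continuous_open_preimage[OF cont open_chart_image[OF c(1)]]) simp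
  moreover have "snd c p0 \<in> ?U \<inter> f -` {0<..}" using c f0 by simp
  ultimately obtain r where r: "0 < r" "ball (snd c p0) r \<subseteq> ?U \<inter> f -` {0<..}" by (rule openE)
  obtain l \<beta> where l: "l \<in> sym2_fields_c X \<A>" "\<And>p. p \<in> fst c \<Longrightarrow> l c p = \<beta> (snd c p) *\<^sub>R C"
      "\<And>d p. p \<notin> fst c \<Longrightarrow> l d p = 0"
    and \<beta>: "continuous_on UNIV \<beta>" "\<And>y. 0 \<le> (\<beta> y :: real)" "0 < \<beta> (snd c p0)"
      "\<And>y. \<beta> y \<noteq> 0 \<Longrightarrow> dist y (snd c p0) < r"
    using bump_tensor[OF c C r(1)] by metis
  have fpos: "0 < f y" if "\<beta> y \<noteq> 0" for y using \<beta>(4)[OF that] r(2) by (auto simp: dist_commute)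
  have l': "l \<in> sym2_fields \<A>" by (rule sym2_fields_c_subset[OF l(1)])
  obtain K where K: "compactin X K" "k \<in> sym2_fields_on \<A> K" "l \<in> sym2_fields_on \<A> K"
    by (rule sym2_fields_c_common[OF k(1) l(1)])
  obtain m cs Ls ix where "mfd_patch_ref X \<A> K m cs Ls ix g q" by (rule ex_patch_ref[OF K(1) g])
  then interpret mfd_patch_ref X \<A> K m cs Ls ix g q .
  have x: "(g, l) \<in> Met_mw X \<A> q" using g l(1) by (simp add: Met_mw_iff)
  let ?D = "\<lambda>p. theta_density (R g p) (R l p) (R k p)"
  have tr: "trace (matrix_inv (g c p) ** k c p ** (matrix_inv (g c p) ** l c p)) = \<beta> (snd c p) * f (snd c p)"
    if "p \<in> fst c" for p
    using c that by (simp add: l(2) f_def matrix_mult.scaleR_right trace_scaleR)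
  \<comment> \<open>\<open>tr2\<close> links the two charts: its expressions in the chart assigned
    to \<open>p\<close> by the patch and in \<open>c\<close> have the same value.\<close>
  have D: "?D p = sqrt \<bar>det (R g p)\<bar> * (\<beta> (snd c p) * f (snd c p))" if p: "p \<in> K" "p \<in> fst c" for p
    using tr2_chart[OF g k' l' cs_in[OF p(1)] ix_chart[OF p(1)]] tr2_chart[OF g k' l' c(1) p(2)] tr[OF p(2)]
    by (simp add: theta_density_def R_def)
  have D0: "?D p = 0" if "p \<notin> fst c" for p
    by (simp add: theta_density_def R_def l(3)[OF that])
  have bf: "0 \<le> \<beta> y * f y" for y using \<beta>(2)[of y] fpos[of y] by (cases "\<beta> y = 0") auto
  have nonneg: "0 \<le> ?D p" if "p \<in> K" for p
    using D[OF that] D0 bf by (cases "p \<in> fst c") auto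
  define B where "B = {p \<in> fst c. snd c p \<in> {y. 0 < \<beta> y}}"
  have "open {y. 0 < \<beta> y}" by (intro open_Collect_less \<beta>(1) continuous_on_const)
  then have "openin X B" unfolding B_def by (rule openin_chart_preimage[OF c(1)])
  then have B: "openin X B" "B \<subseteq> fst c" "p0 \<in> B" using c \<beta>(3) by (auto simp: B_def)
  \<comment> \<open>A nonzero trace forces a nonzero \<open>l\<close>, and \<open>l\<close> is
    supported in \<open>K\<close>.\<close>
  have BK: "B \<subseteq> K"
  proof
    fix p assume "p \<in> B"
    then have p: "p \<in> fst c" "0 < \<beta> (snd c p)" by (auto simp: B_def)
    then have "trace (matrix_inv (g c p) ** k c p ** (matrix_inv (g c p) ** l c p)) \<noteq> 0"
      using tr[OF p(1)] fpos[of "snd c p"] by simp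
    then have "l c p \<noteq> 0" by auto
    then show "p \<in> K" using sym2_fields_on_0[OF K(3)] by blast
  qed
  show thesis
  proof (rule that[OF l(1)], rule notI)
    assume "Theta X \<A> (g, l) (k, 0) = 0"
    then have "(\<integral>p. ?D p \<partial>ref) = 0"
      using Theta_integral[OF x, of "(k, 0)"] K(2) sym2_fields_on_zero by simp
    moreover have "AE p in ref. 0 \<le> ?D p" using nonneg by (intro AE_I2) (simp add: space_ref)
    ultimately have "AE p in ref. ?D p = 0"
      using integral_nonneg_eq_0_iff_AE[OF theta_integrable[OF x k', unfolded fst_conv snd_conv]] by blast
    then have ae: "AE p in ref. ennreal (sqrt \<bar>det (R g p)\<bar>) * indicator B p = 0"
    proof (rule AE_mp, intro AE_I2 impI)
      fix p assume p: "p \<in> space ref" "?D p = 0"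
      then have pK: "p \<in> K" by (simp add: space_ref)
      show "ennreal (sqrt \<bar>det (R g p)\<bar>) * indicator B p = 0"
      proof (cases "p \<in> B")
        case True
        then have q: "p \<in> fst c" "0 < \<beta> (snd c p)" by (auto simp: B_def)
        then show ?thesis using p(2) D[OF pK q(1)] fpos[of "snd c p"] by auto
      qed simp
    qed
    have Bs: "B \<in> sets borelX" by (rule openin_sets[OF B(1)])
    have Br: "B \<in> sets ref" using Bs BK K_sets by (simp add: sets_ref sets_restrict_space_iff Int_absorb2 K_subset)
    note g' = Met_sym2_fields[OF g]
    have "emeasure (metric_measure X \<A> g) B = emeasure (restrict_space (metric_measure X \<A> g) K) B"
      using BK K_sets K_subset metric_measure(1)[OF g']
      by (intro emeasure_restrict_space[symmetric]) (auto simp: sets.Int_space_eq2)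
    also have "\<dots> = (\<integral>\<^sup>+p. ennreal (sqrt \<bar>det (R g p)\<bar>) * indicator B p \<partial>ref)"
      unfolding restrict_metric_measure[OF g']
      using Br by (intro emeasure_density measurable_compose[OF sqrt_abs_det_measurable[OF R_measurable_ref[OF g']]]) auto
    also have "\<dots> = 0" using nn_integral_cong_AE[OF ae] by simp
    finally show False using metric_measure_open_pos[OF g c(1) B(3) B(1,2)] by simp
  qed
qed

lemma tr_zero_fields [simp]:
  "tr1 \<A> g 0 p = 0" "tr2 \<A> g 0 h p = 0" "tr2 \<A> g k 0 p = 0"
  by (simp_all add: tr1_def tr2_def Let_def trace_def)

lemma tr2_commute: "tr2 \<A> g k h p = tr2 \<A> g h k p"
proof -
  have "trace (a ** k' ** a ** h') = trace (a ** h' ** a ** k')" for a k' h' :: "real^'n^'n"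
    using trace_mul_sym[of "a ** k'" "a ** h'"] by (simp only: matrix_mul_assoc)
  then show ?thesis by (simp add: tr2_def Let_def)
qed

text \<open>Testing with (0, l') leaves only Tr(g^-1 k g^-1 l') and forces k = 0. The terms with h
  then vanish, and testing with (l', 0) leaves - Tr(g^-1 l' g^-1 l), which forces l = 0.\<close>

lemma Omega_nondegenerate:
  assumes x: "x \<in> Met_mw X \<A> q" and v: "v \<in> fst TE" and *: "\<And>w. w \<in> fst TE \<Longrightarrow> Omega X \<A> x v w = 0"
  shows "v = 0"
proof -
  obtain g h k l where eq: "x = (g, h)" "v = (k, l)" by (cases x; cases v)
  have g: "g \<in> Met \<A> q" using x by (simp add: eq Met_mw_iff)
  have kl: "k \<in> sym2_fields_c X \<A>" "l \<in> sym2_fields_c X \<A>" using v by (auto simp: eq fst_TE)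
  have k: "k = 0"
  proof (rule ccontr)
    assume "k \<noteq> 0"
    from trace_form_nondegenerate[OF g kl(1) this]
    obtain l' where l': "l' \<in> sym2_fields_c X \<A>" "Theta X \<A> (g, l') (k, 0) \<noteq> 0" .
    have "Omega X \<A> x v (0, l') = Theta X \<A> (g, l') (k, 0)" by (simp add: eq Omega_def Theta_def)
    then show False using l' *[of "(0, l')"] sym2_fields_c_zero by (simp add: fst_TE)
  qed
  have "l = 0"
  proof (rule ccontr)
    assume "l \<noteq> 0"
    from trace_form_nondegenerate[OF g kl(2) this]
    obtain l' where l': "l' \<in> sym2_fields_c X \<A>" "Theta X \<A> (g, l') (l, 0) \<noteq> 0" .
    have "Omega X \<A> x v (l', 0) = - Theta X \<A> (g, l') (l, 0)"
      by (simp add: eq k Omega_def Theta_def ext[OF tr2_commute[of g l' l]])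
    then show False using l' *[of "(l', 0)"] sym2_fields_c_zero by (simp add: fst_TE)
  qed
  with k show ?thesis by (simp add: eq zero_prod_def)
qed

end

theorem theorem9:
  fixes X :: "'a topology" and \<A> :: "('a, 'n::finite) chart set" and q :: nat
  assumes "smooth_manifold X \<A>"
  shows "one_form (Met_mw X \<A> q) (T_Met_mw X \<A>) (Theta X \<A>)
    \<and> is_ext_d (Met_mw X \<A> q) (T_Met_mw X \<A>) (Theta X \<A>)
        (\<lambda>x \<xi>\<^sub>1 \<xi>\<^sub>2. - Omega X \<A> x \<xi>\<^sub>1 \<xi>\<^sub>2)
    \<and> exact_two_form (Met_mw X \<A> q) (T_Met_mw X \<A>) (Omega X \<A>)
    \<and> weak_symplectic (Met_mw X \<A> q) (T_Met_mw X \<A>) (Omega X \<A>)"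
proof -
  interpret smooth_mfd X \<A> by (unfold_locales) (rule assms)
  have "one_form (Met_mw X \<A> q) TE (Theta X \<A>)"
    using one_form_smult_Theta[of q 1] by simp
  moreover have "is_ext_d (Met_mw X \<A> q) TE (Theta X \<A>) (\<lambda>x \<xi>\<^sub>1 \<xi>\<^sub>2. - Omega X \<A> x \<xi>\<^sub>1 \<xi>\<^sub>2)"
    using ext_d1_Theta[of q _ _ _ 1] by (simp add: is_ext_d_def)
  \<comment> \<open>Since \<Omega> = - d\<Theta>, the primitive that witnesses exactness is -
    \<Theta>.\<close>
  moreover have "is_ext_d (Met_mw X \<A> q) TE (\<lambda>x v. -1 * Theta X \<A> x v) (Omega X \<A>)"
    using ext_d1_Theta[of q _ _ _ "-1"] by (simp add: is_ext_d_def)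
  then have "exact_two_form (Met_mw X \<A> q) TE (Omega X \<A>)"
    unfolding exact_two_form_def using two_form_Omega one_form_smult_Theta[of q "-1"] by blast
  moreover have "weak_symplectic (Met_mw X \<A> q) TE (Omega X \<A>)"
    unfolding weak_symplectic_def closed_two_form_def
    using two_form_Omega ext_d2_Omega Omega_nondegenerate by blast
  ultimately show ?thesis by blast
qed

end
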